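(* Let $1\le d\le n$ and let $X\subset\mathbb{C}^n$ be a closed pure $d$-dimensional complex analytic set. Then exactly one of the following alternatives occurs: (i) $X$ is algebraic and $\dim_H\Sigma_\infty(X)=2d-2$; (ii) $X$ is nonalgebraic, $\mathcal{H}^{2d}\bigl(\Sigma_\infty(X)\bigr)>0$, and $\dim_H\Sigma_\infty(X)\ge 2d$. In particular, the value $2d-1$ cannot occur as $\dim_H\Sigma_\infty(X)$.
   Context: A closed pure $d$-dimensional complex analytic set $X\subset\mathbb{C}^n$ is a nonempty closed complex analytic subset having dimension $d$ at each of its points. $X$ is algebraic if it is the common zero set of a family of polynomials in $\mathbb{C}[z_1,\dots,z_n]$, and nonalgebraic otherwise. For $A\subset\mathbb{C}^n$, the total tangent cone at infinity is $$C_\infty(A)=\{v\in\mathbb{C}^n:\exists\, x_j\in A,\ t_j>0,\ \|x_j\|\to\infty,\ t_j\to\infty,\ x_j/t_j\to v\}.$$ The projective asymptotic direction set is $\Sigma_\infty(A)=\{\mathbb{C}v: v\in C_\infty(A)\setminus\{0\}\}\subset\mathbb{P}^{n-1}(\mathbb{C})$, where $\mathbb{P}^{n-1}(\mathbb{C})$ is the space of complex lines through the origin in $\mathbb{C}^n$. $\mathcal{H}^s$ is $s$-dimensional Hausdorff measure and $\dim_H$ is Hausdorff dimension, taken on $\mathbb{P}^{n-1}(\mathbb{C})$ with respect to a fixed smooth Riemannian metric. *)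

theory Defs
  imports "HOL-Analysis.Analysis" "HOL-Library.Poly_Mapping"
begin

section \<open>Analytic subsets of complex affine space\<close>

definition holomorphic_fun_on :: "(complex^'n \<Rightarrow> complex) \<Rightarrow> (complex^'n) set \<Rightarrow> bool" where
  "holomorphic_fun_on f U \<longleftrightarrow>
     (\<forall>z\<in>U. \<exists>f'. (f has_derivative f') (at z) \<and> (\<forall>c u. f' (c *s u) = c * f' u))"

definition holomorphic_map_on :: "(complex^'n \<Rightarrow> complex^'m) \<Rightarrow> (complex^'n) set \<Rightarrow> bool" where
  "holomorphic_map_on \<phi> U \<longleftrightarrow> (\<forall>i. holomorphic_fun_on (\<lambda>z. \<phi> z $ i) U)"

definition biholomorphic_on ::
    "(complex^'n \<Rightarrow> complex^'n) \<Rightarrow> (complex^'n) set \<Rightarrow> (complex^'n) set \<Rightarrow> bool" where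
  "biholomorphic_on \<phi> U V \<longleftrightarrow>
     open U \<and> open V \<and> bij_betw \<phi> U V \<and>
     holomorphic_map_on \<phi> U \<and> holomorphic_map_on (inv_into U \<phi>) V"

text \<open>The local equations are required at every point of the ambient space, not only at the
  points of the set, as usual for closed analytic subsets.\<close>

definition analytic_subset :: "(complex^'n) set \<Rightarrow> bool" where
  "analytic_subset X \<longleftrightarrow>
     (\<forall>a. \<exists>U F. open U \<and> a \<in> U \<and> finite F \<and> (\<forall>f\<in>F. holomorphic_fun_on f U) \<and>
        X \<inter> U = {z\<in>U. \<forall>f\<in>F. f z = 0})"

text \<open>Points near which the set is a complex submanifold of dimension \<open>k\<close>: in suitable
  holomorphic coordinates it is a \<open>k\<close>-dimensional coordinate subspace.\<close>

definition regular_points :: "(complex^'n) set \<Rightarrow> nat \<Rightarrow> (complex^'n) set" where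
  "regular_points X k =
     {a\<in>X. \<exists>U V \<phi> I. a \<in> U \<and> biholomorphic_on \<phi> U V \<and> card I = k \<and>
        \<phi> ` (X \<inter> U) = {w\<in>V. \<forall>i. i \<notin> I \<longrightarrow> w $ i = 0}}"

text \<open>The local dimension at \<open>a\<close> is the upper limit, at \<open>a\<close>, of the manifold
  dimension at regular points. As dimensions take only finitely many values, this is the largest
  \<open>k\<close> such that every neighbourhood of \<open>a\<close> contains a regular point of dimension \<open>k\<close>.\<close>

definition local_dim :: "(complex^'n) set \<Rightarrow> complex^'n \<Rightarrow> nat" where
  "local_dim X a = Max {k. a \<in> closure (regular_points X k)}"

definition pure_analytic_set :: "nat \<Rightarrow> (complex^'n) set \<Rightarrow> bool" where
  "pure_analytic_set d X \<longleftrightarrow>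
     X \<noteq> {} \<and> closed X \<and> analytic_subset X \<and> (\<forall>a\<in>X. local_dim X a = d)"

text \<open>Polynomials are finitely supported families of coefficients indexed by monomials, and
  monomials are finitely supported families of exponents indexed by the variables.\<close>

type_synonym 'n cpoly = "('n \<Rightarrow>\<^sub>0 nat) \<Rightarrow>\<^sub>0 complex"

definition cpoly_eval :: "'n cpoly \<Rightarrow> complex^'n \<Rightarrow> complex" where
  "cpoly_eval p z =
     (\<Sum>m\<in>Poly_Mapping.keys p.
        Poly_Mapping.lookup p m * (\<Prod>i\<in>UNIV. z $ i ^ Poly_Mapping.lookup m i))"

definition algebraic_set :: "(complex^'n) set \<Rightarrow> bool" where
  "algebraic_set X \<longleftrightarrow> (\<exists>P :: 'n cpoly set. X = {z. \<forall>p\<in>P. cpoly_eval p z = 0})"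

section \<open>Asymptotic directions\<close>

definition tangent_cone_inf :: "(complex^'n) set \<Rightarrow> (complex^'n) set" where
  "tangent_cone_inf A =
     {v. \<exists>(x :: nat \<Rightarrow> complex^'n) (t :: nat \<Rightarrow> real).
        (\<forall>j. x j \<in> A) \<and> (\<forall>j. t j > 0) \<and>
        filterlim (\<lambda>j. norm (x j)) at_top sequentially \<and>
        filterlim t at_top sequentially \<and>
        (\<lambda>j. x j /\<^sub>R t j) \<longlonglongrightarrow> v}"

definition complex_line :: "complex^'n \<Rightarrow> (complex^'n) set" where
  "complex_line v = range (\<lambda>c. c *s v)"

definition projective_space :: "(complex^'n) set set" where
  "projective_space = complex_line ` (- {0})"

definition asymptotic_directions :: "(complex^'n) set \<Rightarrow> (complex^'n) set set" where
  "asymptotic_directions A = complex_line ` (tangent_cone_inf A - {0})"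

section \<open>Riemannian metrics on projective space\<close>

primrec Ck_on ::
    "nat \<Rightarrow> 'a::euclidean_space set \<Rightarrow> ('a \<Rightarrow> 'b::real_normed_vector) \<Rightarrow> bool" where
  "Ck_on 0 S f \<longleftrightarrow> continuous_on S f"
| "Ck_on (Suc k) S f \<longleftrightarrow>
     (\<forall>x\<in>S. f differentiable (at x)) \<and> (\<forall>v. Ck_on k S (\<lambda>x. frechet_derivative f (at x) v))"

definition smooth_on ::
    "'a::euclidean_space set \<Rightarrow> ('a \<Rightarrow> 'b::real_normed_vector) \<Rightarrow> bool" where
  "smooth_on S f \<longleftrightarrow> (\<forall>k. Ck_on k S f)"

text \<open>A Riemannian metric on projective space is represented by its pullback along the submersion
  sending \<open>z \<noteq> 0\<close> to the line through \<open>z\<close>. The differential at \<open>z\<close> of this submersion has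
  kernel \<open>complex_line z\<close>, and it takes the same value on \<open>u\<close> at \<open>z\<close> as on \<open>c *s u\<close> at
  \<open>c *s z\<close>. So the smooth Riemannian metrics on the quotient correspond exactly to the smooth
  families of positive semidefinite real forms below. The values of \<open>g\<close> at \<open>0\<close> are irrelevant.\<close>

definition projective_riemannian_metric ::
    "(complex^'n \<Rightarrow> complex^'n \<Rightarrow> complex^'n \<Rightarrow> real) \<Rightarrow> bool" where
  "projective_riemannian_metric g \<longleftrightarrow>
     (\<forall>z. z \<noteq> 0 \<longrightarrow>
        bilinear (g z) \<and>
        (\<forall>u v. g z u v = g z v u) \<and>
        (\<forall>u. g z u u \<ge> 0) \<and>
        (\<forall>u. g z u u = 0 \<longleftrightarrow> u \<in> complex_line z) \<and>
        (\<forall>c u v. c \<noteq> 0 \<longrightarrow> g (c *s z) (c *s u) (c *s v) = g z u v)) \<and>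
     (\<forall>u v. smooth_on (- {0}) (\<lambda>z. g z u v))"

definition curve_length ::
    "(complex^'n \<Rightarrow> complex^'n \<Rightarrow> complex^'n \<Rightarrow> real) \<Rightarrow> (real \<Rightarrow> complex^'n) \<Rightarrow> real" where
  "curve_length g \<gamma> =
     integral {0..1}
       (\<lambda>t. sqrt (g (\<gamma> t) (vector_derivative \<gamma> (at t)) (vector_derivative \<gamma> (at t))))"

text \<open>The Riemannian distance, with curves in projective space given by lifts that avoid the
  origin; every \<open>C\<^sup>1\<close> curve in projective space has such a lift.\<close>

definition riemannian_dist ::
    "(complex^'n \<Rightarrow> complex^'n \<Rightarrow> complex^'n \<Rightarrow> real) \<Rightarrow>
       (complex^'n) set \<Rightarrow> (complex^'n) set \<Rightarrow> real" where
  "riemannian_dist g L M =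
     Inf (curve_length g ` {\<gamma>. \<gamma> C1_differentiable_on {0..1} \<and> 0 \<notin> \<gamma> ` {0..1} \<and>
                               \<gamma> 0 \<in> L \<and> \<gamma> 1 \<in> M})"

section \<open>Hausdorff measure and dimension\<close>

text \<open>Here \<open>M\<close> is the underlying set of a metric space and \<open>\<rho>\<close> its distance function.\<close>

definition ediam :: "('a \<Rightarrow> 'a \<Rightarrow> real) \<Rightarrow> 'a set \<Rightarrow> ennreal" where
  "ediam \<rho> U = (SUP x\<in>U. SUP y\<in>U. ennreal (\<rho> x y))"

text \<open>The case distinction makes \<open>s = 0\<close> yield counting measure, since \<open>0 powr 0 = 0\<close>.\<close>

definition diam_power :: "('a \<Rightarrow> 'a \<Rightarrow> real) \<Rightarrow> real \<Rightarrow> 'a set \<Rightarrow> ennreal" where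
  "diam_power \<rho> s U =
     (if U = {} then 0 else if s = 0 then 1 else ennreal (enn2real (ediam \<rho> U) powr s))"

definition hausdorff_premeasure ::
    "'a set \<Rightarrow> ('a \<Rightarrow> 'a \<Rightarrow> real) \<Rightarrow> real \<Rightarrow> real \<Rightarrow> 'a set \<Rightarrow> ennreal" where
  "hausdorff_premeasure M \<rho> s \<delta> A =
     (INF U \<in> {U :: nat \<Rightarrow> 'a set.
                 (\<forall>i. U i \<subseteq> M \<and> ediam \<rho> (U i) \<le> ennreal \<delta>) \<and> A \<subseteq> (\<Union>i. U i)}.
        suminf (\<lambda>i. diam_power \<rho> s (U i)))"

definition hausdorff_measure ::
    "'a set \<Rightarrow> ('a \<Rightarrow> 'a \<Rightarrow> real) \<Rightarrow> real \<Rightarrow> 'a set \<Rightarrow> ennreal" where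
  "hausdorff_measure M \<rho> s A = (SUP \<delta>\<in>{0<..}. hausdorff_premeasure M \<rho> s \<delta> A)"

definition hausdorff_dim ::
    "'a set \<Rightarrow> ('a \<Rightarrow> 'a \<Rightarrow> real) \<Rightarrow> 'a set \<Rightarrow> ereal" where
  "hausdorff_dim M \<rho> A = Inf {ereal s | s. s \<ge> 0 \<and> hausdorff_measure M \<rho> s A = 0}"

definition proj_hausdorff_measure ::
    "(complex^'n \<Rightarrow> complex^'n \<Rightarrow> complex^'n \<Rightarrow> real) \<Rightarrow> real \<Rightarrow>
       (complex^'n) set set \<Rightarrow> ennreal" where
  "proj_hausdorff_measure g = hausdorff_measure projective_space (riemannian_dist g)"

definition proj_hausdorff_dim ::
    "(complex^'n \<Rightarrow> complex^'n \<Rightarrow> complex^'n \<Rightarrow> real) \<Rightarrow> (complex^'n) set set \<Rightarrow> ereal" where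
  "proj_hausdorff_dim g = hausdorff_dim projective_space (riemannian_dist g)"

end

theory Submission
 imports Defs "HOL-Complex_Analysis.Complex_Analysis"
  "HOL-Computational_Algebra.Fundamental_Theorem_Algebra"
begin

text \<open>
  Let \<open>k = d\<close> or \<open>k = d - 1\<close>. If the asymptotic directions of \<open>X\<close> were null for the measure of
  dimension \<open>2 * k\<close>, then, by a volume count among the matrices close to the identity, some
  invertible linear map moves \<open>X\<close> so that a set \<open>I\<close> of \<open>k\<close> coordinates vanishes simultaneously in no
  asymptotic direction; that is, the norm of a point of \<open>X\<close> is linearly bounded by the norm of its
  projection to the coordinates in \<open>I\<close>. The projection is then proper with finite fibres. For
  \<open>k = d - 1\<close> this contradicts the dimension of \<open>X\<close>. For \<open>k = d\<close> the elementary symmetric functions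
  of a linear form on the fibres extend to entire functions of polynomial growth (Riemann extension
  across the branch locus and Liouville), so they are polynomials and \<open>X\<close> is algebraic.

  Conversely an algebraic \<open>X\<close> is brought into such a position by successive elimination, the
  equations of a projection being norms along lines. The top degree parts of the fibre polynomials
  confine the asymptotic directions to countably many Lipschitz images of sets of real dimension
  \<open>2 * d - 2\<close>, one for each multiplicity type of the roots.
\<close>

section \<open>Holomorphic functions of several variables\<close>

text \<open>Images of analytic sets, equations for single coordinates and norms of polynomials all
  come from one tool. On a complex line where \<open>f\<close> has isolated zeros, the contour
  integral of its logarithmic derivative times \<open>q\<close> sums \<open>q\<close> over the zeros
  with multiplicity, and this sum depends holomorphically on the line. Newton's identities turn such
  sums into coefficients of monic polynomials, so elimination always proceeds along one direction at
  a time. The linear bound of the norm by the projection links infinity to algebra: transversality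
  gives it by compactness, and it controls the growth of the fibre polynomials. The exponent
  \<open>2 * k\<close> is the break-even point of the volume count: matrices near the identity that
  bring \<open>k\<close> complex coordinates of a unit vector to size \<open>r\<close> have volume
  of order \<open>r ^ (2 * k)\<close>. In the algebraic case the cone of asymptotic directions is
  described over \<open>d\<close> complex coordinates, one of which can be scaled to
  \<open>1\<close>; this leaves \<open>2 * d - 2\<close> real parameters. Nothing lies between,
  because nullity in dimension \<open>2 * d\<close> already forces algebraicity.\<close>

abbreviation hol :: "(complex^'n => complex) => (complex^'n) set => bool" where
 "hol == holomorphic_fun_on"

abbreviation holmap :: "(complex^'n => complex^'m) => (complex^'n) set => bool" where
 "holmap == holomorphic_map_on"

lemma holomorphic_funI:
 assumes "!!z. z : U ==> EX f'. (f has_derivative f') (at z) & (ALL c u. f' (c *s u) = c * f' u)"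
 shows "hol f U"
 using assms unfolding holomorphic_fun_on_def by blast

lemma holomorphic_funE:
 assumes "hol f U" "z : U"
 obtains f' where "(f has_derivative f') (at z)" "!!c u. f' (c *s u) = c * f' u"
 using assms unfolding holomorphic_fun_on_def by blast

lemma hol_on_subset:
 "hol f U ==> V \<subseteq> U ==> hol f V"
 unfolding holomorphic_fun_on_def by blast

lemma hol_local:
 assumes "!!z. z : U ==> EX V. open V & z : V & hol f V"
 shows "hol f U"
proof (rule holomorphic_funI)
 fix z assume "z : U"
 then obtain V where "z : V" "hol f V" using assms by metis
 then show "EX f'. (f has_derivative f') (at z) & (ALL c u. f' (c *s u) = c * f' u)"
  unfolding holomorphic_fun_on_def by (rule bspec[rotated])
qed

lemma hol_cong:
 assumes "hol f U" "open U" "!!z. z : U ==> g z = f z"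
 shows "hol g U"
proof (rule holomorphic_funI)
 fix z assume z: "z : U"
 obtain f' where "(f has_derivative f') (at z)" and lin: "!!c u. f' (c *s u) = c * f' u"
  using holomorphic_funE assms z by metis
 then have "(g has_derivative f') (at z)"
  using has_derivative_transform_within_open[of f f' z UNIV U g] assms z by auto
 with lin show "EX f'. (g has_derivative f') (at z) & (ALL c u. f' (c *s u) = c * f' u)" by blast
qed

lemma hol_const [simp]: "hol (%_. c) U"
 by (rule holomorphic_funI) (rule exI[of _ "%_. 0"], simp)

lemma bounded_linear_coord: "bounded_linear (%z :: complex^'n. z $ i)"
 by (rule bounded_linear_vec_nth)

lemma hol_coord [simp]: "hol (%z. z $ i) U"
 by (rule holomorphic_funI)
  (rule exI[of _ "%z. z $ i"], simp add: bounded_linear_coord bounded_linear_imp_has_derivative)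

lemma hol_add:
 assumes "hol f U" "hol g U"
 shows "hol (%z. f z + g z) U"
proof (rule holomorphic_funI)
 fix z assume z: "z : U"
 obtain f' g' where "(f has_derivative f') (at z)" "!!c u. f' (c *s u) = c * f' u"
  "(g has_derivative g') (at z)" "!!c u. g' (c *s u) = c * g' u"
  using holomorphic_funE assms z by metis
 then show "EX f'. ((%z. f z + g z) has_derivative f') (at z) & (ALL c u. f' (c *s u) = c * f' u)"
  by (intro exI[of _ "%u. f' u + g' u"]) (auto intro!: derivative_eq_intros simp: algebra_simps)
qed

lemma hol_mult:
 assumes "hol f U" "hol g U"
 shows "hol (%z. f z * g z) U"
proof (rule holomorphic_funI)
 fix z assume z: "z : U"
 obtain f' g' where "(f has_derivative f') (at z)" "!!c u. f' (c *s u) = c * f' u"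
  "(g has_derivative g') (at z)" "!!c u. g' (c *s u) = c * g' u"
  using holomorphic_funE assms z by metis
 then show "EX f'. ((%z. f z * g z) has_derivative f') (at z) & (ALL c u. f' (c *s u) = c * f' u)"
  by (intro exI[of _ "%u. f z * g' u + f' u * g z"])
   (auto intro!: has_derivative_mult simp: algebra_simps)
qed

lemma hol_uminus:
 "hol f U ==> hol (%z. - f z) U"
 using hol_mult[OF hol_const[of "-1"], of f U] by simp

lemma hol_diff:
 "hol f U ==> hol g U ==> hol (%z. f z - g z) U"
 using hol_add[of f U "%z. - g z"] hol_uminus[of g U] by simp

lemma hol_sum:
 "(!!i. i : A ==> hol (f i) U) ==> hol (%z. \<Sum>i\<in>A. f i z) U"
 by (induction A rule: infinite_finite_induct) (auto intro: hol_add)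

lemma hol_prod:
 "(!!i. i : A ==> hol (f i) U) ==> hol (%z. \<Prod>i\<in>A. f i z) U"
 by (induction A rule: infinite_finite_induct) (auto intro: hol_mult)

lemma hol_power:
 "hol f U ==> hol (%z. f z ^ k) U"
 by (induction k) (auto intro: hol_mult)

lemmas holomorphic_fun_intros =
 hol_const hol_coord hol_add hol_mult
 hol_uminus hol_diff hol_sum hol_prod
 hol_power

lemma hol_compose_field:
 assumes "hol f U" "!!z. z : U ==> g field_differentiable (at (f z))"
 shows "hol (%z. g (f z)) U"
proof (rule holomorphic_funI)
 fix z assume z: "z : U"
 obtain f' where f: "(f has_derivative f') (at z)" and lin: "!!c u. f' (c *s u) = c * f' u"
  using holomorphic_funE assms z by metis
 obtain D where "(g has_field_derivative D) (at (f z))"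
  using assms(2)[OF z] by (auto simp: field_differentiable_def)
 then have "(g has_derivative (*) D) (at (f z))" by (simp add: has_field_derivative_def)
 from diff_chain_at[OF f this] lin
 show "EX f'. ((%z. g (f z)) has_derivative f') (at z) & (ALL c u. f' (c *s u) = c * f' u)"
  by (intro exI[of _ "(*) D \<circ> f'"]) (auto simp: o_def)
qed

lemma hol_inverse:
 assumes "hol f U" "!!z. z : U ==> f z ~= 0"
 shows "hol (%z. inverse (f z)) U"
proof (rule hol_compose_field[OF assms(1)])
 fix z assume "z : U"
 then show "inverse field_differentiable at (f z)"
  using assms(2) DERIV_inverse field_differentiable_def by blast
qed

lemma hol_divide:
 assumes "hol f U" "hol g U" "!!z. z : U ==> g z ~= 0"
 shows "hol (%z. f z / g z) U"
 using hol_mult[OF assms(1) hol_inverse[OF assms(2,3)]]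
 by (simp add: divide_inverse)

lemma hol_imp_continuous_on:
 assumes "hol f U"
 shows "continuous_on U f"
proof (rule continuous_at_imp_continuous_on, rule ballI)
 fix z assume "z : U"
 then show "isCont f z"
  using holomorphic_funE[OF assms] has_derivative_continuous by metis
qed

section \<open>Restriction to complex lines and Cauchy's formula\<close>

lemma norm_vec_scale: "norm (c *s (v :: complex^'n)) = norm c * norm v"
 unfolding norm_vec_def by (simp add: norm_mult L2_set_right_distrib)

lemma bounded_linear_line: "bounded_linear (%t. t *s (v :: complex^'n))"
proof (rule bounded_linear_intro[where K = "norm v"])
 show "(r *\<^sub>R x) *s v = r *\<^sub>R (x *s v)" for r x
  by (simp add: vec_eq_iff)
qed (auto simp: vec.scale_left_distrib norm_vec_scale)

lemma continuous_on_scale_vec [continuous_intros]: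
 fixes g :: "'a::topological_space => complex^'n"
 assumes "continuous_on S f" "continuous_on S g"
 shows "continuous_on S (%x. f x *s g x)"
 unfolding vector_scalar_mult_def using assms
 by (intro continuous_on_vec_lambda continuous_intros)

lemma has_derivative_line:
 fixes z v :: "complex^'n"
 shows "((%t. z + t *s v) has_derivative (%h. h *s v)) (at t)"
proof -
 have "((%t. t *s v) has_derivative (%h. h *s v)) (at t)"
  using bounded_linear_line bounded_linear_imp_has_derivative by blast
 then show ?thesis by (auto intro: derivative_eq_intros)
qed

lemma has_field_derivative_line:
 fixes z v :: "complex^'n"
 assumes "(f has_derivative f') (at (z + t *s v))" "!!c u. f' (c *s u) = c * f' u"
 shows "((%t. f (z + t *s v)) has_field_derivative f' v) (at t)"
proof -
 have "((%t. f (z + t *s v)) has_derivative (%h. f' (h *s v))) (at t)"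
  using diff_chain_at[OF has_derivative_line assms(1)] by (simp add: o_def)
 then show ?thesis
  by (simp add: has_field_derivative_def assms(2) mult.commute[of _ "f' v"])
qed

lemma holomorphic_on_line:
 fixes z v :: "complex^'n"
 assumes "hol f U" "!!t. t : S ==> z + t *s v : U"
 shows "(%t. f (z + t *s v)) holomorphic_on S"
proof (rule holomorphic_onI)
 fix t assume "t : S"
 then obtain f' where "(f has_derivative f') (at (z + t *s v))" "!!c u. f' (c *s u) = c * f' u"
  using holomorphic_funE assms by metis
 then have "((%t. f (z + t *s v)) has_field_derivative f' v) (at t)"
  by (rule has_field_derivative_line)
 then show "(%t. f (z + t *s v)) field_differentiable at t within S"
  using field_differentiable_at_within field_differentiable_def by blast
qed

definition dir_deriv :: "(complex^'n => complex) => complex^'n => complex^'n => complex" where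
 "dir_deriv f v z = deriv (%t. f (z + t *s v)) 0"

lemma dir_deriv_eq:
 assumes "(f has_derivative f') (at z)" "!!c u. f' (c *s u) = c * f' u"
 shows "dir_deriv f v z = f' v"
 unfolding dir_deriv_def using has_field_derivative_line[of f f' z 0 v] assms
 by (auto intro: DERIV_imp_deriv)

lemma hol_has_derivative:
 assumes "hol f U" "z : U"
 shows "(f has_derivative (%v. dir_deriv f v z)) (at z)"
  and "!!c v. dir_deriv f (c *s v) z = c * dir_deriv f v z"
proof -
 obtain f' where f': "(f has_derivative f') (at z)" "!!c u. f' (c *s u) = c * f' u"
  using holomorphic_funE assms by metis
 then have "(%v. dir_deriv f v z) = f'" using dir_deriv_eq by blast
 with f' show "(f has_derivative (%v. dir_deriv f v z)) (at z)"
  "!!c v. dir_deriv f (c *s v) z = c * dir_deriv f v z" by (auto simp: fun_eq_iff)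
qed

lemma hol_line_derivative:
 assumes "hol f U" "z + t *s v : U"
 shows "((%t. f (z + t *s v)) has_field_derivative dir_deriv f v (z + t *s v)) (at t)"
 by (intro has_field_derivative_line hol_has_derivative[OF assms])

text \<open>Cauchy's formula for the first derivative on the line through \<open>z\<close>. It
  expresses a derivative by values of \<open>f\<close> on a circle, which is how continuity and
  holomorphy pass from functions to their directional derivatives.\<close>

lemma dir_deriv_circle_integral:
 assumes f: "hol f U" and r: "r > 0"
  and U: "!!t. norm t <= r ==> z + t *s v : U"
 shows "dir_deriv f v z = integral {0..1} (%s. f (z + (r * exp (2 * of_real pi * \<i> * of_real s)) *s v) *
     exp (- (2 * of_real pi * \<i> * of_real s))) / r"
proof -
 let ?h = "%t. f (z + t *s v)"
 have hol: "?h holomorphic_on cball 0 r"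
  by (rule holomorphic_on_line[OF f]) (use U in auto)
 have "((%u. ?h u / (u - 0) ^ Suc 1) has_contour_integral
  (2 * pi) * \<i> / (fact 1) * (deriv ^^ 1) ?h 0) (circlepath 0 r)"
  using r hol by (intro Cauchy_has_contour_integral_higher_derivative_circlepath)
   (auto intro: holomorphic_on_subset holomorphic_on_imp_continuous_on)
 then have "((%u. ?h u / u^2) has_contour_integral (2 * pi) * \<i> * dir_deriv f v z) (circlepath 0 r)"
  by (simp add: dir_deriv_def power2_eq_square)
 then have "((%x. ?h (circlepath 0 r x) / (circlepath 0 r x)^2 *
    vector_derivative (circlepath 0 r) (at x)) has_integral (2 * pi) * \<i> * dir_deriv f v z) {0..1}"
  unfolding has_contour_integral_def
  by (rule has_integral_eq[rotated]) (auto simp: vector_derivative_at_within_ivl vector_derivative_circlepath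
    vector_derivative_circlepath01)
 then have "((%x. (2 * pi) * \<i> / r * (?h (r * exp (2 * of_real pi * \<i> * of_real x)) *
    exp (- (2 * of_real pi * \<i> * of_real x)))) has_integral (2 * pi) * \<i> * dir_deriv f v z) {0..1}"
  by (rule has_integral_eq[rotated])
   (unfold vector_derivative_circlepath, use r in \<open>auto simp: circlepath power2_eq_square field_simps exp_minus\<close>)
 from has_integral_mult_right[OF this, of "r / (2 * pi * \<i>)"] r
 have "((%x. ?h (r * exp (2 * of_real pi * \<i> * of_real x)) *
    exp (- (2 * of_real pi * \<i> * of_real x))) has_integral r * dir_deriv f v z) {0..1}"
  by (simp add: algebra_simps)
 then show ?thesis using r by (simp add: integral_unique)
qed

lemma hol_translate:
 assumes "hol f U" "!!z. z : V ==> z + a : U"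
 shows "hol (%z. f (z + a)) V"
proof (rule holomorphic_funI)
 fix z assume "z : V"
 then obtain f' where f: "(f has_derivative f') (at (z + a))" and lin: "!!c u. f' (c *s u) = c * f' u"
  using holomorphic_funE assms by metis
 have "((%z. z + a) has_derivative (%u. u)) (at z)" by (auto intro!: derivative_eq_intros)
 from diff_chain_at[OF this f] lin
 show "EX f'. ((%z. f (z + a)) has_derivative f') (at z) & (ALL c u. f' (c *s u) = c * f' u)"
  by (intro exI[of _ f']) (auto simp: o_def)
qed

lemma line_in_ball:
 fixes z v :: "complex^'n"
 assumes "z : ball z0 \<delta>" "norm t * norm v <= \<delta>"
 shows "z + t *s v : ball z0 (2 * \<delta>)"
proof -
 have "dist z0 (z + t *s v) <= dist z0 z + norm (t *s v)"
  using dist_triangle[of z0 "z + t *s v" z] by (simp add: dist_norm norm_minus_commute)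
 then show ?thesis using assms by (simp add: norm_vec_scale)
qed

text \<open>Differentiation under the integral sign requires a derivative that is jointly continuous
  in \<open>(z, s)\<close>, while only \<open>F\<close> is assumed continuous. Cauchy's formula
  writes each directional derivative as an integral of \<open>F\<close> over a circle, and such an
  integral is jointly continuous.\<close>

lemma hol_integral:
 fixes F :: "complex^'n => real => complex"
 assumes U: "open U" and hol: "!!s. s : {0..1} ==> hol (%z. F z s) U"
  and cont: "continuous_on (U \<times> {0..1}) (%(z, s). F z s)"
 shows "hol (%z. integral {0..1} (F z)) U"
proof (rule holomorphic_funI)
 fix z0 assume z0: "z0 : U"
 obtain \<epsilon> where e: "\<epsilon> > 0" "ball z0 \<epsilon> \<subseteq> U" using U z0 openE by blast
 \<comment> \<open>Half the radius leaves room for circles of radius \<delta> around all points of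
   the smaller ball.\<close>
 define \<delta> where "\<delta> = \<epsilon> / 2"
 have \<delta>: "\<delta> > 0" "ball z0 (2 * \<delta>) \<subseteq> U" using e by (auto simp: \<delta>_def)
 let ?B = "ball z0 \<delta>"
 have BU: "?B \<subseteq> U" using \<delta> by (intro order_trans[OF _ \<delta>(2)]) auto
 define D where "D = (%z s. Blinfun (%v. dir_deriv (%z. F z s) v z))"
 have der: "((%z. F z s) has_derivative (%v. dir_deriv (%z. F z s) v z)) (at z)"
  and lin: "dir_deriv (%z. F z s) (c *s v) z = c * dir_deriv (%z. F z s) v z"
  if "z : ?B" "s : {0..1}" for z s c v
  using hol_has_derivative[OF hol[OF that(2)]] that BU by blast+
 have D: "blinfun_apply (D z s) = (%v. dir_deriv (%z. F z s) v z)" if "z : ?B" "s : {0..1}" for z s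
  unfolding D_def using der[OF that] has_derivative_bounded_linear bounded_linear_Blinfun_apply by blast
 have circ: "dir_deriv (%z. F z s) v z = integral {0..1} (%\<theta>. F (z + (\<delta> * exp (2 * of_real pi * \<i> * of_real \<theta>)) *s v) s *
     exp (- (2 * of_real pi * \<i> * of_real \<theta>))) / \<delta>"
  if "z : ?B" "s : {0..1}" "norm v = 1" for z s v
  using line_in_ball[OF that(1)] that \<delta> by (intro dir_deriv_circle_integral[OF hol]) auto
 have contD: "continuous_on (?B \<times> {0..1}) (%(z, s). D z s)"
 proof (rule continuous_on_blinfun_componentwise)
  fix v :: "complex^'n" assume v: "v : Basis"
  then have nv: "norm v = 1" by simp
  have "continuous_on ((?B \<times> {0..1}) \<times> cbox 0 1)
   (%(p, \<theta>). (case p of (z, s) => %\<theta>. F (z + (\<delta> * exp (2 * of_real pi * \<i> * of_real \<theta>)) *s v) s *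
     exp (- (2 * of_real pi * \<i> * of_real \<theta>))) \<theta>)" (is "continuous_on _ ?f")
  proof -
   have "continuous_on ((?B \<times> {0..1}) \<times> {0..1})
    (%q. (case (fst (fst q) + (\<delta> * exp (2 * of_real pi * \<i> * of_real (snd q))) *s v, snd (fst q))
       of (z, s) => F z s) * exp (- (2 * of_real pi * \<i> * of_real (snd q :: real))))"
    by (intro continuous_intros continuous_on_compose2[OF cont])
     (use line_in_ball[of _ z0 \<delta> _ v] \<delta> nv in \<open>auto simp: norm_mult subset_iff mem_ball\<close>)
   moreover have "?f = (%q. (case (fst (fst q) + (\<delta> * exp (2 * of_real pi * \<i> * of_real (snd q))) *s v, snd (fst q))
       of (z, s) => F z s) * exp (- (2 * of_real pi * \<i> * of_real (snd q :: real))))"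
    by (auto simp: fun_eq_iff)
   ultimately show ?thesis by simp
  qed
  from integral_continuous_on_param[OF this]
  have "continuous_on (?B \<times> {0..1}) (%p. integral (cbox 0 1) ((case p of (z, s) => %\<theta>. F (z + (\<delta> * exp (2 * of_real pi * \<i> * of_real \<theta>)) *s v) s *
     exp (- (2 * of_real pi * \<i> * of_real \<theta>)))) / \<delta>)"
   using \<delta> by (intro continuous_intros) auto
  then show "continuous_on (?B \<times> {0..1}) (%x. blinfun_apply (case x of (z, s) => D z s) v)"
   by (rule continuous_on_eq) (auto simp: D circ nv)
 qed
 have F_int: "F z integrable_on cbox 0 1" if "z : ?B" for z
 proof -
  have "continuous_on {0..1} (%s. case (z, s) of (z, s) => F z s)"
   by (intro continuous_on_compose2[OF cont] continuous_intros) (use that BU in auto)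
  then show ?thesis by (simp add: integrable_continuous_interval)
 qed
 have "((%z. integral (cbox 0 1) (F z)) has_derivative integral (cbox 0 1) (D z0)) (at z0 within ?B)"
 proof (rule leibniz_rule[of ?B 0 1 F D])
  fix z t assume "z : ?B" "t : cbox 0 (1::real)"
  then show "((%z. F z t) has_derivative blinfun_apply (D z t)) (at z within ?B)"
   using D[of z t] der[of z t] has_derivative_at_withinI by force
 qed (use F_int contD \<delta> in auto)
 then have "((%z. integral {0..1} (F z)) has_derivative integral {0..1} (D z0)) (at z0)"
  using \<delta> at_within_open[of z0 ?B] by simp
 moreover have "integral {0..1} (D z0) (c *s u) = c * integral {0..1} (D z0) u" for c u
 proof -
  have "continuous_on {0..1} (%s. case (z0, s) of (z, s) => D z s)"
   by (intro continuous_on_compose2[OF contD] continuous_intros) (use \<delta> in auto)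
  then have int: "D z0 integrable_on {0..1}" by (simp add: integrable_continuous_interval)
  have app: "integral {0..1} (D z0) w = integral {0..1} (%s. D z0 s w)" for w
   using blinfun_apply_integral[OF int] by metis
  have "integral {0..1} (%s. D z0 s (c *s u)) = integral {0..1} (%s. c * D z0 s u)"
   by (intro integral_cong) (use D lin \<delta> in auto)
  then show ?thesis by (simp add: app)
 qed
 ultimately show "EX f'. ((%z. integral {0..1} (F z)) has_derivative f') (at z0) & (ALL c u. f' (c *s u) = c * f' u)"
  by blast
qed

lemma hol_dir_deriv:
 assumes U: "open U" and f: "hol f U"
 shows "hol (dir_deriv f v) U"
proof (rule hol_local)
 fix z0 assume z0: "z0 : U"
 obtain \<epsilon> where e: "\<epsilon> > 0" "ball z0 \<epsilon> \<subseteq> U" using U z0 openE by blast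
 define \<delta> where "\<delta> = \<epsilon> / 2"
 have \<delta>: "\<delta> > 0" "ball z0 (2 * \<delta>) \<subseteq> U" using e by (auto simp: \<delta>_def)
 \<comment> \<open>The \<open>1\<close> in the denominator keeps the quotient defined when
   \<open>v = 0\<close>.\<close>
 define r where "r = \<delta> / (1 + norm v)"
 have r: "r > 0" "r * norm v <= \<delta>"
 proof -
  have pos: "0 < 1 + norm v" using norm_ge_zero[of v] by linarith
  then show "r > 0" using \<delta> by (simp add: r_def)
  show "r * norm v <= \<delta>" using pos \<delta> by (simp add: r_def field_simps)
 qed
 let ?B = "ball z0 \<delta>"
 have inU: "z + t *s v : U" if "z : ?B" "norm t <= r" for z t
 proof -
  have "norm t * norm v <= \<delta>" using that r mult_right_mono[of "norm t" r "norm v"] by auto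
  then show ?thesis using line_in_ball that \<delta> by blast
 qed
 let ?F = "%z \<theta>. f (z + (r * exp (2 * of_real pi * \<i> * of_real \<theta>)) *s v) *
     exp (- (2 * of_real pi * \<i> * of_real \<theta>))"
 have "hol (%z. integral {0..1} (?F z)) ?B"
 proof (rule hol_integral)
  show "hol (%z. ?F z s) ?B" for s :: real
   by (intro hol_mult hol_const hol_translate[OF f] inU)
    (use r in \<open>auto simp: norm_mult\<close>)
  show "continuous_on (?B \<times> {0..1}) (%(z, s). ?F z s)"
   unfolding split_beta
   by (intro continuous_intros continuous_on_compose2[OF hol_imp_continuous_on[OF f]])
    (use inU r in \<open>auto simp: norm_mult\<close>)
 qed auto
 then have "hol (%z. integral {0..1} (?F z) * (1 / r)) ?B"
  by (intro hol_mult) auto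
 then have "hol (dir_deriv f v) ?B"
  by (rule hol_cong) (use r inU in \<open>auto simp: dir_deriv_circle_integral[OF f r(1)]\<close>)
 then show "EX V. open V & z0 : V & hol (dir_deriv f v) V"
  using \<delta> by (intro exI[of _ ?B]) auto
qed

section \<open>Holomorphic maps\<close>

lemma holmap_has_derivative:
 fixes \<phi> :: "complex^'n => complex^'m"
 assumes "holmap \<phi> U" "z : U"
 defines "D \<equiv> (%v. \<chi> i. dir_deriv (%z. \<phi> z $ i) v z)"
 shows "(\<phi> has_derivative D) (at z)" "!!c u. D (c *s u) = c *s D u"
proof -
 have hol: "hol (%z. \<phi> z $ i) U" for i
  using assms(1) by (simp add: holomorphic_map_on_def)
 have bl: "bounded_linear (%c :: complex. axis i c :: complex^'m)" for i
 proof (rule bounded_linear_intro[where K = 1])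
  show "norm (axis i x :: complex^'m) <= norm x * 1" for x
   by (simp add: norm_vec_def axis_def L2_set_def if_distrib[of norm] if_distrib[of "%x. x\<^sup>2"] sum.delta cong: if_cong)
 qed (auto simp: axis_def vec_eq_iff)
 have "((%z. \<Sum>i\<in>UNIV. axis i (\<phi> z $ i)) has_derivative (%v. \<Sum>i\<in>UNIV. axis i (dir_deriv (%z. \<phi> z $ i) v z))) (at z)"
  by (intro has_derivative_sum bounded_linear.has_derivative[OF bl]
    hol_has_derivative(1)[OF hol assms(2)])
 moreover have axs: "(\<Sum>i\<in>UNIV. axis i (x i)) = (\<chi> i. x i)" for x :: "'m => complex"
  by (simp add: vec_eq_iff axis_def sum.delta)
 ultimately show "(\<phi> has_derivative D) (at z)" by (simp add: axs D_def)
 show "D (c *s u) = c *s D u" for c u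
  using hol_has_derivative(2)[OF hol assms(2)] by (simp add: D_def vec_eq_iff)
qed

lemma holmapI:
 assumes "!!z. z : U ==> EX D. (\<phi> has_derivative D) (at z) & (ALL c u. D (c *s u) = c *s D u)"
 shows "holmap \<phi> U"
 unfolding holomorphic_map_on_def
proof (rule allI, rule holomorphic_funI)
 fix i z assume "z : U"
 then obtain D where D: "(\<phi> has_derivative D) (at z)" "ALL c u. D (c *s u) = c *s D u" using assms by metis
 then show "EX f'. ((%z. \<phi> z $ i) has_derivative f') (at z) & (ALL c u. f' (c *s u) = c * f' u)"
  by (intro exI[of _ "%u. D u $ i"]) (auto intro: bounded_linear.has_derivative[OF bounded_linear_coord])
qed

lemma hol_compose:
 assumes "hol f V" "holmap \<phi> U" "!!z. z : U ==> \<phi> z : V"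
 shows "hol (%z. f (\<phi> z)) U"
proof (rule holomorphic_funI)
 fix z assume z: "z : U"
 obtain f' where f: "(f has_derivative f') (at (\<phi> z))" and lin: "!!c u. f' (c *s u) = c * f' u"
  using holomorphic_funE assms z by metis
 from diff_chain_at[OF holmap_has_derivative(1)[OF assms(2) z] f] lin
  holmap_has_derivative(2)[OF assms(2) z]
 show "EX f'. ((%z. f (\<phi> z)) has_derivative f') (at z) & (ALL c u. f' (c *s u) = c * f' u)"
  by (intro exI) (auto simp: o_def)
qed

lemma holmap_compose:
 assumes "holmap \<psi> V" "holmap \<phi> U" "!!z. z : U ==> \<phi> z : V"
 shows "holmap (%z. \<psi> (\<phi> z)) U"
 using assms hol_compose unfolding holomorphic_map_on_def[of \<psi>] holomorphic_map_on_def[of "%z. \<psi> (\<phi> z)"]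
 by blast

lemma holmap_imp_continuous_on:
 "holmap \<phi> U ==> continuous_on U \<phi>"
 by (rule continuous_at_imp_continuous_on)
  (use has_derivative_continuous holmap_has_derivative(1) in blast)

lemma scaleR_vec_eq: "r *\<^sub>R (u :: complex^'n) = of_real r *s u"
 by (simp add: vec_eq_iff scaleR_conv_of_real[where 'a = complex])

section \<open>The identity theorem and nonvanishing loci\<close>

lemma convex_line_vimage:
 fixes p v :: "complex^'n"
 assumes "convex U"
 shows "convex ((%t. p + t *s v) -` U)"
proof (rule convexI)
 let ?L = "%t. p + t *s v"
 fix x y :: complex and a b :: real
 assume xy: "x : ?L -` U" "y : ?L -` U" "0 <= a" "0 <= b" "a + b = 1"
 have "complex_of_real a + complex_of_real b = 1" using xy by (metis of_real_1 of_real_add)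
 then have pi: "p $ i = of_real a * p $ i + of_real b * p $ i" for i by (metis distrib_right mult_1)
 have "?L (a *\<^sub>R x + b *\<^sub>R y) $ i = (a *\<^sub>R ?L x + b *\<^sub>R ?L y) $ i" for i
 proof -
  have "?L (a *\<^sub>R x + b *\<^sub>R y) $ i = p $ i + (of_real a * x + of_real b * y) * v $ i"
   by (simp add: scaleR_conv_of_real[where 'a = complex] distrib_right)
  also have "\<dots> = of_real a * (p $ i + x * v $ i) + of_real b * (p $ i + y * v $ i)"
   by (subst pi) (simp only: distrib_left distrib_right mult.assoc add.assoc add.left_commute)
  also have "\<dots> = (a *\<^sub>R ?L x + b *\<^sub>R ?L y) $ i"
   by (simp add: scaleR_conv_of_real[where 'a = complex])
  finally show ?thesis .
 qed
 then have "?L (a *\<^sub>R x + b *\<^sub>R y) = a *\<^sub>R ?L x + b *\<^sub>R ?L y"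
  by (intro vec_eq_iff[THEN iffD2] allI)
 then show "a *\<^sub>R x + b *\<^sub>R y : ?L -` U" using xy convexD[OF assms] by simp
qed

lemma linear_scale_imp_bounded_linear:
 fixes L :: "complex^'n => complex^'m"
 assumes "!!u v. L (u + v) = L u + L v" "!!c u. L (c *s u) = c *s L u"
 shows "bounded_linear L"
proof -
 have "linear L"
 proof (rule linearI)
  fix r :: real and u
  show "L (r *\<^sub>R u) = r *\<^sub>R L u" by (simp add: scaleR_vec_eq assms(2))
 qed (rule assms)
 then show ?thesis by (simp add: linear_conv_bounded_linear)
qed

lemma holmap_linear:
 fixes L :: "complex^'n => complex^'m"
 assumes "!!u v. L (u + v) = L u + L v" "!!c u. L (c *s u) = c *s L u"
 shows "holmap L U"
 by (rule holmapI)
  (use assms linear_scale_imp_bounded_linear[OF assms] bounded_linear_imp_has_derivative in blast)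

text \<open>Join \<open>z\<close> to a point \<open>p\<close> of \<open>W\<close> by a complex line.
  The parameters that land in the convex set \<open>U\<close> form a convex, hence connected, plane
  domain, so the one-variable identity theorem carries the zeros near the parameter \<open>0\<close>
  to the parameter \<open>1\<close>.\<close>

lemma hol_identity:
 assumes f: "hol f U" and U: "convex U" "open U"
  and W: "open W" "W ~= {}" "W \<subseteq> U" and zero: "!!z. z : W ==> f z = 0" and z: "z : U"
 shows "f z = 0"
proof -
 obtain p where p: "p : W" using W by blast
 let ?L = "%t. p + t *s (z - p)"
 have cont: "continuous_on UNIV ?L" by (intro continuous_intros)
 have op: "open (?L -` T)" if "open T" for T using open_vimage[OF that cont] .
 have conv: "convex (?L -` U)" by (rule convex_line_vimage[OF U(1)])
 have "f (?L 1) = (%_. 0) (1::complex)"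
 proof (rule analytic_continuation_open[of "?L -` W" "?L -` U" "%t. f (?L t)" "%_. 0" 1])
  show "(%t. f (?L t)) holomorphic_on ?L -` U" by (rule holomorphic_on_line[OF f]) auto
  have "0 : ?L -` W" using p by simp
  then show "?L -` W ~= {}" by (metis empty_iff)
  show "1 : ?L -` U" using z by simp
 qed (use W op U zero convex_connected[OF conv] in auto)
 then show ?thesis by simp
qed

lemma nonzero_set_meets_open:
 assumes f: "hol f U" and U: "convex U" "open U" and nz: "z : U" "f z ~= 0"
  and W: "open W" "W ~= {}" "W \<subseteq> U"
 shows "EX w:W. f w ~= 0"
 using hol_identity[OF f U W] nz by blast

lemma open_nonzero_set:
 assumes "hol f U" "open U"
 shows "open {z:U. f z ~= 0}"
proof -
 have "open (f -` (- {0}) Int U)"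
  using continuous_open_preimage[OF hol_imp_continuous_on[OF assms(1)] assms(2), of "- {0}"]
  by (simp add: Int_commute open_Compl)
 then show ?thesis by (simp add: vimage_def Int_def conj_commute)
qed

text \<open>Two points where \<open>f\<close> is nonzero lie on a complex line. On it
  \<open>f\<close> does not vanish identically, so its zeros are countable, and a connected open
  plane set stays path connected when a countable set is removed.\<close>

lemma connected_nonzero_set:
 assumes f: "hol f U" and U: "convex U" "open U"
 shows "connected {z:U. f z ~= 0}"
proof -
 have "path_component {z:U. f z ~= 0} p q" if p: "p : U" "f p ~= 0" and q: "q : U" "f q ~= 0" for p q
 proof -
  let ?L = "%t. p + t *s (q - p)"
  let ?S = "?L -` U"
  have cont: "continuous_on UNIV ?L" by (intro continuous_intros)
  have op: "open ?S" using open_vimage[OF U(2) cont] .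
  have conv: "convex ?S" by (rule convex_line_vimage[OF U(1)])
  have hol: "(%t. f (?L t)) holomorphic_on ?S" by (rule holomorphic_on_line[OF f]) auto
  have "countable {t:?S. f (?L t) = 0}"
  proof (cases "(%t. f (?L t)) constant_on ?S")
   case True
   then obtain c where c: "!!t. t : ?S ==> f (?L t) = c" unfolding constant_on_def by blast
   have "f (?L 0) = c" using p by (intro c) simp
   then have "c ~= 0" using p by simp
   then have "{t:?S. f (?L t) = 0} = {}" using c by force
   then show ?thesis using countable_empty by (simp only:)
  next
   case False
   obtain C where "!!m::nat. compact (C m)" "(\<Union>m. C m) = ?S"
    using open_Union_compact_subsets[OF op] by metis
   then have "fsigma ?S" unfolding fsigma_Union_compact by (intro exI[of _ C]) auto
   with False show ?thesis
    using holomorphic_countable_zeros[OF hol op convex_connected[OF conv]] by blast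
  qed
  then have "path_connected (?S - {t:?S. f (?L t) = 0})"
   by (intro path_connected_open_diff_countable op convex_connected conv) auto
  then have "path_connected (?L ` (?S - {t:?S. f (?L t) = 0}))"
   by (rule path_connected_continuous_image[rotated]) (intro continuous_intros)
  moreover have "?L ` (?S - {t:?S. f (?L t) = 0}) \<subseteq> {z:U. f z ~= 0}" by auto
  moreover have "p : ?L ` (?S - {t:?S. f (?L t) = 0})"
   using p by (intro image_eqI[of _ _ 0]) auto
  moreover have "q : ?L ` (?S - {t:?S. f (?L t) = 0})"
   using q by (intro image_eqI[of _ _ 1]) auto
  ultimately show ?thesis
   by (meson path_component_of_subset path_connected_component)
 qed
 then show ?thesis
  by (intro path_connected_imp_connected) (auto simp: path_connected_component)
qed

section \<open>Riemann's extension theorem\<close>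

lemma extend_over_finite_set:
 assumes "finite Z" "s holomorphic_on (S - Z)" "open S" "!!t. t : S - Z ==> norm (s t) <= B"
 shows "EX g. g holomorphic_on S & (ALL t:S - Z. g t = s t)"
 using assms
proof (induction Z arbitrary: s)
 case empty
 then show ?case by auto
next
 case (insert a Z)
 show ?case
 proof (cases "a : S - Z")
  case False
  then have "S - insert a Z = S - Z" by auto
  then show ?thesis using insert by metis
 next
  case True
  have op: "open (S - Z)" by (intro open_Diff finite_imp_closed insert)
  have "eventually (%t. t : S - Z - {a}) (at a)"
   using op True by (auto simp: eventually_at_topological)
  then have "EX B. eventually (%t. norm (s t) <= B) (at a)"
   by (intro exI[of _ B], elim eventually_mono) (use insert in auto)
  moreover have "s holomorphic_on (S - Z) - {a}" using insert.prems(1) by (metis Diff_insert)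
  moreover have "a : interior (S - Z)" using op True by (simp add: interior_open)
  ultimately obtain g where g: "g holomorphic_on S - Z" "!!t. t : S - Z - {a} ==> g t = s t"
   using holomorphic_on_extend_bounded by meson
  \<comment> \<open>The bound must survive the removal of each point for the induction to continue;
    it does because the extended function is continuous at \<open>a\<close>.\<close>
  have "norm (g a) <= B"
  proof -
   have "isCont g a"
    using g(1) op True continuous_on_eq_continuous_at holomorphic_on_imp_continuous_on by blast
   then have "((%t. norm (g t)) \<longlongrightarrow> norm (g a)) (at a)"
    by (intro tendsto_norm) (simp add: isCont_def)
   moreover have "eventually (%t. norm (g t) <= B) (at a)"
    using \<open>eventually (%t. t : S - Z - {a}) (at a)\<close>
    by eventually_elim (use g insert in auto)
   ultimately show ?thesis by (intro tendsto_upperbound) auto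
  qed
  then have "norm (g t) <= B" if "t : S - Z" for t
   using that g insert by (cases "t = a") auto
  from insert.IH[OF g(1) insert.prems(2) this] obtain k where
   "k holomorphic_on S" "ALL t:S - Z. k t = g t" by blast
  then show ?thesis using g by (intro exI[of _ k]) auto
 qed
qed

lemma mean_value_circle:
 assumes "g holomorphic_on cball 0 r" "r > 0"
 shows "integral {0..1} (%\<theta>. g (r * exp (2 * of_real pi * \<i> * of_real \<theta>))) = g 0"
proof -
 have "((%u. g u / (u - 0)) has_contour_integral (2 * of_real pi * \<i> * g 0)) (circlepath 0 r)"
  using assms by (intro Cauchy_integral_circlepath_simple) auto
 then have "((%x. g (circlepath 0 r x) / (circlepath 0 r x) *
    vector_derivative (circlepath 0 r) (at x)) has_integral 2 * of_real pi * \<i> * g 0) {0..1}"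
  unfolding has_contour_integral_def
  by (rule has_integral_eq[rotated]) (auto simp: vector_derivative_at_within_ivl vector_derivative_circlepath
    vector_derivative_circlepath01)
 then have "((%x. (2 * of_real pi * \<i>) * g (r * exp (2 * of_real pi * \<i> * of_real x)))
  has_integral 2 * of_real pi * \<i> * g 0) {0..1}"
  by (rule has_integral_eq[rotated])
   (unfold vector_derivative_circlepath, use assms in \<open>auto simp: circlepath field_simps\<close>)
 from has_integral_mult_right[OF this, of "1 / (2 * of_real pi * \<i>)"]
 have "((%x. g (r * exp (2 * of_real pi * \<i> * of_real x))) has_integral g 0) {0..1}"
  by (simp add: field_simps)
 then show ?thesis by (rule integral_unique)
qed

text \<open>The direction \<open>v\<close> leads from \<open>b\<close> to a point where
  \<open>f\<close> is nonzero, so \<open>f\<close> does not vanish identically on this line and a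
  zero at \<open>b\<close> is isolated on it.\<close>

lemma nonzero_punctured_disc:
 assumes f: "hol f U" and U: "convex U" "open U" and b: "b : U"
  and nz: "b + v : U" "f (b + v) ~= 0"
 shows "EX r>0. ALL t. norm t <= r --> b + t *s v : U & (t ~= 0 --> f (b + t *s v) ~= 0)"
proof -
 let ?L = "%t. b + t *s v"
 have cont: "continuous_on UNIV ?L" by (intro continuous_intros)
 have op: "open (?L -` T)" if "open T" for T using open_vimage[OF that cont] .
 have hol: "(%t. f (?L t)) holomorphic_on ?L -` U" by (rule holomorphic_on_line[OF f]) auto
 obtain e where e: "e > 0" "ball 0 e \<subseteq> ?L -` U" "!!t. t : ball 0 e - {0} ==> f (?L t) ~= 0"
 proof (cases "f b = 0")
  case True
  show ?thesis
   by (rule isolated_zeros[OF hol op[OF U(2)] convex_connected[OF convex_line_vimage[OF U(1)]], of 0 1])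
    (use b nz True that in auto)
 next
  case False
  have "open (?L -` {z:U. f z ~= 0})" using op open_nonzero_set[OF f U(2)] by blast
  moreover have "0 : ?L -` {z:U. f z ~= 0}" using False b by simp
  ultimately obtain e where "e > 0" "ball 0 e \<subseteq> ?L -` {z:U. f z ~= 0}" using openE by blast
  then show ?thesis by (intro that[of e]) auto
 qed
 then show ?thesis by (intro exI[of _ "e / 2"]) (auto simp: subset_iff)
qed

lemma tube_in_open:
 fixes b v :: "complex^'n"
 assumes "open U" "compact T" "!!t. t : T ==> b + t *s v : U"
 shows "EX \<delta>>0. ALL z:ball b \<delta>. ALL t:T. z + t *s v : U"
proof -
 have "compact ((%t. b + t *s v) ` T)"
  by (intro compact_continuous_image continuous_intros assms)
 then obtain \<delta> where \<delta>: "\<delta> > 0" "(\<Union>x\<in>(%t. b + t *s v) ` T. ball x \<delta>) \<subseteq> U"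
  using compact_subset_open_imp_ball_epsilon_subset[of "(%t. b + t *s v) ` T" U] assms by blast
 have "z + t *s v : ball (b + t *s v) \<delta>" if "z : ball b \<delta>" for z t
  using that by (simp add: dist_norm)
 then show ?thesis using \<delta> by (intro exI[of _ \<delta>]) blast
qed

text \<open>The extension is the mean of \<sigma> over a small circle in the direction
  \<open>p - b\<close>. The circle avoids the zeros of \<open>h\<close>, even after its centre is
  moved a little, so the mean is holomorphic. At a point with \<open>h z ~= 0\<close>, the
  one-variable extension along the line and the mean value property show that the mean equals
  \<open>\<sigma> z\<close>.\<close>

lemma riemann_extension_local:
 assumes D: "convex D" "open D" and h: "hol h D" and nz: "p : D" "h p ~= 0"
  and s: "hol \<sigma> {z:D. h z ~= 0}" and B: "!!z. z : D ==> h z ~= 0 ==> norm (\<sigma> z) <= B"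
  and b: "b : D"
 shows "EX \<delta>>0. EX \<tau>. ball b \<delta> \<subseteq> D & hol \<tau> (ball b \<delta>) &
     (ALL z:ball b \<delta>. h z ~= 0 --> \<tau> z = \<sigma> z)"
proof -
 let ?v = "p - b" and ?N = "{z:D. h z ~= 0}"
 obtain r where r: "r > 0" "!!t. norm t <= r ==> b + t *s ?v : D"
  "!!t. norm t <= r ==> t ~= 0 ==> h (b + t *s ?v) ~= 0"
  using nonzero_punctured_disc[OF h D b, of ?v] nz by auto
 have opN: "open ?N" by (rule open_nonzero_set[OF h D(2)])
 obtain d1 where d1: "d1 > 0" "!!z t. z : ball b d1 ==> norm t <= r ==> z + t *s ?v : D"
  using tube_in_open[OF D(2) compact_cball[of 0 r], of b ?v] r by auto
 obtain d2 where d2: "d2 > 0" "!!z t. z : ball b d2 ==> norm t = r / 2 ==> z + t *s ?v : ?N"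
  using tube_in_open[OF opN compact_sphere[of 0 "r / 2"], of b ?v] r by force
 define \<delta> where "\<delta> = min d1 d2"
 have \<delta>: "\<delta> > 0" using d1 d2 by (simp add: \<delta>_def)
 let ?F = "%z \<theta>. \<sigma> (z + ((r / 2) * exp (2 * of_real pi * \<i> * of_real \<theta>)) *s ?v)"
 have inN: "z + (complex_of_real (r / 2) * exp (2 * of_real pi * \<i> * of_real \<theta>)) *s ?v : ?N"
  if "z : ball b \<delta>" for z and \<theta> :: real
  by (rule d2(2)) (use that r in \<open>auto simp: norm_mult \<delta>_def norm_divide\<close>)
 have ballD: "ball b \<delta> \<subseteq> D" using d1(2)[of _ 0] r by (auto simp: \<delta>_def)
 have "hol (%z. integral {0..1} (?F z)) (ball b \<delta>)"
 proof (rule hol_integral)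
  show "hol (%z. ?F z \<theta>) (ball b \<delta>)" for \<theta> :: real
   using inN by (intro hol_translate[OF s]) auto
  show "continuous_on (ball b \<delta> \<times> {0..1}) (%(z, s). ?F z s)"
   unfolding split_beta
   by (intro continuous_intros continuous_on_compose2[OF hol_imp_continuous_on[OF s]])
    (use inN in \<open>auto\<close>)
 qed auto
 moreover have "integral {0..1} (?F z) = \<sigma> z" if z: "z : ball b \<delta>" "h z ~= 0" for z
 proof -
  let ?L = "%t. z + t *s ?v"
  let ?S = "?L -` D"
  have opS: "open ?S" by (intro open_vimage[OF D(2)] continuous_intros)
  have cS: "connected ?S" by (intro convex_connected convex_line_vimage D)
  have zr: "cball 0 r \<subseteq> ?S" using d1(2) z by (auto simp: \<delta>_def)
  have hol: "(%t. h (?L t)) holomorphic_on ?S" by (rule holomorphic_on_line[OF h]) auto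
  have inD: "?L t : D" if "norm t <= r" for t using d1(2)[of z t] that z by (simp add: \<delta>_def)
  let ?Z = "{t:cball 0 r. h (?L t) = 0}"
  have fin: "finite ?Z"
  proof (cases "(%t. h (?L t)) constant_on ?S")
   case True
   then obtain c where c: "!!t. t : ?S ==> h (?L t) = c" unfolding constant_on_def by blast
   have "(0::complex) : cball 0 r" using r by simp
   then have "h (?L 0) = c" using c zr by blast
   then have "?Z = {}" using c zr z by force
   then show ?thesis by (metis finite.emptyI)
  next
   case False
   then show ?thesis
    using holomorphic_compact_finite_zeros[OF hol opS cS compact_cball zr] by blast
  qed
  have "EX g. g holomorphic_on ball 0 r & (ALL t:ball 0 r - ?Z. g t = \<sigma> (?L t))"
  proof (rule extend_over_finite_set[OF fin])
   show "(%t. \<sigma> (?L t)) holomorphic_on ball 0 r - ?Z"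
   proof (rule holomorphic_on_line[OF s])
    fix t :: complex assume "t : ball 0 r - ?Z"
    then show "?L t : ?N" using inD[of t] by simp
   qed
   show "norm (\<sigma> (?L t)) <= B" if "t : ball 0 r - ?Z" for t
    by (rule B) (use inD[of t] that in simp_all)
  qed auto
  then obtain g where g: "g holomorphic_on ball 0 r" "!!t. t : ball 0 r - ?Z ==> g t = \<sigma> (?L t)" by blast
  have "integral {0..1} (?F z) = integral {0..1} (%\<theta>. g (complex_of_real (r/2) * exp (2 * of_real pi * \<i> * of_real \<theta>)))"
  proof (rule integral_cong)
   fix \<theta> :: real
   let ?t = "complex_of_real (r/2) * exp (2 * of_real pi * \<i> * of_real \<theta>)"
   have "norm ?t = r / 2" using r by (simp add: norm_mult norm_divide)
   then have "?t : ball 0 r - ?Z" using r inN[OF z(1), of \<theta>] by simp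
   from g(2)[OF this] show "?F z \<theta> = g ?t" by simp
  qed
  also have "\<dots> = g 0"
   by (rule mean_value_circle) (use r in \<open>auto intro: holomorphic_on_subset[OF g(1)]\<close>)
  also have "\<dots> = \<sigma> z" using z r by (subst g(2)) auto
  finally show ?thesis .
 qed
 ultimately show ?thesis using \<delta> ballD by (intro exI[of _ \<delta>] conjI exI[of _ "%z. integral {0..1} (?F z)"]) auto
qed

text \<open>The complement of \<open>G\<close> lies locally in the zero set of a nontrivial
  holomorphic function, so \<open>G\<close> is dense. Local extensions therefore agree wherever they
  overlap and can be glued.\<close>

theorem riemann_extension:
 assumes G: "open G"
  and thin: "!!b. EX r>0. EX h p. hol h (ball b r) & p : ball b r & h p ~= 0 &
        {z:ball b r. h z ~= 0} \<subseteq> G & (EX B. ALL z:ball b r. h z ~= 0 --> norm (\<sigma> z) <= B)"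
  and s: "hol \<sigma> G"
 shows "EX \<tau>. hol \<tau> UNIV & (ALL z:G. \<tau> z = \<sigma> z)"
proof -
 have dense: "W Int G ~= {}" if W: "open W" "W ~= {}" for W
 proof -
  obtain b where b: "b : W" using W by blast
  obtain r h p where h: "r > 0" "hol h (ball b r)" "p : ball b r" "h p ~= 0"
   "{z:ball b r. h z ~= 0} \<subseteq> G"
   using thin[of b] by (elim exE conjE) (rule that; assumption)
  have "EX w:W Int ball b r. h w ~= 0"
   by (rule nonzero_set_meets_open[OF h(2) _ _ h(3,4)]) (use W b h in auto)
  then show ?thesis using h by auto
 qed
 have loc: "EX \<delta>>0. EX \<tau>. hol \<tau> (ball b \<delta>) & (ALL z:ball b \<delta> Int G. \<tau> z = \<sigma> z)" for b
 proof -
  obtain r h p B where h: "r > 0" "hol h (ball b r)" "p : ball b r" "h p ~= 0"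
   "{z:ball b r. h z ~= 0} \<subseteq> G" and B: "ALL z:ball b r. h z ~= 0 --> norm (\<sigma> z) <= B"
   using thin[of b] by (elim exE conjE) (rule that; assumption)
  obtain \<delta> \<tau> where \<tau>: "\<delta> > 0" "ball b \<delta> \<subseteq> ball b r" "hol \<tau> (ball b \<delta>)"
   "!!z. z:ball b \<delta> ==> h z ~= 0 ==> \<tau> z = \<sigma> z"
   using riemann_extension_local[OF convex_ball open_ball h(2-4) hol_on_subset[OF s h(5)], of B b] h B
   by auto
  \<comment> \<open>Points of \<open>G\<close> where \<open>h\<close> vanishes are not covered by
    the local lemma. Near them both functions are holomorphic and agree where \<open>h\<close> is
    nonzero, which is a dense set.\<close>
  have "\<tau> z = \<sigma> z" if z: "z : ball b \<delta> Int G" for z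
  proof (rule ccontr)
   assume ne: "\<tau> z ~= \<sigma> z"
   let ?f = "%z. \<tau> z - \<sigma> z"
   have hol: "hol ?f (ball b \<delta> Int G)"
    using \<tau> s by (intro hol_diff) (auto intro: hol_on_subset)
   have "open {z:ball b \<delta> Int G. ?f z ~= 0}" using open_nonzero_set[OF hol] G by auto
   then have "EX w:{z:ball b \<delta> Int G. ?f z ~= 0}. h w ~= 0"
    by (intro nonzero_set_meets_open[OF h(2) _ _ h(3,4)]) (use ne z \<tau> in auto)
   then show False using \<tau> by auto
  qed
  then show ?thesis using \<tau> by blast
 qed
 obtain \<delta> T where T: "!!b. \<delta> b > 0" "!!b. hol (T b) (ball b (\<delta> b))"
  "!!b z. z : ball b (\<delta> b) ==> z : G ==> T b z = \<sigma> z"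
 proof -
  have "ALL b. EX p. fst p > 0 & hol (snd p) (ball b (fst p)) & (ALL z:ball b (fst p) Int G. snd p z = \<sigma> z)"
   using loc by simp
  then obtain P where "ALL b. fst (P b) > 0 & hol (snd (P b)) (ball b (fst (P b))) &
   (ALL z:ball b (fst (P b)) Int G. snd (P b) z = \<sigma> z)"
   by (rule choice[THEN exE])
  then show ?thesis by (intro that[of "%b. fst (P b)" "%b. snd (P b)"]) auto
 qed
 have eq: "T z z = T b z" if z: "z : ball b (\<delta> b)" for z b
 proof (rule ccontr)
  assume ne: "T z z ~= T b z"
  let ?f = "%w. T z w - T b w" and ?W = "ball b (\<delta> b) Int ball z (\<delta> z)"
  have hol: "hol ?f ?W"
   by (intro hol_diff) (auto intro: hol_on_subset[OF T(2)])
  have "open {w:?W. ?f w ~= 0}" using open_nonzero_set[OF hol] by auto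
  moreover have "z : {w:?W. ?f w ~= 0}" using z ne T by auto
  ultimately have "{w:?W. ?f w ~= 0} Int G ~= {}" using dense by blast
  then show False using T by auto
 qed
 have "hol (%z. T z z) UNIV"
 proof (rule hol_local)
  fix b
  have "hol (%z. T z z) (ball b (\<delta> b))"
   by (rule hol_cong[OF T(2)]) (use eq in auto)
  then show "EX V. open V & b : V & hol (%z. T z z) V"
   using T(1)[of b] by (intro exI[of _ "ball b (\<delta> b)"]) auto
 qed
 moreover have "T z z = \<sigma> z" if "z : G" for z using T that by auto
 ultimately show ?thesis by blast
qed

subsection \<open>Entire functions of polynomial growth\<close>

text \<open>Polynomial functions as an inductive closure, which gives induction on the construction
  instead of work with coefficient families. \<open>polyfn_cpoly_eval\<close> and
  \<open>cpoly_eval_if_polyfn\<close> connect them with \<open>cpoly_eval\<close>.\<close>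

inductive polyfn :: "(complex^'n => complex) => bool" where
 const: "polyfn (%_. c)"
| coord: "polyfn (%z. z $ i)"
| add: "polyfn f ==> polyfn g ==> polyfn (%z. f z + g z)"
| mult: "polyfn f ==> polyfn g ==> polyfn (%z. f z * g z)"

lemma polyfn_sum:
 "(!!i. i : A ==> polyfn (f i)) ==> polyfn (%z. \<Sum>i\<in>A. f i z)"
 by (induction A rule: infinite_finite_induct) (simp_all add: polyfn.const polyfn.add)

lemma polyfn_power: "polyfn f ==> polyfn (%z. f z ^ k)"
 by (induction k) (simp_all add: polyfn.const polyfn.mult)

lemma polyfn_prod:
 "(!!i. i : A ==> polyfn (f i)) ==> polyfn (%z. \<Prod>i\<in>A. f i z)"
 by (induction A rule: infinite_finite_induct) (simp_all add: polyfn.const polyfn.mult)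

lemma polyfn_holomorphic: "polyfn f ==> hol f U"
 by (induction rule: polyfn.induct) (simp_all add: hol_add hol_mult)

text \<open>The projection is an endomorphism that sets the remaining coordinates to zero. Base and
  total space thus share one type, and functions on the base are those with
  \<open>f z = f (cproj I z)\<close>.\<close>

definition cproj :: "'n set => complex^'n => complex^'n" where
 "cproj I z = (\<chi> i. if i : I then z $ i else 0)"

lemma cproj_nth [simp]: "cproj I z $ i = (if i : I then z $ i else 0)"
 by (simp add: cproj_def)

lemma cproj_add [simp]: "cproj I (z + w) = cproj I z + cproj I w"
 by (simp add: vec_eq_iff)

lemma cproj_diff [simp]: "cproj I (z - w) = cproj I z - cproj I w"
 by (simp add: vec_eq_iff)

lemma cproj_scale [simp]: "cproj I (c *s z) = c *s cproj I z"
 by (simp add: vec_eq_iff)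

lemma cproj_cproj [simp]: "cproj I (cproj K z) = cproj (I Int K) z"
 by (simp add: vec_eq_iff)

lemma norm_cproj_le: "norm (cproj I z) <= norm z"
 by (rule norm_le_componentwise_cart) simp

lemma bounded_linear_cproj: "bounded_linear (cproj I)"
 by (rule linear_scale_imp_bounded_linear) auto

lemma continuous_on_cproj [continuous_intros]:
 "continuous_on S f ==> continuous_on S (%x. cproj I (f x))"
 using bounded_linear.continuous_on[OF bounded_linear_cproj] .

lemma holmap_cproj: "holmap (cproj I) U"
 by (rule holmap_linear) auto

definition poly_growth :: "nat => (complex^'n => complex) => bool" where
 "poly_growth M f \<longleftrightarrow> (EX C>=0. ALL z. norm (f z) <= C * (1 + norm z) ^ M)"

lemma polyfn_growth: "polyfn f ==> EX M. poly_growth M f"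
proof (induction rule: polyfn.induct)
 case (const c)
 have "EX C>=0. norm c <= C" by (intro exI[of _ "norm c"]) auto
 then show ?case by (intro exI[of _ 0]) (auto simp: poly_growth_def)
next
 case (coord i)
 have "norm (z $ i) <= 1 * (1 + norm z) ^ 1" for z :: "complex^'a"
 proof -
  have "norm (z $ i) <= norm z" by (rule Finite_Cartesian_Product.norm_nth_le)
  then show ?thesis by simp
 qed
 then show ?case unfolding poly_growth_def by (intro exI[of _ 1] conjI allI) auto
next
 case (add f g)
 then obtain M N C D where M: "C >= 0" "!!z. norm (f z) <= C * (1 + norm z) ^ M"
  and N: "D >= 0" "!!z. norm (g z) <= D * (1 + norm z) ^ N" unfolding poly_growth_def by blast
 have "norm (f z + g z) <= (C + D) * (1 + norm z) ^ (M + N)" for z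
 proof -
  have "C * (1 + norm z) ^ M <= C * (1 + norm z) ^ (M + N)" "D * (1 + norm z) ^ N <= D * (1 + norm z) ^ (M + N)"
   using M N by (auto intro!: mult_left_mono power_increasing)
  then show ?thesis using M(2)[of z] N(2)[of z] norm_triangle_ineq[of "f z" "g z"] by (simp add: algebra_simps)
 qed
 then show ?case using M N unfolding poly_growth_def by (intro exI[of _ "M + N"] exI[of _ "C + D"]) auto
next
 case (mult f g)
 then obtain M N C D where M: "C >= 0" "!!z. norm (f z) <= C * (1 + norm z) ^ M"
  and N: "D >= 0" "!!z. norm (g z) <= D * (1 + norm z) ^ N" unfolding poly_growth_def by blast
 have "norm (f z * g z) <= (C * D) * (1 + norm z) ^ (M + N)" for z
  using mult_mono[OF M(2)[of z] N(2)[of z]] M N by (simp add: norm_mult power_add algebra_simps)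
 then show ?case using M N unfolding poly_growth_def by (intro exI[of _ "M + N"] exI[of _ "C * D"]) auto
qed

lemma higher_deriv_line:
 assumes "hol f UNIV"
 shows "(deriv ^^ k) (%t. f (z + t *s v)) = (%t. ((%f. dir_deriv f v) ^^ k) f (z + t *s v))"
  and "hol (((%f. dir_deriv f v) ^^ k) f) UNIV"
proof -
 have "hol (((%f. dir_deriv f v) ^^ k) f) UNIV &
  (deriv ^^ k) (%t. f (z + t *s v)) = (%t. ((%f. dir_deriv f v) ^^ k) f (z + t *s v))"
 proof (induction k)
  case 0
  then show ?case using assms by auto
 next
  case (Suc k)
  let ?g = "((%f. dir_deriv f v) ^^ k) f"
  have "deriv (%t. ?g (z + t *s v)) t = dir_deriv ?g v (z + t *s v)" for t
   using hol_line_derivative[of ?g UNIV z t v] Suc DERIV_imp_deriv by blast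
  then show ?case using Suc hol_dir_deriv[of UNIV ?g] by auto
 qed
 then show "(deriv ^^ k) (%t. f (z + t *s v)) = (%t. ((%f. dir_deriv f v) ^^ k) f (z + t *s v))"
  "hol (((%f. dir_deriv f v) ^^ k) f) UNIV" by auto
qed

definition taylor_coeff :: "complex^'n => nat => (complex^'n => complex) => complex^'n => complex" where
 "taylor_coeff v k f z = ((%f. dir_deriv f v) ^^ k) f z / fact k"

lemma hol_taylor_coeff:
 "hol f UNIV ==> hol (taylor_coeff v k f) UNIV"
 unfolding taylor_coeff_def divide_inverse
 by (intro hol_mult hol_const higher_deriv_line(2))

text \<open>On a complex line an entire function of growth \<open>M\<close> is a polynomial of
  degree at most \<open>M\<close> by Liouville, so its Taylor expansion stops at
  \<open>k = M\<close>.\<close>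

lemma taylor_expansion_line:
 assumes f: "hol f UNIV" and g: "poly_growth M f"
 shows "f (z + t *s v) = (\<Sum>k\<le>M. taylor_coeff v k f z * t ^ k)"
proof -
 obtain C where C: "C >= 0" "!!z. norm (f z) <= C * (1 + norm z) ^ M" using g unfolding poly_growth_def by blast
 have "f (z + t *s v) = (\<Sum>k\<le>M. (deriv ^^ k) (%t. f (z + t *s v)) 0 / fact k * t ^ k)"
 proof (rule Liouville_polynomial[of _ 1 "C * (1 + norm z + norm v) ^ M"])
  show "(%t. f (z + t *s v)) holomorphic_on UNIV" by (rule holomorphic_on_line[OF f]) auto
  fix t :: complex assume t: "1 <= norm t"
  have "norm (z + t *s v) <= norm z + norm t * norm v" using norm_triangle_ineq[of z "t *s v"] by (simp add: norm_vec_scale)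
  then have "1 + norm (z + t *s v) <= 1 + norm z + norm t * norm v" by simp
  also have "\<dots> <= (1 + norm z + norm v) * norm t"
   using t mult_left_mono[of 1 "norm t" "1 + norm z"] by (simp add: algebra_simps)
  finally have "(1 + norm (z + t *s v)) ^ M <= ((1 + norm z + norm v) * norm t) ^ M"
   by (intro power_mono) auto
  then show "norm (f (z + t *s v)) <= C * (1 + norm z + norm v) ^ M * norm t ^ M"
   using C(2)[of "z + t *s v"] mult_left_mono[OF _ C(1)] by (fastforce simp: power_mult_distrib)
 qed
 then show ?thesis by (simp add: higher_deriv_line(1)[OF f] taylor_coeff_def)
qed

lemma taylor_coeff_growth:
 assumes f: "hol f UNIV" and g: "poly_growth M f"
 shows "poly_growth M (taylor_coeff v k f)"
proof -
 obtain C where C: "C >= 0" "!!z. norm (f z) <= C * (1 + norm z) ^ M" using g unfolding poly_growth_def by blast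
 have "norm (taylor_coeff v k f z) <= (C * (1 + norm v) ^ M) * (1 + norm z) ^ M" for z
 proof -
  let ?B = "(C * (1 + norm v) ^ M) * (1 + norm z) ^ M"
  have "norm ((deriv ^^ k) (%t. f (z + t *s v)) 0) <= fact k * ?B / 1 ^ k"
  proof (rule Cauchy_inequality)
   show "(%t. f (z + t *s v)) holomorphic_on ball 0 1" by (rule holomorphic_on_line[OF f]) auto
   show "continuous_on (cball 0 1) (%t. f (z + t *s v))"
    by (intro holomorphic_on_imp_continuous_on holomorphic_on_line[OF f]) auto
   fix t :: complex assume "norm (0 - t) = 1"
   then have "1 + norm (z + t *s v) <= 1 + norm z + norm v"
    using norm_triangle_ineq[of z "t *s v"] by (simp add: norm_vec_scale)
   also have "\<dots> <= (1 + norm v) * (1 + norm z)" by (simp add: algebra_simps)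
   finally have "(1 + norm (z + t *s v)) ^ M <= ((1 + norm v) * (1 + norm z)) ^ M"
    by (intro power_mono) auto
   then show "norm (f (z + t *s v)) <= ?B"
    using C(2)[of "z + t *s v"] mult_left_mono[OF _ C(1)] by (fastforce simp: power_mult_distrib)
  qed auto
  then show ?thesis
   by (simp add: higher_deriv_line(1)[OF f] taylor_coeff_def norm_divide divide_simps mult.commute)
 qed
 then show ?thesis unfolding poly_growth_def using C by (intro exI[of _ "C * (1 + norm v) ^ M"]) auto
qed

text \<open>Induction on the set of variables on which \<open>f\<close> depends. Expanding in one
  variable leaves finitely many coefficients; these are entire, have the same growth by Cauchy's
  inequality, and depend on one variable less.\<close>

theorem polyfn_if_growth:
 assumes "hol f UNIV" "poly_growth M f"
 shows "polyfn f"
proof -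
 have "polyfn f" if "finite S" "hol f UNIV" "poly_growth M f"
  "!!z. f z = f (cproj S z)" for S and f :: "complex^'n => complex"
  using that
 proof (induction S arbitrary: f)
  case empty
  have "cproj {} z = 0" for z :: "complex^'n" by (simp add: vec_eq_iff)
  then have "f = (%_. f 0)" using empty by (metis (no_types))
  then show ?case using polyfn.const by metis
 next
  case (insert i S)
  let ?v = "axis i 1 :: complex^'n"
  let ?q = "cproj (- {i})"
  let ?g = "%k z. taylor_coeff ?v k f (cproj S z)"
  have dec: "cproj (insert i S) z = cproj S z + (z $ i) *s ?v" for z
   using insert.hyps by (auto simp: vec_eq_iff axis_def)
  have "f z = (\<Sum>k\<le>M. ?g k z * (z $ i) ^ k)" for z
   using taylor_expansion_line[OF insert.prems(1,2), of "cproj S z" "z $ i" ?v]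
    insert.prems(3)[of z] dec[of z] by simp
  then have f: "f = (%z. \<Sum>k\<le>M. ?g k z * (z $ i) ^ k)" by blast
  have "polyfn (?g k)" for k
  proof (rule insert.IH)
   show "hol (?g k) UNIV"
    by (intro hol_compose[OF hol_taylor_coeff[OF insert.prems(1)]] holmap_cproj) auto
   obtain C where C: "C >= 0" "!!z. norm (taylor_coeff ?v k f z) <= C * (1 + norm z) ^ M"
    using taylor_coeff_growth[OF insert.prems(1,2)] unfolding poly_growth_def by blast
   have "norm (?g k z) <= C * (1 + norm z) ^ M" for z
    using C(2)[of "cproj S z"] mult_left_mono[OF power_mono[of "1 + norm (cproj S z)" "1 + norm z" M] C(1)]
     norm_cproj_le[of S z] by force
   then show "poly_growth M (?g k)" unfolding poly_growth_def using C by blast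
  qed auto
  then show ?case by (subst f) (intro polyfn_sum polyfn.mult polyfn_power polyfn.coord)
 qed
 from this[of UNIV f] assms show ?thesis by (simp add: cproj_def)
qed

subsection \<open>Local inverses\<close>

text \<open>The real inverse function theorem supplies the local inverse. Its derivative is the
  inverse of a complex linear bijection and therefore complex linear.\<close>

theorem holomorphic_local_inverse:
 fixes \<phi> :: "complex^'n => complex^'n"
 assumes hol: "holmap \<phi> U" and U: "open U" "p : U"
  and der: "(\<phi> has_derivative D) (at p)" and inj: "!!v. D v = 0 ==> v = 0"
 obtains U' V \<theta> where "open U'" "U' \<subseteq> U" "p : U'" "open V" "homeomorphism U' V \<phi> \<theta>"
  "holmap \<theta> V"
proof -
 define D' where "D' = (%z v. (\<chi> i. dir_deriv (%z. \<phi> z $ i) v z))"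
 have D': "(\<phi> has_derivative D' z) (at z)" "!!c u. D' z (c *s u) = c *s D' z u" if "z : U" for z
  using holmap_has_derivative[OF hol that] by (auto simp: D'_def)
 have bl: "bounded_linear (D' z)" if "z : U" for z using D'(1)[OF that] has_derivative_bounded_linear by blast
 define f' where "f' = (%z. Blinfun (D' z))"
 have f': "blinfun_apply (f' z) = D' z" if "z : U" for z
  unfolding f'_def using bl[OF that] bounded_linear_Blinfun_apply by blast
 have "continuous_on U f'"
 proof (rule continuous_on_blinfun_componentwise)
  fix v :: "complex^'n"
  have "continuous_on U (%z. D' z v)"
   unfolding D'_def using hol U
   by (intro continuous_on_vec_lambda hol_imp_continuous_on hol_dir_deriv)
    (auto simp: holomorphic_map_on_def)
  then show "continuous_on U (%z. blinfun_apply (f' z) v)" by (rule continuous_on_eq) (simp add: f')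
 qed
 moreover have "D = D' p" using has_derivative_unique[OF der D'(1)[OF U(2)]] .
 then have "inj (D' p)"
  using inj linear_injective_0 bounded_linear.linear[OF bl[OF U(2)]] by blast
 then obtain g where g: "linear g" "g \<circ> D' p = id"
  using linear_injective_left_inverse[OF bounded_linear.linear[OF bl[OF U(2)]]] by blast
 then have blg: "bounded_linear g" by (simp add: linear_conv_bounded_linear)
 have "Blinfun g o\<^sub>L f' p = id_blinfun"
  by (rule blinfun_eqI) (use g in \<open>auto simp: bounded_linear_Blinfun_apply[OF blg] f' U fun_eq_iff\<close>)
 ultimately obtain U' V \<theta> g' where *: "open U'" "U' \<subseteq> U" "p : U'" "open V" "homeomorphism U' V \<phi> \<theta>"
  "!!y. y : V ==> (\<theta> has_derivative (g' y)) (at y)"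
  "!!y. y : V ==> g' y = inv (blinfun_apply (f'(\<theta> y)))"
  "!!y. y : V ==> bij (blinfun_apply (f'(\<theta> y)))"
  using inverse_function_theorem[OF U(1) _ _ U(2), of \<phi> f' "Blinfun g"] D'(1) f' by (metis (no_types, lifting))
 have "holmap \<theta> V"
 proof (rule holmapI)
  fix y assume y: "y : V"
  then have thU: "\<theta> y : U" using *(2,5) by (auto simp: homeomorphism_def)
  have bij: "bij (D' (\<theta> y))" and g': "g' y = inv (D' (\<theta> y))" using *(7,8)[OF y] f'[OF thU] by auto
  have "g' y (c *s u) = c *s g' y u" for c u
  proof -
   have "D' (\<theta> y) (c *s g' y u) = c *s u"
    using D'(2)[OF thU] bij g' by (simp add: bij_is_surj surj_f_inv_f)
   then show ?thesis using g' bij by (metis bij_inv_eq_iff)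
  qed
  then show "EX D. (\<theta> has_derivative D) (at y) & (ALL c u. D (c *s u) = c *s D u)" using *(6)[OF y] by blast
 qed
 then show ?thesis using that * by blast
qed

section \<open>Traces and norms over the zeros on a line\<close>

lemma finite_zeros_compact:
 fixes g :: "complex => complex"
 assumes "g holomorphic_on S" "open S" "connected S" "compact K" "K \<subseteq> S" "p : S" "g p ~= 0"
 shows "finite {t:K. g t = 0}"
proof (cases "g constant_on S")
 case True
 then obtain c where "!!t. t : S ==> g t = c" unfolding constant_on_def by blast
 then have "{t:K. g t = 0} = {}" using assms by force
 then show ?thesis by (metis finite.emptyI)
next
 case False
 then show ?thesis using holomorphic_compact_finite_zeros assms by blast
qed

definition line_zeros :: "(complex^'n => complex) => complex^'n => real => complex^'n => complex set" where
 "line_zeros f v r z = {t:ball 0 r. f (z + t *s v) = 0}"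

text \<open>\<open>nat\<close> loses nothing at the zeros that are counted: under the hypotheses of
  \<open>trace_formula\<close> their order is positive.\<close>

definition line_order :: "(complex^'n => complex) => complex^'n => complex^'n => complex => nat" where
 "line_order f v z t = nat (zorder (%t. f (z + t *s v)) t)"

text \<open>The argument principle with weight \<open>q\<close>: the contour integral of
  \<open>q\<close> times the logarithmic derivative of \<open>f\<close> sums \<open>q\<close> over
  the enclosed zeros with multiplicity. It is written over the parameter interval so that
  \<open>hol_integral\<close> applies to it.\<close>

lemma trace_formula:
 assumes R: "r < R" and r: "r > 0"
  and f: "hol f U" and q: "hol q U"
  and U: "!!t. norm t < R ==> z + t *s v : U"
  and nz: "!!t. norm t = r ==> f (z + t *s v) ~= 0"
 shows "finite (line_zeros f v r z)" and "!!t. t : line_zeros f v r z ==> line_order f v z t > 0"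
  and "integral {0..1} (%\<theta>. let x = r * exp (2 * of_real pi * \<i> * of_real \<theta>) in
      dir_deriv f v (z + x *s v) * q (z + x *s v) / f (z + x *s v) * x)
    = (\<Sum>t\<in>line_zeros f v r z. of_nat (line_order f v z t) * q (z + t *s v))"
proof -
 let ?g = "%t. f (z + t *s v)" and ?q = "%t. q (z + t *s v)"
 \<comment> \<open>The argument principle is applied on an open disc slightly larger than the
   circle. Its closure still lies in the domain, which makes the set of zeros finite.\<close>
 define R' where "R' = (r + R) / 2"
 have R': "r < R'" "R' < R" using R by (auto simp: R'_def)
 have hg: "?g holomorphic_on ball 0 R" by (rule holomorphic_on_line[OF f]) (use U in auto)
 have hq: "?q holomorphic_on ball 0 R" by (rule holomorphic_on_line[OF q]) (use U in auto)
 have rR: "of_real r : ball (0::complex) R" "?g (of_real r) ~= 0" using r R nz[of "of_real r"] by auto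
 have fin': "finite {t:cball 0 R'. ?g t = 0}"
  using R' rR by (intro finite_zeros_compact[OF hg, of _ "of_real r"]) auto
 show fin: "finite (line_zeros f v r z)"
  by (rule finite_subset[OF _ fin']) (use R' in \<open>auto simp: line_zeros_def\<close>)
 have zo: "zorder ?g t > 0" if "t : line_zeros f v r z" for t
 proof -
  have t: "t : ball 0 R" "?g t = 0" using that R by (auto simp: line_zeros_def)
  have "EX w:ball 0 R. ?g w ~= 0" using rR by blast
  from zorder_exist_zero[OF hg open_ball connected_ball t(1) this] show ?thesis using t(2) by simp
 qed
 then show "line_order f v z t > 0" if "t : line_zeros f v r z" for t
  using that by (simp add: line_order_def)
 have *: "contour_integral (circlepath 0 r) (%x. deriv ?g x * ?q x / ?g x) = 2 * pi * \<i> *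
     (\<Sum>p\<in>{w:ball 0 R'. ?g w = 0 \<or> w : {}}. winding_number (circlepath 0 r) p * ?q p * zorder ?g p)"
 proof (rule argument_principle)
  show "?g holomorphic_on ball 0 R' - {}" "?q holomorphic_on ball 0 R'"
   by (rule holomorphic_on_subset[OF hg], use R' in auto) (rule holomorphic_on_subset[OF hq], use R' in auto)
  show "path_image (circlepath 0 r) \<subseteq> ball 0 R' - {w : ball 0 R'. ?g w = 0 \<or> w : {}}"
   using r R' nz by auto
  show "ALL w. w ~: ball 0 R' --> winding_number (circlepath 0 r) w = 0"
   using R' r by (intro allI impI winding_number_zero_outside[of _ "cball 0 r"]) auto
  show "finite {w : ball 0 R'. ?g w = 0 \<or> w : {}}"
   by (rule finite_subset[OF _ fin']) auto
 qed auto
 have "(\<Sum>p\<in>{w:ball 0 R'. ?g w = 0 \<or> w : {}}. winding_number (circlepath 0 r) p * ?q p * zorder ?g p)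
  = (\<Sum>p\<in>line_zeros f v r z. winding_number (circlepath 0 r) p * ?q p * zorder ?g p)"
 proof (rule sum.mono_neutral_right)
  show "finite {w:ball 0 R'. ?g w = 0 \<or> w : {}}" by (rule finite_subset[OF _ fin']) auto
  show "line_zeros f v r z \<subseteq> {w : ball 0 R'. ?g w = 0 \<or> w : {}}" using R' by (auto simp: line_zeros_def)
  show "ALL i:{w : ball 0 R'. ?g w = 0 \<or> w : {}} - line_zeros f v r z.
   winding_number (circlepath 0 r) i * ?q i * zorder ?g i = 0"
  proof
   fix i assume i: "i : {w : ball 0 R'. ?g w = 0 \<or> w : {}} - line_zeros f v r z"
   then have "norm i > r" using nz[of i] by (auto simp: line_zeros_def not_less order.order_iff_strict)
   then have "winding_number (circlepath 0 r) i = 0"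
    using r by (intro winding_number_zero_outside[of _ "cball 0 r"]) auto
   then show "winding_number (circlepath 0 r) i * ?q i * zorder ?g i = 0" by simp
  qed
 qed
 also have "\<dots> = (\<Sum>t\<in>line_zeros f v r z. of_nat (line_order f v z t) * ?q t)"
 proof (rule sum.cong[OF refl])
  fix t assume t: "t : line_zeros f v r z"
  then have "winding_number (circlepath 0 r) t = 1"
   by (intro winding_number_circlepath) (simp add: line_zeros_def)
  moreover have "complex_of_int (zorder ?g t) = of_nat (line_order f v z t)"
   using zo[OF t] by (simp add: line_order_def of_nat_nat)
  ultimately show "winding_number (circlepath 0 r) t * ?q t * zorder ?g t = of_nat (line_order f v z t) * ?q t"
   by (simp add: mult.commute)
 qed
 finally have ci: "contour_integral (circlepath 0 r) (%x. deriv ?g x * ?q x / ?g x) = 2 * pi * \<i> *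
  (\<Sum>t\<in>line_zeros f v r z. of_nat (line_order f v z t) * ?q t)" using * by simp
 let ?h = "%x. deriv ?g x * ?q x / ?g x"
 have "continuous_on (sphere 0 r) ?h"
  using nz r R hg hq
  by (intro continuous_intros holomorphic_on_imp_continuous_on holomorphic_on_subset[OF hq]
    holomorphic_on_subset[OF hg] holomorphic_on_subset[OF holomorphic_deriv[OF hg]]) auto
 then have "?h contour_integrable_on circlepath 0 r"
  using r by (intro contour_integrable_continuous_circlepath) auto
 then have "(?h has_contour_integral 2 * pi * \<i> *
  (\<Sum>t\<in>line_zeros f v r z. of_nat (line_order f v z t) * ?q t)) (circlepath 0 r)"
  unfolding ci[symmetric] by (rule has_contour_integral_integral)
 then have "((%x. ?h (circlepath 0 r x) * vector_derivative (circlepath 0 r) (at x)) has_integral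
  2 * pi * \<i> * (\<Sum>t\<in>line_zeros f v r z. of_nat (line_order f v z t) * ?q t)) {0..1}"
  unfolding has_contour_integral_def
  by (rule has_integral_eq[rotated]) (auto simp: vector_derivative_circlepath vector_derivative_circlepath01)
 then have "((%\<theta>. (2 * pi * \<i>) * (let x = r * exp (2 * of_real pi * \<i> * of_real \<theta>) in
      dir_deriv f v (z + x *s v) * q (z + x *s v) / f (z + x *s v) * x)) has_integral
  2 * pi * \<i> * (\<Sum>t\<in>line_zeros f v r z. of_nat (line_order f v z t) * ?q t)) {0..1}"
 proof (rule has_integral_eq[rotated])
  fix \<theta> :: real assume "\<theta> : {0..1}"
  define x where "x = r * exp (2 * of_real pi * \<i> * of_real \<theta>)"
  have "norm x = r" using r by (simp add: x_def norm_mult)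
  then have "deriv ?g x = dir_deriv f v (z + x *s v)"
   using U[of x] R by (intro DERIV_imp_deriv hol_line_derivative[OF f]) auto
  moreover have "circlepath 0 r \<theta> = x" by (simp add: circlepath x_def)
  moreover have "vector_derivative (circlepath 0 r) (at \<theta>) = 2 * pi * \<i> * x"
   unfolding vector_derivative_circlepath by (simp add: x_def algebra_simps)
  ultimately show "?h (circlepath 0 r \<theta>) * vector_derivative (circlepath 0 r) (at \<theta>) =
   (2 * pi * \<i>) * (let x = r * exp (2 * of_real pi * \<i> * of_real \<theta>) in
      dir_deriv f v (z + x *s v) * q (z + x *s v) / f (z + x *s v) * x)"
   unfolding x_def[symmetric] Let_def by (simp add: mult.assoc mult.commute mult.left_commute)
 qed
 from has_integral_mult_right[OF this, of "1 / (2 * pi * \<i>)"]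
 show "integral {0..1} (%\<theta>. let x = r * exp (2 * of_real pi * \<i> * of_real \<theta>) in
      dir_deriv f v (z + x *s v) * q (z + x *s v) / f (z + x *s v) * x)
    = (\<Sum>t\<in>line_zeros f v r z. of_nat (line_order f v z t) * q (z + t *s v))"
  by (intro integral_unique) (simp add: mult.assoc[symmetric])
qed

text \<open>Compactness of the closed disc gives the margin beyond the circle that
  \<open>trace_formula\<close> asks for.\<close>

lemma disc_in_larger_disc:
 fixes b v :: "complex^'n"
 assumes "open U" "!!t. norm t <= r ==> b + t *s v : U" "r > 0"
 shows "EX R>r. ALL t. norm t <= R --> b + t *s v : U"
proof -
 let ?S = "(%t. b + t *s v) -` U"
 have "open ?S" by (intro open_vimage assms continuous_intros)
 moreover have "cball 0 r \<subseteq> ?S" using assms by auto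
 ultimately obtain e where e: "e > 0" "(\<Union>x\<in>cball 0 r. ball x e) \<subseteq> ?S"
  using compact_subset_open_imp_ball_epsilon_subset[OF compact_cball] by metis
 have "b + t *s v : U" if t: "norm t <= r + e / 2" for t
 proof (cases "norm t <= r")
  case False
  define x where "x = of_real (r / norm t) * t"
  have nt: "norm t > r" "norm t > 0" using False assms by auto
  have "norm x <= r" using assms nt by (simp add: x_def norm_mult norm_divide)
  moreover have "norm (t - x) = norm t - r"
  proof -
   have "t - x = of_real (1 - r / norm t) * t" by (simp add: x_def algebra_simps)
   then have "norm (t - x) = \<bar>1 - r / norm t\<bar> * norm t" by (simp only: norm_mult norm_of_real)
   also have "\<dots> = norm t - r" using nt by (simp add: field_simps abs_of_nonneg)
   finally show ?thesis .
  qed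
  ultimately have "x : cball 0 r" "t : ball x e" using t e by (auto simp: dist_norm norm_minus_commute)
  then show ?thesis using e by blast
 qed (use assms in auto)
 then show ?thesis using e by (intro exI[of _ "r + e / 2"]) auto
qed

text \<open>The integrand of the trace formula depends holomorphically on \<open>z\<close>, hence so
  do the sums over the zeros. With \<open>q = 1\<close> the sum counts the zeros, and a continuous
  integer-valued function on a ball is constant; this is the number \<open>m\<close>.\<close>

theorem trace_holomorphic:
 assumes U: "open U" and f: "hol f U" and r: "r > 0"
  and inU: "!!t. norm t <= r ==> b + t *s v : U"
  and nz: "!!t. norm t = r ==> f (b + t *s v) ~= 0"
 shows "EX \<delta>>0. EX m. (ALL z:ball b \<delta>. (ALL t. norm t <= r --> z + t *s v : U) &
   (ALL t. norm t = r --> f (z + t *s v) ~= 0) &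
   finite (line_zeros f v r z) & (ALL t:line_zeros f v r z. line_order f v z t > 0) &
   (\<Sum>t\<in>line_zeros f v r z. line_order f v z t) = m) &
   (ALL q. hol q U --> hol
    (%z. \<Sum>t\<in>line_zeros f v r z. of_nat (line_order f v z t) * q (z + t *s v)) (ball b \<delta>))"
proof -
 obtain R where R: "R > r" "!!t. norm t <= R ==> b + t *s v : U"
  using disc_in_larger_disc[OF U inU r] by blast
 obtain d1 where d1: "d1 > 0" "!!z t. z : ball b d1 ==> norm t <= R ==> z + t *s v : U"
  using tube_in_open[OF U compact_cball[of 0 R], of b v] R by auto
 obtain d2 where d2: "d2 > 0" "!!z t. z : ball b d2 ==> norm t = r ==> z + t *s v : {z:U. f z ~= 0}"
  using tube_in_open[OF open_nonzero_set[OF f U] compact_sphere[of 0 r], of b v] inU nz by force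
 define \<delta> where "\<delta> = min d1 d2"
 let ?B = "ball b \<delta>"
 have \<delta>: "\<delta> > 0" using d1 d2 by (simp add: \<delta>_def)
 have zU: "z + t *s v : U" if "z : ?B" "norm t <= R" for z t using d1(2)[of z t] that by (simp add: \<delta>_def)
 have znz: "f (z + t *s v) ~= 0" if "z : ?B" "norm t = r" for z t using d2(2)[of z t] that by (simp add: \<delta>_def)
 have tf: "finite (line_zeros f v r z)" "!!t. t : line_zeros f v r z ==> line_order f v z t > 0" if "z : ?B" for z
  using trace_formula(1,2)[OF R(1) r f f, of z v] zU znz that by auto
 have hol: "hol
    (%z. \<Sum>t\<in>line_zeros f v r z. of_nat (line_order f v z t) * q (z + t *s v)) ?B"
  if q: "hol q U" for q
 proof -
  let ?F = "%z \<theta>. let x = r * exp (2 * of_real pi * \<i> * of_real \<theta>) in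
      dir_deriv f v (z + x *s v) * q (z + x *s v) / f (z + x *s v) * x"
  have nx: "norm (r * exp (2 * of_real pi * \<i> * of_real \<theta>)) = r" for \<theta> :: real
   using r by (simp add: norm_mult)
  have "hol (%z. integral {0..1} (?F z)) ?B"
  proof (rule hol_integral)
   fix \<theta> :: real
   show "hol (%z. ?F z \<theta>) ?B"
    unfolding Let_def
    by (intro hol_mult hol_divide hol_const
      hol_translate[OF f] hol_translate[OF q]
      hol_translate[OF hol_dir_deriv[OF U f]])
     (use zU znz nx R in \<open>auto\<close>)
  next
   have c: "continuous_on (?B \<times> {0..1}) (%p. k (fst p + (r * exp (2 * of_real pi * \<i> * of_real (snd p))) *s v))"
    if "hol k U" for k
    by (rule continuous_on_compose2[OF hol_imp_continuous_on[OF that]])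
     (use zU nx R in \<open>auto intro!: continuous_intros\<close>)
   show "continuous_on (?B \<times> {0..1}) (%(z, s). ?F z s)"
    unfolding split_beta Let_def
    by (intro continuous_on_mult continuous_on_divide c[OF f] c[OF q] c[OF hol_dir_deriv[OF U f]])
     (use znz nx in \<open>auto intro!: continuous_intros\<close>)
  qed auto
  then show ?thesis
   by (rule hol_cong) (use trace_formula(3)[OF R(1) r f q] zU znz in \<open>auto simp: less_imp_le\<close>)
 qed
 let ?n = "%z. \<Sum>t\<in>line_zeros f v r z. line_order f v z t"
 have "(%z. complex_of_nat (?n z)) constant_on ?B"
 proof (rule continuous_discrete_range_constant)
  have "hol (%z. complex_of_nat (?n z)) ?B"
   using hol[of "%_. 1"] by simp
  then show "continuous_on ?B (%z. complex_of_nat (?n z))" by (rule hol_imp_continuous_on)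
  fix x
  have "1 <= norm (of_nat (?n y) - complex_of_nat (?n x))" if "complex_of_nat (?n y) ~= complex_of_nat (?n x)" for y
  proof -
   have "norm (of_nat (?n y) - complex_of_nat (?n x)) = \<bar>real_of_int (int (?n y) - int (?n x))\<bar>"
    by (metis (no_types, opaque_lifting) norm_of_int of_int_diff of_int_of_nat_eq)
   moreover have "?n y ~= ?n x" using that by metis
   then have "int (?n y) - int (?n x) ~= 0" by (simp only: right_minus_eq of_nat_eq_iff not_False_eq_True)
   ultimately show ?thesis by linarith
  qed
  then show "EX e>0. ALL y. y : ?B & complex_of_nat (?n y) ~= complex_of_nat (?n x) -->
    e <= norm (of_nat (?n y) - complex_of_nat (?n x))"
   by (intro exI[of _ 1]) auto
 qed auto
 then obtain c where c: "!!z. z : ?B ==> complex_of_nat (?n z) = c" unfolding constant_on_def by blast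
 have n: "?n z = ?n b" if "z : ?B" for z
  using c[OF that] c[of b] \<delta> by (metis centre_in_ball of_nat_eq_iff)
 show ?thesis
 proof (intro exI[of _ \<delta>] exI[of _ "?n b"] conjI ballI allI impI)
  fix z assume z: "z : ?B"
  show "z + t *s v : U" if "norm t <= r" for t by (rule zU[OF z]) (use that R in linarith)
  show "f (z + t *s v) ~= 0" if "norm t = r" for t by (rule znz[OF z that])
  show "finite (line_zeros f v r z)" by (rule tf[OF z])
  show "line_order f v z t > 0" if "t : line_zeros f v r z" for t by (rule tf(2)[OF z that])
  show "?n z = ?n b" by (rule n[OF z])
 qed (use \<delta> hol in blast)+
qed

subsection \<open>Newton's identities\<close>

definition root_poly :: "complex set => (complex => nat) => (complex => complex) => complex poly" where
 "root_poly A k x = (\<Prod>a\<in>A. [:- x a, 1:] ^ k a)"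

text \<open>The reversed polynomial of \<open>root_poly\<close> as a power series, that is, the
  generating function of the elementary symmetric functions with alternating signs.\<close>

definition elem_fps :: "complex set => (complex => nat) => (complex => complex) => complex fps" where
 "elem_fps A k x = (\<Prod>a\<in>A. (1 - fps_const (x a) * fps_X) ^ k a)"

lemma degree_root_poly: "finite A ==> degree (root_poly A k x) = (\<Sum>a\<in>A. k a)"
 unfolding root_poly_def by (subst degree_prod_eq_sum_degree) (auto simp: degree_linear_power)

lemma lead_coeff_root_poly: "lead_coeff (root_poly A k x) = 1"
 unfolding root_poly_def by (simp add: lead_coeff_prod lead_coeff_power)

lemma poly_root_poly: "poly (root_poly A k x) t = (\<Prod>a\<in>A. (t - x a) ^ k a)"
 unfolding root_poly_def by (simp add: poly_prod)

lemma elem_fps_nth: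
 assumes "finite A"
 shows "elem_fps A k x $ i = (if i <= (\<Sum>a\<in>A. k a) then coeff (root_poly A k x) ((\<Sum>a\<in>A. k a) - i) else 0)"
proof -
 have r: "reflect_poly [:- x a, 1:] = [:1, - x a:]" for a
  by (cases "x a = 0") (simp_all add: reflect_poly_def)
 have "reflect_poly (root_poly A k x) = (\<Prod>a\<in>A. [:1, - x a:] ^ k a)"
  unfolding root_poly_def by (simp add: reflect_poly_prod reflect_poly_power r)
 then have "fps_of_poly (reflect_poly (root_poly A k x)) = elem_fps A k x"
  unfolding elem_fps_def by (simp add: fps_of_poly_prod fps_of_poly_power fps_of_poly_pCons)
   (simp add: fps_const_neg[symmetric] mult.commute del: fps_const_neg)
 then have "elem_fps A k x $ i = coeff (reflect_poly (root_poly A k x)) i" by (metis fps_of_poly_nth)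
 then show ?thesis by (auto simp: coeff_reflect_poly degree_root_poly[OF assms])
qed

text \<open>The logarithmic derivative of a factor \<open>1 - x X\<close> is
  \<open>- x / (1 - x X)\<close>, a geometric series. Summed over the factors it is minus the
  generating function of the power sums; comparing coefficients gives Newton's identities.\<close>

lemma fps_deriv_elem_fps:
 "finite A ==> fps_deriv (elem_fps A k x) = - (elem_fps A k x * Abs_fps (%i. \<Sum>a\<in>A. of_nat (k a) * x a ^ Suc i))"
proof (induction A rule: finite_induct)
 case empty
 have "Abs_fps (%i. 0::complex) = 0" by (simp add: fps_eq_iff)
 then show ?case by (simp add: elem_fps_def)
next
 case (insert a A)
 let ?L = "1 - fps_const (x a) * fps_X :: complex fps" and ?P = "%A. Abs_fps (%i. \<Sum>a\<in>A. of_nat (k a) * x a ^ Suc i)"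
 let ?G = "Abs_fps (%i. x a ^ Suc i)"
 have LG: "?L * ?G = fps_const (x a)"
 proof (rule fps_ext)
  fix i show "(?L * ?G) $ i = fps_const (x a) $ i"
   by (cases i) (simp_all add: left_diff_distrib mult.assoc fps_X_mult_nth)
 qed
 have dL: "fps_deriv (?L ^ k a) = - (?L ^ k a * (of_nat (k a) * ?G))"
 proof (cases "k a")
  case (Suc n)
  have "fps_deriv (?L ^ k a) = - (of_nat (k a) * fps_const (x a) * ?L ^ n)"
  proof -
   have "fps_deriv ?L = - fps_const (x a)" by simp
   then show ?thesis by (simp only: fps_deriv_power' Suc diff_Suc_1 mult_minus_right mult_minus_left)
  qed
  also have "\<dots> = - (of_nat (k a) * (?L * ?G) * ?L ^ n)" by (simp only: LG)
  also have "\<dots> = - (?L ^ k a * (of_nat (k a) * ?G))" by (simp only: Suc power_Suc mult.assoc mult.commute mult.left_commute)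
  finally show ?thesis .
 qed simp
 have PP: "?P (insert a A) = of_nat (k a) * ?G + ?P A"
  using insert.hyps by (simp add: fps_eq_iff flip: fps_of_nat)
 have E: "elem_fps (insert a A) k x = ?L ^ k a * elem_fps A k x" using insert.hyps by (simp add: elem_fps_def)
 show ?case unfolding E PP by (simp only: fps_deriv_mult dL insert.IH) (simp add: algebra_simps)
qed

lemma newton_identity:
 assumes "finite A"
 shows "of_nat (Suc i) * elem_fps A k x $ Suc i =
  - (\<Sum>l\<le>i. elem_fps A k x $ l * (\<Sum>a\<in>A. of_nat (k a) * x a ^ Suc (i - l)))"
proof -
 have "fps_deriv (elem_fps A k x) $ i = - (elem_fps A k x * Abs_fps (%i. \<Sum>a\<in>A. of_nat (k a) * x a ^ Suc i)) $ i"
  by (simp add: fps_deriv_elem_fps[OF assms])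
 then show ?thesis by (simp add: fps_mult_nth atLeast0AtMost add.commute)
qed

lemma elem_fps_0: "elem_fps A k x $ 0 = 1"
 unfolding elem_fps_def by (induction A rule: infinite_finite_induct) (auto simp: fps_power_zeroth)

text \<open>Newton's identities express each coefficient by power sums and earlier coefficients. The
  total multiplicity is a constant \<open>m\<close> because the position of a coefficient in the
  reversed series depends on it.\<close>

lemma holomorphic_root_poly_coeff:
 fixes x :: "complex^'n => complex => complex"
 assumes fin: "!!z. z : D ==> finite (A z)" and m: "!!z. z : D ==> (\<Sum>a\<in>A z. k z a) = m"
  and D: "open D"
  and ps: "!!i. hol (%z. \<Sum>a\<in>A z. of_nat (k z a) * x z a ^ i) D"
 shows "hol (%z. coeff (root_poly (A z) (k z) (x z)) j) D"
proof -
 have E: "hol (%z. elem_fps (A z) (k z) (x z) $ i) D" for i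
 proof (induction i rule: less_induct)
  case (less i)
  show ?case
  proof (cases i)
   case 0
   then show ?thesis by (simp add: elem_fps_0)
  next
   case (Suc n)
   have "hol (%z. - (1 / of_nat (Suc n)) * (\<Sum>l\<le>n. elem_fps (A z) (k z) (x z) $ l *
     (\<Sum>a\<in>A z. of_nat (k z a) * x z a ^ Suc (n - l)))) D"
    by (intro hol_mult hol_const hol_sum less ps) (auto simp: Suc)
   then show ?thesis
   proof (rule hol_cong[OF _ D])
    fix z assume "z : D"
    have "of_nat (Suc n) ~= (0::complex)" by (metis of_nat_neq_0)
    then show "elem_fps (A z) (k z) (x z) $ i = - (1 / of_nat (Suc n)) * (\<Sum>l\<le>n. elem_fps (A z) (k z) (x z) $ l *
     (\<Sum>a\<in>A z. of_nat (k z a) * x z a ^ Suc (n - l)))"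
     using newton_identity[OF fin[OF \<open>z : D\<close>], of n "k z" "x z"] unfolding Suc by (simp add: field_simps)
   qed
  qed
 qed
 show ?thesis
 proof (cases "j <= m")
  case True
  show ?thesis
   by (rule hol_cong[OF E[of "m - j"] D]) (use True in \<open>simp add: elem_fps_nth fin m\<close>)
 next
  case False
  show ?thesis
   by (rule hol_cong[OF hol_const[of 0] D])
    (use False in \<open>simp add: coeff_eq_0 degree_root_poly fin m\<close>)
 qed
qed

text \<open>The same recursion solved for the power sum: it stands in the term of index
  \<open>0\<close>, with coefficient \<open>1\<close>.\<close>

lemma holomorphic_power_sums:
 fixes x :: "complex^'n => complex => complex"
 assumes fin: "!!z. z : D ==> finite (A z)" and m: "!!z. z : D ==> (\<Sum>a\<in>A z. k z a) = m"
  and D: "open D"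
  and co: "!!j. hol (%z. coeff (root_poly (A z) (k z) (x z)) j) D"
 shows "hol (%z. \<Sum>a\<in>A z. of_nat (k z a) * x z a ^ i) D"
proof -
 have E: "hol (%z. elem_fps (A z) (k z) (x z) $ i) D" for i
  by (cases "i <= m"; rule hol_cong[OF _ D], rule co[of "m - i"] hol_const[of 0])
   (auto simp: elem_fps_nth fin m)
 show ?thesis
 proof (induction i rule: less_induct)
  case (less i)
  show ?case
  proof (cases i)
   case 0
   show ?thesis by (rule hol_cong[OF hol_const[of "of_nat m"] D]) (simp add: 0 m flip: of_nat_sum)
  next
   case (Suc n)
   have "hol (%z. - (of_nat (Suc n) * elem_fps (A z) (k z) (x z) $ Suc n) -
     (\<Sum>l\<in>{1..n}. elem_fps (A z) (k z) (x z) $ l * (\<Sum>a\<in>A z. of_nat (k z a) * x z a ^ Suc (n - l)))) D"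
    by (intro hol_diff hol_uminus hol_mult hol_const
      hol_sum less E) (auto simp: Suc)
   then show ?thesis
   proof (rule hol_cong[OF _ D])
    fix z assume "z : D"
    have "{..n} = insert 0 {1..n}" by auto
    then show "(\<Sum>a\<in>A z. of_nat (k z a) * x z a ^ i) = - (of_nat (Suc n) * elem_fps (A z) (k z) (x z) $ Suc n) -
     (\<Sum>l\<in>{1..n}. elem_fps (A z) (k z) (x z) $ l * (\<Sum>a\<in>A z. of_nat (k z a) * x z a ^ Suc (n - l)))"
     using newton_identity[OF fin[OF \<open>z : D\<close>], of n "k z" "x z"]
     by (simp add: Suc elem_fps_0)
   qed
  qed
 qed
qed

section \<open>Projections of analytic sets\<close>

lemma analytic_subsetE:
 assumes "analytic_subset X"
 obtains U F where "open U" "a : U" "finite F" "!!f. f : F ==> hol f U"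
  "X Int U = {z:U. ALL f:F. f z = 0}"
proof -
 obtain U F where *: "open U & a : U & finite F & (ALL f:F. hol f U) &
   X Int U = {z:U. ALL f:F. f z = 0}"
  using assms[unfolded analytic_subset_def, rule_format, of a] by (elim exE)
 show thesis by (rule that[of U F]) (use * in simp_all)
qed

lemma analytic_subset_closed:
 assumes "analytic_subset X"
 shows "closed X"
proof -
 have "EX T. open T & a : T & T \<subseteq> - X" if a: "a ~: X" for a
 proof -
  obtain U F where U: "open U" "a : U" "finite F" "!!f. f : F ==> hol f U"
   "X Int U = {z:U. ALL f:F. f z = 0}" by (rule analytic_subsetE[OF assms, where a = "a"]) (rule that; (assumption | simp only:))
  then obtain f where f: "f : F" "f a ~= 0" using a by auto
  have "open {z:U. f z ~= 0}" by (rule open_nonzero_set[OF U(4)[OF f(1)] U(1)])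
  moreover have "{z:U. f z ~= 0} \<subseteq> - X" using U f by auto
  ultimately show ?thesis using f U by blast
 qed
 then have "open (- X)" by (subst open_subopen) auto
 then show ?thesis by (simp add: closed_def)
qed

section \<open>Properness and finiteness of fibres along one direction\<close>

definition proper_along :: "(complex^'n) set => complex^'n => complex^'n => bool" where
 "proper_along X v b \<longleftrightarrow> (EX r. EX \<epsilon>>0. ALL z:ball b \<epsilon>. ALL t. z + t *s v : X --> norm t < r)"

lemma closed_fibre:
 fixes b v :: "complex^'n"
 assumes "closed X"
 shows "closed {t. b + t *s v : X}"
 using closed_vimage[OF assms, of "%t. b + t *s v"] by (simp add: vimage_def continuous_intros)

text \<open>An infinite bounded closed fibre has limit points. Near such a point every local
  equation vanishes on a whole disc by the identity theorem, so the limit points form an open set.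
  It is also closed and, being bounded, not the whole plane, which contradicts
  connectedness.\<close>

lemma finite_fibre:
 assumes X: "analytic_subset X" and pr: "proper_along X v b"
 shows "finite {t. b + t *s v : X}"
proof (rule ccontr)
 let ?T = "{t. b + t *s v : X}"
 assume inf: "infinite ?T"
 obtain r e where "e > 0" "!!z t. z : ball b e ==> z + t *s v : X ==> norm t < r"
  using pr unfolding proper_along_def by blast
 then have r: "norm t < r" if "t : ?T" for t using that centre_in_ball by blast
 then have bd: "bounded ?T" unfolding bounded_iff by (meson less_imp_le)
 have cl: "closed ?T" by (rule closed_fibre[OF analytic_subset_closed[OF X]])
 then have comp: "compact ?T" using bd by (simp add: compact_eq_bounded_closed)
 let ?L = "{t. t islimpt ?T}"
 have sub: "?L \<subseteq> ?T" using cl closed_limpt by blast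
 have "?L ~= {}" using comp inf by (auto simp: compact_eq_Bolzano_Weierstrass)
 moreover have "?L ~= UNIV"
 proof
  assume "?L = UNIV"
  then have "of_real \<bar>r\<bar> : ?T" using sub by blast
  from r[OF this] show False by simp
 qed
 moreover have "closed ?L" by (rule closed_limpts)
 moreover have "open ?L"
 proof (subst open_subopen, intro ballI)
  fix t0 assume t0: "t0 : ?L"
  obtain U F where U: "open U" "b + t0 *s v : U" "finite F" "!!f. f : F ==> hol f U"
   "X Int U = {z:U. ALL f:F. f z = 0}" by (rule analytic_subsetE[OF X, where a = "b + t0 *s v"]) (rule that; (assumption | simp only:))
  have "open ((%t. b + t *s v) -` U)" by (intro open_vimage U continuous_intros)
  moreover have "t0 : (%t. b + t *s v) -` U" using U by simp
  ultimately obtain e where e: "e > 0" "ball t0 e \<subseteq> (%t. b + t *s v) -` U" by (rule openE)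
  have lim: "t0 islimpt (?T Int ball t0 e)"
   unfolding islimpt_approachable
  proof (intro allI impI)
   fix d :: real assume "d > 0"
   then obtain t where "t : ?T" "t ~= t0" "dist t t0 < min d e"
    using t0 e unfolding mem_Collect_eq[of t0] islimpt_approachable by (metis min_less_iff_conj)
   then show "EX x':?T Int ball t0 e. x' ~= t0 & dist x' t0 < d"
    by (intro bexI[of _ t]) (auto simp: dist_commute)
  qed
  have "ball t0 e \<subseteq> ?T"
  proof
   fix t assume t: "t : ball t0 e"
   have "f (b + t *s v) = 0" if f: "f : F" for f
   proof (rule analytic_continuation[of "%t. f (b + t *s v)" "ball t0 e" "?T Int ball t0 e" t0])
    show "(%t. f (b + t *s v)) holomorphic_on ball t0 e"
     by (rule holomorphic_on_line[OF U(4)[OF f]]) (use e in auto)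
    show "f (b + w *s v) = 0" if "w : ?T Int ball t0 e" for w
     using that e U f by blast
   qed (use e lim t in auto)
   then show "t : ?T" using U e t by blast
  qed
  then have "ball t0 e \<subseteq> interior ?T" by (simp add: interior_maximal)
  then have "ball t0 e \<subseteq> ?L" using interior_limit_point by blast
  then show "EX T. open T & t0 : T & T \<subseteq> ?L" using e by (intro exI[of _ "ball t0 e"]) auto
 qed
 ultimately show False using clopen[of ?L] by blast
qed

text \<open>The input of the trace formula at a point \<open>a\<close>: among the local equations of
  \<open>X\<close> there is one, \<open>f\<close>, whose only possible zero on the closed disc in
  the direction \<open>v\<close> is the centre.\<close>

definition fibre_disc where
 "fibre_disc X v a r U F f \<longleftrightarrow> r > (0::real) & open U & finite F & (ALL g:F. hol g U) &
  X Int U = {z:U. ALL g:F. g z = 0} & f : F &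
  (ALL t. norm t <= r --> a + t *s v : U & (t ~= 0 --> f (a + t *s v) ~= (0::complex)))"

lemma fibre_disc_exists:
 fixes b v :: "complex^'n"
 assumes X: "analytic_subset X" and fin: "finite {t. b + t *s v : X}" and t0: "b + t0 *s v : X"
 shows "EX r U F f. fibre_disc X v (b + t0 *s v) r U F f"
proof -
 let ?T = "{t. b + t *s v : X}"
 obtain U F where U: "open U" "b + t0 *s v : U" "finite F" "!!f. f : F ==> hol f U"
   "X Int U = {z:U. ALL f:F. f z = 0}" by (rule analytic_subsetE[OF X, where a = "b + t0 *s v"]) (rule that; (assumption | simp only:))
 have "open ((%t. b + t *s v) -` U - (?T - {t0}))"
  by (intro open_Diff open_vimage U continuous_intros finite_imp_closed finite_Diff fin)
 moreover have "t0 : (%t. b + t *s v) -` U - (?T - {t0})" using U by simp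
 ultimately obtain e where e: "e > 0" "ball t0 e \<subseteq> (%t. b + t *s v) -` U - (?T - {t0})" by (meson openE)
 define t1 where "t1 = t0 + of_real (e / 2)"
 have t1: "t1 : ball t0 e" "t1 ~= t0" using e by (auto simp: t1_def dist_norm)
 then have "b + t1 *s v : U" "b + t1 *s v ~: X" using e by auto
 then obtain f where f: "f : F" "f (b + t1 *s v) ~= 0" using U by auto
 have hol: "(%t. f (b + t *s v)) holomorphic_on ball t0 e"
  by (rule holomorphic_on_line[OF U(4)[OF f(1)]]) (use e in auto)
 obtain \<rho> where \<rho>: "\<rho> > 0" "ball t0 \<rho> \<subseteq> ball t0 e" "!!t. t : ball t0 \<rho> - {t0} ==> f (b + t *s v) ~= 0"
  by (rule isolated_zeros[OF hol open_ball connected_ball, of t0 t1]) (use e t1 f t0 U in auto)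
 have sh: "b + t0 *s v + t *s v = b + (t0 + t) *s v" for t by (simp add: vec.scale_left_distrib add.assoc)
 have "fibre_disc X v (b + t0 *s v) (\<rho> / 2) U F f"
  unfolding fibre_disc_def
 proof (intro conjI allI impI ballI)
  fix t :: complex assume t: "norm t <= \<rho> / 2"
  then have in_ball: "t0 + t : ball t0 \<rho>" using \<rho> by (simp add: dist_norm)
  then show "b + t0 *s v + t *s v : U" unfolding sh using \<rho> e by blast
  show "f (b + t0 *s v + t *s v) ~= 0" if "t ~= 0" unfolding sh using \<rho>(3)[of "t0 + t"] in_ball that by simp
 qed (use U f \<rho> in auto)
 then show ?thesis by blast
qed

text \<open>The bounded parameters outside the discs form a compact set whose points over
  \<open>b\<close> miss \<open>X\<close>. As \<open>X\<close> is closed, the corresponding points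
  over nearby \<open>z\<close> miss \<open>X\<close> as well.\<close>

lemma fibre_cover:
 fixes b v :: "complex^'n"
 assumes X: "closed X" and pr: "proper_along X v b" and r: "!!t. b + t *s v : X ==> r t > (0::real)"
 shows "EX \<delta>>0. ALL z:ball b \<delta>. ALL t. z + t *s v : X --> (EX t0. b + t0 *s v : X & norm (t - t0) < r t0)"
proof -
 let ?T = "{t. b + t *s v : X}"
 obtain R e where e: "e > 0" "!!z t. z : ball b e ==> z + t *s v : X ==> norm t < R"
  using pr unfolding proper_along_def by blast
 let ?K = "cball 0 R - (\<Union>t\<in>?T. ball t (r t))"
 have "compact ?K" by (intro compact_diff compact_cball open_UN) auto
 moreover have "b + t *s v : - X" if "t : ?K" for t using that r[of t] by force
 ultimately have "EX d>0. ALL z:ball b d. ALL t:?K. z + t *s v : - X"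
  by (intro tube_in_open open_Compl X) auto
 then obtain d where d: "d > 0" "!!z t. z : ball b d ==> t : ?K ==> z + t *s v : - X" by blast
 have "EX t0. b + t0 *s v : X & norm (t - t0) < r t0" if "z : ball b (min d e)" "z + t *s v : X" for z t
 proof -
  have "t : cball 0 R" using e(2)[of z t] that by simp
  moreover have "t ~: ?K" using d(2)[of z t] that by auto
  ultimately show ?thesis by (auto simp: dist_norm norm_minus_commute)
 qed
 then show ?thesis using d e by (intro exI[of _ "min d e"]) auto
qed

section \<open>Images of analytic sets under projection along one direction\<close>

lemma finite_common_radius:
 assumes "finite T" "!!t. t : T ==> EX \<delta>>0::real. Q t \<delta>"
  and "!!t \<delta> \<delta>'. Q t \<delta> ==> 0 < \<delta>' ==> \<delta>' <= \<delta> ==> Q t \<delta>'"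
 shows "EX \<delta>>0. ALL t:T. Q t \<delta>"
 using assms(1,2)
proof (induction T rule: finite_induct)
 case empty
 show ?case by (intro exI[of _ 1]) auto
next
 case (insert t T)
 then obtain d1 d2 where "d1 > 0" "ALL t:T. Q t d1" "d2 > 0" "Q t d2" by (metis insertCI)
 then show ?case using assms(3) by (intro exI[of _ "min d1 d2"]) (auto intro: assms(3))
qed

text \<open>Local equations on a prescribed domain, so that finite unions can be formed by
  multiplying equations.\<close>

definition zero_set_on :: "(complex^'n) set => (complex^'n) set => bool" where
 "zero_set_on D A \<longleftrightarrow> (EX F. finite F & (ALL f:F. hol f D) & A Int D = {z:D. ALL f:F. f z = 0})"

lemma zero_set_onE:
 assumes "zero_set_on D A"
 obtains F where "finite F" "!!f. f:F ==> hol f D" "A Int D = {z:D. ALL f:F. f z = 0}"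
proof -
 obtain F where *: "finite F & (ALL f:F. hol f D) & A Int D = {z:D. ALL f:F. f z = 0}"
  using assms unfolding zero_set_on_def by (elim exE)
 show thesis by (rule that[of F]) (use * in simp_all)
qed

lemma zero_set_onI:
 assumes "finite F" "!!f. f:F ==> hol f D" "A Int D = {z:D. ALL f:F. f z = 0}"
 shows "zero_set_on D A"
 unfolding zero_set_on_def by (rule exI[of _ F]) (use assms in simp)

lemma zero_set_on_subset:
 assumes "zero_set_on D A" "D' \<subseteq> D"
 shows "zero_set_on D' A"
proof -
 obtain F where F: "finite F" "!!f. f:F ==> hol f D" "A Int D = {z:D. ALL f:F. f z = 0}"
  by (rule zero_set_onE[OF assms(1)]) (rule that; (assumption | simp only:))
 have eq: "A Int D' = {z:D'. ALL f:F. f z = 0}" using F(3) assms(2) by blast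
 show ?thesis by (intro zero_set_onI[OF F(1) _ eq] hol_on_subset[OF F(2) assms(2)])
qed

lemma zero_set_on_Un:
 assumes "zero_set_on D A" "zero_set_on D B"
 shows "zero_set_on D (A \<union> B)"
proof -
 obtain F where F: "finite F" "!!f. f:F ==> hol f D" "A Int D = {z:D. ALL f:F. f z = 0}"
  by (rule zero_set_onE[OF assms(1)]) (rule that; (assumption | simp only:))
 obtain G where G: "finite G" "!!f. f:G ==> hol f D" "B Int D = {z:D. ALL f:G. f z = 0}"
  by (rule zero_set_onE[OF assms(2)]) (rule that; (assumption | simp only:))
 let ?H = "(%(f, g) z. f z * g z) ` (F \<times> G)"
 have "(A \<union> B) Int D = {z:D. (ALL f:F. f z = 0) \<or> (ALL f:G. f z = 0)}" using F(3) G(3) by blast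
 also have "\<dots> = {z:D. ALL h:?H. h z = 0}" by auto
 finally show ?thesis
  by (rule zero_set_onI[rotated 2]) (use F(1,2) G(1,2) in \<open>auto intro!: hol_mult\<close>)
qed

lemma zero_set_on_empty: "zero_set_on D {}"
 by (rule zero_set_onI[of "{%_. 1}"]) auto

lemma zero_set_on_UN:
 "finite T ==> (!!t. t : T ==> zero_set_on D (A t)) ==> zero_set_on D (\<Union>t\<in>T. A t)"
 by (induction T rule: finite_induct) (simp_all add: zero_set_on_empty zero_set_on_Un)

lemma zero_set_on_translate:
 assumes "zero_set_on (ball (b + c) \<delta>) A"
 shows "zero_set_on (ball b \<delta>) {z. z + c : A}"
proof -
 obtain F where F: "finite F" "!!f. f:F ==> hol f (ball (b + c) \<delta>)"
  "A Int ball (b + c) \<delta> = {z:ball (b + c) \<delta>. ALL f:F. f z = 0}"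
  by (rule zero_set_onE[OF assms]) (rule that; (assumption | simp only:))
 have sh: "z + c : ball (b + c) \<delta> \<longleftrightarrow> z : ball b \<delta>" for z by (simp add: dist_norm)
 have "{z. z + c : A} Int ball b \<delta> = {z:ball b \<delta>. ALL f:(%f z. f (z + c)) ` F. f z = 0}"
 proof -
  have A: "w : A \<longleftrightarrow> (ALL f:F. f w = 0)" if "w : ball (b + c) \<delta>" for w using F(3) that by blast
  have "z + c : A \<longleftrightarrow> (ALL f:F. f (z + c) = 0)" if "z : ball b \<delta>" for z using A sh that by blast
  then show ?thesis by auto
 qed
 then show ?thesis
  by (rule zero_set_onI[rotated 2]) (use F(1) in \<open>auto intro!: hol_translate[OF F(2)] simp: dist_norm\<close>)
qed

lemma analytic_subset_iff_zero_set:
 "analytic_subset X \<longleftrightarrow> (ALL a. EX \<delta>>0. zero_set_on (ball a \<delta>) X)"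
proof
 assume X: "analytic_subset X"
 show "ALL a. EX \<delta>>0. zero_set_on (ball a \<delta>) X"
 proof
  fix a
  obtain U F where U: "open U" "a : U" "finite F" "!!f. f : F ==> hol f U"
   "X Int U = {z:U. ALL f:F. f z = 0}" by (rule analytic_subsetE[OF X, where a = "a"]) (rule that; (assumption | simp only:))
  then have "zero_set_on U X" by (intro zero_set_onI)
  moreover obtain \<delta> where "\<delta> > 0" "ball a \<delta> \<subseteq> U" using U openE by blast
  ultimately show "EX \<delta>>0. zero_set_on (ball a \<delta>) X" using zero_set_on_subset by blast
 qed
next
 assume "ALL a. EX \<delta>>0. zero_set_on (ball a \<delta>) X"
 then have loc: "EX \<delta>>0. zero_set_on (ball a \<delta>) X" for a by blast
 show "analytic_subset X"
  unfolding analytic_subset_def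
 proof
  fix a
  obtain \<delta> where \<delta>: "\<delta> > 0" "zero_set_on (ball a \<delta>) X" using loc by blast
  obtain F where F: "finite F" "!!f. f:F ==> hol f (ball a \<delta>)"
   "X Int ball a \<delta> = {z:ball a \<delta>. ALL f:F. f z = 0}"
   by (rule zero_set_onE[OF \<delta>(2)]) (rule that; (assumption | simp only:))
  show "EX U F. open U & a : U & finite F & (ALL f:F. hol f U) &
    X Int U = {z : U. ALL f:F. f z = 0}"
   by (rule exI[of _ "ball a \<delta>"], rule exI[of _ F]) (use F \<delta> in simp)
 qed
qed

text \<open>A point of the base is in the image iff one of the zeros of \<open>f\<close> above it is a common zero of all
  the \<open>g\<^sub>i\<close>. That is detected by the norms of \<open>\<Sum>i. \<tau>\<^sup>i g\<^sub>i\<close> for sufficiently many \<open>\<tau>\<close>.\<close>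

lemma norm_of_combination_nonzero:
 fixes g :: "nat => 'a => complex"
 assumes fin: "finite Z" and card: "card Z <= m" and nz: "!!t. t : Z ==> EX i<k. g i t ~= 0"
 shows "EX \<tau>:of_nat ` {..m * k}. ALL t:Z. (\<Sum>i<k. \<tau> ^ i * g i t) ~= 0"
proof -
 define R where "R t = (\<Sum>i<k. monom (g i t) i)" for t
 have coeff_R: "coeff (R t) i = (if i < k then g i t else 0)" for t i
  by (simp add: R_def coeff_sum)
 have poly_R: "poly (R t) \<tau> = (\<Sum>i<k. \<tau> ^ i * g i t)" for t \<tau>
  by (simp add: R_def poly_sum poly_monom mult.commute)
 have R0: "R t ~= 0" if t: "t : Z" for t
 proof
  assume "R t = 0"
  obtain i where "i < k" "g i t ~= 0" using nz[OF t] by blast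
  then show False using coeff_R[of t i] \<open>R t = 0\<close> by simp
 qed
 have degR: "degree (R t) <= k" for t by (rule degree_le) (simp add: coeff_R)
 \<comment> \<open>The product over all \<open>t\<close> has degree at most \<open>m * k\<close>, so
   it is nonzero at one of the \<open>m * k + 1\<close> sample points; this single \<tau> serves all
   \<open>t\<close>.\<close>
 let ?Q = "\<Prod>t\<in>Z. R t"
 have Q0: "?Q ~= 0" using R0 fin by simp
 have "degree ?Q <= (\<Sum>t\<in>Z. degree (R t))" using degree_prod_sum_le[OF fin, of R] by (simp add: o_def)
 also have "\<dots> <= (\<Sum>t\<in>Z. k)" by (intro sum_mono degR)
 also have "\<dots> <= m * k" using card by simp
 finally have "card {\<tau>. poly ?Q \<tau> = 0} <= m * k" using card_poly_roots_bound[OF Q0] by simp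
 moreover have "card (complex_of_nat ` {..m * k}) = Suc (m * k)" by (simp add: card_image inj_on_def)
 ultimately have "\<not> complex_of_nat ` {..m * k} \<subseteq> {\<tau>. poly ?Q \<tau> = 0}"
  using card_mono[OF poly_roots_finite[OF Q0], of "complex_of_nat ` {..m * k}"] by linarith
 then obtain \<tau> where "\<tau> : complex_of_nat ` {..m * k}" "poly ?Q \<tau> ~= 0" by blast
 then show ?thesis using fin by (intro bexI[of _ \<tau>]) (auto simp: poly_prod poly_R)
qed

lemma local_image_zero_set:
 assumes fd: "fibre_disc X v a r U F f"
 shows "EX \<delta>>0. zero_set_on (ball a \<delta>) {z. EX t. norm t < r & z + t *s v : X}"
proof -
 have fd': "r > 0" "open U" "finite F" "!!g. g : F ==> hol g U"
  "X Int U = {z:U. ALL g:F. g z = 0}" "f : F"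
  "!!t. norm t <= r ==> a + t *s v : U" "!!t. norm t <= r ==> t ~= 0 ==> f (a + t *s v) ~= 0"
  using fd unfolding fibre_disc_def by auto
 have nz: "f (a + t *s v) ~= 0" if "norm t = r" for t using fd'(8)[of t] that fd'(1) by auto
 obtain \<delta> m where \<delta>: "\<delta> > 0"
  and inU: "!!z t. z:ball a \<delta> ==> norm t <= r ==> z + t *s v : U"
  and fin: "!!z. z:ball a \<delta> ==> finite (line_zeros f v r z)"
  and pos: "!!z t. z:ball a \<delta> ==> t:line_zeros f v r z ==> line_order f v z t > 0"
  and m: "!!z. z:ball a \<delta> ==> (\<Sum>t\<in>line_zeros f v r z. line_order f v z t) = m"
  and tr: "!!q. hol q U ==> hol
    (%z. \<Sum>t\<in>line_zeros f v r z. of_nat (line_order f v z t) * q (z + t *s v)) (ball a \<delta>)"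
  using trace_holomorphic[OF fd'(2) fd'(4)[OF fd'(6)] fd'(1) fd'(7) nz] by auto
 obtain k g where g: "F = g ` {..<k::nat}" using finite_imp_nat_seg_image_inj_on[OF fd'(3)] by (auto simp: lessThan_def)
 define h where "h \<tau> z = (\<Sum>i<k. \<tau> ^ i * g i z)" for \<tau> z
 have holh: "hol (h \<tau>) U" for \<tau>
  unfolding h_def using g by (intro hol_sum hol_mult hol_const fd'(4)) auto
 \<comment> \<open>Up to sign this is the norm of \<open>h \<tau>\<close> over the zeros above
   \<open>z\<close>. As the constant coefficient of a \<open>root_poly\<close> it is holomorphic by
   Newton's identities.\<close>
 define N where "N \<tau> z = coeff (root_poly (line_zeros f v r z) (line_order f v z) (%t. h \<tau> (z + t *s v))) 0" for \<tau> z
 have N: "N \<tau> z = (\<Prod>t\<in>line_zeros f v r z. (- h \<tau> (z + t *s v)) ^ line_order f v z t)" for \<tau> z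
  unfolding N_def poly_0_coeff_0[symmetric] poly_root_poly by simp
 have holN: "hol (N \<tau>) (ball a \<delta>)" for \<tau>
  unfolding N_def
 proof (rule holomorphic_root_poly_coeff[where m = m])
  show "hol (%z. \<Sum>t\<in>line_zeros f v r z. of_nat (line_order f v z t) * h \<tau> (z + t *s v) ^ i) (ball a \<delta>)" for i
   using tr[OF hol_power[OF holh]] .
 qed (use fin m in auto)
 have iff: "(EX t. norm t < r & z + t *s v : X) \<longleftrightarrow> (ALL \<tau>:of_nat ` {..m * k}. N \<tau> z = 0)" if z: "z : ball a \<delta>" for z
 proof
  assume "EX t. norm t < r & z + t *s v : X"
  then obtain t where t: "norm t < r" "z + t *s v : X" by blast
  then have "z + t *s v : X Int U" using inU[OF z, of t] by simp
  then have g0: "!!g. g : F ==> g (z + t *s v) = 0" using fd'(5) by blast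
  then have "t : line_zeros f v r z" using t fd'(6) by (simp add: line_zeros_def)
  moreover have "h \<tau> (z + t *s v) = 0" for \<tau> unfolding h_def using g0 g by (intro sum.neutral) auto
  ultimately show "ALL \<tau>:of_nat ` {..m * k}. N \<tau> z = 0"
   unfolding N using fin[OF z] pos[OF z] by (auto intro!: prod_zero bexI[of _ t] simp: power_0_left)
 next
  assume N0: "ALL \<tau>:of_nat ` {..m * k}. N \<tau> z = 0"
  show "EX t. norm t < r & z + t *s v : X"
  proof (rule ccontr)
   assume no: "\<not> (EX t. norm t < r & z + t *s v : X)"
   have "EX i<k. g i (z + t *s v) ~= 0" if t: "t : line_zeros f v r z" for t
   proof -
    have t': "norm t < r" "f (z + t *s v) = 0" using t by (auto simp: line_zeros_def)
    then have "z + t *s v ~: X Int U" "z + t *s v : U" using no inU[OF z, of t] by auto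
    then obtain g' where "g' : F" "g' (z + t *s v) ~= 0" using fd'(5) by blast
    then show ?thesis using g by auto
   qed
   moreover have "card (line_zeros f v r z) <= m"
   proof -
    have "card (line_zeros f v r z) = (\<Sum>t\<in>line_zeros f v r z. 1)" by simp
    also have "\<dots> <= m" unfolding m[OF z, symmetric] using pos[OF z] by (intro sum_mono) (simp add: Suc_leI)
    finally show ?thesis .
   qed
   ultimately obtain \<tau> where \<tau>: "\<tau>:of_nat ` {..m * k}" "!!t. t:line_zeros f v r z ==> h \<tau> (z + t *s v) ~= 0"
    using norm_of_combination_nonzero[OF fin[OF z], of m k "%i t. g i (z + t *s v)"] unfolding h_def by blast
   then have "N \<tau> z ~= 0" unfolding N using fin[OF z] by simp
   then show False using N0 \<tau> by blast
  qed
 qed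
 have "zero_set_on (ball a \<delta>) {z. EX t. norm t < r & z + t *s v : X}"
 proof (rule zero_set_onI[of "N ` of_nat ` {..m * k}"])
  have "(EX t. norm t < r & z + t *s v : X) & z : ball a \<delta> \<longleftrightarrow> z : ball a \<delta> & (ALL f:N ` of_nat ` {..m * k}. f z = 0)" for z
   by (cases "z : ball a \<delta>") (simp_all only: iff simp_thms ball_simps)
  then show "{z. EX t. norm t < r & z + t *s v : X} Int ball a \<delta> =
   {z : ball a \<delta>. ALL f:N ` of_nat ` {..m * k}. f z = 0}" by blast
 qed (use holN in auto)
 then show ?thesis using \<delta> by blast
qed

text \<open>The fibre over \<open>b\<close> is finite, each of its points contributes a local image
  given by finitely many equations, and nearby fibres stay in the chosen discs. Near
  \<open>b\<close> the image is therefore a finite union of zero sets.\<close>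

theorem analytic_subset_cylinder:
 assumes X: "analytic_subset X" and pr: "!!b. proper_along X v b"
 shows "analytic_subset {z. EX t. z + t *s v : X}"
 unfolding analytic_subset_iff_zero_set
proof
 fix b
 let ?T = "{t. b + t *s v : X}"
 have fin: "finite ?T" by (rule finite_fibre[OF X pr])
 have "EX r. ALL t:?T. EX U F f. fibre_disc X v (b + t *s v) (r t) U F f"
  by (rule bchoice) (use fibre_disc_exists[OF X fin] in blast)
 then obtain r where r: "!!t. t : ?T ==> EX U F f. fibre_disc X v (b + t *s v) (r t) U F f" by blast
 then have rpos: "r t > 0" if "t : ?T" for t using that unfolding fibre_disc_def by blast
 let ?A = "%t0. {z. EX t. norm (t - t0) < r t0 & z + t *s v : X}"
 have "EX \<delta>>0. zero_set_on (ball b \<delta>) (?A t0)" if t0: "t0 : ?T" for t0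
 proof -
  obtain U F f where "fibre_disc X v (b + t0 *s v) (r t0) U F f" using r[OF t0] by blast
  from local_image_zero_set[OF this] obtain \<delta> where \<delta>: "\<delta> > 0"
   "zero_set_on (ball (b + t0 *s v) \<delta>) {z. EX t. norm t < r t0 & z + t *s v : X}" by blast
  have eqA: "{z. z + t0 *s v : {z. EX t. norm t < r t0 & z + t *s v : X}} = ?A t0"
  proof -
   have "(EX t. norm t < r t0 & z + t0 *s v + t *s v : X) \<longleftrightarrow> (EX t. norm (t - t0) < r t0 & z + t *s v : X)" for z
   proof
    assume "EX t. norm t < r t0 & z + t0 *s v + t *s v : X"
    then obtain t where "norm t < r t0" "z + t0 *s v + t *s v : X" by blast
    then show "EX t. norm (t - t0) < r t0 & z + t *s v : X"
     by (intro exI[of _ "t0 + t"]) (simp add: vec.scale_left_distrib add.assoc)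
   next
    assume "EX t. norm (t - t0) < r t0 & z + t *s v : X"
    then obtain t where "norm (t - t0) < r t0" "z + t *s v : X" by blast
    then show "EX t. norm t < r t0 & z + t0 *s v + t *s v : X"
     by (intro exI[of _ "t - t0"]) (simp add: vec.scale_left_diff_distrib)
   qed
   then show ?thesis by simp
  qed
  show ?thesis using zero_set_on_translate[OF \<delta>(2)] \<delta>(1) unfolding eqA by blast
 qed
 then have "EX \<delta>>0. ALL t0:?T. zero_set_on (ball b \<delta>) (?A t0)"
  by (rule finite_common_radius[OF fin]) (auto intro: zero_set_on_subset subset_ball)
 then obtain d1 where d1: "d1 > 0" "!!t0. t0 : ?T ==> zero_set_on (ball b d1) (?A t0)" by blast
 obtain d2 where d2: "d2 > 0" "!!z t. z : ball b d2 ==> z + t *s v : X ==>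
   (EX t0. b + t0 *s v : X & norm (t - t0) < r t0)"
  using fibre_cover[OF analytic_subset_closed[OF X] pr, of b r] rpos by blast
 let ?D = "ball b (min d1 d2)"
 have "zero_set_on ?D (\<Union>t0\<in>?T. ?A t0)"
  by (intro zero_set_on_UN fin) (rule zero_set_on_subset[OF d1(2)], auto)
 moreover have "{z. EX t. z + t *s v : X} Int ?D = (\<Union>t0\<in>?T. ?A t0) Int ?D"
 proof (intro equalityI subsetI)
  fix z assume z: "z : {z. EX t. z + t *s v : X} Int ?D"
  then obtain t where t: "z + t *s v : X" by blast
  from z have "z : ball b d2" by simp
  from d2(2)[OF this t] t z show "z : (\<Union>t0\<in>?T. ?A t0) Int ?D" by blast
 qed blast
 ultimately have "zero_set_on ?D {z. EX t. z + t *s v : X}" by (simp only: zero_set_on_def)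
 then show "EX \<delta>>0. zero_set_on (ball b \<delta>) {z. EX t. z + t *s v : X}"
  using d1 d2 by (intro exI[of _ "min d1 d2"]) auto
qed

text \<open>Cone position: at infinity the norm on \<open>X\<close> is controlled linearly by the
  coordinates in \<open>I\<close>. It makes the projection proper and later determines the growth of
  the coefficients of the fibre polynomials.\<close>

definition in_cone :: "'n set => (complex^'n) set => bool" where
 "in_cone I X \<longleftrightarrow> (EX C>=0. ALL x:X. norm x <= C * (1 + norm (cproj I x)))"

text \<open>The full preimage of the image of \<open>X\<close> under the projection that forgets the
  coordinates in \<open>S\<close>; it replaces that image without a change of type.\<close>

definition cylinder :: "'n set => (complex^'n) set => (complex^'n) set" where
 "cylinder S X = {z. EX x:X. cproj (- S) z = cproj (- S) x}"

lemma cproj_eq_iff: "cproj I z = cproj I w \<longleftrightarrow> (ALL k:I. z $ k = w $ k)"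
 by (auto simp: vec_eq_iff)

lemma cylinder_empty [simp]: "cylinder {} X = X"
 by (auto simp: cylinder_def cproj_eq_iff vec_eq_iff[symmetric])

lemma cylinder_insert:
 assumes "j ~: S"
 shows "cylinder (insert j S) X = {z. EX t. z + t *s axis j 1 : cylinder S X}"
proof (intro set_eqI iffI)
 fix z assume "z : cylinder (insert j S) X"
 then obtain x where "x : X" "ALL k: - insert j S. z $ k = x $ k" unfolding cylinder_def cproj_eq_iff by blast
 then have "z + (x $ j - z $ j) *s axis j 1 : cylinder S X"
  unfolding cylinder_def cproj_eq_iff by (auto intro!: bexI[of _ x] simp: axis_def)
 then show "z : {z. EX t. z + t *s axis j 1 : cylinder S X}" by blast
next
 fix z assume "z : {z. EX t. z + t *s axis j 1 : cylinder S X}"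
 then obtain t x where "x : X" and x: "ALL k: - S. (z + t *s axis j 1) $ k = x $ k" unfolding cylinder_def cproj_eq_iff by blast
 moreover have "z $ k = x $ k" if "k : - insert j S" for k
  using x[rule_format, of k] that by (simp add: axis_def)
 ultimately show "z : cylinder (insert j S) X"
  unfolding cylinder_def cproj_eq_iff by blast
qed

lemma proper_along_cylinder:
 assumes X: "in_cone I X" and S: "S \<subseteq> - I" and j: "j ~: I" "j ~: S"
 shows "proper_along (cylinder S X) (axis j 1) b"
proof -
 obtain C where C: "C >= 0" "!!x. x : X ==> norm x <= C * (1 + norm (cproj I x))"
  using X unfolding in_cone_def by blast
 have "norm t < C * (2 + norm b) + norm b + 2" if z: "z : ball b 1" and t: "z + t *s axis j 1 : cylinder S X" for z t
 proof -
  obtain x where x: "x : X" "ALL k: - S. (z + t *s axis j 1) $ k = x $ k"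
   using t unfolding cylinder_def cproj_eq_iff by blast
  have "(z + t *s axis j 1) $ j = x $ j" using x(2) j by blast
  then have xj: "t = x $ j - z $ j" by (simp add: axis_def algebra_simps)
  have "cproj I x = cproj I z"
   unfolding cproj_eq_iff
  proof
   fix k assume "k : I"
   then have "k : - S" "k ~= j" using S j by auto
   then show "x $ k = z $ k" using x(2)[rule_format, of k] by (simp add: axis_def)
  qed
  then have "norm x <= C * (1 + norm z)"
   using C(2)[OF x(1)] norm_cproj_le[of I z] mult_left_mono[of "1 + norm (cproj I z)" "1 + norm z" C] C(1) by simp
  moreover have nz: "norm z < norm b + 1"
   using z norm_triangle_ineq2[of z b] by (simp add: dist_norm norm_minus_commute)
  moreover have "norm t <= norm x + norm z"
   unfolding xj using norm_triangle_ineq4[of "x $ j" "z $ j"] Finite_Cartesian_Product.norm_nth_le[of x j]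
    Finite_Cartesian_Product.norm_nth_le[of z j] by linarith
  moreover have "C * (1 + norm z) <= C * (2 + norm b)" using nz C by (intro mult_left_mono) auto
  ultimately show ?thesis by linarith
 qed
 then show ?thesis unfolding proper_along_def by (intro exI[of _ "C * (2 + norm b) + norm b + 2"] exI[of _ 1]) simp
qed

text \<open>One coordinate is forgotten at a time. Properness in the next direction comes from the
  cone position of \<open>X\<close> itself: points of \<open>X\<close> over a bounded part of the
  base are bounded in all coordinates.\<close>

theorem analytic_cylinder:
 assumes "analytic_subset X" "in_cone I X" "S \<subseteq> - I"
 shows "analytic_subset (cylinder S X)"
proof -
 have "finite S" by simp
 then show ?thesis using assms(3)
 proof (induction S rule: finite_induct)
  case empty
  then show ?case using assms by simp
 next
  case (insert j S)
  then show ?case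
   unfolding cylinder_insert[OF insert.hyps(2)]
   by (intro analytic_subset_cylinder proper_along_cylinder[OF assms(2)]) auto
 qed
qed

section \<open>Integral equations for the coordinates\<close>

definition monic_family :: "(complex^'n) set => nat => (complex^'n => complex poly) => bool" where
 "monic_family D m P \<longleftrightarrow> (ALL z:D. degree (P z) = m & coeff (P z) m = 1) &
  (ALL i. hol (%z. coeff (P z) i) D)"

lemma monic_family_subset: "monic_family D m P ==> D' \<subseteq> D ==> monic_family D' m P"
 unfolding monic_family_def using hol_on_subset by blast

lemma monic_family_mult:
 assumes "monic_family D m P" "monic_family D k Q"
 shows "monic_family D (m + k) (%z. P z * Q z)"
 unfolding monic_family_def
proof (intro conjI ballI allI)
 fix z assume "z : D"
 then have *: "degree (P z) = m" "coeff (P z) m = 1" "degree (Q z) = k" "coeff (Q z) k = 1"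
  using assms unfolding monic_family_def by auto
 then have "P z ~= 0" "Q z ~= 0" by auto
 then show "degree (P z * Q z) = m + k" using * by (simp add: degree_mult_eq)
 show "coeff (P z * Q z) (m + k) = 1" using coeff_mult_degree_sum[of "P z" "Q z"] * by simp
next
 fix i
 show "hol (%z. coeff (P z * Q z) i) D"
  unfolding coeff_mult using assms unfolding monic_family_def
  by (intro hol_sum hol_mult) auto
qed

lemma monic_family_one: "monic_family D 0 (%_. 1)"
 unfolding monic_family_def by simp

lemma monic_family_prod:
 "finite T ==> (!!t. t : T ==> EX m. monic_family D m (P t)) ==> EX m. monic_family D m (%z. \<Prod>t\<in>T. P t z)"
proof (induction T rule: finite_induct)
 case empty
 then show ?case using monic_family_one by auto
next
 case (insert t T)
 obtain m where "monic_family D m (P t)" using insert.prems by blast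
 moreover obtain k where "monic_family D k (%z. \<Prod>t\<in>T. P t z)" using insert.IH insert.prems by blast
 ultimately show ?case using monic_family_mult insert.hyps by fastforce
qed

lemma monic_family_compose:
 assumes "monic_family D m P" "holmap \<phi> D'" "!!z. z : D' ==> \<phi> z : D"
 shows "monic_family D' m (%z. P (\<phi> z))"
 using assms unfolding monic_family_def by (auto intro: hol_compose)

lemma hol_poly:
 assumes "monic_family D m P" "open D" "hol f D"
 shows "hol (%z. poly (P z) (f z)) D"
proof -
 have "hol (%z. \<Sum>i\<le>m. coeff (P z) i * f z ^ i) D"
  using assms unfolding monic_family_def
  by (intro hol_sum hol_mult hol_power) auto
 then show ?thesis
  by (rule hol_cong[OF _ assms(2)]) (use assms(1) in \<open>auto simp: poly_altdef monic_family_def\<close>)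
qed

lemma holmap_translate: "holmap (%z. z + c) U"
 unfolding holomorphic_map_on_def by (auto intro!: holomorphic_fun_intros)

text \<open>\<open>P\<close> is the characteristic polynomial of the coordinate \<open>z $ j\<close>
  on the zeros of \<open>f\<close> along the disc. It vanishes at the \<open>j\<close>-th coordinate
  of each such zero, in particular at those of the points of \<open>Y\<close>.\<close>

lemma local_monic:
 fixes Y :: "(complex^'n) set"
 assumes fd: "fibre_disc Y (axis j 1) a r U F f"
 shows "EX \<delta>>0. EX m P. monic_family (ball a \<delta>) m P & (ALL z:ball a \<delta>. ALL t. norm t < r -->
     z + t *s axis j 1 : Y --> poly (P z) ((z + t *s axis j 1) $ j) = 0)"
proof -
 let ?v = "axis j 1 :: complex^'n"
 have fd': "r > 0" "open U" "finite F" "!!g. g : F ==> hol g U"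
  "Y Int U = {z:U. ALL g:F. g z = 0}" "f : F"
  "!!t. norm t <= r ==> a + t *s ?v : U" "!!t. norm t <= r ==> t ~= 0 ==> f (a + t *s ?v) ~= 0"
  using fd unfolding fibre_disc_def by auto
 have nz: "f (a + t *s ?v) ~= 0" if "norm t = r" for t using fd'(8)[of t] that fd'(1) by auto
 obtain \<delta> m where \<delta>: "\<delta> > 0"
  and inU: "!!z t. z:ball a \<delta> ==> norm t <= r ==> z + t *s ?v : U"
  and fin: "!!z. z:ball a \<delta> ==> finite (line_zeros f ?v r z)"
  and pos: "!!z t. z:ball a \<delta> ==> t:line_zeros f ?v r z ==> line_order f ?v z t > 0"
  and m: "!!z. z:ball a \<delta> ==> (\<Sum>t\<in>line_zeros f ?v r z. line_order f ?v z t) = m"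
  and tr: "!!q. hol q U ==> hol
    (%z. \<Sum>t\<in>line_zeros f ?v r z. of_nat (line_order f ?v z t) * q (z + t *s ?v)) (ball a \<delta>)"
  using trace_holomorphic[OF fd'(2) fd'(4)[OF fd'(6)] fd'(1) fd'(7) nz] by auto
 define P where "P z = root_poly (line_zeros f ?v r z) (line_order f ?v z) (%t. (z + t *s ?v) $ j)" for z
 have "monic_family (ball a \<delta>) m P"
  unfolding monic_family_def
 proof (intro conjI ballI allI)
  fix z assume z: "z : ball a \<delta>"
  show deg: "degree (P z) = m" unfolding P_def using degree_root_poly[OF fin[OF z]] m[OF z] by simp
  show "coeff (P z) m = 1" unfolding deg[symmetric] unfolding P_def by (rule lead_coeff_root_poly)
 next
  fix i
  show "hol (%z. coeff (P z) i) (ball a \<delta>)"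
   unfolding P_def
  proof (rule holomorphic_root_poly_coeff[where m = m])
   show "hol (%z. \<Sum>t\<in>line_zeros f ?v r z. of_nat (line_order f ?v z t) * (z + t *s ?v) $ j ^ i) (ball a \<delta>)" for i
    using tr[OF hol_power[OF hol_coord]] .
  qed (use fin m in auto)
 qed
 moreover have "poly (P z) ((z + t *s ?v) $ j) = 0" if z: "z : ball a \<delta>" and t: "norm t < r" "z + t *s ?v : Y" for z t
 proof -
  have "z + t *s ?v : Y Int U" using inU[OF z, of t] t by simp
  then have "f (z + t *s ?v) = 0" using fd'(5,6) by blast
  then have "t : line_zeros f ?v r z" using t by (simp add: line_zeros_def)
  then show ?thesis unfolding P_def poly_root_poly using fin[OF z] pos[OF z]
   by (intro prod_zero bexI[of _ t]) (auto simp: power_0_left)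
 qed
 ultimately show ?thesis using \<delta> by (intro exI[of _ \<delta>] exI[of _ m] exI[of _ P] conjI ballI allI impI)
qed

text \<open>A ball in the base times the whole fibre direction. Membership depends only on the base
  coordinates, as functions of these coordinates require.\<close>

definition tube :: "'n set => complex^'n => real => (complex^'n) set" where
 "tube I c \<epsilon> = {z. cproj I z : ball (cproj I c) \<epsilon>}"

lemma open_tube [simp]: "open (tube I c \<epsilon>)"
proof -
 have "open (cproj I -` ball (cproj I c) \<epsilon>)"
  by (intro open_vimage open_ball continuous_on_cproj continuous_intros)
 then show ?thesis by (simp add: tube_def vimage_def)
qed

lemma convex_tube [simp]: "convex (tube I c \<epsilon>)"
proof -
 have "convex (cproj I -` ball (cproj I c) \<epsilon>)"
  by (intro convex_linear_vimage bounded_linear.linear[OF bounded_linear_cproj] convex_ball)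
 then show ?thesis by (simp add: tube_def vimage_def)
qed

lemma tube_cproj [simp]:
 "cproj I z : tube I c \<epsilon> \<longleftrightarrow> z : tube I c \<epsilon>"
 "tube I (cproj I c) \<epsilon> = tube I c \<epsilon>"
 by (simp_all add: tube_def)

lemma centre_in_tube [simp]: "c : tube I c \<epsilon> \<longleftrightarrow> \<epsilon> > 0"
 by (simp add: tube_def)

lemma tube_mono: "\<delta> <= \<epsilon> ==> tube I c \<delta> \<subseteq> tube I c \<epsilon>"
 by (auto simp: tube_def)

lemma ball_subset_tube: "ball c \<epsilon> \<subseteq> tube I c \<epsilon>"
proof
 fix z assume "z : ball c \<epsilon>"
 then have "dist (cproj I c) (cproj I z) < \<epsilon>"
  using norm_cproj_le[of I "c - z"] by (simp add: dist_norm)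
 then show "z : tube I c \<epsilon>" by (simp add: tube_def)
qed

lemma tube_sub_tube:
 assumes "c' : tube I c \<epsilon>"
 shows "EX \<delta>>0. tube I c' \<delta> \<subseteq> tube I c \<epsilon>"
proof -
 obtain \<delta> where "\<delta> > 0" "ball (cproj I c') \<delta> \<subseteq> ball (cproj I c) \<epsilon>"
  using assms openE[OF open_ball, of "cproj I c'"] unfolding tube_def by blast
 then show ?thesis unfolding tube_def by blast
qed

text \<open>Locally over the base, each coordinate outside \<open>I\<close> is integral over the
  functions of the base. The cylinder forgets all other fibre coordinates and has finite fibres in
  the direction \<open>j\<close>; the product of the local characteristic polynomials over the
  points of one fibre then kills \<open>x $ j\<close> on the whole tube.\<close>

theorem coordinate_integral:
 fixes X :: "(complex^'n) set"
 assumes X: "analytic_subset X" "in_cone I X" and j: "j ~: I"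
 shows "EX \<delta>>0. EX m P. monic_family (tube I b \<delta>) m P & (ALL z. P z = P (cproj I z)) &
     (ALL x:X Int tube I b \<delta>. poly (P x) (x $ j) = 0)"
proof -
 let ?v = "axis j 1 :: complex^'n" and ?Y = "cylinder (- I - {j}) X" and ?b = "cproj I b"
 let ?T = "{t. ?b + t *s ?v : ?Y}"
 have Y: "analytic_subset ?Y" by (rule analytic_cylinder[OF X]) auto
 have pr: "proper_along ?Y ?v ?b" by (rule proper_along_cylinder[OF X(2)]) (use j in auto)
 have fin: "finite ?T" by (rule finite_fibre[OF Y pr])
 have "EX r. ALL t:?T. EX U F f. fibre_disc ?Y ?v (?b + t *s ?v) (r t) U F f"
  by (rule bchoice) (use fibre_disc_exists[OF Y fin] in blast)
 then obtain r where r: "!!t. t : ?T ==> EX U F f. fibre_disc ?Y ?v (?b + t *s ?v) (r t) U F f" by blast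
 then have rpos: "r t > 0" if "t : ?T" for t using that unfolding fibre_disc_def by blast
 define Q where "Q t0 \<delta> \<longleftrightarrow> (EX m P. monic_family (ball ?b \<delta>) m P & (ALL z:ball ?b \<delta>. ALL t. norm (t - t0) < r t0 -->
     z + t *s ?v : ?Y --> poly (P z) ((z + t *s ?v) $ j) = 0))" for t0 \<delta>
 have "EX \<delta>>0. Q t0 \<delta>" if t0: "t0 : ?T" for t0
 proof -
  obtain U F f where "fibre_disc ?Y ?v (?b + t0 *s ?v) (r t0) U F f" using r[OF t0] by blast
  from local_monic[OF this] obtain \<delta> m P where \<delta>: "\<delta> > 0" "monic_family (ball (?b + t0 *s ?v) \<delta>) m P"
   "!!z t. z : ball (?b + t0 *s ?v) \<delta> ==> norm t < r t0 ==> z + t *s ?v : ?Y ==> poly (P z) ((z + t *s ?v) $ j) = 0"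
   by blast
  have sh: "z + t0 *s ?v : ball (?b + t0 *s ?v) \<delta>" if "z : ball ?b \<delta>" for z using that by (simp add: dist_norm)
  have "monic_family (ball ?b \<delta>) m (%z. P (z + t0 *s ?v))"
   by (rule monic_family_compose[OF \<delta>(2) holmap_translate]) (rule sh)
  moreover have "poly (P (z + t0 *s ?v)) ((z + t *s ?v) $ j) = 0"
   if "z : ball ?b \<delta>" "norm (t - t0) < r t0" "z + t *s ?v : ?Y" for z t
  proof -
   have "z + t0 *s ?v + (t - t0) *s ?v = z + t *s ?v" by (simp add: vec.scale_left_diff_distrib)
   then show ?thesis using \<delta>(3)[OF sh[OF that(1)] that(2)] that(3) by metis
  qed
  ultimately show ?thesis unfolding Q_def using \<delta>(1) by blast
 qed
 then have "EX \<delta>>0. ALL t0:?T. Q t0 \<delta>"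
 proof (rule finite_common_radius[OF fin])
  fix t0 \<delta> \<delta>' assume "Q t0 \<delta>" "\<delta>' <= \<delta>"
  then show "Q t0 \<delta>'" unfolding Q_def using monic_family_subset[of "ball ?b \<delta>" _ _ "ball ?b \<delta>'"] subset_ball[of \<delta>' \<delta> ?b]
   by blast
 qed
 then obtain d1 where d1: "d1 > 0" "!!t0. t0 : ?T ==> Q t0 d1" by blast
 have "EX P. ALL t0:?T. EX m. monic_family (ball ?b d1) m (P t0) & (ALL z:ball ?b d1. ALL t. norm (t - t0) < r t0 -->
     z + t *s ?v : ?Y --> poly (P t0 z) ((z + t *s ?v) $ j) = 0)"
  by (rule bchoice) (use d1(2) in \<open>unfold Q_def, blast\<close>)
 then obtain P where P: "!!t0. t0 : ?T ==> EX m. monic_family (ball ?b d1) m (P t0)"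
  "!!t0 z t. t0 : ?T ==> z : ball ?b d1 ==> norm (t - t0) < r t0 ==>
     z + t *s ?v : ?Y ==> poly (P t0 z) ((z + t *s ?v) $ j) = 0" by blast
 obtain m where m: "monic_family (ball ?b d1) m (%z. \<Prod>t\<in>?T. P t z)"
  using monic_family_prod[OF fin, of "ball ?b d1" P] P(1) by blast
 obtain d2 where d2: "d2 > 0" "!!z t. z : ball ?b d2 ==> z + t *s ?v : ?Y ==>
   (EX t0. ?b + t0 *s ?v : ?Y & norm (t - t0) < r t0)"
  using fibre_cover[OF analytic_subset_closed[OF Y] pr, of r] rpos by blast
 define \<delta> where "\<delta> = min d1 d2"
 define R where "R z = (\<Prod>t\<in>?T. P t (cproj I z))" for z
 have "monic_family (tube I b \<delta>) m R"
  unfolding R_def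
  by (rule monic_family_compose[OF m holmap_cproj]) (simp add: tube_def \<delta>_def)
 moreover have "R z = R (cproj I z)" for z by (simp add: R_def)
 moreover have "poly (R x) (x $ j) = 0" if x: "x : X Int tube I b \<delta>" for x
 proof -
  let ?w = "cproj I x"
  have w: "?w : ball ?b d1" "?w : ball ?b d2" using x by (auto simp: tube_def \<delta>_def)
  have wj: "(?w + x $ j *s ?v) $ j = x $ j" using j by (simp add: axis_def)
  have inY: "?w + x $ j *s ?v : ?Y"
   unfolding cylinder_def cproj_eq_iff using x j by (auto intro!: bexI[of _ x] simp: axis_def)
  obtain t0 where t0: "t0 : ?T" "norm (x $ j - t0) < r t0" using d2(2)[OF w(2) inY] by blast
  have "poly (P t0 ?w) (x $ j) = 0" using P(2)[OF t0(1) w(1) t0(2) inY] wj by simp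
  then show ?thesis unfolding R_def poly_prod using fin t0(1) by (intro prod_zero) auto
 qed
 ultimately show ?thesis using d1 d2 by (intro exI[of _ \<delta>] conjI exI[of _ m] exI[of _ R]) (auto simp: \<delta>_def)
qed

subsection \<open>The discriminant locus\<close>

text \<open>Polynomials in \<open>k\<close> variables as sums of monomials, the form in which a sum
  over tuples of roots splits into power sums.\<close>

inductive monomial_sum :: "nat => ((nat => complex) => complex) => bool" for k where
 monomial: "monomial_sum k (%x. c * (\<Prod>a<k. x a ^ e a))"
| plus: "monomial_sum k M ==> monomial_sum k M' ==> monomial_sum k (%x. M x + M' x)"

lemma monomial_sum_times_var:
 assumes "monomial_sum k M" "i < k"
 shows "monomial_sum k (%x. M x * (s * x i))"
 using assms(1)
proof (induction rule: monomial_sum.induct)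
 case (monomial c e)
 have "(\<Prod>a<k. x a ^ (e(i := Suc (e i))) a) = (\<Prod>a<k. x a ^ e a) * x i" for x :: "nat => complex"
 proof -
  have "(\<Prod>a<k. x a ^ (e(i := Suc (e i))) a) = x i ^ Suc (e i) * (\<Prod>a\<in>{..<k} - {i}. x a ^ (e(i := Suc (e i))) a)"
   using assms(2) by (subst prod.remove[of _ i]) auto
  also have "(\<Prod>a\<in>{..<k} - {i}. x a ^ (e(i := Suc (e i))) a) = (\<Prod>a\<in>{..<k} - {i}. x a ^ e a)"
   by (rule prod.cong) auto
  also have "x i ^ Suc (e i) * \<dots> = (\<Prod>a<k. x a ^ e a) * x i"
   using assms(2) by (subst (2) prod.remove[of _ i]) auto
  finally show ?thesis .
 qed
 then have "(%x. c * (\<Prod>a<k. x a ^ e a) * (s * x i)) = (%x. (c * s) * (\<Prod>a<k. x a ^ (e(i := Suc (e i))) a))"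
  by (auto simp: fun_eq_iff)
 then show ?case using monomial_sum.monomial by metis
next
 case (plus M M')
 then show ?case using monomial_sum.plus[OF plus.IH] by (simp add: distrib_right)
qed

lemma monomial_sum_prod_diff:
 assumes "finite E" "!!a b. (a, b) : E ==> a < k & b < k"
 shows "monomial_sum k (%x. \<Prod>(a, b)\<in>E. x a - x b)"
 using assms
proof (induction E rule: finite_induct)
 case empty
 show ?case using monomial_sum.monomial[of k 1 "%_. 0"] by simp
next
 case (insert p E)
 obtain a b where p: "p = (a, b)" by force
 have ab: "a < k" "b < k" using insert.prems[of a b] p by auto
 have IH: "monomial_sum k (%x. \<Prod>(a, b)\<in>E. x a - x b)" using insert by auto
 have "monomial_sum k (%x. (\<Prod>(a, b)\<in>E. x a - x b) * (1 * x a) + (\<Prod>(a, b)\<in>E. x a - x b) * ((- 1) * x b))"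
  by (intro monomial_sum.plus monomial_sum_times_var[OF IH] ab)
 then show ?case using insert.hyps by (simp add: p algebra_simps)
qed

text \<open>The sum runs over all \<open>k\<close>-tuples, repetitions included, so for a monomial
  it factors into a product of \<open>k\<close> weighted power sums.\<close>

lemma holomorphic_symmetric_sum:
 fixes A :: "complex^'n => complex set" and o' :: "complex^'n => complex => nat"
 assumes M: "monomial_sum k M"
  and ps: "!!i. hol (%z. \<Sum>w\<in>A z. of_nat (o' z w) * w ^ i) D" and D: "open D"
  and fin: "!!z. z : D ==> finite (A z)"
 shows "hol (%z. \<Sum>t\<in>Pi\<^sub>E {..<k} (%_. A z). (\<Prod>a<k. of_nat (o' z (t a))) * M t) D"
 using M
proof (induction rule: monomial_sum.induct)
 case (monomial c e)
 have "hol (%z. c * (\<Prod>a<k. \<Sum>w\<in>A z. of_nat (o' z w) * w ^ e a)) D"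
  by (intro hol_mult hol_const hol_prod ps)
 then show ?case
 proof (rule hol_cong[OF _ D])
  fix z assume "z : D"
  have "(\<Prod>a<k. \<Sum>w\<in>A z. of_nat (o' z w) * w ^ e a) =
   (\<Sum>t\<in>Pi\<^sub>E {..<k} (%_. A z). \<Prod>a<k. of_nat (o' z (t a)) * t a ^ e a)"
   by (rule prod_sum_PiE) (use fin[OF \<open>z : D\<close>] in auto)
  then show "(\<Sum>t\<in>Pi\<^sub>E {..<k} (%_. A z). (\<Prod>a<k. of_nat (o' z (t a))) * (c * (\<Prod>a<k. t a ^ e a))) =
   c * (\<Prod>a<k. \<Sum>w\<in>A z. of_nat (o' z w) * w ^ e a)"
   by (simp add: sum_distrib_left prod.distrib mult_ac)
 qed
next
 case (plus M M')
 show ?case using hol_add[OF plus.IH] by (simp add: distrib_left sum.distrib)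
qed

lemma root_poly_of_roots:
 assumes "p ~= (0 :: complex poly)" "lead_coeff p = 1"
 shows "root_poly {t. poly p t = 0} (%t. order t p) (%t. t) = p"
 using complex_poly_decompose[of p] assms unfolding root_poly_def by simp

text \<open>Where the number \<open>k\<close> of distinct roots is maximal, exactly the tuples enumerating all the roots
  contribute to this sum; where there are fewer roots, no tuple does.\<close>

definition root_tuple_sum :: "nat => complex poly => complex" where
 "root_tuple_sum k p = (\<Sum>t\<in>Pi\<^sub>E {..<k} (%_. {t. poly p t = 0}).
  (\<Prod>a<k. of_nat (order (t a) p)) * (\<Prod>(a, b)\<in>{(a, b). a < k & b < k & a ~= b}. t a - t b))"

lemma root_tuple_sum_nonzero_iff:
 assumes p: "p ~= 0" and le: "card {t. poly p t = 0} <= k"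
 shows "root_tuple_sum k p ~= 0 \<longleftrightarrow> card {t. poly p t = 0} = k"
proof -
 let ?A = "{t. poly p t = 0}" and ?E = "{(a, b). a < k & b < k & a ~= b}"
 let ?V = "%t. \<Prod>(a, b)\<in>?E. t a - t b" and ?W = "%t. \<Prod>a<k. complex_of_nat (order (t a) p)"
 have finA: "finite ?A" by (rule poly_roots_finite[OF p])
 have finE: "finite ?E" by (rule finite_subset[of _ "{..<k} \<times> {..<k}"]) auto
 have V0: "?V t = 0" if "\<not> inj_on t {..<k}" for t :: "nat => complex"
 proof -
  obtain a b where "a < k" "b < k" "a ~= b" "t a = t b" using \<open>\<not> inj_on t {..<k}\<close> unfolding inj_on_def by blast
  then show ?thesis using finE by (intro prod_zero bexI[of _ "(a, b)"]) auto
 qed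
 show ?thesis
 proof
  assume nz: "root_tuple_sum k p ~= 0"
  have "EX t:Pi\<^sub>E {..<k} (%_. ?A). ?V t ~= 0"
   using nz unfolding root_tuple_sum_def by (metis (no_types, lifting) mult_zero_right sum.neutral)
  then obtain t where "t : Pi\<^sub>E {..<k} (%_. ?A)" "?V t ~= 0" by blast
  then have "inj_on t {..<k}" "t ` {..<k} \<subseteq> ?A" using V0 by (auto simp: PiE_iff)
  then have "k <= card ?A" using card_inj_on_le[of t "{..<k}" ?A] finA by simp
  then show "card ?A = k" using le by simp
 next
  assume card: "card ?A = k"
  let ?B = "{t : Pi\<^sub>E {..<k} (%_. ?A). inj_on t {..<k}}"
  have finP: "finite (Pi\<^sub>E {..<k} (%_. ?A))" using finA by (intro finite_PiE) auto
  \<comment> \<open>The products run over all roots and over all ordered pairs of distinct roots, so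
    \<open>c\<close> does not depend on an enumeration of the roots. Every injective tuple
    contributes exactly \<open>c\<close>.\<close>
  define c where "c = (\<Prod>w\<in>?A. complex_of_nat (order w p)) * (\<Prod>(w, w')\<in>{(w, w'). w : ?A & w' : ?A & w ~= w'}. w - w')"
  have c0: "c ~= 0"
  proof -
   have "finite {(w, w'). w : ?A & w' : ?A & w ~= w'}" by (rule finite_subset[of _ "?A \<times> ?A"]) (use finA in auto)
   then show ?thesis unfolding c_def using finA p by (auto simp: order_gt_0_iff order_eq_0_iff)
  qed
  have eq: "?W t * ?V t = c" if t: "t : ?B" for t
  proof -
   have bij: "bij_betw t {..<k} ?A"
    using t finA card by (intro bij_betw_imageI card_subset_eq) (auto simp: card_image PiE_iff)
   have "?W t = (\<Prod>w\<in>?A. complex_of_nat (order w p))"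
    by (rule prod.reindex_bij_betw[OF bij])
   moreover have "?V t = (\<Prod>(w, w')\<in>{(w, w'). w : ?A & w' : ?A & w ~= w'}. w - w')"
   proof -
    have "bij_betw (%(a, b). (t a, t b)) ?E {(w, w'). w : ?A & w' : ?A & w ~= w'}"
     unfolding bij_betw_def
    proof
     show "inj_on (%(a, b). (t a, t b)) ?E" using t by (auto simp: inj_on_def)
     show "(%(a, b). (t a, t b)) ` ?E = {(w, w'). w : ?A & w' : ?A & w ~= w'}"
     proof (intro equalityI subsetI)
      fix q assume "q : (%(a, b). (t a, t b)) ` ?E"
      then show "q : {(w, w'). w : ?A & w' : ?A & w ~= w'}"
       using t by (auto simp: PiE_iff inj_on_def)
     next
      fix q assume "q : {(w, w'). w : ?A & w' : ?A & w ~= w'}"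
      then obtain w w' where w: "q = (w, w')" "w : ?A" "w' : ?A" "w ~= w'" by blast
      then obtain a b where "w = t a" "a < k" "w' = t b" "b < k"
       using bij unfolding bij_betw_def by (metis imageE lessThan_iff)
      then show "q : (%(a, b). (t a, t b)) ` ?E" using w by (intro image_eqI[of _ _ "(a, b)"]) auto
     qed
    qed
    from prod.reindex_bij_betw[OF this, of "%(w, w'). w - w'"] show ?thesis by (simp add: case_prod_unfold)
   qed
   ultimately show ?thesis by (simp add: c_def)
  qed
  have "root_tuple_sum k p = (\<Sum>t\<in>?B. ?W t * ?V t)"
   unfolding root_tuple_sum_def
   by (rule sum.mono_neutral_right[OF finP]) (use V0 in auto)
  also have "\<dots> = of_nat (card ?B) * c" using eq by simp
  finally have s: "root_tuple_sum k p = of_nat (card ?B) * c" .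
  obtain t where "bij_betw t {..<k} ?A"
   using ex_bij_betw_nat_finite[OF finA] card by (auto simp: atLeast0LessThan)
  then have "restrict t {..<k} : ?B" by (auto simp: bij_betw_def inj_on_def)
  then have "?B ~= {}" by blast
  moreover have "finite ?B" using finP by simp
  ultimately have "card ?B > 0" by (simp only: card_gt_0_iff simp_thms)
  then show "root_tuple_sum k p ~= 0" unfolding s using c0 by simp
 qed
qed

text \<open>The power sums of the roots are holomorphic by Newton's identities, and the tuple sum is
  a combination of products of power sums.\<close>

lemma holomorphic_root_tuple_sum:
 assumes P: "monic_family D m P" and D: "open D"
 shows "hol (%z. root_tuple_sum k (P z)) D"
proof -
 let ?A = "%z. {t. poly (P z) t = 0}"
 have P': "P z ~= 0" "lead_coeff (P z) = 1" "degree (P z) = m" if "z : D" for z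
  using P that unfolding monic_family_def by auto
 have fin: "finite (?A z)" if "z : D" for z by (rule poly_roots_finite[OF P'(1)[OF that]])
 have rp: "root_poly (?A z) (%t. order t (P z)) (%t. t) = P z" if "z : D" for z
  using root_poly_of_roots[OF P'(1,2)[OF that]] .
 have "hol (%z. \<Sum>t\<in>?A z. of_nat (order t (P z)) * t ^ i) D" for i
 proof (rule holomorphic_power_sums[where m = m])
  show "(\<Sum>t\<in>?A z. order t (P z)) = m" if "z : D" for z
   using degree_root_poly[OF fin[OF that], of "%t. order t (P z)" "%t. t"] rp[OF that] P'(3)[OF that] by simp
  show "hol (%z. coeff (root_poly (?A z) (%t. order t (P z)) (%t. t)) j) D" for j
   by (rule hol_cong[of "%z. coeff (P z) j"]) (use P D rp in \<open>auto simp: monic_family_def\<close>)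
 qed (use fin D in auto)
 moreover have "monomial_sum k (%x. \<Prod>(a, b)\<in>{(a, b). a < k & b < k & a ~= b}. x a - x b)"
  by (rule monomial_sum_prod_diff) (auto intro: finite_subset[of _ "{..<k} \<times> {..<k}"])
 ultimately show ?thesis
  unfolding root_tuple_sum_def by (intro holomorphic_symmetric_sum D) (use fin in auto)
qed

text \<open>At \<open>z0\<close> the number of distinct roots has its maximal value
  \<open>k\<close>. Disjoint discs around these roots each keep at least one root nearby, hence
  exactly one, possibly multiple. Its value is the trace of the coordinate divided by the
  multiplicity, which is holomorphic.\<close>

lemma local_simple_roots:
 fixes P :: "complex^'n => complex poly"
 assumes P: "monic_family (tube I b \<delta>) m P" and dep: "!!z. P z = P (cproj I z)" and j: "j ~: I"
  and le: "!!z. z : tube I b \<delta> ==> card {t. poly (P z) t = 0} <= k"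
  and z0: "z0 : tube I b \<delta>" and card: "card {t. poly (P z0) t = 0} = k"
 shows "EX \<epsilon>>0. EX \<rho>. tube I z0 \<epsilon> \<subseteq> tube I b \<delta> &
  (ALL a:{t. poly (P z0) t = 0}. hol (\<rho> a) (tube I z0 \<epsilon>) & (ALL z. \<rho> a z = \<rho> a (cproj I z))) &
  (ALL z:tube I z0 \<epsilon>. {t. poly (P z) t = 0} = (%a. \<rho> a z) ` {t. poly (P z0) t = 0} &
    inj_on (%a. \<rho> a z) {t. poly (P z0) t = 0})"
proof -
 let ?D = "tube I b \<delta>" and ?A = "%z. {t. poly (P z) t = 0}" and ?v = "axis j 1 :: complex^'n"
 define f where "f z = poly (P z) (z $ j)" for z
 have holf: "hol f ?D" unfolding f_def by (rule hol_poly[OF P]) auto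
 have cpv: "cproj I (z + t *s ?v) = cproj I z" for z t using j by (auto simp: vec_eq_iff axis_def)
 have P0: "P z ~= 0" if "z : ?D" for z using P that unfolding monic_family_def by auto
 have finA: "finite (?A z)" if "z : ?D" for z by (rule poly_roots_finite[OF P0[OF that]])
 have fline: "f (cproj I z + y *s ?v + t *s ?v) = poly (P z) (y + t)" for z y t
 proof -
  have "cproj I (cproj I z + y *s ?v + t *s ?v) = cproj I z" by (simp only: cpv) simp
  then have "P (cproj I z + y *s ?v + t *s ?v) = P z" using dep by metis
  then show ?thesis unfolding f_def using j by (simp add: axis_def)
 qed
 obtain r where r: "r > 0" "!!a b. a : ?A z0 ==> b : ?A z0 ==> a ~= b ==> 2 * r < dist a b"
 proof -
  have "EX e>0. ALL a:?A z0. ALL b:?A z0. a ~= b --> e <= dist a b"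
  proof (rule finite_common_radius[OF finA[OF z0]])
   show "EX e>0. ALL b:?A z0. a ~= b --> e <= dist a b" for a
    using finite_set_avoid[OF finA[OF z0], of a] by metis
  qed force
  then obtain e where "e > 0" "!!a b. a : ?A z0 ==> b : ?A z0 ==> a ~= b ==> e <= dist a b" by blast
  then show ?thesis by (intro that[of "e / 3"]) force+
 qed
 \<comment> \<open>\<rho> is pinned down only where the disc contains a single root. That this is
   always so is a counting argument, possible once the discs around all roots are available.\<close>
 define Q where "Q y \<epsilon> \<longleftrightarrow> (EX \<rho>. hol \<rho> (tube I z0 \<epsilon>) & (ALL z. \<rho> z = \<rho> (cproj I z)) &
  tube I z0 \<epsilon> \<subseteq> ?D &
  (ALL z:tube I z0 \<epsilon>. ?A z Int ball y r ~= {} & (ALL w. ?A z Int ball y r = {w} --> \<rho> z = w)))" for y \<epsilon>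
 have "EX \<epsilon>>0. Q y \<epsilon>" if y: "y : ?A z0" for y
 proof -
  let ?a = "cproj I z0 + y *s ?v"
  have inD: "?a + t *s ?v : ?D" for t
  proof -
   have "cproj I (?a + t *s ?v) : ?D" unfolding cpv using z0 by simp
   then show ?thesis by (simp only: tube_cproj)
  qed
  have nz: "f (?a + t *s ?v) ~= 0" if t: "norm t = r" for t
  proof
   assume "f (?a + t *s ?v) = 0"
   then have "y + t : ?A z0" using fline by simp
   moreover have "y ~= y + t" using t r by auto
   ultimately have "2 * r < dist y (y + t)" using r(2) y by blast
   then show False using t r by (simp add: dist_norm)
  qed
  obtain e m' where e: "e > 0"
   and fin: "!!z. z:ball ?a e ==> finite (line_zeros f ?v r z)"
   and pos: "!!z t. z:ball ?a e ==> t:line_zeros f ?v r z ==> line_order f ?v z t > 0"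
   and m': "!!z. z:ball ?a e ==> (\<Sum>t\<in>line_zeros f ?v r z. line_order f ?v z t) = m'"
   and tr: "!!q. hol q ?D ==> hol
     (%z. \<Sum>t\<in>line_zeros f ?v r z. of_nat (line_order f ?v z t) * q (z + t *s ?v)) (ball ?a e)"
   using trace_holomorphic[OF open_tube holf r(1) inD nz] by auto
  obtain e' where e': "e' > 0" "tube I z0 e' \<subseteq> ?D" using tube_sub_tube[OF z0] by blast
  define \<epsilon> where "\<epsilon> = min e e'"
  let ?s = "%z. cproj I z + y *s ?v"
  have sin: "?s z : ball ?a e" if "z : tube I z0 \<epsilon>" for z
   using that by (simp add: tube_def \<epsilon>_def dist_norm)
  have lz: "line_zeros f ?v r (?s z) = {t. y + t : ?A z Int ball y r}" for z
   unfolding line_zeros_def using fline by (auto simp: dist_norm)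
  have "?a : ball ?a e" using e by simp
  have "0 : line_zeros f ?v r ?a" unfolding lz using y r by simp
  then have "line_order f ?v ?a 0 <= m'"
   unfolding m'[OF \<open>?a : ball ?a e\<close>, symmetric] by (rule member_le_sum) (use fin[OF \<open>?a : ball ?a e\<close>] in auto)
  then have m'0: "m' > 0"
   using pos[OF \<open>?a : ball ?a e\<close> \<open>0 : line_zeros f ?v r ?a\<close>] by linarith
  \<comment> \<open>The mean of the roots in the disc with multiplicity; it is the root itself if
    there is only one.\<close>
  define \<rho> where "\<rho> z = (\<Sum>t\<in>line_zeros f ?v r (?s z). of_nat (line_order f ?v (?s z) t) * (?s z + t *s ?v) $ j) / of_nat m'" for z
  have "hol (%z. (\<Sum>t\<in>line_zeros f ?v r z. of_nat (line_order f ?v z t) * (z + t *s ?v) $ j) * (1 / of_nat m')) (ball ?a e)"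
   by (intro hol_mult tr[OF hol_coord] hol_const)
  moreover have "holmap ?s (tube I z0 \<epsilon>)"
   by (rule holmap_compose[OF holmap_translate[of _ UNIV] holmap_cproj]) simp
  ultimately have "hol (%z. (%z. (\<Sum>t\<in>line_zeros f ?v r z. of_nat (line_order f ?v z t) * (z + t *s ?v) $ j) * (1 / of_nat m')) (?s z)) (tube I z0 \<epsilon>)"
   by (rule hol_compose) (rule sin)
  then have "hol \<rho> (tube I z0 \<epsilon>)" unfolding \<rho>_def by simp
  moreover have "\<rho> z = \<rho> (cproj I z)" for z unfolding \<rho>_def by simp
  moreover have "?A z Int ball y r ~= {}" if z: "z : tube I z0 \<epsilon>" for z
  proof -
   have "line_zeros f ?v r (?s z) ~= {}" using m'[OF sin[OF z]] m'0 by (intro notI) simp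
   then show ?thesis unfolding lz by blast
  qed
  moreover have "\<rho> z = w" if z: "z : tube I z0 \<epsilon>" and w: "?A z Int ball y r = {w}" for z w
  proof -
   have l: "line_zeros f ?v r (?s z) = {w - y}" unfolding lz w by (auto simp: algebra_simps)
   have "line_order f ?v (?s z) (w - y) = m'" using m'[OF sin[OF z]] unfolding l by simp
   moreover have "(?s z + (w - y) *s ?v) $ j = w" using j by (simp add: axis_def)
   ultimately show ?thesis unfolding \<rho>_def l using m'0 by simp
  qed
  moreover have "tube I z0 \<epsilon> \<subseteq> ?D" using e' tube_mono[of \<epsilon> e' I z0] by (auto simp: \<epsilon>_def)
  ultimately have "Q y \<epsilon>" unfolding Q_def by blast
  then show ?thesis using e e' by (intro exI[of _ \<epsilon>]) (simp add: \<epsilon>_def)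
 qed
 then have "EX \<epsilon>>0. ALL y:?A z0. Q y \<epsilon>"
 proof (rule finite_common_radius[OF finA[OF z0]])
  fix y \<epsilon> \<epsilon>' :: real and y' assume "Q y' \<epsilon>" "\<epsilon>' <= \<epsilon>"
  have sub: "tube I z0 \<epsilon>' \<subseteq> tube I z0 \<epsilon>" by (rule tube_mono[OF \<open>\<epsilon>' <= \<epsilon>\<close>])
  from \<open>Q y' \<epsilon>\<close> obtain \<rho> where \<rho>: "hol \<rho> (tube I z0 \<epsilon>)" "ALL z. \<rho> z = \<rho> (cproj I z)"
  "tube I z0 \<epsilon> \<subseteq> ?D"
  "ALL z:tube I z0 \<epsilon>. ?A z Int ball y' r ~= {} & (ALL w. ?A z Int ball y' r = {w} --> \<rho> z = w)"
   unfolding Q_def by (elim exE conjE) (rule that; assumption)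
  show "Q y' \<epsilon>'" unfolding Q_def
   by (rule exI[of _ \<rho>])
    (intro conjI hol_on_subset[OF \<rho>(1) sub] \<rho>(2) order_trans[OF sub \<rho>(3)] ballI bspec[OF \<rho>(4)] subsetD[OF sub])
 qed
 then obtain \<epsilon>1 where e1: "\<epsilon>1 > 0" "!!y. y : ?A z0 ==> Q y \<epsilon>1" by blast
 obtain \<epsilon>2 where e2: "\<epsilon>2 > 0" "tube I z0 \<epsilon>2 \<subseteq> ?D" using tube_sub_tube[OF z0] by blast
 define \<epsilon> where "\<epsilon> = min \<epsilon>1 \<epsilon>2"
 have sub1: "tube I z0 \<epsilon> \<subseteq> tube I z0 \<epsilon>1" and sub: "tube I z0 \<epsilon> \<subseteq> ?D"
  using tube_mono[of \<epsilon> \<epsilon>1 I z0] tube_mono[of \<epsilon> \<epsilon>2 I z0] e2 by (auto simp: \<epsilon>_def)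
 have "EX \<rho>. ALL y:?A z0. hol (\<rho> y) (tube I z0 \<epsilon>1) & (ALL z. \<rho> y z = \<rho> y (cproj I z)) &
  tube I z0 \<epsilon>1 \<subseteq> ?D &
  (ALL z:tube I z0 \<epsilon>1. ?A z Int ball y r ~= {} & (ALL w. ?A z Int ball y r = {w} --> \<rho> y z = w))"
  by (rule bchoice) (use e1(2) in \<open>unfold Q_def, blast\<close>)
 then obtain \<rho> where \<rho>: "!!y. y : ?A z0 ==> hol (\<rho> y) (tube I z0 \<epsilon>1)"
  "!!y z. y : ?A z0 ==> \<rho> y z = \<rho> y (cproj I z)"
  "!!y z. y : ?A z0 ==> z : tube I z0 \<epsilon>1 ==> ?A z Int ball y r ~= {}"
  "!!y z w. y : ?A z0 ==> z : tube I z0 \<epsilon>1 ==> ?A z Int ball y r = {w} ==> \<rho> y z = w" by blast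
 have main: "?A z = (%a. \<rho> a z) ` ?A z0 & inj_on (%a. \<rho> a z) (?A z0)" if z: "z : tube I z0 \<epsilon>" for z
 proof -
  have z1: "z : tube I z0 \<epsilon>1" "z : ?D" using z sub1 sub by auto
  have "EX g. ALL y:?A z0. g y : ?A z Int ball y r" by (rule bchoice) (use \<rho>(3) z1 in blast)
  then obtain g where g: "!!y. y : ?A z0 ==> g y : ?A z" "!!y. y : ?A z0 ==> dist y (g y) < r" by (auto simp: Ball_def)
  have injd: "y = y'" if "y : ?A z0" "y' : ?A z0" "dist y w < r" "dist y' w < r" for y y' w
   using r(2)[OF that(1,2)] that(3,4) dist_triangle2[of y y' w] by fastforce
  have inj: "inj_on g (?A z0)" by (rule inj_onI) (metis g(2) injd)
  \<comment> \<open>\<open>k\<close> roots in disjoint discs exhaust the at most \<open>k\<close>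
    roots of \<open>P z\<close>.\<close>
  have "g ` ?A z0 = ?A z"
   using g(1) finA[OF z1(2)] card_image[OF inj] le[OF z1(2)] card by (intro card_seteq) auto
  have "?A z Int ball y r = {g y}" if y: "y : ?A z0" for y
  proof -
   have "w = g y" if w: "w : ?A z" "dist y w < r" for w
   proof -
    obtain y' where "y' : ?A z0" "w = g y'" using w(1) \<open>g ` ?A z0 = ?A z\<close> by blast
    then show ?thesis using injd[OF y, of y' w] w(2) g(2) by blast
   qed
   then show ?thesis using g y by auto
  qed
  then have "\<rho> y z = g y" if "y : ?A z0" for y using \<rho>(4) z1 that by blast
  then show ?thesis using inj \<open>g ` ?A z0 = ?A z\<close> by (auto simp: inj_on_def image_iff)
 qed
 show ?thesis
 proof (rule exI[of _ \<epsilon>], rule conjI, use e1 e2 in \<open>simp add: \<epsilon>_def\<close>, rule exI[of _ \<rho>], intro conjI ballI allI)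
  show "tube I z0 \<epsilon> \<subseteq> ?D" by (rule sub)
  show "hol (\<rho> a) (tube I z0 \<epsilon>)" if "a : ?A z0" for a
   by (rule hol_on_subset[OF \<rho>(1)[OF that] sub1])
  show "\<rho> a z = \<rho> a (cproj I z)" if "a : ?A z0" for a z by (rule \<rho>(2)[OF that])
  fix z assume "z : tube I z0 \<epsilon>"
  from main[OF this] show "?A z = (%a. \<rho> a z) ` ?A z0" "inj_on (%a. \<rho> a z) (?A z0)" by blast+
 qed
qed

section \<open>Regular points\<close>

lemma higher_deriv_line_on:
 assumes U: "open U" and f: "hol f U"
 shows "hol (((%f. dir_deriv f v) ^^ k) f) U"
  and "z + t *s v : U ==> (deriv ^^ k) (%t. f (z + t *s v)) t = ((%f. dir_deriv f v) ^^ k) f (z + t *s v)"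
proof -
 let ?\<Omega> = "(%t. z + t *s v) -` U"
 have op: "open ?\<Omega>" by (intro open_vimage U continuous_intros)
 have hol: "hol (((%f. dir_deriv f v) ^^ k) f) U" for k
  by (induction k) (auto intro: f hol_dir_deriv[OF U])
 then show "hol (((%f. dir_deriv f v) ^^ k) f) U" .
 have "ALL t:?\<Omega>. (deriv ^^ k) (%t. f (z + t *s v)) t = ((%f. dir_deriv f v) ^^ k) f (z + t *s v)"
 proof (induction k)
  case 0
  then show ?case by simp
 next
  case (Suc k)
  let ?g = "((%f. dir_deriv f v) ^^ k) f"
  show ?case
  proof
   fix t assume t: "t : ?\<Omega>"
   have ev: "\<forall>\<^sub>F t in nhds t. (deriv ^^ k) (%t. f (z + t *s v)) t = ?g (z + t *s v)"
    using op t Suc unfolding eventually_nhds by blast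
   have "(deriv ^^ Suc k) (%t. f (z + t *s v)) t = deriv ((deriv ^^ k) (%t. f (z + t *s v))) t" by simp
   also have "\<dots> = deriv (%t. ?g (z + t *s v)) t" by (rule deriv_cong_ev[OF ev refl])
   also have "\<dots> = dir_deriv ?g v (z + t *s v)"
    using hol_line_derivative[OF hol, of z t v k] t DERIV_imp_deriv by blast
   finally show "(deriv ^^ Suc k) (%t. f (z + t *s v)) t = ((%f. dir_deriv f v) ^^ Suc k) f (z + t *s v)" by simp
  qed
 qed
 then show "z + t *s v : U ==> (deriv ^^ k) (%t. f (z + t *s v)) t = ((%f. dir_deriv f v) ^^ k) f (z + t *s v)"
  by simp
qed

lemma zero_along_line:
 assumes U: "open U" "convex U" and f: "hol f U" and z: "z : U" "z + v : U"
  and zero: "!!k. ((%f. dir_deriv f v) ^^ k) f z = 0"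
 shows "f (z + v) = 0"
proof -
 let ?\<Omega> = "(%t. z + t *s v) -` U"
 have "f (z + 1 *s v) = 0"
 proof (rule holomorphic_fun_eq_0_on_connected[of "%t. f (z + t *s v)" ?\<Omega> 0 1])
  show "(%t. f (z + t *s v)) holomorphic_on ?\<Omega>" by (rule holomorphic_on_line[OF f]) auto
  show "open ?\<Omega>" by (intro open_vimage U continuous_intros)
  show "connected ?\<Omega>" by (intro convex_connected convex_line_vimage U)
  show "(deriv ^^ k) (%t. f (z + t *s v)) 0 = 0" for k
   using higher_deriv_line_on(2)[OF U(1) f, of z 0 v k] zero[of k] z by simp
 qed (use z in auto)
 then show ?thesis by simp
qed

lemma dir_deriv_sum_axis:
 assumes "hol f U" "z : U"
 shows "dir_deriv f u z = (\<Sum>s\<in>UNIV. u $ s * dir_deriv f (axis s 1) z)"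
proof -
 have lin: "linear (%v. dir_deriv f v z)"
  using hol_has_derivative(1)[OF assms] has_derivative_linear by blast
 have "u = (\<Sum>s\<in>UNIV. u $ s *s axis s 1)" by (simp add: vec_eq_iff axis_def if_distrib sum.delta cong: if_cong)
 then have "dir_deriv f u z = dir_deriv f (\<Sum>s\<in>UNIV. u $ s *s axis s 1) z" by simp
 also have "\<dots> = (\<Sum>s\<in>UNIV. dir_deriv f (u $ s *s axis s 1) z)" by (rule linear_sum[OF lin])
 finally show ?thesis by (simp add: hol_has_derivative(2)[OF assms])
qed

lemma dir_deriv_compose:
 assumes "hol f V" "\<phi> z : V" "(\<phi> has_derivative D) (at z)" "!!c u. D (c *s u) = c *s D u"
 shows "dir_deriv (%z. f (\<phi> z)) v z = dir_deriv f (D v) (\<phi> z)"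
proof -
 have "((%z. f (\<phi> z)) has_derivative (%v. dir_deriv f (D v) (\<phi> z))) (at z)"
  using diff_chain_at[OF assms(3) hol_has_derivative(1)[OF assms(1,2)]] by (simp add: o_def)
 then show ?thesis
  by (rule dir_deriv_eq) (simp add: assms(4) hol_has_derivative(2)[OF assms(1,2)])
qed

lemma derivative_of_inverse:
 fixes \<phi> \<theta> :: "complex^'n => complex^'n"
 assumes "open U" "z : U" "!!x. x : U ==> \<theta> (\<phi> x) = x"
  "(\<phi> has_derivative D) (at z)" "(\<theta> has_derivative E) (at (\<phi> z))"
 shows "E (D v) = v"
proof -
 have "((%x. \<theta> (\<phi> x)) has_derivative (%v. E (D v))) (at z)"
  using diff_chain_at[OF assms(4,5)] by (simp add: o_def)
 moreover have "((%x. \<theta> (\<phi> x)) has_derivative (%v. v)) (at z)"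
  by (rule has_derivative_transform_within_open[of "%x. x" _ z UNIV U]) (use assms in auto)
 ultimately show ?thesis by (metis has_derivative_unique)
qed

text \<open>At a point where a maximal number of local equations of \<open>X\<close> have independent differentials, use
  those equations as coordinates. By maximality the derivatives of every local equation in the
  remaining directions vanish on \<open>X\<close> again, so its Taylor series in these directions vanishes.\<close>

definition partial_coordinates ::
  "(complex^'n) set => (complex^'n) set => nat => 'n set => (complex^'n => complex^'n) =>
   (complex^'n) set => complex^'n => bool" where
 "partial_coordinates X W r T \<phi> W' p \<longleftrightarrow> card T = r & open W' & W' \<subseteq> W & p : X Int W' &
  holmap \<phi> W' & (EX D. (\<phi> has_derivative D) (at p) & (ALL v. D v = 0 --> v = 0)) &
  (ALL i:T. ALL x:X Int W'. \<phi> x $ i = 0)"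

theorem regular_points_dense:
 fixes X :: "(complex^'n) set"
 assumes X: "analytic_subset X" and a: "a : X" and W: "open W" "a : W"
 shows "EX k. EX p:W. p : regular_points X k"
proof -
 \<comment> \<open>The number of independent equations is maximised over all points of
   \<open>X\<close> in \<open>W\<close>, so the regular point found may differ from
   \<open>a\<close>.\<close>
 define R where "R r \<longleftrightarrow> (EX T \<phi> W' p. partial_coordinates X W r T \<phi> W' p)" for r
 have "holmap (%z :: complex^'n. z) W" by (simp add: holomorphic_map_on_def)
 then have "partial_coordinates X W 0 {} (%z. z) W a"
  unfolding partial_coordinates_def using a W by (auto intro!: exI[of _ "%v. v"])
 then have "R 0" unfolding R_def by (intro exI)
 moreover have "ALL r. R r --> r <= CARD('n)"
  unfolding R_def partial_coordinates_def by (metis card_mono finite top_greatest)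
 ultimately obtain g where g: "R g" "!!r. R r ==> r <= g"
  using GreatestI_nat[of R 0] Greatest_le_nat[of R] by blast
 obtain T \<phi> W' p where pc: "partial_coordinates X W g T \<phi> W' p"
  using g(1) unfolding R_def by (elim exE)
 have pc': "open W'" "W' \<subseteq> W" "p : X" "p : W'" "holmap \<phi> W'"
  "!!i x. i : T ==> x : X ==> x : W' ==> \<phi> x $ i = 0" and cardT: "card T = g"
  using pc unfolding partial_coordinates_def by simp_all
 have mx: "r <= card T" if "R r" for r using g(2)[OF that] cardT by simp
 obtain D where D: "(\<phi> has_derivative D) (at p)" "!!v. D v = 0 ==> v = 0"
 proof -
  have "EX D. (\<phi> has_derivative D) (at p) & (ALL v. D v = 0 --> v = 0)"
   using pc unfolding partial_coordinates_def by (elim conjE)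
  then show ?thesis using that by blast
 qed
 obtain U F where U: "open U" "p : U" "finite F" "!!f. f : F ==> hol f U"
  "X Int U = {z:U. ALL f:F. f z = 0}"
  by (rule analytic_subsetE[OF X, where a = p]) (rule that; (assumption | simp only:))
 have hol1: "holmap \<phi> (W' Int U)"
  using pc'(5) hol_on_subset unfolding holomorphic_map_on_def by blast
 obtain U' V \<theta> where inv: "open U'" "U' \<subseteq> W' Int U" "p : U'" "open V" "homeomorphism U' V \<phi> \<theta>"
  "holmap \<theta> V"
  by (rule holomorphic_local_inverse[OF hol1 _ _ D]) (use pc' U in auto)
 define w0 where "w0 = \<phi> p"
 have "w0 : V" using inv by (auto simp: w0_def homeomorphism_def)
 then obtain \<epsilon> where \<epsilon>: "\<epsilon> > 0" "ball w0 \<epsilon> \<subseteq> V" using inv(4) openE by blast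
 define V0 where "V0 = ball w0 \<epsilon>"
 define U0 where "U0 = U' Int \<phi> -` V0"
 have th: "\<theta> w : U0" "\<phi> (\<theta> w) = w" if "w : V0" for w
  using that \<epsilon> inv(5) by (auto simp: homeomorphism_def U0_def V0_def)
 have ph: "\<phi> z : V0" "\<theta> (\<phi> z) = z" if "z : U0" for z
  using that inv(5) by (auto simp: homeomorphism_def U0_def)
 have U0sub: "U0 \<subseteq> W'" "U0 \<subseteq> U" using inv(2) by (auto simp: U0_def)
 have contU': "continuous_on U' \<phi>" using inv(5) by (simp add: homeomorphism_def)
 have opU0: "open U0"
  unfolding U0_def using continuous_open_preimage[OF contU' inv(1), of V0] by (simp add: V0_def)
 have pU0: "p : U0" using inv(3) \<epsilon> by (simp add: U0_def V0_def w0_def)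
 have holU0: "holmap \<phi> U0"
  using pc'(5) hol_on_subset[OF _ U0sub(1)] unfolding holomorphic_map_on_def by blast
 have holV0: "holmap \<theta> V0"
  using inv(6) hol_on_subset[OF _ \<epsilon>(2)] unfolding holomorphic_map_on_def V0_def by blast
 \<comment> \<open>If such a derivative were nonzero at a point of \<open>X\<close>, replacing a
   suitable coordinate \<open>s\<close> outside \<open>T\<close> by \<open>G\<close> would produce
   one more independent equation, against maximality.\<close>
 have step: "dir_deriv G u (\<phi> x) = 0"
  if G: "hol G V0" "!!x. x : X Int U0 ==> G (\<phi> x) = 0"
   and u: "!!i. i : T ==> u $ i = 0" and x: "x : X Int U0" for G u x
 proof (rule ccontr)
  assume ne: "dir_deriv G u (\<phi> x) ~= 0"
  have xU0: "x : U0" using x by simp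
  have phx: "\<phi> x : V0" using ph x by blast
  obtain s where "u $ s * dir_deriv G (axis s 1) (\<phi> x) ~= 0"
  proof (atomize_elim, rule ccontr)
   assume "\<nexists>s. u $ s * dir_deriv G (axis s 1) (\<phi> x) ~= 0"
   then have "(\<Sum>s\<in>UNIV. u $ s * dir_deriv G (axis s 1) (\<phi> x)) = 0" by (intro sum.neutral) simp
   then show False using ne dir_deriv_sum_axis[OF G(1) phx, of u] by simp
  qed
  then have s: "s ~: T" "dir_deriv G (axis s 1) (\<phi> x) ~= 0" using u by auto
  define \<phi>2 where "\<phi>2 z = (\<chi> i. if i = s then G (\<phi> z) else \<phi> z $ i)" for z
  have hol2: "holmap \<phi>2 U0"
   unfolding holomorphic_map_on_def
  proof
   fix i
   show "hol (%z. \<phi>2 z $ i) U0"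
    using hol_compose[OF G(1) holU0] ph(1) holU0
    by (cases "i = s") (auto simp: \<phi>2_def holomorphic_map_on_def)
  qed
  define E where "E = (%v. \<chi> i. dir_deriv (%z. \<phi> z $ i) v x)"
  define E2 where "E2 = (%v. \<chi> i. dir_deriv (%z. \<phi>2 z $ i) v x)"
  have E: "(\<phi> has_derivative E) (at x)" "!!c u. E (c *s u) = c *s E u"
   unfolding E_def using holmap_has_derivative[OF holU0 xU0] by auto
  have E2: "(\<phi>2 has_derivative E2) (at x)"
   unfolding E2_def using holmap_has_derivative(1)[OF hol2 xU0] .
  have Einj: "v = 0" if "E v = 0" for v
  proof -
   obtain E' where E': "(\<theta> has_derivative E') (at (\<phi> x))"
    using holmap_has_derivative(1)[OF holV0 phx] by blast
   have "E' (E v) = v" by (rule derivative_of_inverse[OF opU0 xU0 ph(2) E(1) E'])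
   moreover have "E' 0 = 0" using linear_0[OF has_derivative_linear[OF E']] .
   ultimately show ?thesis using that by simp
  qed
  have E2inj: "v = 0" if v: "E2 v = 0" for v
  proof -
   have c: "E2 v $ i = 0" for i using v by simp
   have "E v $ i = 0" if "i ~= s" for i using c[of i] that by (simp add: E2_def E_def \<phi>2_def)
   then have Ev: "E v = (E v $ s) *s axis s 1" by (simp add: vec_eq_iff axis_def)
   have "dir_deriv (%z. G (\<phi> z)) v x = 0" using c[of s] by (simp add: E2_def \<phi>2_def)
   then have "dir_deriv G (E v) (\<phi> x) = 0" using dir_deriv_compose[OF G(1) phx E] by simp
   then have "(E v $ s) * dir_deriv G (axis s 1) (\<phi> x) = 0"
    using hol_has_derivative(2)[OF G(1) phx, of "E v $ s" "axis s 1"] Ev by simp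
   then have "E v $ s = 0" using s(2) by simp
   then have "E v = 0" using Ev by simp
   then show ?thesis by (rule Einj)
  qed
  have "partial_coordinates X W (Suc (card T)) (insert s T) \<phi>2 U0 x"
   unfolding partial_coordinates_def
  proof (intro conjI ballI exI[of _ E2] allI impI)
   show "card (insert s T) = Suc (card T)" using s(1) by simp
   show "\<phi>2 y $ i = 0" if "i : insert s T" "y : X Int U0" for i y
    using that G(2)[of y] pc'(6)[of i y] U0sub by (auto simp: \<phi>2_def)
  qed (use opU0 U0sub pc'(2) x hol2 E2 E2inj in auto)
  then have "R (Suc (card T))" unfolding R_def by (intro exI)
  then show False using mx by fastforce
 qed
 have w0T: "w0 $ i = 0" if "i : T" for i using pc'(3,4,6) that by (simp add: w0_def)
 \<comment> \<open>By \<open>step\<close> all iterated derivatives of \<open>G\<close> in the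
   direction \<open>w - w0\<close> vanish on \<open>X\<close>, in particular at \<open>w0\<close>;
   hence \<open>G\<close> vanishes along the line from \<open>w0\<close> to
   \<open>w\<close>.\<close>
 have zeroG: "G w = 0"
  if G: "hol G V0" "!!x. x : X Int U0 ==> G (\<phi> x) = 0"
   and w: "w : V0" "!!i. i : T ==> w $ i = 0" for G w
 proof -
  let ?u = "w - w0"
  have uT: "?u $ i = 0" if "i : T" for i using w(2) w0T that by simp
  have opV0: "open V0" by (simp add: V0_def)
  have it: "((%f. dir_deriv f ?u) ^^ k) G (\<phi> x) = 0" if "x : X Int U0" for k x
   using that
  proof (induction k arbitrary: x)
   case 0
   then show ?case using G(2) by simp
  next
   case (Suc k)
   have "dir_deriv (((%f. dir_deriv f ?u) ^^ k) G) ?u (\<phi> x) = 0"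
    by (rule step[OF higher_deriv_line_on(1)[OF opV0 G(1)] Suc.IH uT Suc.prems])
   then show ?case by simp
  qed
  have "((%f. dir_deriv f ?u) ^^ k) G w0 = 0" for k
   using it[of p k] pc'(3) pU0 by (simp add: w0_def)
  then have "G (w0 + ?u) = 0"
   by (intro zero_along_line[OF opV0 _ G(1)]) (use w \<epsilon> in \<open>auto simp: V0_def\<close>)
  then show ?thesis by simp
 qed
 have img: "\<phi> ` (X Int U0) = {w:V0. ALL i. i ~: - T --> w $ i = 0}"
 proof (intro equalityI subsetI)
  fix w assume "w : \<phi> ` (X Int U0)"
  then show "w : {w:V0. ALL i. i ~: - T --> w $ i = 0}" using ph pc'(6) U0sub by auto
 next
  fix w assume w: "w : {w:V0. ALL i. i ~: - T --> w $ i = 0}"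
  have "f (\<theta> w) = 0" if f: "f : F" for f
  proof (rule zeroG[of "%w. f (\<theta> w)" w])
   show "hol (%w. f (\<theta> w)) V0"
    by (rule hol_compose[OF U(4)[OF f] holV0]) (use th U0sub in auto)
   show "f (\<theta> (\<phi> x)) = 0" if "x : X Int U0" for x
   proof -
    have "x : X Int U" using that U0sub by blast
    then show ?thesis using U(5) f ph that by auto
   qed
  qed (use w in auto)
  then have "\<theta> w : X Int U" unfolding U(5) using th w U0sub by auto
  then show "w : \<phi> ` (X Int U0)" using th w by (intro image_eqI[of _ _ "\<theta> w"]) auto
 qed
 have bij: "bij_betw \<phi> U0 V0"
  by (rule bij_betw_byWitness[of _ \<theta>]) (use th ph in auto)
 have holinv: "holmap (inv_into U0 \<phi>) V0"
  unfolding holomorphic_map_on_def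
 proof
  fix i
  have eq: "inv_into U0 \<phi> w = \<theta> w" if "w : V0" for w
   using bij_betw_inv_into_left[OF bij th(1)[OF that]] th(2)[OF that] by simp
  have "open V0" by (simp add: V0_def)
  then show "hol (%z. inv_into U0 \<phi> z $ i) V0"
   by (rule hol_cong[OF holV0[unfolded holomorphic_map_on_def, rule_format, of i]]) (simp add: eq)
 qed
 have "open V0" by (simp add: V0_def)
 then have bih: "biholomorphic_on \<phi> U0 V0"
  unfolding biholomorphic_on_def by (intro conjI opU0 bij holU0 holinv)
 have "p : regular_points X (card (- T))"
  unfolding regular_points_def mem_Collect_eq
  by (intro conjI exI[of _ U0] exI[of _ V0] exI[of _ \<phi>] exI[of _ "- T"] pc'(3) pU0 bih img refl)
 then show ?thesis using pc'(2,4) by blast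
qed

section \<open>Local dimension and purity\<close>

lemma regular_points_card_le:
 fixes X :: "(complex^'n) set"
 assumes "p : regular_points X k"
 shows "k <= CARD('n)"
proof -
 obtain I :: "'n set" where "card I = k" using assms unfolding regular_points_def by blast
 then show ?thesis using card_mono[of UNIV I] by simp
qed

text \<open>\<open>local_dim\<close> is a \<open>Max\<close>, which carries information only for a
  finite nonempty set. Finiteness holds because dimensions are at most \<open>CARD('n)\<close>, and
  nonemptiness because regular points are dense and only finitely many dimensions occur.\<close>

theorem pure_closure_regular:
 fixes X :: "(complex^'n) set"
 assumes X: "pure_analytic_set d X" and a: "a : X"
 shows "a : closure (regular_points X d)"
  and "!!k. a : closure (regular_points X k) ==> k <= d"
proof -
 let ?S = "{k. a : closure (regular_points X k)}"
 have d: "d = Max ?S" using X a unfolding pure_analytic_set_def local_dim_def by simp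
 have "?S \<subseteq> {..CARD('n)}"
 proof
  fix k assume "k : ?S"
  then have "regular_points X k ~= {}" by auto
  then show "k : {..CARD('n)}" using regular_points_card_le by auto
 qed
 then have fin: "finite ?S" using finite_subset by blast
 have an: "analytic_subset X" using X by (simp add: pure_analytic_set_def)
 have "?S ~= {}"
 proof
  assume "?S = {}"
  then have "a : (\<Inter>k\<in>{..CARD('n)}. - closure (regular_points X k))" by blast
  moreover have "open (\<Inter>k\<in>{..CARD('n)}. - closure (regular_points X k))" by (intro open_INT) auto
  ultimately obtain k p where p: "p : (\<Inter>k\<in>{..CARD('n)}. - closure (regular_points X k))" "p : regular_points X k"
   using regular_points_dense[OF an a] by blast
  then show False using regular_points_card_le[OF p(2)] closure_subset by blast
 qed
 then show "a : closure (regular_points X d)" using Max_in[OF fin] unfolding d by blast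
 show "k <= d" if "a : closure (regular_points X k)" for k
  unfolding d using fin that by (intro Max_ge) auto
qed

text \<open>The derivative of order equal to the degree is a nonzero constant. This guarantees that
  a search for a nonvanishing derivative ends.\<close>

lemma higher_pderiv_monic:
 assumes "degree p = m" "coeff p m = (1 :: complex)"
 shows "(pderiv ^^ m) p = [:fact m:]"
proof (rule poly_eqI)
 fix i
 show "coeff ((pderiv ^^ m) p) i = coeff [:fact m:] i"
  unfolding coeff_higher_pderiv
  by (cases i) (use assms in \<open>simp_all add: coeff_eq_0 pochhammer_fact[symmetric] coeff_pCons\<close>)
qed

lemma hol_higher_pderiv:
 assumes P: "monic_family D m P" and D: "open D" and f: "hol f D"
 shows "hol (%z. poly ((pderiv ^^ \<mu>) (P z)) (f z)) D"
proof -
 have "hol (%z. \<Sum>i\<le>m. pochhammer (of_nat (Suc i)) \<mu> * coeff (P z) (i + \<mu>) * f z ^ i) D"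
  using P f unfolding monic_family_def
  by (intro hol_sum hol_mult hol_power hol_const) auto
 then show ?thesis
 proof (rule hol_cong[OF _ D])
  fix z assume "z : D"
  then have deg: "degree (P z) = m" using P unfolding monic_family_def by simp
  have "degree ((pderiv ^^ \<mu>) (P z)) <= m"
   by (rule degree_le) (simp add: coeff_higher_pderiv deg coeff_eq_0)
  then have "poly ((pderiv ^^ \<mu>) (P z)) (f z) = (\<Sum>i\<le>m. coeff ((pderiv ^^ \<mu>) (P z)) i * f z ^ i)"
   unfolding poly_altdef by (intro sum.mono_neutral_left) (auto simp: coeff_eq_0)
  then show "poly ((pderiv ^^ \<mu>) (P z)) (f z) =
   (\<Sum>i\<le>m. pochhammer (of_nat (Suc i)) \<mu> * coeff (P z) (i + \<mu>) * f z ^ i)"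
   by (simp add: coeff_higher_pderiv)
 qed
qed

text \<open>Near a generic regular point, some iterated derivative in \<open>T\<close> of the monic polynomial killing \<open>z\<^sub>j\<close>
  vanishes on \<open>X\<close> while the next one does not. Hence the differential of \<open>z\<^sub>j\<close> on \<open>X\<close> is a combination of
  those of the base coordinates.\<close>

theorem projection_of_regular_part:
 fixes X :: "(complex^'n) set"
 assumes X: "analytic_subset X" "in_cone I X" and p: "p : regular_points X d"
  and W: "open W" "p : W" and le: "card I <= d"
 shows "card I = d & (EX N. open N & N ~= {} & (ALL z:N. EX x:X Int W. cproj I x = cproj I z))"
proof -
 obtain U V I0 and \<phi> :: "complex^'n => complex^'n" where reg: "p : U" "biholomorphic_on \<phi> U V" "card I0 = d"
  "\<phi> ` (X Int U) = {w:V. ALL i. i ~: I0 --> w $ i = 0}" and pX: "p : X"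
  using p unfolding regular_points_def by (elim CollectE conjE exE) (rule that; assumption)
 define \<theta> where "\<theta> = inv_into U \<phi>"
 have bih: "open U" "open V" "bij_betw \<phi> U V" "holmap \<phi> U" "holmap \<theta> V"
  using reg(2) unfolding biholomorphic_on_def \<theta>_def by auto
 have th: "\<theta> w : U" "\<phi> (\<theta> w) = w" if "w : V" for w
  unfolding \<theta>_def using that bih(3) by (auto simp: bij_betw_def inv_into_into f_inv_into_f)
 have ph: "\<phi> z : V" "\<theta> (\<phi> z) = z" if "z : U" for z
  unfolding \<theta>_def using that bih(3) by (auto simp: bij_betw_def)
 let ?cp0 = "cproj I0"
 define w0 where "w0 = \<phi> p"
 have "w0 : {w:V. ALL i. i ~: I0 --> w $ i = 0}" unfolding reg(4)[symmetric] w0_def using pX reg(1) by blast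
 then have w0: "w0 : V" "?cp0 w0 = w0" by (auto simp: vec_eq_iff)
 define V' where "V' = {w. ?cp0 w : V}"
 have opV': "open V'"
  using open_vimage[OF bih(2), of ?cp0] by (simp add: V'_def vimage_def continuous_intros)
 \<comment> \<open>A parametrisation of \<open>X\<close> near \<open>p\<close> that ignores the
   coordinates outside \<open>I0\<close>. It lives on an open set of the full space, where
   derivatives are available.\<close>
 define \<psi> where "\<psi> w = \<theta> (?cp0 w)" for w
 have hol\<psi>: "holmap \<psi> V'"
  unfolding \<psi>_def by (rule holmap_compose[OF bih(5) holmap_cproj]) (simp add: V'_def)
 have \<psi>X: "\<psi> w : X" if "w : V'" for w
 proof -
  have "?cp0 w : \<phi> ` (X Int U)" unfolding reg(4) using that by (simp add: V'_def)
  then show ?thesis using ph(2) by (auto simp: \<psi>_def)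
 qed
 have \<psi>w0: "\<psi> w0 = p" using w0 ph reg(1) by (simp add: \<psi>_def w0_def)
 have "ALL j: - I. EX q. fst q > 0 & monic_family (tube I p (fst q)) (fst (snd q)) (snd (snd q)) &
   (ALL z. snd (snd q) z = snd (snd q) (cproj I z)) &
   (ALL x:X Int tube I p (fst q). poly (snd (snd q) x) (x $ j) = 0)"
 proof
  fix j assume "j : - I"
  then have j: "j ~: I" by simp
  obtain \<delta> m P where "\<delta> > 0" "monic_family (tube I p \<delta>) m P" "ALL z. P z = P (cproj I z)"
   "ALL x:X Int tube I p \<delta>. poly (P x) (x $ j) = 0"
   using coordinate_integral[OF X j, of p] by (elim exE conjE) (rule that; assumption)
  then show "EX q. fst q > 0 & monic_family (tube I p (fst q)) (fst (snd q)) (snd (snd q)) &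
   (ALL z. snd (snd q) z = snd (snd q) (cproj I z)) &
   (ALL x:X Int tube I p (fst q). poly (snd (snd q) x) (x $ j) = 0)"
   by (intro exI[of _ "(\<delta>, m, P)"]) simp
 qed
 from bchoice[OF this] obtain q where q: "ALL j: - I. fst (q j) > 0 &
   monic_family (tube I p (fst (q j))) (fst (snd (q j))) (snd (snd (q j))) &
   (ALL z. snd (snd (q j)) z = snd (snd (q j)) (cproj I z)) &
   (ALL x:X Int tube I p (fst (q j)). poly (snd (snd (q j)) x) (x $ j) = 0)" by (elim exE)
 define \<delta> where "\<delta> j = fst (q j)" for j
 define m where "m j = fst (snd (q j))" for j
 define P where "P j = snd (snd (q j))" for j
 have Pj: "\<delta> j > 0" "monic_family (tube I p (\<delta> j)) (m j) (P j)" "!!z. P j z = P j (cproj I z)"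
  "!!x. x : X ==> x : tube I p (\<delta> j) ==> poly (P j x) (x $ j) = 0" if "j ~: I" for j
  using bspec[OF q, of j] that unfolding \<delta>_def m_def P_def by simp_all
 define N0 where "N0 = W Int (\<Inter>j\<in>- I. tube I p (\<delta> j))"
 have opN0: "open N0" unfolding N0_def by (intro open_Int W open_INT) auto
 define B0 where "B0 = V' Int \<psi> -` N0"
 have opB0: "open B0"
  unfolding B0_def using continuous_open_preimage[OF holmap_imp_continuous_on[OF hol\<psi>] opV' opN0] .
 have w0B0: "w0 : B0" using w0 Pj(1) W(2) by (simp add: B0_def V'_def \<psi>w0 N0_def)
 have B0V': "B0 \<subseteq> V'" by (simp add: B0_def)
 have B0t: "\<psi> w : tube I p (\<delta> j)" if "w : B0" "j ~: I" for w j using that by (simp add: B0_def N0_def)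
 have hol\<psi>B0: "holmap \<psi> B0"
  using hol\<psi> hol_on_subset[OF _ B0V'] unfolding holomorphic_map_on_def by blast
 define K where "K j \<mu> x = poly ((pderiv ^^ \<mu>) (P j x)) (x $ j)" for j \<mu> x
 have holK: "hol (K j \<mu>) (tube I p (\<delta> j))" if "j ~: I" for j \<mu>
  unfolding K_def by (rule hol_higher_pderiv[OF Pj(2)[OF that]]) auto
 have holH: "hol (%w. K j \<mu> (\<psi> w)) B0" if "j ~: I" for j \<mu>
  by (rule hol_compose[OF holK[OF that] hol\<psi>B0]) (use B0t that in auto)
 \<comment> \<open>The ball shrinks once for each fibre coordinate, so that in the end one ball
   serves all \<open>j\<close>.\<close>
 have shrink: "EX c \<epsilon>. \<epsilon> > 0 & ball c \<epsilon> \<subseteq> B0 & (ALL j:S. EX \<mu>. (ALL w:ball c \<epsilon>. K j \<mu> (\<psi> w) = 0) &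
   (ALL w:ball c \<epsilon>. K j (Suc \<mu>) (\<psi> w) ~= 0))" if "finite S" "S \<subseteq> - I" for S
  using that
 proof (induction S rule: finite_induct)
  case empty
  obtain \<epsilon> where "\<epsilon> > 0" "ball w0 \<epsilon> \<subseteq> B0" using opB0 w0B0 openE by blast
  then show ?case by auto
 next
  case (insert j S)
  have j: "j ~: I" using insert.prems by auto
  obtain c \<epsilon> where c: "\<epsilon> > 0" "ball c \<epsilon> \<subseteq> B0" "ALL j:S. EX \<mu>. (ALL w:ball c \<epsilon>. K j \<mu> (\<psi> w) = 0) &
   (ALL w:ball c \<epsilon>. K j (Suc \<mu>) (\<psi> w) ~= 0)" using insert.IH insert.prems by auto
  \<comment> \<open>The first derivative order that is not identically zero along \<psi> on the
    ball. It is not \<open>0\<close>, since the polynomial itself vanishes on \<open>X\<close>; so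
    it has a predecessor \<mu>, and the derivative of order \<mu> vanishes on the whole
    ball.\<close>
  define \<nu> where "\<nu> = (LEAST \<mu>. EX w:ball c \<epsilon>. K j \<mu> (\<psi> w) ~= 0)"
  have cB0: "c : B0" using c by (meson centre_in_ball subsetD)
  have "K j (m j) (\<psi> c) ~= 0"
  proof -
   have "degree (P j (\<psi> c)) = m j" "coeff (P j (\<psi> c)) (m j) = 1"
    using Pj(2)[OF j] B0t[OF cB0 j] unfolding monic_family_def by auto
   then show ?thesis unfolding K_def by (simp add: higher_pderiv_monic)
  qed
  then have ex: "EX \<mu>. EX w:ball c \<epsilon>. K j \<mu> (\<psi> w) ~= 0" using c by (intro exI[of _ "m j"] bexI[of _ c]) auto
  have "EX w:ball c \<epsilon>. K j \<nu> (\<psi> w) ~= 0" unfolding \<nu>_def using ex by (rule LeastI_ex)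
  then obtain c' where c': "c' : ball c \<epsilon>" "K j \<nu> (\<psi> c') ~= 0" by blast
  have "K j 0 (\<psi> w) = 0" if "w : ball c \<epsilon>" for w
  proof -
   have "w : B0" using that c by blast
   then show ?thesis unfolding K_def using Pj(4)[OF j] \<psi>X B0V' B0t[OF _ j] by auto
  qed
  then have "\<nu> ~= 0" using c' by metis
  then obtain \<mu> where \<mu>: "\<nu> = Suc \<mu>" by (cases \<nu>) auto
  have "\<mu> < (LEAST \<mu>. EX w:ball c \<epsilon>. K j \<mu> (\<psi> w) ~= 0)" using \<mu> unfolding \<nu>_def by simp
  from not_less_Least[OF this] have zero: "K j \<mu> (\<psi> w) = 0" if "w : ball c \<epsilon>" for w using that by blast
  have "open (ball c \<epsilon> Int {w:B0. K j \<nu> (\<psi> w) ~= 0})"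
   by (intro open_Int open_ball open_nonzero_set[OF holH[OF j] opB0])
  moreover have "c' : ball c \<epsilon> Int {w:B0. K j \<nu> (\<psi> w) ~= 0}" using c c' by auto
  ultimately obtain \<epsilon>' where e': "\<epsilon>' > 0" "ball c' \<epsilon>' \<subseteq> ball c \<epsilon> Int {w:B0. K j \<nu> (\<psi> w) ~= 0}" by (rule openE)
  have "ALL j:insert j S. EX \<mu>. (ALL w:ball c' \<epsilon>'. K j \<mu> (\<psi> w) = 0) & (ALL w:ball c' \<epsilon>'. K j (Suc \<mu>) (\<psi> w) ~= 0)"
  proof
   fix i assume "i : insert j S"
   then consider "i = j" | "i : S" by blast
   then show "EX \<mu>. (ALL w:ball c' \<epsilon>'. K i \<mu> (\<psi> w) = 0) & (ALL w:ball c' \<epsilon>'. K i (Suc \<mu>) (\<psi> w) ~= 0)"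
   proof cases
    case 1
    then show ?thesis using zero e' \<mu> by (intro exI[of _ \<mu>]) blast
   next
    case 2
    then show ?thesis using c(3) e' by blast
   qed
  qed
  then show ?case using e' c(2) by (intro exI[of _ c'] exI[of _ \<epsilon>'] conjI) auto
 qed
 obtain c \<epsilon> where c: "\<epsilon> > 0" "ball c \<epsilon> \<subseteq> B0" and cK: "!!j. j ~: I ==> EX \<mu>. (ALL w:ball c \<epsilon>. K j \<mu> (\<psi> w) = 0) &
   (ALL w:ball c \<epsilon>. K j (Suc \<mu>) (\<psi> w) ~= 0)"
  using shrink[of "- I"] by auto
 have cB0: "c : B0" and cc: "c : ball c \<epsilon>" using c by auto
 define D where "D = (%v. \<chi> i. dir_deriv (%z. \<psi> z $ i) v c)"
 have D: "(\<psi> has_derivative D) (at c)" "!!s u. D (s *s u) = s *s D u"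
  unfolding D_def using holmap_has_derivative[OF hol\<psi>B0 cB0] by auto
 have linD: "linear D" using D(1) has_derivative_linear by blast
 \<comment> \<open>Differentiate the identity \<open>K j \<mu> (\<psi> w) = 0\<close>. When the base
   coordinates of \<open>D v\<close> vanish, the polynomial is constant in that direction and only
   the \<open>j\<close>-th coordinate moves, with the nonzero factor
   \<open>K j (Suc \<mu>) (\<psi> c)\<close>.\<close>
 have Dj: "D v $ j = 0" if v: "cproj I (D v) = 0" and j: "j ~: I" for v j
 proof -
  obtain \<mu> where \<mu>: "!!w. w:ball c \<epsilon> ==> K j \<mu> (\<psi> w) = 0" "K j (Suc \<mu>) (\<psi> c) ~= 0" using cK[OF j] cc by blast
  have tube: "\<psi> c : tube I p (\<delta> j)" by (rule B0t[OF cB0 j])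
  have "((%w. K j \<mu> (\<psi> w)) has_derivative (%v. 0)) (at c)"
   by (rule has_derivative_transform_within_open[of "%_. 0" _ c UNIV "ball c \<epsilon>"]) (use \<mu>(1) c in auto)
  then have "dir_deriv (%w. K j \<mu> (\<psi> w)) v c = 0" by (rule dir_deriv_eq) simp
  then have "dir_deriv (K j \<mu>) (D v) (\<psi> c) = 0"
   using dir_deriv_compose[OF holK[OF j] tube D] by simp
  moreover have "dir_deriv (K j \<mu>) (D v) (\<psi> c) = K j (Suc \<mu>) (\<psi> c) * (D v $ j)"
  proof -
   have PP: "P j (\<psi> c + t *s D v) = P j (\<psi> c)" for t
    using Pj(3)[OF j, of "\<psi> c + t *s D v"] Pj(3)[OF j, of "\<psi> c"] v by simp
   let ?R = "(pderiv ^^ \<mu>) (P j (\<psi> c))"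
   have "((%t. poly ?R (\<psi> c $ j + t * (D v $ j))) has_field_derivative
     poly (pderiv ?R) (\<psi> c $ j + 0 * (D v $ j)) * (D v $ j)) (at 0)"
    by (intro DERIV_chain2[OF poly_DERIV] derivative_eq_intros) auto
   then have "deriv (%t. poly ?R (\<psi> c $ j + t * (D v $ j))) 0 = poly (pderiv ?R) (\<psi> c $ j) * (D v $ j)"
    by (simp add: DERIV_imp_deriv)
   then show ?thesis unfolding dir_deriv_def K_def by (simp add: PP)
  qed
  ultimately show ?thesis using \<mu>(2) by simp
 qed
 have Dinj: "?cp0 v = 0" if v: "cproj I (D v) = 0" for v
 proof -
  have "D v $ i = 0" for i
  proof (cases "i : I")
   case True
   have "cproj I (D v) $ i = 0" using v by simp
   then show ?thesis using True by simp
  qed (rule Dj[OF v])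
  then have Dv: "D v = 0" by (simp add: vec_eq_iff)
  have cV: "?cp0 c : V" using cB0 B0V' by (auto simp: V'_def)
  obtain E where E: "(\<theta> has_derivative E) (at (?cp0 c))" using holmap_has_derivative(1)[OF bih(5) cV] by blast
  obtain F where F: "(\<phi> has_derivative F) (at (\<theta> (?cp0 c)))"
   using holmap_has_derivative(1)[OF bih(4) th(1)[OF cV]] by blast
  have "(?cp0 has_derivative ?cp0) (at c)" using bounded_linear_cproj bounded_linear_imp_has_derivative by blast
  from diff_chain_at[OF this E] have "(\<psi> has_derivative (%v. E (?cp0 v))) (at c)" unfolding \<psi>_def by (simp add: o_def)
  then have "D v = E (?cp0 v)" using D(1) has_derivative_unique by metis
  then have "F (E (?cp0 v)) = F 0" using Dv by simp
  moreover have "F (E (?cp0 v)) = ?cp0 v" by (rule derivative_of_inverse[OF bih(2) cV th(2) E F])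
  moreover have "F 0 = 0" using linear_0[OF has_derivative_linear[OF F]] .
  ultimately show ?thesis by simp
 qed
 have "card (- I0) <= card (- I)" using le reg(3) by (simp add: Compl_eq_Diff_UNIV card_Diff_subset)
 then obtain \<gamma> where \<gamma>: "inj_on \<gamma> (- I0)" "\<gamma> ` (- I0) \<subseteq> - I" using card_le_inj[of "- I0" "- I"] by auto
 define \<gamma>' where "\<gamma>' = inv_into (- I0) \<gamma>"
 have \<gamma>': "\<gamma>' i : - I0" if "i : \<gamma> ` (- I0)" for i unfolding \<gamma>'_def using that by (rule inv_into_into)
 have \<gamma>'\<gamma>: "\<gamma>' (\<gamma> s) = s" if "s ~: I0" for s unfolding \<gamma>'_def using that \<gamma> by (simp add: inv_into_f_f)
 \<comment> \<open>To obtain an endomorphism, the directions outside \<open>I0\<close>, which \<psi>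
   ignores, are stored in positions outside \<open>I\<close>. It is injective, hence surjective, so
   every position outside \<open>I\<close> is occupied; this yields
   \<open>card I = d\<close>.\<close>
 define M where "M v = (\<chi> i. if i : I then D v $ i else if i : \<gamma> ` (- I0) then v $ \<gamma>' i else 0)" for v
 have linM: "linear M"
  by (rule linearI) (auto simp: M_def vec_eq_iff linear_add[OF linD] linear_cmul[OF linD])
 have Minj: "v = 0" if "M v = 0" for v
 proof -
  have c: "M v $ i = 0" for i using that by simp
  have "cproj I (D v) = 0"
   unfolding vec_eq_iff
  proof
   fix i show "cproj I (D v) $ i = 0 $ i" using c[of i] by (auto simp: M_def split: if_splits)
  qed
  from Dinj[OF this] have "?cp0 v = 0" .
  then have "?cp0 v $ s = 0" for s by simp
  then have v0: "v $ s = 0" if "s : I0" for s using that by (metis cproj_nth)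
  have "v $ s = 0" if "s ~: I0" for s
  proof -
   have "\<gamma> s ~: I" "\<gamma> s : \<gamma> ` (- I0)" using \<gamma> that by auto
   then show ?thesis using c[of "\<gamma> s"] \<gamma>'\<gamma>[OF that] by (simp add: M_def)
  qed
  then show ?thesis using v0 by (auto simp: vec_eq_iff)
 qed
 then have "inj M" using linear_injective_0[OF linM] by blast
 then have "surj M" using linear_injective_imp_surjective[OF linM] by simp
 have surj\<gamma>: "\<gamma> ` (- I0) = - I"
 proof (rule ccontr)
  assume "\<gamma> ` (- I0) ~= - I"
  then obtain i where i: "i ~: I" "i ~: \<gamma> ` (- I0)" using \<gamma>(2) by blast
  obtain v where "axis i 1 = M v" using \<open>surj M\<close> by (metis surjD)
  then have "(axis i 1 :: complex^'n) $ i = M v $ i" by simp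
  then show False using i by (simp add: M_def axis_def)
 qed
 then have "card (- I) = card (- I0)" using card_image[OF \<gamma>(1)] by simp
 moreover have "card I <= CARD('n)" "card I0 <= CARD('n)" by (auto intro: card_mono)
 ultimately have card: "card I = d" using reg(3) by (simp add: Compl_eq_Diff_UNIV card_Diff_subset)
 \<comment> \<open>The nonlinear map with derivative \<open>M\<close> at \<open>c\<close>. The open
   mapping theorem gives interior points of its image, and each image point has the base coordinates
   of a point of \<open>X\<close>.\<close>
 define G where "G w = (\<chi> i. if i : I then \<psi> w $ i else w $ \<gamma>' i)" for w
 have holG: "holmap G (ball c \<epsilon>)"
  unfolding holomorphic_map_on_def
 proof
  fix i
  have "hol (%z. \<psi> z $ i) (ball c \<epsilon>)"
   using hol\<psi>B0 hol_on_subset[OF _ c(2)] unfolding holomorphic_map_on_def by blast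
  then show "hol (%z. G z $ i) (ball c \<epsilon>)" by (cases "i : I") (simp_all add: G_def)
 qed
 have derG: "(G has_derivative M) (at c)"
 proof -
  have "(G has_derivative (%v. \<chi> i. dir_deriv (%z. G z $ i) v c)) (at c)"
   by (rule holmap_has_derivative(1)[OF holG cc])
  moreover have "(\<chi> i. dir_deriv (%z. G z $ i) v c) = M v" for v
   unfolding vec_eq_iff
  proof
   fix i
   have co: "((%z :: complex^'n. z $ s) has_derivative (%u. u $ s)) (at c)" for s
    using bounded_linear_coord bounded_linear_imp_has_derivative by blast
   have "dir_deriv (%z. z $ \<gamma>' i) v c = v $ \<gamma>' i" by (rule dir_deriv_eq[OF co]) simp
   then show "(\<chi> i. dir_deriv (%z. G z $ i) v c) $ i = M v $ i"
    using surj\<gamma> by (cases "i : I") (simp_all add: G_def M_def D_def)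
  qed
  ultimately show ?thesis by simp
 qed
 obtain M' where M': "linear M'" "M \<circ> M' = id"
  using linear_surjective_right_inverse[OF linM \<open>surj M\<close>] by blast
 have "G c : interior (G ` ball c \<epsilon>)"
  by (rule sussmann_open_mapping[OF open_ball _ cc derG _ M'(2)])
   (use M'(1) holmap_imp_continuous_on[OF holG] cc in \<open>auto simp: linear_conv_bounded_linear\<close>)
 moreover have "EX x:X Int W. cproj I x = cproj I z" if z: "z : interior (G ` ball c \<epsilon>)" for z
 proof -
  obtain w where w: "w : ball c \<epsilon>" "z = G w" using z interior_subset by blast
  then have wB0: "w : B0" using c by blast
  have "cproj I (\<psi> w) = cproj I z" unfolding w(2) by (auto simp: vec_eq_iff G_def)
  moreover have "\<psi> w : X Int W" using wB0 \<psi>X B0V' by (auto simp: B0_def N0_def)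
  ultimately show ?thesis by blast
 qed
 ultimately show ?thesis using card by (intro conjI exI[of _ "interior (G ` ball c \<epsilon>)"]) auto
qed

section \<open>Sheets over the base\<close>

definition section_family where
 "section_family I z0 \<epsilon> A \<longleftrightarrow> finite A &
  (ALL s:A. holmap s (tube I z0 \<epsilon>) & (ALL z. s z = s (cproj I z)) &
    (ALL z. cproj I (s z) = cproj I z)) &
  (ALL s:A. ALL s':A. s ~= s' --> (ALL z:tube I z0 \<epsilon>. s z ~= s' z))"

lemma section_familyD:
 assumes "section_family I z0 \<epsilon> A"
 shows "finite A" "!!s. s : A ==> holmap s (tube I z0 \<epsilon>)"
  "!!s z. s : A ==> s z = s (cproj I z)" "!!s z. s : A ==> cproj I (s z) = cproj I z"
  "!!s s' z. s : A ==> s' : A ==> s ~= s' ==> z : tube I z0 \<epsilon> ==> s z ~= s' z"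
proof -
 have 1: "finite A" using assms unfolding section_family_def by (elim conjE)
 have 2: "ALL s:A. holmap s (tube I z0 \<epsilon>) & (ALL z. s z = s (cproj I z)) &
    (ALL z. cproj I (s z) = cproj I z)"
  using assms unfolding section_family_def by (elim conjE)
 have 3: "ALL s:A. ALL s':A. s ~= s' --> (ALL z:tube I z0 \<epsilon>. s z ~= s' z)"
  using assms unfolding section_family_def by (elim conjE)
 show "finite A" by (rule 1)
 show "holmap s (tube I z0 \<epsilon>)" if "s : A" for s using bspec[OF 2 that] by (elim conjE)
 show "s z = s (cproj I z)" if "s : A" for s z using bspec[OF 2 that] by (elim conjE) (rule spec)
 show "cproj I (s z) = cproj I z" if "s : A" for s z using bspec[OF 2 that] by (elim conjE) (rule spec)
 show "s z ~= s' z" if "s : A" "s' : A" "s ~= s'" "z : tube I z0 \<epsilon>" for s s' z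
  using bspec[OF bspec[OF 3 that(1)] that(2)] that(3,4) by blast
qed

lemma holmap_on_subset:
 "holmap \<phi> U ==> V \<subseteq> U ==> holmap \<phi> V"
 unfolding holomorphic_map_on_def using hol_on_subset by blast

lemma section_family_mono:
 assumes A: "section_family I z0 \<epsilon> A" and B: "B \<subseteq> A" and sub: "tube I z1 \<delta> \<subseteq> tube I z0 \<epsilon>"
 shows "section_family I z1 \<delta> B"
 unfolding section_family_def
proof (intro conjI ballI allI impI)
 show "finite B" using section_familyD(1)[OF A] B finite_subset by blast
 fix s assume s: "s : B"
 show "holmap s (tube I z1 \<delta>)"
  by (rule holmap_on_subset[OF section_familyD(2)[OF A] sub]) (use s B in blast)
 show "s z = s (cproj I z)" for z by (rule section_familyD(3)[OF A]) (use s B in blast)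
 show "cproj I (s z) = cproj I z" for z by (rule section_familyD(4)[OF A]) (use s B in blast)
 show "s z ~= s' z" if "s' : B" "s ~= s'" "z : tube I z1 \<delta>" for s' z
  by (rule section_familyD(5)[OF A subsetD[OF B s] subsetD[OF B that(1)] that(2) subsetD[OF sub that(3)]])
qed

text \<open>Each factor is nonzero somewhere, hence in every nonempty open part of the convex
  domain; the factors are handled one after another.\<close>

lemma prod_nonzero_point:
 assumes "finite J" "open D" "convex D" "D ~= {}"
  "!!j. j : J ==> hol (h j) D" "!!j. j : J ==> EX p:D. h j p ~= 0"
 shows "EX p:D. ALL j:J. h j p ~= 0"
 using assms(1,5,6)
proof (induction J rule: finite_induct)
 case empty
 then show ?case using assms by auto
next
 case (insert j J)
 then obtain p where p: "p : D" "ALL j:J. h j p ~= 0" by auto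
 let ?h = "%z. \<Prod>j\<in>J. h j z"
 have hol: "hol ?h D" by (rule hol_prod) (use insert in auto)
 obtain q where q: "q : D" "h j q ~= 0" using insert.prems(2)[of j] by blast
 have "EX w:{z:D. ?h z ~= 0}. h j w ~= 0"
  by (rule nonzero_set_meets_open[where f = "h j" and U = D and z = q])
   (use insert p assms q open_nonzero_set[OF hol assms(2)] in auto)
 then show ?case using insert.hyps by (auto simp: prod_zero_iff)
qed

text \<open>Off the discriminant locus every fibre coordinate has finitely many holomorphic root
  functions nearby. Choosing one root function for each coordinate gives the sections. All
  combinations are taken, so they cover \<open>X\<close> but may also leave it.\<close>

theorem sheets_exist:
 fixes X :: "(complex^'n) set"
 assumes X: "analytic_subset X" "in_cone I X"
 shows "EX r>0. EX h. hol h (tube I b r) & (EX p:tube I b r. h p ~= 0) &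
  (ALL z0:tube I b r. h z0 ~= 0 --> (EX \<epsilon>>0. EX A. section_family I z0 \<epsilon> A &
    (ALL x:X Int tube I z0 \<epsilon>. EX s:A. x = s x)))"
proof -
 define Q where "Q j \<delta> \<longleftrightarrow> (EX m P. monic_family (tube I b \<delta>) m P & (ALL z. P z = P (cproj I z)) &
   (ALL x:X Int tube I b \<delta>. poly (P x) (x $ j) = 0))" for j \<delta>
 have "EX r>0. ALL j: - I. Q j r"
 proof (rule finite_common_radius)
  show "EX \<delta>>0. Q j \<delta>" if "j : - I" for j
   unfolding Q_def by (rule coordinate_integral[OF X]) (use that in simp)
  fix j \<delta> \<delta>' assume Q: "Q j \<delta>" and le: "\<delta>' <= (\<delta>::real)"
  have sub: "tube I b \<delta>' \<subseteq> tube I b \<delta>" by (rule tube_mono[OF le])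
  from Q obtain m P where P: "monic_family (tube I b \<delta>) m P" "ALL z. P z = P (cproj I z)"
   "ALL x:X Int tube I b \<delta>. poly (P x) (x $ j) = 0" unfolding Q_def by (elim exE conjE)
  show "Q j \<delta>'" unfolding Q_def
   by (rule exI[of _ m], rule exI[of _ P], intro conjI monic_family_subset[OF P(1) sub] P(2) ballI bspec[OF P(3)])
    (use sub in blast)
 qed simp
 then obtain r where r: "r > 0" "!!j. j : - I ==> Q j r" by blast
 let ?D = "tube I b r"
 have "ALL j: - I. EX q. monic_family ?D (fst q) (snd q) & (ALL z. snd q z = snd q (cproj I z)) &
   (ALL x:X Int ?D. poly (snd q x) (x $ j) = 0)"
 proof
  fix j assume "j : - I"
  from r(2)[OF this] obtain m P where "monic_family ?D m P" "ALL z. P z = P (cproj I z)"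
   "ALL x:X Int ?D. poly (P x) (x $ j) = 0" unfolding Q_def by (elim exE conjE)
  then show "EX q. monic_family ?D (fst q) (snd q) & (ALL z. snd q z = snd q (cproj I z)) &
   (ALL x:X Int ?D. poly (snd q x) (x $ j) = 0)" by (intro exI[of _ "(m, P)"]) simp
 qed
 from bchoice[OF this] obtain q where q: "ALL j: - I. monic_family ?D (fst (q j)) (snd (q j)) &
  (ALL z. snd (q j) z = snd (q j) (cproj I z)) & (ALL x:X Int ?D. poly (snd (q j) x) (x $ j) = 0)" by (elim exE)
 define m where "m j = fst (q j)" for j
 define P where "P j = snd (q j)" for j
 have P: "monic_family ?D (m j) (P j)" "!!z. P j z = P j (cproj I z)"
  "!!x. x : X ==> x : ?D ==> poly (P j x) (x $ j) = 0" if "j ~: I" for j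
  using bspec[OF q, of j] that unfolding m_def P_def by blast+
 define R where "R j z = {t. poly (P j z) t = 0}" for j z
 have P0: "P j z ~= 0" if "j ~: I" "z : ?D" for j z using P(1)[OF that(1)] that(2) unfolding monic_family_def by force
 have finR: "finite (R j z)" if "j ~: I" "z : ?D" for j z unfolding R_def by (rule poly_roots_finite[OF P0[OF that]])
 have cardR: "card (R j z) <= m j" if "j ~: I" "z : ?D" for j z
  unfolding R_def using card_poly_roots_bound[OF P0[OF that]] P(1)[OF that(1)] that(2) unfolding monic_family_def by simp
 have bD: "b : ?D" using r by simp
 have "EX p:?D. ALL z:?D. card (R j z) <= card (R j p)" if j: "j ~: I" for j
 proof -
  have "finite ((%z. card (R j z)) ` ?D)"
   by (rule finite_subset[of _ "{..m j}"]) (use cardR[OF j] in auto)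
  then have "Max ((%z. card (R j z)) ` ?D) : (%z. card (R j z)) ` ?D" "!!z. z : ?D ==> card (R j z) <= Max ((%z. card (R j z)) ` ?D)"
   using bD by (blast intro: Max_in, simp)
  then show ?thesis by force
 qed
 then have "ALL j: - I. EX p. p : ?D & (ALL z:?D. card (R j z) <= card (R j p))" by blast
 from bchoice[OF this] obtain pm where pm: "!!j. j ~: I ==> pm j : ?D"
  "!!j z. j ~: I ==> z : ?D ==> card (R j z) <= card (R j (pm j))" by auto
 define k where "k j = card (R j (pm j))" for j
 define h where "h j z = root_tuple_sum (k j) (P j z)" for j z
 have holh: "hol (h j) ?D" if "j ~: I" for j
  unfolding h_def by (rule holomorphic_root_tuple_sum[OF P(1)[OF that]]) simp
 have h0: "h j z ~= 0 \<longleftrightarrow> card (R j z) = k j" if "j ~: I" "z : ?D" for j z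
  unfolding h_def R_def
  by (rule root_tuple_sum_nonzero_iff[OF P0[OF that]]) (use pm(2)[OF that] in \<open>simp add: k_def R_def\<close>)
 define H where "H z = (\<Prod>j\<in>- I. h j z)" for z
 have holH: "hol H ?D" unfolding H_def by (rule hol_prod) (use holh in auto)
 have H0: "H z ~= 0 \<longleftrightarrow> (ALL j: - I. h j z ~= 0)" for z unfolding H_def by simp
 have "EX p:?D. ALL j: - I. h j p ~= 0"
 proof (rule prod_nonzero_point)
  show "?D ~= {}" using bD by blast
  show "EX p:?D. h j p ~= 0" if "j : - I" for j
   using pm(1)[of j] h0[of j "pm j"] that by (auto simp: k_def)
 qed (use holh in auto)
 then have "EX p:?D. H p ~= 0" unfolding H0 .
 moreover have "EX \<epsilon>>0. EX A. section_family I z0 \<epsilon> A & (ALL x:X Int tube I z0 \<epsilon>. EX s:A. x = s x)"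
  if z0: "z0 : ?D" "H z0 ~= 0" for z0
 proof -
  define S where "S j \<epsilon> \<rho> \<longleftrightarrow> tube I z0 \<epsilon> \<subseteq> ?D &
  (ALL a:R j z0. hol (\<rho> a) (tube I z0 \<epsilon>) & (ALL z. \<rho> a z = \<rho> a (cproj I z))) &
  (ALL z:tube I z0 \<epsilon>. R j z = (%a. \<rho> a z) ` R j z0 & inj_on (%a. \<rho> a z) (R j z0))" for j \<epsilon> \<rho>
  have "EX \<epsilon>>0. ALL j: - I. EX \<rho>. S j \<epsilon> \<rho>"
  proof (rule finite_common_radius)
   fix j assume "j : - I"
   then have j: "j ~: I" by simp
   have "h j z0 ~= 0" using z0(2) j unfolding H0 by blast
   then have "card (R j z0) = k j" using h0[OF j z0(1)] by blast
   then show "EX \<epsilon>>0. EX \<rho>. S j \<epsilon> \<rho>"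
    unfolding S_def R_def
    by (intro local_simple_roots[OF P(1)[OF j] P(2)[OF j] j _ z0(1), of "k j"])
     (use pm(2)[OF j] in \<open>simp_all add: k_def R_def\<close>)
  next
   fix j \<epsilon> \<epsilon>' assume S: "EX \<rho>. S j \<epsilon> \<rho>" and le: "\<epsilon>' <= (\<epsilon>::real)"
   have sub: "tube I z0 \<epsilon>' \<subseteq> tube I z0 \<epsilon>" by (rule tube_mono[OF le])
   from S obtain \<rho> where \<rho>: "S j \<epsilon> \<rho>" by blast
   have "S j \<epsilon>' \<rho>" unfolding S_def
   proof (intro conjI ballI allI)
    show "tube I z0 \<epsilon>' \<subseteq> ?D" using \<rho> sub unfolding S_def by blast
    fix a assume a: "a : R j z0"
    show "hol (\<rho> a) (tube I z0 \<epsilon>')"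
     using \<rho> a hol_on_subset[OF _ sub] unfolding S_def by blast
    show "\<rho> a z = \<rho> a (cproj I z)" for z using \<rho> a unfolding S_def by blast
   next
    fix z assume "z : tube I z0 \<epsilon>'"
    then have "z : tube I z0 \<epsilon>" using sub by blast
    then show "R j z = (%a. \<rho> a z) ` R j z0" "inj_on (%a. \<rho> a z) (R j z0)"
     using \<rho> unfolding S_def by blast+
   qed
   then show "EX \<rho>. S j \<epsilon>' \<rho>" by blast
  qed simp
  then obtain \<epsilon> where \<epsilon>: "\<epsilon> > 0" "ALL j: - I. EX \<rho>. S j \<epsilon> \<rho>" by blast
  from bchoice[OF \<epsilon>(2)] obtain \<rho> where \<rho>: "ALL j: - I. S j \<epsilon> (\<rho> j)" by (elim exE)
  have tubeD: "tube I z0 \<epsilon> \<subseteq> ?D" if "j ~: I" for j using \<rho> that unfolding S_def by blast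
  have hol\<rho>: "hol (\<rho> j a) (tube I z0 \<epsilon>)" if "j ~: I" "a : R j z0" for j a
   using \<rho> that unfolding S_def by blast
  have dep\<rho>: "\<rho> j a z = \<rho> j a (cproj I z)" if "j ~: I" "a : R j z0" for j a z
   using bspec[OF \<rho>, of j] that unfolding S_def by blast
  have img\<rho>: "R j z = (%a. \<rho> j a z) ` R j z0" "inj_on (%a. \<rho> j a z) (R j z0)"
   if "j ~: I" "z : tube I z0 \<epsilon>" for j z using bspec[OF \<rho>, of j] that unfolding S_def by blast+
  define sec where "sec \<alpha> z = (\<chi> i. if i : I then z $ i else \<rho> i (\<alpha> i) z)" for \<alpha> z
  define A where "A = sec ` (Pi\<^sub>E (- I) (%j. R j z0))"
  have fam: "section_family I z0 \<epsilon> A"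
   unfolding section_family_def
  proof (intro conjI ballI allI impI)
   show "finite A" unfolding A_def using finR z0 by (intro finite_imageI finite_PiE) auto
   fix s assume "s : A"
   then obtain \<alpha> where \<alpha>: "s = sec \<alpha>" "\<alpha> : Pi\<^sub>E (- I) (%j. R j z0)" unfolding A_def by blast
   have \<alpha>j: "\<alpha> j : R j z0" if "j ~: I" for j using \<alpha>(2) that by (auto simp: PiE_iff)
   show "holmap s (tube I z0 \<epsilon>)"
    unfolding holomorphic_map_on_def
   proof
    fix i show "hol (%z. s z $ i) (tube I z0 \<epsilon>)"
     by (cases "i : I") (simp_all add: \<alpha>(1) sec_def hol\<rho> \<alpha>j)
   qed
   show "s z = s (cproj I z)" for z
    unfolding vec_eq_iff
   proof
    fix i
    show "s z $ i = s (cproj I z) $ i"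
    proof (cases "i : I")
     case True
     then show ?thesis by (simp add: \<alpha>(1) sec_def)
    next
     case False
     show ?thesis using dep\<rho>[OF False \<alpha>j[OF False], of z] False
      by (simp only: \<alpha>(1) sec_def vec_lambda_beta if_False)
    qed
   qed
   show "cproj I (s z) = cproj I z" for z by (simp add: \<alpha>(1) sec_def vec_eq_iff)
   fix s' z assume "s' : A" "s ~= s'" and z: "z : tube I z0 \<epsilon>"
   then obtain \<beta> where \<beta>: "s' = sec \<beta>" "\<beta> : Pi\<^sub>E (- I) (%j. R j z0)" unfolding A_def by blast
   have "\<alpha> ~= \<beta>" using \<open>s ~= s'\<close> \<alpha>(1) \<beta>(1) by auto
   then obtain j where j: "j ~: I" "\<alpha> j ~= \<beta> j" using PiE_ext[OF \<alpha>(2) \<beta>(2)] by auto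
   have "\<beta> j : R j z0" using \<beta>(2) j by (auto simp: PiE_iff)
   then have "\<rho> j (\<alpha> j) z ~= \<rho> j (\<beta> j) z" using inj_onD[OF img\<rho>(2)[OF j(1) z]] \<alpha>j[OF j(1)] j(2) by blast
   then have "s z $ j ~= s' z $ j" using j(1) by (simp add: \<alpha>(1) \<beta>(1) sec_def)
   then show "s z ~= s' z" by auto
  qed
  moreover have "EX s:A. x = s x" if x: "x : X Int tube I z0 \<epsilon>" for x
  proof -
   have "ALL j: - I. EX a. a : R j z0 & x $ j = \<rho> j a x"
   proof
    fix j assume "j : - I"
    then have j: "j ~: I" by simp
    have "x $ j : R j x" unfolding R_def using P(3)[OF j] x tubeD[OF j] by blast
    then show "EX a. a : R j z0 & x $ j = \<rho> j a x" using img\<rho>(1)[OF j, of x] x by auto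
   qed
   from bchoice[OF this] obtain a where a: "ALL j: - I. a j : R j z0 & x $ j = \<rho> j (a j) x" by (elim exE)
   have "sec (restrict a (- I)) : A" unfolding A_def using a by (intro imageI) auto
   moreover have "x = sec (restrict a (- I)) x" using a by (auto simp: vec_eq_iff sec_def)
   ultimately show ?thesis by blast
  qed
  ultimately show ?thesis using \<epsilon>(1) by blast
 qed
 ultimately show ?thesis using r(1) holH by (intro exI[of _ r] conjI exI[of _ H]) auto
qed

text \<open>Purity in the form that the covering argument uses: no relatively open piece of
  \<open>X\<close> lies over a set without interior in the base.\<close>

definition dense_projection :: "'n set => (complex^'n) set => bool" where
 "dense_projection I X \<longleftrightarrow> (ALL x:X. ALL W. open W & x : W -->
  (EX N. open N & N ~= {} & (ALL z:N. EX x':X Int W. cproj I x' = cproj I z)))"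

text \<open>Near \<open>s z1\<close> only the sheet \<open>s\<close> can meet \<open>X\<close>. The
  projection of this part of \<open>X\<close> contains an open set, and over it \<open>s\<close>
  lies in \<open>X\<close>. The local equations composed with \<open>s\<close> vanish there, hence
  on the whole small tube.\<close>

lemma sheet_in_X_open:
 fixes X :: "(complex^'n) set"
 assumes X: "analytic_subset X" and dp: "dense_projection I X"
  and A: "section_family I z0 \<epsilon> A" and cov: "!!x. x : X Int tube I z0 \<epsilon> ==> EX s:A. x = s x"
  and s: "s : A" and z1: "z1 : tube I z0 \<epsilon>" "s z1 : X"
 shows "EX \<eta>>0. ALL z:tube I z1 \<eta>. s z : X"
proof -
 note A' = section_familyD[OF A]
 let ?D = "tube I z0 \<epsilon>"
 define x1 where "x1 = s z1"
 obtain U F where U: "open U" "x1 : U" "finite F" "!!f. f : F ==> hol f U"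
  "X Int U = {z:U. ALL f:F. f z = 0}"
  by (rule analytic_subsetE[OF X, where a = x1]) (rule that; (assumption | simp only:))
 have cont: "continuous_on ?D s'" if "s' : A" for s' by (rule holmap_imp_continuous_on[OF A'(2)[OF that]])
 have "open (?D Int s -` U)" by (rule continuous_open_preimage[OF cont[OF s] open_tube U(1)])
 moreover have "cproj I z1 : ?D Int s -` U" using z1 U(2) A'(3)[OF s, of z1] by (simp add: x1_def)
 ultimately obtain \<eta> where \<eta>: "\<eta> > 0" "ball (cproj I z1) \<eta> \<subseteq> ?D Int s -` U" by (rule openE)
 let ?T = "tube I z1 \<eta>"
 have T: "z : ?D" "s z : U" if "z : ?T" for z
 proof -
  have "cproj I z : ?D Int s -` U" using that \<eta> by (auto simp: tube_def)
  then show "z : ?D" "s z : U" using A'(3)[OF s, of z] by auto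
 qed
 \<comment> \<open>A point \<open>x\<close> lies on the sheet \<open>s'\<close> exactly when
   \<open>s' x = x\<close>; removing such points for all other sheets leaves only \<open>s\<close>
   inside \<open>W\<close>.\<close>
 define W where "W = U Int ?T Int (\<Inter>s'\<in>A - {s}. {x:?T. s' x - x : - {0}})"
 have TD: "?T \<subseteq> ?D" using T by blast
 have "open {x:?T. s' x - x : - {0}}" if "s' : A" for s'
 proof -
  have "continuous_on ?T (%x. s' x - x)"
   by (intro continuous_intros continuous_on_subset[OF cont[OF that] TD])
  then have "open (?T Int (%x. s' x - x) -` (- {0}))"
   by (rule continuous_open_preimage) auto
  then show ?thesis by (simp add: vimage_def Int_def)
 qed
 then have opW: "open W" unfolding W_def using A'(1) U(1) by (intro open_Int open_INT) auto
 have cpx1: "cproj I x1 = cproj I z1" unfolding x1_def by (rule A'(4)[OF s])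
 have "x1 : ?T" using \<eta>(1) cpx1 by (simp add: tube_def)
 moreover have "s' x1 ~= x1" if "s' : A - {s}" for s'
 proof -
  have "s' x1 = s' z1" using A'(3)[of s' x1] A'(3)[of s' z1] cpx1 that by auto
  then show ?thesis using A'(5)[of s' s z1] that s z1 by (auto simp: x1_def)
 qed
 ultimately have "x1 : W" unfolding W_def using U(2) by auto
 then have "EX N. open N & N ~= {} & (ALL z:N. EX x':X Int W. cproj I x' = cproj I z)"
  by (intro dp[unfolded dense_projection_def, rule_format, of x1] conjI opW) (simp_all add: x1_def z1(2))
 then obtain N where N: "open N" "N ~= {}" "!!z. z : N ==> EX x':X Int W. cproj I x' = cproj I z"
  by blast
 have NT: "z : ?T" "s z : X" if z: "z : N" for z
 proof -
  obtain x' where x': "x' : X" "x' : W" "cproj I x' = cproj I z" using N(3)[OF z] by blast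
  have "x' : ?T" using x'(2) by (simp add: W_def)
  then show zT: "z : ?T" using x'(3) by (simp add: tube_def)
  obtain s' where s': "s' : A" "x' = s' x'" using cov x'(1) TD \<open>x' : ?T\<close> by blast
  have "s' = s"
  proof (rule ccontr)
   assume "s' ~= s"
   then have "s' x' - x' : - {0}" using x'(2) s'(1) unfolding W_def by blast
   then show False using s'(2) by simp
  qed
  then have "x' = s z" using s' A'(3)[OF s, of x'] A'(3)[OF s, of z] x'(3) by simp
  then show "s z : X" using x'(1) by simp
 qed
 have "f (s z) = 0" if f: "f : F" and z: "z : ?T" for f z
 proof (rule hol_identity[of "%z. f (s z)" ?T N z])
  show "hol (%z. f (s z)) ?T"
   by (rule hol_compose[OF U(4)[OF f] holmap_on_subset[OF A'(2)[OF s] TD] T(2)])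
  show "f (s z) = 0" if "z : N" for z using NT[OF that] T(2)[of z] U(5) f by blast
 qed (use N NT z in auto)
 then have "s z : X" if "z : ?T" for z using U(5) T(2)[OF that] that by blast
 then show ?thesis using \<eta>(1) by blast
qed

definition sheeted :: "'n set => (complex^'n) set => complex^'n => bool" where
 "sheeted I X z0 \<longleftrightarrow> (EX \<epsilon>>0. EX A. section_family I z0 \<epsilon> A &
  (ALL z:tube I z0 \<epsilon>. {x:X. cproj I x = cproj I z} = (%s. s z) ` A))"

text \<open>The base points over which a sheet lies in \<open>X\<close> form an open and closed part
  of the connected tube. A sheet is thus in \<open>X\<close> everywhere or nowhere, and the sheets
  of the first kind make up the fibres.\<close>

lemma sheetedI:
 fixes X :: "(complex^'n) set"
 assumes X: "analytic_subset X" and dp: "dense_projection I X" and \<epsilon>: "\<epsilon> > 0"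
  and A: "section_family I z0 \<epsilon> A" and cov: "!!x. x : X Int tube I z0 \<epsilon> ==> EX s:A. x = s x"
 shows "sheeted I X z0"
proof -
 note A' = section_familyD[OF A]
 let ?D = "tube I z0 \<epsilon>"
 have conn: "s w : X" if s: "s : A" "z : ?D" "s z : X" "w : ?D" for s z w
 proof (rule ccontr)
  assume "s w ~: X"
  let ?E1 = "{z:?D. s z : X}" and ?E2 = "?D Int s -` (- X)"
  have op2: "open ?E2"
   by (rule continuous_open_preimage[OF holmap_imp_continuous_on[OF A'(2)[OF s(1)]] open_tube])
    (simp add: open_Compl analytic_subset_closed[OF X])
  have op1: "open ?E1"
  proof (subst open_subopen, intro ballI)
   fix z1 assume z1: "z1 : ?E1"
   then obtain \<eta> where "\<eta> > 0" "ALL z:tube I z1 \<eta>. s z : X"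
    using sheet_in_X_open[OF X dp A cov s(1), of z1] by auto
   then show "EX T. open T & z1 : T & T \<subseteq> ?E1"
    using z1 by (intro exI[of _ "tube I z1 \<eta> Int ?D"]) auto
  qed
  have "?E1 Int ?D = {} \<or> ?E2 Int ?D = {}"
   by (rule connectedD[OF convex_connected[OF convex_tube] op1 op2]) auto
  then show False using s \<open>s w ~: X\<close> by auto
 qed
 define B where "B = {s:A. s z0 : X}"
 have z0: "z0 : ?D" using \<epsilon> by simp
 have "{x:X. cproj I x = cproj I z} = (%s. s z) ` B" if z: "z : ?D" for z
 proof (intro equalityI subsetI)
  fix x assume x: "x : {x:X. cproj I x = cproj I z}"
  then have "x : ?D" using z by (simp add: tube_def)
  then obtain s where s: "s : A" "x = s x" using cov x by blast
  have "x = s z" using s A'(3)[OF s(1), of x] A'(3)[OF s(1), of z] x by simp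
  moreover have "s z0 : X" using conn[OF s(1) z _ z0] x \<open>x = s z\<close> by simp
  ultimately show "x : (%s. s z) ` B" using s(1) by (auto simp: B_def)
 next
  fix x assume "x : (%s. s z) ` B"
  then obtain s where s: "s : A" "s z0 : X" "x = s z" by (auto simp: B_def)
  then show "x : {x:X. cproj I x = cproj I z}" using conn[OF s(1) z0 s(2) z] A'(4)[OF s(1)] by simp
 qed
 moreover have "section_family I z0 \<epsilon> B" by (rule section_family_mono[OF A]) (auto simp: B_def)
 ultimately show ?thesis unfolding sheeted_def using \<epsilon> by (intro exI[of _ \<epsilon>] conjI exI[of _ B]) simp_all
qed

section \<open>Generic base points and thin complements\<close>

definition thin_complement :: "(complex^'n) set => bool" where
 "thin_complement G \<longleftrightarrow> open G & (ALL b. EX r>0. EX h p. hol h (ball b r) & p : ball b r &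
  h p ~= 0 & {z:ball b r. h z ~= 0} \<subseteq> G)"

lemma thin_complementE:
 assumes "thin_complement G"
 obtains r h p where "r > 0" "hol h (ball b r)" "p : ball b r" "h p ~= 0" "{z:ball b r. h z ~= 0} \<subseteq> G"
proof -
 have "EX r>0. EX h p. hol h (ball b r) & p : ball b r & h p ~= 0 & {z:ball b r. h z ~= 0} \<subseteq> G"
  using assms unfolding thin_complement_def by (elim conjE) (rule spec)
 then show thesis by (elim exE conjE) (rule that)
qed

lemma thin_complement_dense:
 assumes G: "thin_complement G" and W: "open W" "w : W"
 shows "W Int G ~= {}"
proof -
 obtain r h p where h: "r > 0" "hol h (ball w r)" "p : ball w r" "h p ~= 0"
  "{z:ball w r. h z ~= 0} \<subseteq> G" by (rule thin_complementE[OF G])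
 have "EX w:W Int ball w r. h w ~= 0"
  by (rule nonzero_set_meets_open[OF h(2) _ _ h(3,4)]) (use W h(1) in auto)
 then show ?thesis using h(5) by auto
qed

lemma closed_property_from_dense:
 assumes "thin_complement G" "closed C" "open W" "!!z. z : G ==> z : W ==> z : C" "z : W"
 shows "z : C"
proof (rule ccontr)
 assume "z ~: C"
 then have "(W Int - C) Int G ~= {}"
  by (intro thin_complement_dense[OF assms(1)]) (use assms in auto)
 then show False using assms by blast
qed

text \<open>A set with thin complement is connected. If \<open>c\<close> took two values, the set
  where it has the value \<open>c z1\<close> and the rest of \<open>G\<close> would have closures
  that meet, since \<open>G\<close> is dense. Near a common point \<open>b\<close> the set where
  \<open>h\<close> is nonzero is connected, lies in \<open>G\<close> and meets both parts.\<close>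

lemma locally_constant_thin:
 fixes c :: "complex^'n => nat"
 assumes G: "thin_complement G" and lc: "!!z. z : G ==> EX \<epsilon>>0. ALL w:G Int ball z \<epsilon>. c w = c z"
 shows "EX k. ALL z:G. c z = k"
proof (rule ccontr)
 assume no: "\<nexists>k. ALL z:G. c z = k"
 obtain z1 where z1: "z1 : G" using thin_complement_dense[OF G open_UNIV UNIV_I] by blast
 define G1 where "G1 = {z:G. c z = c z1}"
 define G2 where "G2 = {z:G. c z ~= c z1}"
 have opG: "open G" using G by (simp add: thin_complement_def)
 have op: "open {z:G. Q (c z)}" for Q
 proof (subst open_subopen, intro ballI)
  fix z assume z: "z : {z:G. Q (c z)}"
  then have "z : G" by simp
  from lc[OF this] obtain \<epsilon> where e: "\<epsilon> > 0" "ALL w:G Int ball z \<epsilon>. c w = c z" by blast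
  have "G Int ball z \<epsilon> \<subseteq> {z:G. Q (c z)}"
  proof
   fix w assume w: "w : G Int ball z \<epsilon>"
   then have "c w = c z" using e(2) by blast
   then show "w : {z:G. Q (c z)}" using w z by simp
  qed
  moreover have "open (G Int ball z \<epsilon>)" using opG by auto
  ultimately show "EX T. open T & z : T & T \<subseteq> {z:G. Q (c z)}"
   using \<open>z : G\<close> e(1) by (intro exI[of _ "G Int ball z \<epsilon>"]) simp
 qed
 have op1: "open G1" and op2: "open G2" unfolding G1_def G2_def by (rule op)+
 have ne: "G1 ~= {}" "G2 ~= {}" using z1 no by (auto simp: G1_def G2_def)
 have "closure G1 Int closure G2 ~= {}"
 proof
  assume dis: "closure G1 Int closure G2 = {}"
  have "x : closure G1 \<union> closure G2" for x
   by (rule closed_property_from_dense[OF G, of _ UNIV]) (auto simp: G1_def G2_def intro: closure_subset[THEN subsetD])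
  then have "closure G1 Int UNIV = {} \<or> closure G2 Int UNIV = {}"
   using connected_closedD[OF connected_UNIV, of "closure G1" "closure G2"] dis by auto
  then show False using ne by auto
 qed
 then obtain b where b: "b : closure G1" "b : closure G2" by blast
 obtain r h p where h: "r > 0" "hol h (ball b r)" "p : ball b r" "h p ~= 0"
  "{z:ball b r. h z ~= 0} \<subseteq> G" by (rule thin_complementE[OF G])
 let ?N = "{z:ball b r. h z ~= 0}"
 have meet: "S Int ?N ~= {}" if S: "open S" "b : closure S" for S
 proof -
  obtain y where "y : S" "dist y b < r" using S(2) h(1) unfolding closure_approachable by blast
  then have "S Int ball b r ~= {}" by (auto simp: dist_commute)
  then have "EX w:S Int ball b r. h w ~= 0"
   by (intro nonzero_set_meets_open[OF h(2) _ _ h(3,4)]) (use S in auto)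
  then show ?thesis by auto
 qed
 have "G1 Int ?N = {} \<or> G2 Int ?N = {}"
  by (rule connectedD[OF connected_nonzero_set[OF h(2) convex_ball open_ball] op1 op2])
   (use h(5) in \<open>auto simp: G1_def G2_def\<close>)
 then show False using meet[OF op1 b(1)] meet[OF op2 b(2)] by blast
qed

lemma sheeted_cproj: "sheeted I X (cproj I z) = sheeted I X z"
 by (simp only: sheeted_def section_family_def tube_cproj)

lemma sheeted_thin:
 fixes X :: "(complex^'n) set"
 assumes X: "analytic_subset X" "in_cone I X" and dp: "dense_projection I X"
 shows "thin_complement (Collect (sheeted I X))"
 unfolding thin_complement_def
proof (intro conjI allI)
 show "open (Collect (sheeted I X))"
 proof (subst open_subopen, intro ballI)
  fix z0 assume "z0 : Collect (sheeted I X)"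
  then obtain \<epsilon> A where A: "\<epsilon> > 0" "section_family I z0 \<epsilon> A"
   "ALL z:tube I z0 \<epsilon>. {x:X. cproj I x = cproj I z} = (%s. s z) ` A"
   unfolding sheeted_def mem_Collect_eq by (elim exE conjE)
  have "sheeted I X z1" if z1: "z1 : tube I z0 \<epsilon>" for z1
  proof -
   obtain \<delta> where \<delta>: "\<delta> > 0" "tube I z1 \<delta> \<subseteq> tube I z0 \<epsilon>" using tube_sub_tube[OF z1] by blast
   show ?thesis unfolding sheeted_def
    by (rule exI[of _ \<delta>], rule conjI[OF \<delta>(1)], rule exI[of _ A],
      intro conjI section_family_mono[OF A(2) order_refl \<delta>(2)] ballI bspec[OF A(3)] subsetD[OF \<delta>(2)])
  qed
  then show "EX T. open T & z0 : T & T \<subseteq> Collect (sheeted I X)"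
   using A(1) by (intro exI[of _ "tube I z0 \<epsilon>"]) auto
 qed
 fix b :: "complex^'n"
 obtain r h p where h: "r > 0" "hol h (tube I b r)" "p:tube I b r" "h p ~= 0"
  and sh: "ALL z0:tube I b r. h z0 ~= 0 --> (EX \<epsilon>>0. EX A. section_family I z0 \<epsilon> A &
    (ALL x:X Int tube I z0 \<epsilon>. EX s:A. x = s x))"
  using sheets_exist[OF X, of b] by (elim exE conjE bexE) (rule that; assumption)
 have sub: "ball b r \<subseteq> tube I b r" by (rule ball_subset_tube)
 have "EX w:ball b r. h w ~= 0"
  by (rule nonzero_set_meets_open[OF h(2) _ _ h(3,4)]) (use h(1) sub in auto)
 then obtain w where w: "w : ball b r" "h w ~= 0" by blast
 have "sheeted I X z" if z: "z : ball b r" "h z ~= 0" for z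
 proof -
  have "z : tube I b r" using z sub by blast
  from bspec[OF sh this] z(2) obtain \<epsilon> A where A: "\<epsilon> > 0" "section_family I z \<epsilon> A"
   "ALL x:X Int tube I z \<epsilon>. EX s:A. x = s x" by (elim impE exE conjE)
  show ?thesis by (rule sheetedI[OF X(1) dp A(1,2)]) (rule bspec[OF A(3)])
 qed
 then show "EX r>0. EX h p. hol h (ball b r) & p : ball b r &
  h p ~= 0 & {z:ball b r. h z ~= 0} \<subseteq> Collect (sheeted I X)"
  using h(1) w hol_on_subset[OF h(2) sub]
  by (intro exI[of _ r] conjI exI[of _ h] exI[of _ w]) auto
qed

section \<open>Polynomials satisfied on the fibres\<close>

lemma coeff_bound_prod_linear:
 fixes f :: "'a => complex"
 assumes "finite S" "!!x. x : S ==> norm (f x) <= M" "M >= 0" "i <= card S"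
 shows "norm (coeff (\<Prod>x\<in>S. [:- f x, 1:]) i) <= 2 ^ card S * M ^ (card S - i)"
 using assms(1,2,4)
proof (induction S arbitrary: i rule: finite_induct)
 case empty
 then show ?case by simp
next
 case (insert y S)
 let ?p = "\<Prod>x\<in>S. [:- f x, 1:]" and ?k = "card S"
 have deg: "degree ?p = ?k" by (subst degree_prod_eq_sum_degree) auto
 have P: "(\<Prod>x\<in>insert y S. [:- f x, 1:]) = [:- f y, 1:] * ?p" using insert.hyps by simp
 have c: "coeff ([:- f y, 1:] * ?p) i = (if i = 0 then 0 else coeff ?p (i - 1)) - f y * coeff ?p i"
  by (cases i) simp_all
 have A: "norm (if i = 0 then 0 else coeff ?p (i - 1)) <= 2 ^ ?k * M ^ (Suc ?k - i)"
 proof (cases "i = 0")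
  case True
  then show ?thesis using assms(3) by simp
 next
  case False
  then have "i - 1 <= ?k" "?k - (i - 1) = Suc ?k - i" using insert by auto
  then show ?thesis using insert.IH[of "i - 1"] insert.prems False by simp
 qed
 have B: "norm (f y * coeff ?p i) <= 2 ^ ?k * M ^ (Suc ?k - i)"
 proof (cases "i <= ?k")
  case True
  then have "norm (coeff ?p i) <= 2 ^ ?k * M ^ (?k - i)" using insert by auto
  then have "norm (f y * coeff ?p i) <= M * (2 ^ ?k * M ^ (?k - i))"
   unfolding norm_mult using insert.prems assms(3) by (intro mult_mono) auto
  also have "\<dots> = 2 ^ ?k * M ^ (Suc ?k - i)" using True by (simp add: Suc_diff_le)
  finally show ?thesis .
 next
  case False
  then have "coeff ?p i = 0" using deg by (simp add: coeff_eq_0)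
  then show ?thesis using assms(3) by simp
 qed
 \<comment> \<open>A new linear factor contributes two terms with the same bound, hence one factor
   \<open>2\<close> for each root.\<close>
 have "norm (coeff ([:- f y, 1:] * ?p) i) <= 2 ^ ?k * M ^ (Suc ?k - i) + 2 ^ ?k * M ^ (Suc ?k - i)"
  unfolding c by (rule order_trans[OF norm_triangle_ineq4 add_mono[OF A B]])
 then show ?case unfolding P using insert.hyps by simp
qed

definition lin_form :: "complex^'n => complex^'n => complex" where
 "lin_form c z = (\<Sum>i\<in>UNIV. c $ i * z $ i)"

lemma hol_lin_form: "hol (lin_form c) U"
 unfolding lin_form_def by (intro hol_sum hol_mult hol_const hol_coord)

lemma lin_form_bound: "norm (lin_form c z) <= (\<Sum>i\<in>UNIV. norm (c $ i)) * norm z"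
proof -
 have "norm (lin_form c z) <= (\<Sum>i\<in>UNIV. norm (c $ i * z $ i))" unfolding lin_form_def by (rule norm_sum)
 also have "\<dots> <= (\<Sum>i\<in>UNIV. norm (c $ i) * norm z)"
  by (intro sum_mono) (simp add: norm_mult mult_left_mono Finite_Cartesian_Product.norm_nth_le)
 finally show ?thesis by (simp add: sum_distrib_right)
qed

text \<open>The polynomial whose roots are the values of the form on a fibre has coefficients that
  are holomorphic over generic base points and locally bounded. The extension theorem makes them
  entire, and cone position gives the coefficient of index \<open>i\<close> the growth
  \<open>k - i\<close>. The number \<open>k\<close> of sheets is the same for all \<open>c\<close>.
  The last clause, nonvanishing at points that the form separates from their fibre, is what recovers
  \<open>X\<close> from these equations.\<close>

theorem fibre_polynomials:
 fixes X :: "(complex^'n) set"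
 assumes X: "analytic_subset X" "in_cone I X" and dp: "dense_projection I X"
 shows "EX k. ALL c. EX \<sigma>. (ALL i. hol (\<sigma> i) UNIV) & (ALL i<=k. poly_growth (k - i) (\<sigma> i)) &
  (ALL z. \<sigma> k z = 1) & (ALL i z. \<sigma> i z = \<sigma> i (cproj I z)) &
  (ALL x:X. (\<Sum>i\<le>k. \<sigma> i x * lin_form c x ^ i) = 0) &
  (ALL z. (ALL x:X. cproj I x = cproj I z --> lin_form c x ~= lin_form c z) -->
    (\<Sum>i\<le>k. \<sigma> i z * lin_form c z ^ i) ~= 0)"
proof -
 define G where "G = Collect (sheeted I X)"
 have thin: "thin_complement G" unfolding G_def by (rule sheeted_thin[OF X dp])
 have opG: "open G" using thin by (simp add: thin_complement_def)
 have Gcp: "cproj I z : G \<longleftrightarrow> z : G" for z by (simp add: G_def sheeted_cproj)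
 define fib where "fib z = {x:X. cproj I x = cproj I z}" for z
 have fibcp: "fib (cproj I z) = fib z" for z by (simp add: fib_def)
 obtain C where C: "C >= 0" "!!x. x : X ==> norm x <= C * (1 + norm (cproj I x))"
  using X(2) unfolding in_cone_def by blast
 have fibC: "norm x <= C * (1 + norm z)" if "x : fib z" for x z
 proof -
  have "norm x <= C * (1 + norm (cproj I z))" using C(2)[of x] that by (simp add: fib_def)
  also have "\<dots> <= C * (1 + norm z)" using norm_cproj_le[of I z] C(1) by (intro mult_left_mono) auto
  finally show ?thesis .
 qed
 have loc: "EX \<epsilon>>0. EX A. section_family I z0 \<epsilon> A & (ALL z:tube I z0 \<epsilon>. fib z = (%s. s z) ` A)" if "z0 : G" for z0
  using that unfolding G_def mem_Collect_eq sheeted_def fib_def .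
 have inj: "inj_on (%s. s z) A" if "section_family I z0 \<epsilon> A" "z : tube I z0 \<epsilon>" for z0 \<epsilon> A z
  using section_familyD(5)[OF that(1) _ _ _ that(2)] by (intro inj_onI) blast
 have "EX k. ALL z:G. card (fib z) = k"
 proof (rule locally_constant_thin[OF thin])
  fix z0 assume z0: "z0 : G"
  obtain \<epsilon> A where A: "\<epsilon> > 0" "section_family I z0 \<epsilon> A" "ALL z:tube I z0 \<epsilon>. fib z = (%s. s z) ` A"
   using loc[OF z0] by (elim exE conjE)
  have "card (fib z) = card A" if "z : tube I z0 \<epsilon>" for z
   using A(3) that card_image[OF inj[OF A(2) that]] by simp
  then show "EX \<epsilon>>0. ALL w:G Int ball z0 \<epsilon>. card (fib w) = card (fib z0)"
   using A(1) ball_subset_tube[of z0 \<epsilon> I] by (intro exI[of _ \<epsilon>]) auto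
 qed
 then obtain k where k: "!!z. z : G ==> card (fib z) = k" by blast
 have finfib: "finite (fib z)" if z: "z : G" for z
 proof -
  obtain \<epsilon> A where A: "\<epsilon> > 0" "section_family I z \<epsilon> A" "ALL w:tube I z \<epsilon>. fib w = (%s. s w) ` A"
   using loc[OF z] by (elim exE conjE)
  then show ?thesis using section_familyD(1)[OF A(2)] by simp
 qed
 have "EX \<sigma>. (ALL i. hol (\<sigma> i) UNIV) & (ALL i<=k. poly_growth (k - i) (\<sigma> i)) &
  (ALL z. \<sigma> k z = 1) & (ALL i z. \<sigma> i z = \<sigma> i (cproj I z)) &
  (ALL x:X. (\<Sum>i\<le>k. \<sigma> i x * lin_form c x ^ i) = 0) &
  (ALL z. (ALL x:X. cproj I x = cproj I z --> lin_form c x ~= lin_form c z) -->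
    (\<Sum>i\<le>k. \<sigma> i z * lin_form c z ^ i) ~= 0)" for c
 proof -
  define Q where "Q z = (\<Prod>x\<in>fib z. [:- lin_form c x, 1:])" for z
  have degQ: "degree (Q z) = k" if "z : G" for z
   unfolding Q_def using k[OF that] by (subst degree_prod_eq_sum_degree) auto
  have leadQ: "coeff (Q z) k = 1" if "z : G" for z
   using degQ[OF that] lead_coeff_prod[of "%x. [:- lin_form c x, 1:]" "fib z"] by (simp add: Q_def)
  have holQ: "hol (%z. coeff (Q z) i) G" for i
  proof (rule hol_local)
   fix z0 assume z0: "z0 : G"
   obtain \<epsilon> A where A: "\<epsilon> > 0" "section_family I z0 \<epsilon> A" "ALL z:tube I z0 \<epsilon>. fib z = (%s. s z) ` A"
    using loc[OF z0] by (elim exE conjE)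
   note A' = section_familyD[OF A(2)]
   have eq: "Q z = (\<Prod>s\<in>A. [:- lin_form c (s z), 1:])" if "z : tube I z0 \<epsilon>" for z
    unfolding Q_def using A(3) that by (simp add: prod.reindex[OF inj[OF A(2) that]])
   have "EX m. monic_family (tube I z0 \<epsilon>) m (%z. \<Prod>s\<in>A. [:- lin_form c (s z), 1:])"
   proof (rule monic_family_prod[OF A'(1)])
    fix s assume s: "s : A"
    have "hol (%z. lin_form c (s z)) (tube I z0 \<epsilon>)"
     by (rule hol_compose[OF hol_lin_form[of c UNIV] A'(2)[OF s]]) simp
    then have h: "hol (%z. - lin_form c (s z)) (tube I z0 \<epsilon>)" by (rule hol_uminus)
    have "monic_family (tube I z0 \<epsilon>) 1 (%z. [:- lin_form c (s z), 1:])"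
     unfolding monic_family_def
    proof (intro conjI ballI allI)
     fix i show "hol (%z. coeff [:- lin_form c (s z), 1:] i) (tube I z0 \<epsilon>)"
      using h by (cases i; cases "i - 1") (simp_all add: coeff_pCons)
    qed simp_all
    then show "EX m. monic_family (tube I z0 \<epsilon>) m (%z. [:- lin_form c (s z), 1:])" by blast
   qed
   then have "hol (%z. coeff (\<Prod>s\<in>A. [:- lin_form c (s z), 1:]) i) (tube I z0 \<epsilon>)"
    unfolding monic_family_def by blast
   then have "hol (%z. coeff (Q z) i) (tube I z0 \<epsilon>)"
    by (rule hol_cong) (simp_all add: eq)
   then show "EX V. open V & z0 : V & hol (%z. coeff (Q z) i) V"
    using A(1) by (intro exI[of _ "tube I z0 \<epsilon>"]) simp
  qed
  define c1 where "c1 = (\<Sum>i\<in>UNIV. norm (c $ i)) * C"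
  have c1: "c1 >= 0" unfolding c1_def using C by (intro mult_nonneg_nonneg sum_nonneg) auto
  have root: "norm (lin_form c x) <= c1 * (1 + norm z)" if "x : fib z" for x z
  proof -
   have "norm (lin_form c x) <= (\<Sum>i\<in>UNIV. norm (c $ i)) * norm x" by (rule lin_form_bound)
   also have "\<dots> <= (\<Sum>i\<in>UNIV. norm (c $ i)) * (C * (1 + norm z))"
    by (intro mult_left_mono fibC[OF that] sum_nonneg) auto
   finally show ?thesis by (simp add: c1_def mult.assoc)
  qed
  have bound: "norm (coeff (Q z) i) <= (2 ^ k * c1 ^ (k - i)) * (1 + norm z) ^ (k - i)" if z: "z : G" and i: "i <= k" for z i
   using coeff_bound_prod_linear[OF finfib[OF z], of "lin_form c" "c1 * (1 + norm z)" i] root c1 i k[OF z]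
   by (simp add: Q_def power_mult_distrib mult.assoc)
  have "EX \<tau>. hol \<tau> UNIV & (ALL z:G. \<tau> z = coeff (Q z) i)" for i
  proof (rule riemann_extension[OF opG _ holQ])
   fix b :: "complex^'n"
   obtain r h p where h: "r > 0" "hol h (ball b r)" "p : ball b r" "h p ~= 0"
    "{z:ball b r. h z ~= 0} \<subseteq> G" by (rule thin_complementE[OF thin])
   have bnd: "norm (coeff (Q z) i) <= (2 ^ k * c1 ^ (k - i)) * (1 + norm b + r) ^ (k - i)"
    if z: "z : ball b r" "h z ~= 0" for z
   proof (cases "i <= k")
    case True
    have zG: "z : G" using z h(5) by blast
    have "norm z <= norm b + r" using z norm_triangle_ineq2[of z b] by (simp add: dist_norm norm_minus_commute)
    then have "(1 + norm z) ^ (k - i) <= (1 + norm b + r) ^ (k - i)" by (intro power_mono) auto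
    then have "(2 ^ k * c1 ^ (k - i)) * (1 + norm z) ^ (k - i) <= (2 ^ k * c1 ^ (k - i)) * (1 + norm b + r) ^ (k - i)"
     using c1 by (intro mult_left_mono) auto
    then show ?thesis using bound[OF zG True] by linarith
   next
    case False
    have zG: "z : G" using z h(5) by blast
    then have "coeff (Q z) i = 0" using False degQ[OF zG] by (simp add: coeff_eq_0)
    then show ?thesis using c1 h(1) by simp
   qed
   show "EX r>0. EX h p. hol h (ball b r) & p : ball b r & h p ~= 0 &
        {z:ball b r. h z ~= 0} \<subseteq> G & (EX B. ALL z:ball b r. h z ~= 0 --> norm (coeff (Q z) i) <= B)"
    by (rule exI[of _ r], rule conjI[OF h(1)], rule exI[of _ h], rule exI[of _ p], intro conjI h(2-5),
      rule exI[of _ "(2 ^ k * c1 ^ (k - i)) * (1 + norm b + r) ^ (k - i)"], intro ballI impI bnd)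
  qed
  then have "ALL i. EX \<tau>. hol \<tau> UNIV & (ALL z:G. \<tau> z = coeff (Q z) i)" by (intro allI)
  from choice[OF this] obtain \<sigma> where \<sigma>: "!!i. hol (\<sigma> i) UNIV" "!!i z. z : G ==> \<sigma> i z = coeff (Q z) i" by blast
  have cont: "continuous_on UNIV (\<sigma> i)" for i by (rule hol_imp_continuous_on[OF \<sigma>(1)])
  have polyQ: "(\<Sum>i\<le>k. \<sigma> i z * t ^ i) = poly (Q z) t" if "z : G" for z t
   unfolding poly_altdef degQ[OF that] using \<sigma>(2)[OF that] by simp
  have growth: "poly_growth (k - i) (\<sigma> i)" if "i <= k" for i
  proof -
   have "z : {z. norm (\<sigma> i z) <= (2 ^ k * c1 ^ (k - i)) * (1 + norm z) ^ (k - i)}" for z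
    by (rule closed_property_from_dense[OF thin _ open_UNIV])
     (use bound \<sigma>(2) that in \<open>auto intro!: closed_Collect_le continuous_intros cont\<close>)
   then show ?thesis unfolding poly_growth_def using c1 by (intro exI[of _ "2 ^ k * c1 ^ (k - i)"]) auto
  qed
  have one: "\<sigma> k z = 1" for z
  proof -
   have "z : {z. \<sigma> k z = 1}"
    by (rule closed_property_from_dense[OF thin _ open_UNIV])
     (use leadQ \<sigma>(2) in \<open>auto intro!: closed_Collect_eq continuous_intros cont\<close>)
   then show ?thesis by simp
  qed
  have cp: "\<sigma> i z = \<sigma> i (cproj I z)" for i z
  proof -
   have cc: "continuous_on UNIV (%z. \<sigma> i (cproj I z))"
    by (rule continuous_on_compose2[OF cont]) (auto intro: continuous_intros)
   have "z : {z. \<sigma> i z = \<sigma> i (cproj I z)}"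
   proof (rule closed_property_from_dense[OF thin _ open_UNIV])
    show "closed {z. \<sigma> i z = \<sigma> i (cproj I z)}" by (rule closed_Collect_eq[OF cont cc])
    fix z assume z: "z : G"
    have "coeff (Q z) i = coeff (Q (cproj I z)) i" by (simp only: Q_def fibcp)
    then show "z : {z. \<sigma> i z = \<sigma> i (cproj I z)}" using \<sigma>(2)[OF z, of i] \<sigma>(2)[of "cproj I z" i] z Gcp by simp
   qed auto
   then show ?thesis by simp
  qed
  let ?g = "%x. \<Sum>i\<le>k. \<sigma> i x * lin_form c x ^ i"
  have contg: "continuous_on UNIV ?g"
   by (intro hol_imp_continuous_on hol_sum hol_mult hol_power \<sigma>(1) hol_lin_form)
  \<comment> \<open>Over exceptional base points the equation is inherited from nearby points of
    \<open>X\<close> with generic base point, which \<open>dp\<close> provides.\<close>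
  have vanish: "?g x = 0" if x: "x : X" for x
  proof (rule ccontr)
   assume ne: "?g x ~= 0"
   let ?W = "{x. ?g x ~= 0}"
   have opW: "open ?W" by (rule open_Collect_neq[OF contg]) (rule continuous_on_const)
   have "EX N. open N & N ~= {} & (ALL z:N. EX x':X Int ?W. cproj I x' = cproj I z)"
    using dp[unfolded dense_projection_def, rule_format, OF x] opW ne by blast
   then obtain N where N: "open N" "N ~= {}" "ALL z:N. EX x':X Int ?W. cproj I x' = cproj I z" by blast
   then obtain z where z: "z : N" "z : G" using thin_complement_dense[OF thin N(1)] by blast
   then obtain x' where x': "x' : X" "?g x' ~= 0" "cproj I x' = cproj I z" using N(3) by blast
   have x'G: "x' : G" using z(2) x'(3) Gcp by metis
   have "x' : fib x'" using x'(1) by (simp add: fib_def)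
   then have "poly (Q x') (lin_form c x') = 0"
    unfolding Q_def poly_prod using finfib[OF x'G] by (intro prod_zero bexI[of _ x']) auto
   then show False using x'(2) polyQ[OF x'G, of "lin_form c x'"] by simp
  qed
  have sep: "?g z ~= 0" if z: "ALL x:X. cproj I x = cproj I z --> lin_form c x ~= lin_form c z" for z
  proof -
   \<comment> \<open>If points over base points tending to \<open>z\<close> had form values tending
     to \<open>lin_form c z\<close>, cone position would keep them bounded, and a limit point in
     \<open>X\<close> over \<open>z\<close> would contradict the separation.\<close>
   have "EX \<eta>>0. ALL z':ball z \<eta>. ALL x':fib z'. \<eta> <= norm (lin_form c z - lin_form c x')"
   proof (rule ccontr)
    assume no: "\<not> ?thesis"
    have "ALL n. EX q. fst q : ball z (1 / real (Suc n)) & snd q : fib (fst q) &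
     norm (lin_form c z - lin_form c (snd q)) < 1 / real (Suc n)"
    proof
     fix n
     obtain z' x' where "z' : ball z (1 / real (Suc n))" "x' : fib z'" "norm (lin_form c z - lin_form c x') < 1 / real (Suc n)"
     proof -
      have "\<not> (ALL z':ball z e. ALL x':fib z'. e <= norm (lin_form c z - lin_form c x'))" if "e > 0" for e
       using no that by blast
      from this[of "1 / real (Suc n)"] show ?thesis by (auto simp: not_le intro: that)
     qed
     then show "EX q. fst q : ball z (1 / real (Suc n)) & snd q : fib (fst q) &
      norm (lin_form c z - lin_form c (snd q)) < 1 / real (Suc n)" by (intro exI[of _ "(z', x')"]) simp
    qed
    from choice[OF this] obtain q where q: "!!n. fst (q n) : ball z (1 / real (Suc n))" "!!n. snd (q n) : fib (fst (q n))"
     "!!n. norm (lin_form c z - lin_form c (snd (q n))) < 1 / real (Suc n)" by blast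
    have lim0: "(%n. 1 / real (Suc n)) \<longlonglongrightarrow> 0" by (rule LIMSEQ_Suc[OF lim_1_over_n])
    have limz: "(%n. fst (q n)) \<longlonglongrightarrow> z"
    proof -
     have "(%n. fst (q n) - z) \<longlonglongrightarrow> 0"
      by (rule Lim_null_comparison[OF _ lim0])
       (use q(1) in \<open>auto simp: dist_norm norm_minus_commute intro!: always_eventually less_imp_le\<close>)
     then show ?thesis by (simp add: LIM_zero_iff)
    qed
    have "norm (snd (q n)) <= C * (2 + norm z)" for n
    proof -
     have "norm (fst (q n)) <= norm z + 1"
     proof -
      have "norm (fst (q n) - z) < 1 / real (Suc n)" using q(1)[of n] by (simp add: dist_norm norm_minus_commute)
      moreover have "1 / real (Suc n) <= 1" by simp
      ultimately show ?thesis using norm_triangle_ineq2[of "fst (q n)" z] by linarith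
     qed
     then have "C * (1 + norm (fst (q n))) <= C * (2 + norm z)" using C by (intro mult_left_mono) auto
     then show ?thesis using fibC[OF q(2)[of n]] by linarith
    qed
    then have "bounded (range (%n. snd (q n)))" unfolding bounded_iff by blast
    then obtain x \<phi> where x: "strict_mono \<phi>" "((%n. snd (q n)) \<circ> \<phi>) \<longlonglongrightarrow> x"
     using bounded_imp_convergent_subsequence by blast
    have "x : X"
     by (rule closed_sequentially[OF analytic_subset_closed[OF X(1)] _ x(2)]) (use q(2) in \<open>simp add: fib_def\<close>)
    moreover have "cproj I x = cproj I z"
    proof (rule LIMSEQ_unique)
     show "(%n. cproj I (snd (q (\<phi> n)))) \<longlonglongrightarrow> cproj I x"
      using bounded_linear.tendsto[OF bounded_linear_cproj x(2)] by (simp add: o_def)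
     have "(%n. cproj I (fst (q (\<phi> n)))) \<longlonglongrightarrow> cproj I z"
      using bounded_linear.tendsto[OF bounded_linear_cproj LIMSEQ_subseq_LIMSEQ[OF limz x(1)]] by (simp add: o_def)
     then show "(%n. cproj I (snd (q (\<phi> n)))) \<longlonglongrightarrow> cproj I z"
      using q(2) by (simp add: fib_def)
    qed
    moreover have "lin_form c x = lin_form c z"
    proof (rule LIMSEQ_unique)
     have "isCont (lin_form c) x"
      using hol_imp_continuous_on[OF hol_lin_form[of c UNIV]] by (simp add: continuous_on_eq_continuous_at)
     then show "(%n. lin_form c (snd (q (\<phi> n)))) \<longlonglongrightarrow> lin_form c x"
      using isCont_tendsto_compose x(2) by (fastforce simp: o_def)
     have "(%n. lin_form c (snd (q n)) - lin_form c z) \<longlonglongrightarrow> 0"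
      by (rule Lim_null_comparison[OF _ lim0]) (use q(3) in \<open>auto simp: norm_minus_commute intro!: always_eventually less_imp_le\<close>)
     then have "(%n. lin_form c (snd (q n))) \<longlonglongrightarrow> lin_form c z" by (simp add: LIM_zero_iff)
     then show "(%n. lin_form c (snd (q (\<phi> n)))) \<longlonglongrightarrow> lin_form c z"
      using LIMSEQ_subseq_LIMSEQ[OF _ x(1)] by (fastforce simp: o_def)
    qed
    ultimately show False using z by blast
   qed
   then obtain \<eta> where \<eta>: "\<eta> > 0" "!!z' x'. z':ball z \<eta> ==> x':fib z' ==> \<eta> <= norm (lin_form c z - lin_form c x')" by blast
   \<comment> \<open>Over generic \<open>z'\<close> the polynomial at \<open>lin_form c z\<close> is
     a product of \<open>k\<close> differences of size at least \<eta>. The bound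
     \<open>\<eta> ^ k\<close> is a closed condition and passes to \<open>z\<close>.\<close>
   have "z : {z'. \<eta> ^ k <= norm (\<Sum>i\<le>k. \<sigma> i z' * lin_form c z ^ i)}"
   proof (rule closed_property_from_dense[OF thin])
    show "closed {z'. \<eta> ^ k <= norm (\<Sum>i\<le>k. \<sigma> i z' * lin_form c z ^ i)}"
     by (intro closed_Collect_le continuous_intros cont)
    fix z' assume z': "z' : G" "z' : ball z \<eta>"
    have "\<eta> ^ k = (\<Prod>x'\<in>fib z'. \<eta>)" using k[OF z'(1)] by simp
    also have "\<dots> <= (\<Prod>x'\<in>fib z'. norm (lin_form c z - lin_form c x'))"
     using \<eta> z'(2) by (intro prod_mono) auto
    also have "\<dots> = norm (poly (Q z') (lin_form c z))" by (simp add: Q_def poly_prod prod_norm)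
    finally show "z' : {z'. \<eta> ^ k <= norm (\<Sum>i\<le>k. \<sigma> i z' * lin_form c z ^ i)}" using polyQ[OF z'(1)] by simp
   qed (use \<eta>(1) in simp_all)
   then have "\<eta> ^ k <= norm (?g z)" by simp
   moreover have "0 < \<eta> ^ k" using \<eta>(1) by simp
   ultimately show ?thesis by auto
  qed
  show ?thesis
  proof (rule exI[of _ \<sigma>], intro conjI allI impI ballI)
   show "hol (\<sigma> i) UNIV" for i by (rule \<sigma>(1))
   show "poly_growth (k - i) (\<sigma> i)" if "i <= k" for i by (rule growth[OF that])
   show "\<sigma> k z = 1" for z by (rule one)
   show "\<sigma> i z = \<sigma> i (cproj I z)" for i z by (rule cp)
   show "?g x = 0" if "x : X" for x by (rule vanish[OF that])
   show "?g z ~= 0" if "ALL x:X. cproj I x = cproj I z --> lin_form c x ~= lin_form c z" for z by (rule sep[OF that])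
  qed
 qed
 then show ?thesis by (intro exI[of _ k] allI)
qed

section \<open>Algebraic sets and linear changes of coordinates\<close>

lemma cpoly_eval_superset:
 assumes "finite S" "Poly_Mapping.keys p \<subseteq> S"
 shows "cpoly_eval p z = (\<Sum>m\<in>S. Poly_Mapping.lookup p m * (\<Prod>i\<in>UNIV. z $ i ^ Poly_Mapping.lookup m i))"
 unfolding cpoly_eval_def
 by (rule sum.mono_neutral_left[OF assms]) (auto simp: in_keys_iff)

lemma cpoly_eval_add: "cpoly_eval (p + q) z = cpoly_eval p z + cpoly_eval q z"
proof -
 let ?S = "Poly_Mapping.keys p \<union> Poly_Mapping.keys q"
 have S: "finite ?S" "Poly_Mapping.keys (p + q) \<subseteq> ?S" "Poly_Mapping.keys p \<subseteq> ?S" "Poly_Mapping.keys q \<subseteq> ?S"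
  using Poly_Mapping.keys_add[of p q] by (simp_all)
 show ?thesis
  unfolding cpoly_eval_superset[OF S(1,2)] cpoly_eval_superset[OF S(1,3)] cpoly_eval_superset[OF S(1,4)]
  by (simp add: lookup_add distrib_right sum.distrib)
qed

lemma cpoly_eval_single:
 "cpoly_eval (Poly_Mapping.single m c) z = c * (\<Prod>i\<in>UNIV. z $ i ^ Poly_Mapping.lookup m i)"
 by (subst cpoly_eval_superset[of "{m}"]) auto

lemma cpoly_eval_0: "cpoly_eval 0 z = 0"
 by (simp add: cpoly_eval_def)

lemma cpoly_eval_sum: "finite A ==> cpoly_eval (\<Sum>a\<in>A. p a) z = (\<Sum>a\<in>A. cpoly_eval (p a) z)"
 by (induction A rule: finite_induct) (simp_all add: cpoly_eval_0 cpoly_eval_add)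

lemma polyfn_cpoly_eval: "polyfn (cpoly_eval p)"
proof -
 have "polyfn (%z. cpoly_eval p z)"
  unfolding cpoly_eval_def
  by (intro polyfn_sum polyfn.mult polyfn.const polyfn_prod polyfn_power polyfn.coord)
 then show ?thesis by simp
qed

lemma cpoly_eval_if_polyfn:
 assumes "polyfn f"
 shows "EX p. ALL z. f z = cpoly_eval p z"
 using assms
proof (induction rule: polyfn.induct)
 case (const c)
 then show ?case by (intro exI[of _ "Poly_Mapping.single 0 c"]) (simp add: cpoly_eval_single)
next
 case (coord i)
 have "(\<Prod>k\<in>UNIV. z $ k ^ Poly_Mapping.lookup (Poly_Mapping.single i 1) k) = z $ i" for z :: "complex^'a"
 proof -
  have "(\<Prod>k\<in>UNIV. z $ k ^ Poly_Mapping.lookup (Poly_Mapping.single i 1) k) = (\<Prod>k\<in>{i}. z $ k ^ Poly_Mapping.lookup (Poly_Mapping.single i 1) k)"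
   by (rule prod.mono_neutral_right) (auto simp: lookup_single when_def)
  then show ?thesis by simp
 qed
 then show ?case by (intro exI[of _ "Poly_Mapping.single (Poly_Mapping.single i 1) 1"]) (simp add: cpoly_eval_single)
next
 case (add f g)
 then obtain p q where "!!z. f z = cpoly_eval p z" "!!z. g z = cpoly_eval q z" by blast
 then show ?case by (intro exI[of _ "p + q"]) (simp add: cpoly_eval_add)
next
 case (mult f g)
 then obtain p q where pq: "!!z. f z = cpoly_eval p z" "!!z. g z = cpoly_eval q z" by blast
 define r where "r = (\<Sum>m\<in>Poly_Mapping.keys p. \<Sum>m'\<in>Poly_Mapping.keys q.
  Poly_Mapping.single (m + m') (Poly_Mapping.lookup p m * Poly_Mapping.lookup q m'))"
 have "cpoly_eval p z * cpoly_eval q z = cpoly_eval r z" for z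
  unfolding r_def
  by (simp add: cpoly_eval_sum cpoly_eval_single lookup_add power_add prod.distrib cpoly_eval_def[of p]
    cpoly_eval_def[of q] sum_product mult_ac)
 then show ?case using pq by (intro exI[of _ r]) simp
qed

lemma algebraic_setI:
 assumes "!!f. f : F ==> polyfn f" "X = {z. ALL f:F. f z = 0}"
 shows "algebraic_set X"
proof -
 have "X = {z. ALL p:{p. cpoly_eval p : F}. cpoly_eval p z = 0}"
 proof (intro equalityI subsetI)
  fix z assume "z : X"
  then show "z : {z. ALL p:{p. cpoly_eval p : F}. cpoly_eval p z = 0}" using assms(2) by blast
 next
  fix z assume z: "z : {z. ALL p:{p. cpoly_eval p : F}. cpoly_eval p z = 0}"
  have "f z = 0" if f: "f : F" for f
  proof -
   obtain p where "ALL z. f z = cpoly_eval p z" using cpoly_eval_if_polyfn[OF assms(1)[OF f]] by blast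
   then have "f = cpoly_eval p" by (simp add: fun_eq_iff)
   then show ?thesis using z f by simp
  qed
  then show "z : X" using assms(2) by blast
 qed
 then show ?thesis unfolding algebraic_set_def by (rule exI)
qed

lemma algebraic_setE:
 assumes "algebraic_set X"
 obtains F where "!!f. f : F ==> polyfn f" "X = {z. ALL f:F. f z = 0}"
proof -
 obtain P where P: "X = {z. ALL p:P. cpoly_eval p z = 0}" using assms unfolding algebraic_set_def by (elim exE)
 show thesis by (rule that[of "cpoly_eval ` P"]) (use P polyfn_cpoly_eval in auto)
qed

section \<open>Linear changes of coordinates\<close>

definition linear_pair :: "(complex^'n => complex^'n) => (complex^'n => complex^'n) => bool" where
 "linear_pair L L' \<longleftrightarrow> (ALL u v. L (u + v) = L u + L v) & (ALL c u. L (c *s u) = c *s L u) &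
  (ALL u v. L' (u + v) = L' u + L' v) & (ALL c u. L' (c *s u) = c *s L' u) &
  (ALL z. L (L' z) = z) & (ALL z. L' (L z) = z)"

lemma linear_pairD:
 assumes "linear_pair L L'"
 shows "!!u v. L (u + v) = L u + L v" "!!c u. L (c *s u) = c *s L u" "!!z. L (L' z) = z" "!!z. L' (L z) = z"
  "linear_pair L' L"
 using assms unfolding linear_pair_def by blast+

lemma linear_pair_bounded_linear: "linear_pair L L' ==> bounded_linear L"
 by (rule linear_scale_imp_bounded_linear) (erule linear_pairD(1), erule linear_pairD(2))

lemma linear_pair_holomorphic: "linear_pair L L' ==> holmap L U"
 by (rule holmap_linear) (erule linear_pairD(1), erule linear_pairD(2))

lemma linear_pair_id: "linear_pair (%z. z) (%z. z)"
 by (simp add: linear_pair_def)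

lemma linear_pair_compose:
 assumes "linear_pair L L'" "linear_pair M M'"
 shows "linear_pair (%z. L (M z)) (%z. M' (L' z))"
 using assms unfolding linear_pair_def by simp

lemma linear_pair_image:
 assumes L: "linear_pair L L'"
 shows "L ` X = {z. L' z : X}"
proof (intro equalityI subsetI)
 fix z assume "z : {z. L' z : X}"
 then show "z : L ` X" by (intro image_eqI[of _ L "L' z"]) (simp_all add: linear_pairD(3)[OF L])
qed (auto simp: linear_pairD(4)[OF L])

lemma linear_pair_image_open:
 assumes "linear_pair L L'" "open U"
 shows "open (L ` U)"
proof -
 have "continuous_on UNIV L'"
  using linear_pair_bounded_linear[OF linear_pairD(5)[OF assms(1)]] by (rule linear_continuous_on)
 from open_vimage[OF assms(2) this] show ?thesis by (simp add: linear_pair_image[OF assms(1)] vimage_def)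
qed

lemma linear_pair_sum_axis:
 fixes L :: "complex^'n => complex^'n" and z :: "complex^'n"
 assumes "linear_pair L L'"
 shows "L z $ i = (\<Sum>k\<in>UNIV. L (axis k 1) $ i * z $ k)"
proof -
 have "z = (\<Sum>k\<in>UNIV. z $ k *s axis k 1)" by (simp add: vec_eq_iff axis_def if_distrib sum.delta cong: if_cong)
 then have "L z = L (\<Sum>k\<in>UNIV. z $ k *s axis k 1)" by simp
 also have "\<dots> = (\<Sum>k\<in>UNIV. L (z $ k *s axis k 1))"
  by (rule linear_sum) (rule bounded_linear.linear[OF linear_pair_bounded_linear[OF assms]])
 finally show ?thesis by (simp add: linear_pairD(2)[OF assms] mult.commute)
qed

lemma polyfn_linear:
 assumes "linear_pair L L'" "polyfn f"
 shows "polyfn (%z. f (L z))"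
 using assms(2)
proof (induction rule: polyfn.induct)
 case (coord i)
 have eq: "(%z. L z $ i) = (%z. \<Sum>k\<in>UNIV. L (axis k 1) $ i * z $ k)"
  by (rule ext) (rule linear_pair_sum_axis[OF assms(1)])
 show ?case
  by (rule ssubst[OF eq, of polyfn])
   (intro polyfn_sum polyfn.mult polyfn.const polyfn.coord)
qed (rule polyfn.const polyfn.add polyfn.mult; assumption?)+

lemma algebraic_set_linear_image:
 assumes L: "linear_pair L L'" and X: "algebraic_set X"
 shows "algebraic_set (L ` X)"
proof -
 obtain F where F: "!!f. f : F ==> polyfn f" "X = {z. ALL f:F. f z = 0}"
  by (rule algebraic_setE[OF X]) (rule that; assumption)
 show ?thesis
  by (rule algebraic_setI[of "(%f z. f (L' z)) ` F"])
   (use F polyfn_linear[OF linear_pairD(5)[OF L]] in \<open>auto simp: linear_pair_image[OF L]\<close>)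
qed

lemma linear_pair_image_image:
 assumes "linear_pair L L'"
 shows "L' ` L ` X = X"
 by (simp add: image_image linear_pairD(4)[OF assms])

lemma analytic_subset_linear_image:
 assumes L: "linear_pair L L'" and X: "analytic_subset X"
 shows "analytic_subset (L ` X)"
 unfolding analytic_subset_def
proof
 fix a
 obtain U F where U: "open U" "L' a : U" "finite F" "!!f. f : F ==> hol f U"
  "X Int U = {z:U. ALL f:F. f z = 0}"
  by (rule analytic_subsetE[OF X, where a = "L' a"]) (rule that; (assumption | simp only:))
 let ?F = "(%f z. f (L' z)) ` F"
 have im: "L ` S = {z. L' z : S}" for S by (rule linear_pair_image[OF L])
 have "hol g (L ` U)" if "g : ?F" for g
  using that U(4) hol_compose[OF _ linear_pair_holomorphic[OF linear_pairD(5)[OF L], of "L ` U"]]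
  by (auto simp: im)
 moreover have "L ` X Int L ` U = {z:L ` U. ALL f:?F. f z = 0}" using U(5) unfolding im by auto
 moreover have "open (L ` U)" by (rule linear_pair_image_open[OF L U(1)])
 ultimately show "EX U F. open U & a : U & finite F & (ALL f:F. hol f U) &
    L ` X Int U = {z : U. ALL f:F. f z = 0}"
  using U(2,3) by (intro exI[of _ "L ` U"] exI[of _ ?F] conjI) (simp_all add: im)
qed

lemma regular_points_linear_image:
 assumes L: "linear_pair L L'" and p: "p : regular_points X k"
 shows "L p : regular_points (L ` X) k"
proof -
 obtain U V I and \<phi> :: "complex^'a => complex^'a" where reg: "p : U" "biholomorphic_on \<phi> U V" "card I = k"
  "\<phi> ` (X Int U) = {w:V. ALL i. i ~: I --> w $ i = 0}" and pX: "p : X"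
  using p unfolding regular_points_def by (elim CollectE conjE exE) (rule that; assumption)
 have bih: "open U" "open V" "bij_betw \<phi> U V" "holmap \<phi> U" "holmap (inv_into U \<phi>) V"
  using reg(2) unfolding biholomorphic_on_def by auto
 define \<phi>2 where "\<phi>2 z = \<phi> (L' z)" for z
 have im: "L ` S = {z. L' z : S}" for S by (rule linear_pair_image[OF L])
 have bij2: "bij_betw \<phi>2 (L ` U) V"
  unfolding \<phi>2_def
  by (rule bij_betw_byWitness[of _ "%w. L (inv_into U \<phi> w)"])
   (use bih(3) in \<open>auto simp: im linear_pairD[OF L] bij_betw_def inv_into_into f_inv_into_f\<close>)
 have hol2: "holmap \<phi>2 (L ` U)"
  unfolding \<phi>2_def by (rule holmap_compose[OF bih(4) linear_pair_holomorphic[OF linear_pairD(5)[OF L]]]) (simp add: im)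
 have inv: "inv_into (L ` U) \<phi>2 w = L (inv_into U \<phi> w)" if w: "w : V" for w
 proof (rule inv_into_f_eq)
  show "inj_on \<phi>2 (L ` U)" using bij2 by (simp add: bij_betw_def)
  show "L (inv_into U \<phi> w) : L ` U" using w bih(3) by (auto simp: bij_betw_def inv_into_into)
  show "\<phi>2 (L (inv_into U \<phi> w)) = w" using w bih(3) by (auto simp: \<phi>2_def linear_pairD[OF L] bij_betw_def f_inv_into_f)
 qed
 have "holmap (%w. L (inv_into U \<phi> w)) V"
  by (rule holmap_compose[OF linear_pair_holomorphic[OF L, of UNIV] bih(5)]) simp
 then have "holmap (inv_into (L ` U) \<phi>2) V"
  unfolding holomorphic_map_on_def
 proof (intro allI)
  fix i assume "ALL i. hol (%z. L (inv_into U \<phi> z) $ i) V"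
  from hol_cong[OF spec[OF this, of i] bih(2)]
  show "hol (%z. inv_into (L ` U) \<phi>2 z $ i) V" by (simp only: inv)
 qed
 then have bih2: "biholomorphic_on \<phi>2 (L ` U) V"
  unfolding biholomorphic_on_def by (intro conjI linear_pair_image_open[OF L bih(1)] bih(2) bij2 hol2)
 have img: "\<phi>2 ` (L ` X Int L ` U) = {w:V. ALL i. i ~: I --> w $ i = 0}"
 proof -
  have "L ` X Int L ` U = L ` (X Int U)" unfolding im by auto
  then have "\<phi>2 ` (L ` X Int L ` U) = \<phi> ` (X Int U)" by (simp add: image_image \<phi>2_def linear_pairD[OF L])
  then show ?thesis using reg(4) by simp
 qed
 show ?thesis
  unfolding regular_points_def mem_Collect_eq
  by (intro conjI exI[of _ "L ` U"] exI[of _ V] exI[of _ \<phi>2] exI[of _ I] bih2 img reg(3) imageI pX reg(1))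
qed

section \<open>Algebraicity from cone position\<close>

lemma finite_fibre_in_cone:
 fixes X :: "(complex^'n) set"
 assumes X: "analytic_subset X" "in_cone I X"
 shows "finite {x:X. cproj I x = cproj I z}"
proof -
 have "ALL j: - I. EX R. finite R & (ALL x:X. cproj I x = cproj I z --> x $ j : R)"
 proof
  fix j assume "j : - I"
  then have j: "j ~: I" by simp
  obtain \<delta> m P where P: "\<delta> > 0" "monic_family (tube I z \<delta>) m P" "ALL z. P z = P (cproj I z)"
   "ALL x:X Int tube I z \<delta>. poly (P x) (x $ j) = 0"
   using coordinate_integral[OF X j, of z] by (elim exE conjE) (rule that; assumption)
  have "z : tube I z \<delta>" using P(1) by (simp add: tube_def)
  then have "coeff (P z) m = 1" using P(2) unfolding monic_family_def by simp
  then have "P z ~= 0" by auto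
  moreover have "x $ j : {t. poly (P z) t = 0}" if x: "x : X" "cproj I x = cproj I z" for x
  proof -
   have "x : X Int tube I z \<delta>" using x P(1) by (simp add: tube_def)
   from bspec[OF P(4) this] have "poly (P x) (x $ j) = 0" .
   moreover have "P x = P z" using P(3)[rule_format, of x] P(3)[rule_format, of z] x(2) by simp
   ultimately show ?thesis by simp
  qed
  ultimately show "EX R. finite R & (ALL x:X. cproj I x = cproj I z --> x $ j : R)"
   using poly_roots_finite[of "P z"] by (intro exI[of _ "{t. poly (P z) t = 0}"]) auto
 qed
 from bchoice[OF this] obtain R where R: "!!j. j ~: I ==> finite (R j)"
  "!!j x. j ~: I ==> x : X ==> cproj I x = cproj I z ==> x $ j : R j" by auto
 have "{x:X. cproj I x = cproj I z} \<subseteq> (%\<alpha>. \<chi> i. if i : I then z $ i else \<alpha> i) ` Pi\<^sub>E (- I) R"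
 proof
  fix x assume x: "x : {x:X. cproj I x = cproj I z}"
  then have "x = (\<chi> i. if i : I then z $ i else restrict (%j. x $ j) (- I) i)"
   by (auto simp: vec_eq_iff[of x] cproj_eq_iff)
  moreover have "restrict (%j. x $ j) (- I) : Pi\<^sub>E (- I) R" using x R(2) by auto
  ultimately show "x : (%\<alpha>. \<chi> i. if i : I then z $ i else \<alpha> i) ` Pi\<^sub>E (- I) R" by (rule image_eqI)
 qed
 moreover have "finite (Pi\<^sub>E (- I) R)" using R(1) by (intro finite_PiE) auto
 ultimately show ?thesis using finite_surj by blast
qed

text \<open>The coefficients of the form are powers of one number \<tau>, so the difference of its
  values at two points is a polynomial in \<tau>. Finitely many nonzero polynomials have a common
  non-root.\<close>

lemma separating_lin_form:
 fixes z :: "complex^'n"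
 assumes "finite S" "z ~: S"
 shows "EX c. ALL x:S. lin_form c x ~= lin_form c z"
proof -
 obtain e where e: "bij_betw e {..<CARD('n)} (UNIV :: 'n set)"
  using ex_bij_betw_nat_finite[of "UNIV :: 'n set"] by (auto simp: atLeast0LessThan)
 have "EX \<tau>:complex_of_nat ` {..card S * CARD('n)}. ALL x:S. (\<Sum>i<CARD('n). \<tau> ^ i * (x - z) $ e i) ~= 0"
 proof (rule norm_of_combination_nonzero[OF assms(1) order_refl])
  fix x assume "x : S"
  then have "x ~= z" using assms by auto
  then obtain k where "(x - z) $ k ~= 0" by (auto simp: vec_eq_iff)
  moreover obtain i where "i < CARD('n)" "k = e i" using e by (metis UNIV_I bij_betw_imp_surj_on imageE lessThan_iff)
  ultimately show "EX i<CARD('n). (x - z) $ e i ~= 0" by blast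
 qed
 then obtain \<tau> where \<tau>: "!!x. x : S ==> (\<Sum>i<CARD('n). \<tau> ^ i * (x - z) $ e i) ~= 0" by blast
 define c where "c = (\<chi> k. \<tau> ^ (inv_into {..<CARD('n)} e k))"
 have "lin_form c x - lin_form c z = (\<Sum>i<CARD('n). \<tau> ^ i * (x - z) $ e i)" for x
 proof -
  have "lin_form c x - lin_form c z = (\<Sum>k\<in>UNIV. c $ k * (x - z) $ k)"
   by (simp add: lin_form_def right_diff_distrib sum_subtractf)
  also have "\<dots> = (\<Sum>i<CARD('n). c $ e i * (x - z) $ e i)"
   by (rule sum.reindex_bij_betw[OF e, symmetric])
  also have "\<dots> = (\<Sum>i<CARD('n). \<tau> ^ i * (x - z) $ e i)"
   by (rule sum.cong) (use e in \<open>auto simp: c_def bij_betw_def inv_into_f_f\<close>)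
  finally show ?thesis .
 qed
 then have "lin_form c x ~= lin_form c z" if "x : S" for x using \<tau>[OF that] by (metis right_minus_eq)
 then show ?thesis by blast
qed

lemma polyfn_lin_form: "polyfn (lin_form c)"
proof -
 have "polyfn (%z. lin_form c z)" unfolding lin_form_def
  by (intro polyfn_sum polyfn.mult polyfn.const polyfn.coord)
 then show ?thesis by simp
qed

text \<open>The equations are the fibre polynomials for all linear forms. A point outside
  \<open>X\<close> differs from the finitely many points of \<open>X\<close> in its fibre, so some
  form separates it from them, and the equation of that form does not vanish there.\<close>

theorem algebraic_if_in_cone:
 fixes X :: "(complex^'n) set"
 assumes X: "analytic_subset X" "in_cone I X" and dp: "dense_projection I X"
 shows "algebraic_set X"
proof -
 obtain k where k: "ALL c. EX \<sigma>. (ALL i. hol (\<sigma> i) UNIV) & (ALL i<=k. poly_growth (k - i) (\<sigma> i)) &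
  (ALL z. \<sigma> k z = 1) & (ALL i z. \<sigma> i z = \<sigma> i (cproj I z)) &
  (ALL x:X. (\<Sum>i\<le>k. \<sigma> i x * lin_form c x ^ i) = 0) &
  (ALL z. (ALL x:X. cproj I x = cproj I z --> lin_form c x ~= lin_form c z) -->
    (\<Sum>i\<le>k. \<sigma> i z * lin_form c z ^ i) ~= 0)"
  using fibre_polynomials[OF X dp] by (elim exE)
 have "EX f. polyfn f & (ALL x:X. f x = 0) &
  (ALL z. (ALL x:X. cproj I x = cproj I z --> lin_form c x ~= lin_form c z) --> f z ~= 0)" for c
 proof -
  obtain \<sigma> where \<sigma>: "ALL i. hol (\<sigma> i) UNIV" "ALL i<=k. poly_growth (k - i) (\<sigma> i)"
  "ALL x:X. (\<Sum>i\<le>k. \<sigma> i x * lin_form c x ^ i) = 0"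
  "ALL z. (ALL x:X. cproj I x = cproj I z --> lin_form c x ~= lin_form c z) -->
    (\<Sum>i\<le>k. \<sigma> i z * lin_form c z ^ i) ~= 0"
   using k[rule_format, of c] by (elim exE conjE) (rule that; assumption)
  have "polyfn (\<sigma> i)" if "i : {..k}" for i
   by (rule polyfn_if_growth) (use \<sigma>(1,2) that in auto)
  then have "polyfn (%z. \<Sum>i\<le>k. \<sigma> i z * lin_form c z ^ i)"
   by (intro polyfn_sum polyfn.mult polyfn_power polyfn_lin_form)
  then show ?thesis
   by (intro exI[of _ "%z. \<Sum>i\<le>k. \<sigma> i z * lin_form c z ^ i"] conjI \<sigma>(3,4))
 qed
 then have "ALL c. EX f. polyfn f & (ALL x:X. f x = 0) &
  (ALL z. (ALL x:X. cproj I x = cproj I z --> lin_form c x ~= lin_form c z) --> f z ~= 0)" by (intro allI)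
 from choice[OF this] obtain f where f: "ALL c. polyfn (f c) & (ALL x:X. f c x = 0) &
  (ALL z. (ALL x:X. cproj I x = cproj I z --> lin_form c x ~= lin_form c z) --> f c z ~= 0)" by (elim exE)
 show ?thesis
 proof (rule algebraic_setI[of "range f"])
  show "polyfn g" if "g : range f" for g
  proof -
   obtain c where c: "g = f c" using \<open>g : range f\<close> by (rule rangeE)
   show ?thesis unfolding c by (rule conjunct1[OF spec[OF f]])
  qed
  show "X = {z. ALL g:range f. g z = 0}"
  proof (intro equalityI subsetI)
   fix x assume x: "x : X"
   have "f c x = 0" for c by (rule bspec[OF conjunct1[OF conjunct2[OF spec[OF f]]] x])
   then show "x : {z. ALL g:range f. g z = 0}" by simp
  next
   fix z assume z: "z : {z. ALL g:range f. g z = 0}"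
   show "z : X"
   proof (rule ccontr)
    assume "z ~: X"
    then obtain c where c: "ALL x:{x:X. cproj I x = cproj I z}. lin_form c x ~= lin_form c z"
     using separating_lin_form[OF finite_fibre_in_cone[OF X, of z], of z] by blast
    have "f c z ~= 0"
     by (rule mp[OF spec[OF conjunct2[OF conjunct2[OF spec[OF f]]]]]) (use c in simp)
    then show False using z by simp
   qed
  qed
 qed
qed

lemma dense_projection_if_regular_dense:
 fixes X :: "(complex^'n) set"
 assumes X: "analytic_subset X" "in_cone I X" and d: "card I = d"
  and reg: "!!x. x : X ==> x : closure (regular_points X d)"
 shows "dense_projection I X"
 unfolding dense_projection_def
proof (intro ballI allI impI)
 fix x W assume x: "x : X" and W: "open W & x : W"
 obtain p where p: "p : regular_points X d" "p : W"
  using reg[OF x] W unfolding closure_iff_nhds_not_empty by blast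
 show "EX N. open N & N ~= {} & (ALL z:N. EX x':X Int W. cproj I x' = cproj I z)"
  using projection_of_regular_part[OF X p(1) conjunct1[OF W] p(2)] d by blast
qed

lemma regular_dense_linear_image:
 assumes L: "linear_pair L L'" and reg: "!!x. x : X ==> x : closure (regular_points X d)" and x: "x : L ` X"
 shows "x : closure (regular_points (L ` X) d)"
proof -
 obtain y where y: "y : X" "x = L y" using x by blast
 have "continuous_on (closure (regular_points X d)) L"
  using linear_pair_bounded_linear[OF L] by (rule linear_continuous_on)
 then have "L ` closure (regular_points X d) \<subseteq> closure (L ` regular_points X d)"
  by (rule image_closure_subset) (auto intro: closure_subset[THEN subsetD])
 also have "\<dots> \<subseteq> closure (regular_points (L ` X) d)"
  using regular_points_linear_image[OF L] by (intro closure_mono) blast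
 finally show ?thesis using reg[OF y(1)] y(2) by blast
qed

section \<open>Noether position of algebraic sets\<close>

text \<open>\<open>H u\<close> is the restriction of \<open>p\<close> to the line through
  \<open>u\<close>; its coefficient of index \<open>i\<close> is the homogeneous part of degree
  \<open>i\<close> at \<open>u\<close>.\<close>

lemma polyfn_homogeneous_parts:
 assumes "polyfn p"
 shows "EX H M. (ALL u t. p (t *s u) = poly (H u) t) & (ALL i. polyfn (%u. coeff (H u) i)) & (ALL u. degree (H u) <= M)"
 using assms
proof (induction rule: polyfn.induct)
 case (const c)
 show ?case
  by (rule exI[of _ "%u. [:c:]"], rule exI[of _ 0]) (auto intro: polyfn.const)
next
 case (coord i)
 have "polyfn (%u. coeff [:0, u $ i:] k)" for k
 proof (cases "k = 1")
  case True
  then have "(%u. coeff [:0, u $ i:] k) = (%u. u $ i)" by auto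
  then show ?thesis by (rule ssubst[of _ _ polyfn]) (rule polyfn.coord)
 next
  case False
  then have "(%u. coeff [:0, u $ i:] k) = (%u. 0)" by (auto simp: coeff_pCons split: nat.splits)
  then show ?thesis by (rule ssubst[of _ _ polyfn]) (rule polyfn.const)
 qed
 then show ?case
  by (intro exI[of _ "%u. [:0, u $ i:]"] exI[of _ 1]) auto
next
 case (add f g)
 obtain F M where F: "ALL u t. f (t *s u) = poly (F u) t" "ALL i. polyfn (%u. coeff (F u) i)" "ALL u. degree (F u) <= M"
  using add.IH(1) by (elim exE conjE) (rule that; assumption)
 obtain G N where G: "ALL u t. g (t *s u) = poly (G u) t" "ALL i. polyfn (%u. coeff (G u) i)" "ALL u. degree (G u) <= N"
  using add.IH(2) by (elim exE conjE) (rule that; assumption)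
 have "degree (F u + G u) <= max M N" for u
  by (rule degree_add_le) (use F(3) G(3) in \<open>auto simp: le_max_iff_disj\<close>)
 moreover have "polyfn (%u. coeff (F u + G u) i)" for i
  unfolding coeff_add by (rule polyfn.add[OF spec[OF F(2)] spec[OF G(2)]])
 ultimately show ?case
  by (intro exI[of _ "%u. F u + G u"] exI[of _ "max M N"]) (simp add: F(1) G(1))
next
 case (mult f g)
 obtain F M where F: "ALL u t. f (t *s u) = poly (F u) t" "ALL i. polyfn (%u. coeff (F u) i)" "ALL u. degree (F u) <= M"
  using mult.IH(1) by (elim exE conjE) (rule that; assumption)
 obtain G N where G: "ALL u t. g (t *s u) = poly (G u) t" "ALL i. polyfn (%u. coeff (G u) i)" "ALL u. degree (G u) <= N"
  using mult.IH(2) by (elim exE conjE) (rule that; assumption)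
 have "degree (F u * G u) <= M + N" for u
  using degree_mult_le[of "F u" "G u"] F(3) G(3) by (meson add_mono order_trans)
 moreover have "polyfn (%u. coeff (F u * G u) i)" for i
  unfolding coeff_mult by (intro polyfn_sum polyfn.mult spec[OF F(2)] spec[OF G(2)])
 ultimately show ?case
  by (intro exI[of _ "%u. F u * G u"] exI[of _ "M + N"]) (simp add: F(1) G(1))
qed

lemma poly_eq_sum_le: "degree p <= D ==> poly p x = (\<Sum>i\<le>D. coeff p i * x ^ i)" for p :: "complex poly"
 unfolding poly_altdef by (rule sum.mono_neutral_left) (auto simp: coeff_eq_0)

lemma continuous_on_polyfn: "polyfn f ==> continuous_on S f"
 by (rule hol_imp_continuous_on) (rule polyfn_holomorphic)

text \<open>The direction \<open>v\<close> is chosen where the top homogeneous part of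
  \<open>p\<close> is nonzero. For \<open>t\<close> large compared with \<open>z\<close>, the point
  \<open>z + t *s v\<close> is \<open>t *s w\<close> with \<open>w\<close> close to
  \<open>v\<close>, and there the top part dominates all others.\<close>

lemma line_roots_bound:
 fixes p :: "complex^'n => complex"
 assumes p: "polyfn p" "p z0 ~= 0" and pI: "!!z. p (cproj I z) = p z"
 shows "EX v C. C >= 0 & cproj I v = v & (ALL z t. p (z + t *s v) = 0 --> norm t <= C * (1 + norm z))"
proof -
 obtain H M where H: "ALL u t. p (t *s u) = poly (H u) t" "ALL i. polyfn (%u. coeff (H u) i)" "ALL u. degree (H u) <= M"
  using polyfn_homogeneous_parts[OF p(1)] by (elim exE conjE) (rule that; assumption)
 have "poly (H z0) 1 ~= 0" using p(2) H(1)[rule_format, of 1 z0] by simp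
 then have "H z0 ~= 0" by auto
 moreover have "ALL y. H y ~= 0 --> degree (H y) < Suc M" using H(3) by (simp add: less_Suc_eq_le)
 ultimately have "EX v0. H v0 ~= 0 & (ALL u. H u ~= 0 --> degree (H u) <= degree (H v0))"
  by (rule ex_has_greatest_nat)
 then obtain v0 where v0: "H v0 ~= 0" "ALL u. H u ~= 0 --> degree (H u) <= degree (H v0)" by (elim exE conjE)
 define D where "D = degree (H v0)"
 \<comment> \<open>\<open>p\<close> ignores the coordinates outside \<open>I\<close>, so the
   direction can be projected without changing its polynomial \<open>H\<close>.\<close>
 define v where "v = cproj I v0"
 define h where "h i w = coeff (H w) i" for i w
 have D: "degree (H u) <= D" for u using v0(2)[rule_format, of u] by (cases "H u = 0") (auto simp: D_def)
 have "H v = H v0"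
 proof -
  have "poly (H v) t = poly (H v0) t" for t
   using H(1)[rule_format, of t v] H(1)[rule_format, of t v0] pI[of "t *s v0"] by (simp add: v_def)
  then show ?thesis by (simp add: poly_eq_poly_eq_iff[symmetric] fun_eq_iff)
 qed
 then have hD: "h D v ~= 0" using v0(1) by (simp add: h_def D_def)
 have cont: "continuous_on S (h i)" for i S
  using continuous_on_polyfn[OF spec[OF H(2), of i], of S] by (simp add: h_def[abs_def])
 define c where "c = norm (h D v) / 2"
 have c: "c > 0" using hD by (simp add: c_def)
 have "open ((%w. norm (h D w)) -` {c<..})" by (intro open_vimage open_greaterThan continuous_intros cont)
 moreover have "v : (%w. norm (h D w)) -` {c<..}" using hD by (simp add: c_def)
 ultimately obtain \<delta> where \<delta>: "\<delta> > 0" "cball v \<delta> \<subseteq> (%w. norm (h D w)) -` {c<..}"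
  using open_contains_cball by blast
 have "compact ((%w. \<Sum>i<D. norm (h i w)) ` cball v \<delta>)"
  by (intro compact_continuous_image compact_cball continuous_intros cont)
 from compact_imp_bounded[OF this, unfolded bounded_iff] obtain B
  where "ALL x:(%w. \<Sum>i<D. norm (h i w)) ` cball v \<delta>. norm x <= B" by (elim exE)
 then have B: "\<bar>\<Sum>i<D. norm (h i w)\<bar> <= B" if "w : cball v \<delta>" for w
  using that by (auto simp del: mem_cball)
 have B0: "B >= 0" using B[of v] \<delta>(1) by (meson abs_ge_zero centre_in_cball less_imp_le order_trans)
 have key: "norm t <= B / c" if t: "norm t >= 1" "norm z <= \<delta> * norm t" "p (z + t *s v) = 0" for z t
 proof -
  have t0: "t ~= 0" using t(1) by auto
  define w where "w = v + (1 / t) *s z"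
  have "t *s w = z + t *s v" using t0 by (simp add: w_def vec_eq_iff field_simps)
  then have "poly (H w) t = 0" using H(1)[rule_format, of t w] t(3) by simp
  then have "(\<Sum>i\<le>D. h i w * t ^ i) = 0" using poly_eq_sum_le[OF D, of w t] by (simp add: h_def)
  then have "h D w * t ^ D = - (\<Sum>i<D. h i w * t ^ i)"
   by (simp add: lessThan_Suc_atMost[symmetric] eq_neg_iff_add_eq_0 add.commute)
  then have "norm (h D w) * norm t ^ D = norm (\<Sum>i<D. h i w * t ^ i)"
   by (metis norm_minus_cancel norm_mult norm_power)
  also have "\<dots> <= (\<Sum>i<D. norm (h i w) * norm t ^ i)"
   by (rule order_trans[OF norm_sum]) (simp add: norm_mult norm_power)
  finally have 1: "norm (h D w) * norm t ^ D <= (\<Sum>i<D. norm (h i w) * norm t ^ i)" .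
  have "norm ((1 / t) *s z) <= \<delta>" using t(2) t0 by (simp add: norm_vec_scale norm_divide field_simps)
  then have w: "w : cball v \<delta>" by (simp add: w_def dist_norm)
  have "c * norm t ^ D * norm t <= norm (h D w) * norm t ^ D * norm t"
   using subsetD[OF \<delta>(2) w] by (intro mult_right_mono) auto
  also have "\<dots> <= (\<Sum>i<D. norm (h i w) * norm t ^ i) * norm t" using 1 by (rule mult_right_mono) simp
  also have "\<dots> <= (\<Sum>i<D. norm (h i w)) * norm t ^ D"
   unfolding sum_distrib_right
  proof (rule sum_mono)
   fix i assume "i : {..<D}"
   then have "norm t ^ Suc i <= norm t ^ D" using t(1) by (intro power_increasing) auto
   then have "norm (h i w) * norm t ^ Suc i <= norm (h i w) * norm t ^ D" by (rule mult_left_mono) simp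
   then show "norm (h i w) * norm t ^ i * norm t <= norm (h i w) * norm t ^ D" by (simp add: mult_ac)
  qed
  also have "\<dots> <= B * norm t ^ D" using B[OF w] by (intro mult_right_mono) auto
  finally have "c * norm t * norm t ^ D <= B * norm t ^ D" by (simp add: mult_ac)
  then have "c * norm t <= B" using t0 by (simp add: mult_le_cancel_right)
  then show ?thesis using c by (simp add: field_simps)
 qed
 have "norm t <= (1 + 1 / \<delta> + B / c) * (1 + norm z)" if pz: "p (z + t *s v) = 0" for z t
 proof -
  have pos: "1 / \<delta> >= 0" "B / c >= 0" "norm z >= 0" using \<delta>(1) c B0 by auto
  have nn: "0 <= (1 / \<delta>) * norm z" "0 <= (B / c) * norm z" using pos by (blast intro: mult_nonneg_nonneg)+
  have "norm t < 1 \<or> norm z > \<delta> * norm t \<or> norm t <= B / c" using key[of t z] pz by linarith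
  then have "norm t <= 1 \<or> norm t <= (1 / \<delta>) * norm z \<or> norm t <= B / c"
   using \<delta>(1) by (auto simp: field_simps)
  moreover have "(1 + 1 / \<delta> + B / c) * (1 + norm z) = 1 + norm z + 1 / \<delta> + (1 / \<delta>) * norm z + B / c + (B / c) * norm z"
   by (simp add: algebra_simps)
  ultimately show ?thesis using pos nn by linarith
 qed
 moreover have "1 + 1 / \<delta> + B / c >= 0" using \<delta>(1) c B0 by simp
 moreover have "cproj I v = v" by (simp add: v_def)
 ultimately show ?thesis by (intro exI[of _ v] exI[of _ "1 + 1 / \<delta> + B / c"]) simp
qed

text \<open>The equations of the projection are the norms, over the zeros of \<open>p\<close> on a line parallel to
  \<open>v\<close>, of the polynomials vanishing on \<open>Y\<close>.\<close>

lemma algebraic_set_sweep: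
 fixes v :: "complex^'n"
 assumes Y: "algebraic_set Y" and p: "polyfn p" "!!y. y : Y ==> p y = 0"
  and C: "C >= 0" "!!z t. p (z + t *s v) = 0 ==> norm t <= C * (1 + norm z)"
 shows "algebraic_set {z. EX t. z + t *s v : Y}"
proof -
 obtain F where F: "!!f. f : F ==> polyfn f" "Y = {z. ALL f:F. f z = 0}"
  by (rule algebraic_setE[OF Y]) (rule that; assumption)
 define Z where "Z z = {t. p (z + t *s v) = 0}" for z
 define ord where "ord z t = line_order p v z t" for z t
 have loc: "EX \<delta>>0. EX m. (ALL z:ball b \<delta>. finite (Z z) & (ALL t:Z z. ord z t > 0) & (\<Sum>t\<in>Z z. ord z t) = m) &
   (ALL q. polyfn q --> hol (%z. \<Sum>t\<in>Z z. of_nat (ord z t) * q (z + t *s v)) (ball b \<delta>))" for b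
 proof -
  \<comment> \<open>Above the unit ball around \<open>b\<close> the zeros have size at most
    \<open>C * (2 + norm b)\<close>; the summand \<open>1\<close> puts the circle strictly outside
    them.\<close>
  define r where "r = C * (2 + norm b) + 1"
  have r: "r > 0" using C(1) by (simp add: r_def add_nonneg_pos)
  have nz: "p (b + t *s v) ~= 0" if t: "norm t = r" for t
  proof
   assume "p (b + t *s v) = 0"
   then have "C * (2 + norm b) + 1 <= C * (1 + norm b)" using C(2)[of b t] t by (simp add: r_def)
   then show False using C(1) by (simp add: algebra_simps)
  qed
  obtain \<delta>0 m where \<delta>0: "\<delta>0 > 0" "ALL z:ball b \<delta>0. (ALL t. norm t <= r --> z + t *s v : UNIV) &
   (ALL t. norm t = r --> p (z + t *s v) ~= 0) &
   finite (line_zeros p v r z) & (ALL t:line_zeros p v r z. line_order p v z t > 0) &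
   (\<Sum>t\<in>line_zeros p v r z. line_order p v z t) = m"
   "ALL q. hol q UNIV --> hol
    (%z. \<Sum>t\<in>line_zeros p v r z. of_nat (line_order p v z t) * q (z + t *s v)) (ball b \<delta>0)"
   by (rule exE[OF trace_holomorphic[OF open_UNIV polyfn_holomorphic[OF p(1)] r UNIV_I nz]])
    (assumption, elim exE conjE, (rule that; assumption))
  define \<delta> where "\<delta> = min \<delta>0 1"
  have lz: "line_zeros p v r z = Z z" if z: "z : ball b \<delta>" for z
  proof -
   have "norm z <= 1 + norm b" using z norm_triangle_sub[of z b] by (auto simp: \<delta>_def dist_norm norm_minus_commute)
   then have "C * (1 + norm z) <= C * (2 + norm b)" using C(1) by (intro mult_left_mono) auto
   then have "norm t < r" if "p (z + t *s v) = 0" for t using C(2)[OF that] by (simp add: r_def)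
   then show ?thesis by (auto simp: line_zeros_def Z_def)
  qed
  have sub: "ball b \<delta> \<subseteq> ball b \<delta>0" by (auto simp: \<delta>_def)
  have a1: "hol (%z. \<Sum>t\<in>Z z. of_nat (ord z t) * q (z + t *s v)) (ball b \<delta>)" if q: "polyfn q" for q
  proof (rule hol_cong)
   show "hol (%z. \<Sum>t\<in>line_zeros p v r z. of_nat (line_order p v z t) * q (z + t *s v)) (ball b \<delta>)"
    by (rule hol_on_subset[OF mp[OF spec[OF \<delta>0(3)] polyfn_holomorphic[OF q]] sub])
  qed (simp_all add: lz ord_def)
  have a2: "finite (Z z) & (ALL t:Z z. ord z t > 0) & (\<Sum>t\<in>Z z. ord z t) = m" if z: "z : ball b \<delta>" for z
   using bspec[OF \<delta>0(2) subsetD[OF sub z]] by (simp add: lz[OF z] ord_def)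
  have a3: "\<delta> > 0" using \<delta>0(1) by (simp add: \<delta>_def)
  show ?thesis
   by (rule exI[of _ \<delta>], rule conjI[OF a3], rule exI[of _ m], rule conjI, rule ballI, erule a2, rule allI, rule impI, erule a1)
 qed
 have loc': "EX \<delta>>0. EX m. ALL z:ball b \<delta>. finite (Z z) & (ALL t:Z z. ord z t > 0) & (\<Sum>t\<in>Z z. ord z t) = m" for b
  using loc[of b] by (elim exE conjE) (intro exI conjI; assumption)
 have fp: "finite (Z z) & (ALL t:Z z. ord z t > 0)" for z
 proof -
  obtain \<delta> m where d: "\<delta> > 0" "ALL w:ball z \<delta>. finite (Z w) & (ALL t:Z w. ord w t > 0) & (\<Sum>t\<in>Z w. ord w t) = m"
   using loc'[of z] by (elim exE conjE)
  show ?thesis using bspec[OF d(2), of z] d(1) by simp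
 qed
 have fin: "finite (Z z)" and pos: "!!t. t : Z z ==> ord z t > 0" for z using fp[of z] by auto
 have "thin_complement (UNIV :: (complex^'n) set)"
  unfolding thin_complement_def
 proof (intro conjI allI open_UNIV)
  fix b :: "complex^'n"
  show "EX r>0. EX h p. hol h (ball b r) & p : ball b r & h p ~= 0 & {z:ball b r. h z ~= 0} \<subseteq> UNIV"
   by (rule exI[of _ 1], rule conjI, simp, rule exI[of _ "%z. 1"], rule exI[of _ b]) simp
 qed
 then have "EX k. ALL z:UNIV. (\<Sum>t\<in>Z z. ord z t) = k"
 proof (rule locally_constant_thin)
  fix z
  obtain \<delta> m where d: "\<delta> > 0" "ALL w:ball z \<delta>. finite (Z w) & (ALL t:Z w. ord w t > 0) & (\<Sum>t\<in>Z w. ord w t) = m"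
   using loc'[of z] by (elim exE conjE)
  then have "ALL w:UNIV Int ball z \<delta>. (\<Sum>t\<in>Z w. ord w t) = (\<Sum>t\<in>Z z. ord z t)" by simp
  then show "EX \<epsilon>>0. ALL w:UNIV Int ball z \<epsilon>. (\<Sum>t\<in>Z w. ord w t) = (\<Sum>t\<in>Z z. ord z t)" using d(1) by blast
 qed
 then obtain m where m: "!!z. (\<Sum>t\<in>Z z. ord z t) = m" by blast
 define N where "N q z = coeff (root_poly (Z z) (ord z) (%t. q (z + t *s v))) 0" for q z
 have N: "N q z = (\<Prod>t\<in>Z z. (- q (z + t *s v)) ^ ord z t)" for q z
  unfolding N_def poly_0_coeff_0[symmetric] poly_root_poly by simp
 have N0: "N q z = 0 \<longleftrightarrow> (EX t:Z z. q (z + t *s v) = 0)" for q z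
  unfolding N using fin[of z] pos[of _ z] by (auto simp: prod_zero_iff)
 have Nhol: "hol (N q) UNIV" if q: "polyfn q" for q
 proof (rule hol_local)
  fix b
  obtain \<delta> where \<delta>: "\<delta> > 0" "ALL q. polyfn q --> hol (%z. \<Sum>t\<in>Z z. of_nat (ord z t) * q (z + t *s v)) (ball b \<delta>)"
   using loc[of b] by (elim exE conjE) (rule that; assumption)
  have "hol (%z. coeff (root_poly (Z z) (ord z) (%t. q (z + t *s v))) 0) (ball b \<delta>)"
  proof (rule holomorphic_root_poly_coeff)
   show "hol (%z. \<Sum>a\<in>Z z. of_nat (ord z a) * q (z + a *s v) ^ i) (ball b \<delta>)" for i
    by (rule mp[OF spec[OF \<delta>(2), of "%z. q z ^ i"] polyfn_power[OF q]])
  qed (use fin m in auto)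
  then have "hol (N q) (ball b \<delta>)" by (simp add: N_def[abs_def])
  then show "EX V. open V & b : V & hol (N q) V" using \<delta>(1) by (intro exI[of _ "ball b \<delta>"]) simp
 qed
 have Ngr: "EX M. poly_growth M (N q)" if q: "polyfn q" for q
 proof -
  obtain K where "poly_growth K q" using polyfn_growth[OF q] by blast
  then obtain B where B: "B >= 0" "!!z. norm (q z) <= B * (1 + norm z) ^ K" unfolding poly_growth_def by blast
  define B' where "B' = B * (1 + C * norm v) ^ K"
  have B': "B' >= 0" using B(1) C(1) by (simp add: B'_def)
  have "norm (N q z) <= B' ^ m * (1 + norm z) ^ (K * m)" for z
  proof -
   have qb: "norm (q (z + t *s v)) <= B' * (1 + norm z) ^ K" if t: "t : Z z" for t
   proof -
    have "norm t <= C * (1 + norm z)" using C(2) t by (simp add: Z_def)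
    then have "norm t * norm v <= C * (1 + norm z) * norm v" by (rule mult_right_mono) simp
    then have "1 + norm (z + t *s v) <= (1 + C * norm v) * (1 + norm z)"
     using norm_triangle_ineq[of z "t *s v"] by (simp add: norm_vec_scale algebra_simps)
    then have "(1 + norm (z + t *s v)) ^ K <= ((1 + C * norm v) * (1 + norm z)) ^ K" by (rule power_mono) simp
    from mult_left_mono[OF this B(1)] show ?thesis using B(2)[of "z + t *s v"] by (simp add: B'_def power_mult_distrib mult_ac)
   qed
   have "norm (N q z) = (\<Prod>t\<in>Z z. norm (q (z + t *s v)) ^ ord z t)" by (simp add: N prod_norm[symmetric] norm_power)
   also have "\<dots> <= (\<Prod>t\<in>Z z. (B' * (1 + norm z) ^ K) ^ ord z t)" by (intro prod_mono conjI power_mono qb) auto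
   also have "\<dots> = (B' * (1 + norm z) ^ K) ^ m" by (simp add: power_sum[symmetric] m)
   finally show ?thesis by (simp add: power_mult_distrib power_mult)
  qed
  then have "poly_growth (K * m) (N q)" unfolding poly_growth_def using B' by (intro exI[of _ "B' ^ m"]) simp
  then show ?thesis ..
 qed
 \<comment> \<open>All polynomials vanishing on \<open>Y\<close> are taken, not just a defining
   family: the linear combination adapted to a particular fibre has to be among them.\<close>
 define Q where "Q = {q. polyfn q & (ALL y:Y. q y = 0)}"
 show ?thesis
 proof (rule algebraic_setI[of "N ` Q"])
  fix f assume "f : N ` Q"
  then obtain q where q: "f = N q" "polyfn q" by (auto simp: Q_def)
  obtain M where "poly_growth M (N q)" using Ngr[OF q(2)] by blast
  then show "polyfn f" using polyfn_if_growth[OF Nhol[OF q(2)]] q(1) by blast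
 next
  show "{z. EX t. z + t *s v : Y} = {z. ALL f:N ` Q. f z = 0}"
  proof (intro equalityI subsetI)
   fix z assume "z : {z. EX t. z + t *s v : Y}"
   then obtain t where t: "z + t *s v : Y" by blast
   then have "t : Z z" using p(2) by (simp add: Z_def)
   then have "N q z = 0" if "q : Q" for q using that t by (auto simp: N0 Q_def)
   then show "z : {z. ALL f:N ` Q. f z = 0}" by simp
  next
   fix z assume z: "z : {z. ALL f:N ` Q. f z = 0}"
   show "z : {z. EX t. z + t *s v : Y}"
   proof (rule ccontr)
    assume "z ~: {z. EX t. z + t *s v : Y}"
    then have "ALL t. EX f:F. f (z + t *s v) ~= 0" using F(2) by blast
    then have "ALL t. EX f. f : F & f (z + t *s v) ~= 0" by (simp add: Bex_def)
    from choice[OF this] obtain G where G: "!!t. G t : F" "!!t. G t (z + t *s v) ~= 0" by blast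
    obtain e where e: "bij_betw e {..<card (Z z)} (Z z)"
     using ex_bij_betw_nat_finite[OF fin[of z]] by (auto simp: atLeast0LessThan)
    have "EX \<tau>:of_nat ` {..card (Z z) * card (Z z)}. ALL t:Z z. (\<Sum>i<card (Z z). \<tau> ^ i * G (e i) (z + t *s v)) ~= 0"
    proof (rule norm_of_combination_nonzero[OF fin order_refl])
     fix t assume "t : Z z"
     then obtain i where i: "i < card (Z z)" "e i = t"
      using bij_betw_imp_surj_on[OF e] by (metis imageE lessThan_iff)
     then show "EX i<card (Z z). G (e i) (z + t *s v) ~= 0" using G(2)[of t] by auto
    qed
    then obtain \<tau> :: complex where \<tau>: "!!t. t : Z z ==> (\<Sum>i<card (Z z). \<tau> ^ i * G (e i) (z + t *s v)) ~= 0" by blast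
    define q where "q w = (\<Sum>i<card (Z z). \<tau> ^ i * G (e i) w)" for w
    have "polyfn q" unfolding q_def[abs_def]
     by (intro polyfn_sum polyfn.mult polyfn.const F(1) G(1))
    moreover have "q y = 0" if y: "y : Y" for y
    proof -
     have "G (e i) y = 0" for i using y G(1)[of "e i"] F(2) by blast
     then show ?thesis by (simp add: q_def)
    qed
    ultimately have "N q z = 0" using z by (simp add: Q_def)
    then show False using \<tau> by (auto simp: N0 q_def)
   qed
  qed
 qed
qed

lemma polyfn_cproj:
 assumes "polyfn f"
 shows "polyfn (%z. f (cproj I z))"
 using assms
proof (induction rule: polyfn.induct)
 case (coord i)
 show ?case by (cases "i : I") (simp_all add: polyfn.coord polyfn.const)
qed (rule polyfn.const polyfn.add polyfn.mult; assumption?)+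

text \<open>Choose the number of base coordinates minimal. If the projection were not onto, some
  nonzero polynomial in the base coordinates would vanish on \<open>Y\<close>, and a further
  direction could be projected away with cone position and algebraicity preserved, against
  minimality.\<close>

theorem noether_position:
 fixes X :: "(complex^'n) set"
 assumes X: "algebraic_set X" "X ~= {}"
 shows "EX L L' I. linear_pair L L' & in_cone I (L ` X) & cylinder (- I) (L ` X) = UNIV"
proof -
 define good where "good k \<longleftrightarrow> (EX L L' I. linear_pair L L' & card I = k & in_cone I (L ` X) &
  algebraic_set (cylinder (- I) (L ` X)))" for k
 have "in_cone UNIV X" unfolding in_cone_def by (rule exI[of _ 1]) (simp add: cproj_def)
 then have "good CARD('n)"
  unfolding good_def using X(1) linear_pair_id
  by (intro exI[of _ "%z. z"] exI[of _ UNIV]) simp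
 then have "good (LEAST k. good k)" by (rule LeastI)
 from this[THEN good_def[THEN iffD1]] obtain L L' I where L: "linear_pair L L'" and cI: "card I = (LEAST k. good k)"
  and cone: "in_cone I (L ` X)" and alg: "algebraic_set (cylinder (- I) (L ` X))"
  by (elim exE conjE) (rule that; assumption)
 define X' where "X' = L ` X"
 define Y where "Y = cylinder (- I) X'"
 have Y: "z : Y \<longleftrightarrow> (EX x:X'. cproj I z = cproj I x)" for z by (simp add: Y_def cylinder_def)
 have YI: "cproj I z : Y \<longleftrightarrow> z : Y" for z by (simp add: Y)
 have XY: "X' \<subseteq> Y" by (auto simp: Y)
 have "Y = UNIV"
 proof (rule ccontr)
  assume "Y ~= UNIV"
  then obtain z0 where z0: "cproj I z0 ~: Y" by (auto simp: YI)
  obtain F where F: "!!f. f : F ==> polyfn f" "Y = {z. ALL f:F. f z = 0}"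
   by (rule algebraic_setE[OF alg[folded X'_def, folded Y_def]]) (rule that; assumption)
  then obtain f where f: "f : F" "f (cproj I z0) ~= 0" using z0 by blast
  define p where "p z = f (cproj I z)" for z
  have p: "polyfn p" unfolding p_def[abs_def] by (rule polyfn_cproj[OF F(1)[OF f(1)]])
  have pI: "p (cproj I z) = p z" for z by (simp add: p_def)
  have pY: "p y = 0" if "y : Y" for y using that YI[of y] F(2) f(1) unfolding p_def by blast
  have "p z0 ~= 0" using f(2) by (simp add: p_def)
  from line_roots_bound[OF p this pI] obtain v C where C: "C >= 0" and v: "cproj I v = v"
   and bd: "!!z t. p (z + t *s v) = 0 ==> norm t <= C * (1 + norm z)" by blast
  obtain y0 where y0: "y0 : Y" using X(2) XY by (auto simp: X'_def)
  have "v ~= 0"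
  proof
   assume "v = 0"
   then have "norm t <= C * (1 + norm y0)" for t :: complex using bd[of y0 t] pY[OF y0] by simp
   from this[of "of_real (C * (1 + norm y0) + 1)"] show False using C unfolding norm_of_real by simp
  qed
  then obtain i where i: "v $ i ~= 0" by (auto simp: vec_eq_iff)
  have iI: "i : I"
  proof (rule ccontr)
   assume "i ~: I"
   then have "cproj I v $ i = 0" by simp
   then show False using i v by simp
  qed
  define I' where "I' = I - {i}"
  \<comment> \<open>The shear \<open>L1\<close> takes \<open>v\<close> to the \<open>i\<close>-th
    unit vector, and \<open>L1'\<close> is its inverse. Projecting along \<open>v\<close> thereby
    becomes forgetting the coordinate \<open>i\<close>.\<close>
  define e where "e = v - axis i 1"
  define L1 where "L1 z = z - (z $ i / v $ i) *s e" for z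
  define L1' where "L1' z = z + z $ i *s e" for z
  have L1: "linear_pair L1 L1'"
   unfolding linear_pair_def L1_def L1'_def e_def using i
   by (auto simp: vec_eq_iff field_simps axis_def)
  have L2: "linear_pair (%z. L1 (L z)) (%z. L' (L1' z))" by (rule linear_pair_compose[OF L1 L])
  have im: "(%z. L1 (L z)) ` X = L1 ` X'" by (simp add: X'_def image_image)
  have eI: "cproj I e = e" using iI by (simp add: e_def v) (simp add: vec_eq_iff axis_def)
  have L1I: "cproj I (L1 z) = L1 (cproj I z)" "cproj I (L1' z) = L1' (cproj I z)" for z
   using iI by (simp_all add: L1_def L1'_def eI)
  have dec: "L1' z = cproj (- {i}) z + z $ i *s v" for z
   by (simp add: L1'_def e_def vec_eq_iff axis_def algebra_simps)
  have cyl: "cylinder (- I') (L1 ` X') = L1 ` {z. EX t. z + t *s v : Y}"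
  proof -
   have "z : cylinder (- I') (L1 ` X') \<longleftrightarrow> (EX t. L1' z + t *s v : Y)" for z
   proof
    assume "z : cylinder (- I') (L1 ` X')"
    then obtain x where x: "x : X'" "cproj I' z = cproj I' (L1 x)" by (auto simp: cylinder_def)
    define t where "t = L1 x $ i - z $ i"
    have "cproj I (z + t *s axis i 1) = cproj I (L1 x)"
     using x(2) iI unfolding cproj_eq_iff by (auto simp: t_def axis_def I'_def)
    then have "cproj I (L1' (z + t *s axis i 1)) = cproj I (L1' (L1 x))" by (simp only: L1I)
    moreover have "L1' (z + t *s axis i 1) = L1' z + t *s v"
     by (simp add: L1'_def e_def vec_eq_iff axis_def algebra_simps)
    ultimately have "L1' z + t *s v : Y" using x(1) unfolding Y by (auto simp: linear_pairD(4)[OF L1])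
    then show "EX t. L1' z + t *s v : Y" ..
   next
    assume "EX t. L1' z + t *s v : Y"
    then obtain t x where x: "x : X'" "cproj I (L1' z + t *s v) = cproj I x" unfolding Y by blast
    have "L1' (z + t *s axis i 1) = L1' z + t *s v"
     by (simp add: L1'_def e_def vec_eq_iff axis_def algebra_simps)
    then have "cproj I (L1' (z + t *s axis i 1)) = cproj I x" using x(2) by (simp only:)
    then have "cproj I (L1 (L1' (z + t *s axis i 1))) = cproj I (L1 x)" by (simp only: L1I(1))
    then have "cproj I (z + t *s axis i 1) = cproj I (L1 x)" by (simp only: linear_pairD(3)[OF L1])
    then have "cproj I' z = cproj I' (L1 x)"
     unfolding cproj_eq_iff by (force simp: axis_def I'_def)
    then show "z : cylinder (- I') (L1 ` X')" using x(1) by (auto simp: cylinder_def)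
   qed
   then show ?thesis by (auto simp: linear_pair_image[OF L1])
  qed
  have cone': "in_cone I' (L1 ` X')"
  proof -
   obtain K where K: "K >= 0" "!!x. x : X' ==> norm x <= K * (1 + norm (cproj I x))"
    using cone unfolding in_cone_def X'_def by blast
   obtain B where B: "B > 0" "!!z. norm (L1 z) <= norm z * B"
    using bounded_linear.pos_bounded[OF linear_pair_bounded_linear[OF L1]] by blast
   define K' where "K' = K * (1 + C * norm v) * B"
   have "norm y <= K' * (1 + norm (cproj I' y))" if y: "y : L1 ` X'" for y
   proof -
    define x where "x = L1' y"
    have x: "x : X'" "y = L1 x" using y by (auto simp: x_def linear_pair_image[OF L1] linear_pairD[OF L1])
    have Ix: "cproj I x = cproj I' y + y $ i *s v"
     unfolding x_def dec cproj_add cproj_scale v by (simp add: I'_def Diff_eq)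
    have "p (cproj I' y + y $ i *s v) = 0" using pY[of x] x(1) XY pI[of x] Ix by auto
    then have "norm (y $ i) <= C * (1 + norm (cproj I' y))" by (rule bd)
    then have "norm (y $ i) * norm v <= C * (1 + norm (cproj I' y)) * norm v" by (rule mult_right_mono) simp
    then have "1 + norm (cproj I x) <= (1 + C * norm v) * (1 + norm (cproj I' y))"
     using norm_triangle_ineq[of "cproj I' y" "y $ i *s v"]
     unfolding Ix by (simp add: norm_vec_scale algebra_simps)
    from mult_left_mono[OF this K(1)]
    have "norm x <= K * (1 + C * norm v) * (1 + norm (cproj I' y))" using K(2)[OF x(1)] by (simp add: mult_ac)
    then have "norm x * B <= K * (1 + C * norm v) * (1 + norm (cproj I' y)) * B" using B(1) by (intro mult_right_mono) auto
    then show ?thesis using B(2)[of x] x(2) by (simp add: K'_def mult_ac)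
   qed
   moreover have "K' >= 0" using K(1) C B(1) by (simp add: K'_def)
   ultimately show ?thesis unfolding in_cone_def by blast
  qed
  have "algebraic_set (cylinder (- I') (L1 ` X'))"
   unfolding cyl by (rule algebraic_set_linear_image[OF L1 algebraic_set_sweep[OF _ p pY C bd]])
    (use alg in \<open>simp_all add: Y_def X'_def\<close>)
  then have "good (card I')" unfolding good_def
   by (intro exI[of _ "%z. L1 (L z)"] exI[of _ "%z. L' (L1' z)"] exI[of _ I'] conjI L2) (simp_all add: im cone')
  then have "(LEAST k. good k) <= card I'" by (rule Least_le)
  moreover have "card I' < card I" unfolding I'_def using iI by (intro card_Diff1_less) auto
  ultimately show False using cI by simp
 qed
 then show ?thesis using L cone unfolding Y_def X'_def by blast
qed

section \<open>The dimension of an algebraic set in Noether position\<close>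

lemma open_subset_of_finite_closed_cover:
 assumes "finite A" "open W" "W ~= {}" "W \<subseteq> (\<Union>s\<in>A. K s)" "!!s. s : A ==> open (W - K s)"
 shows "EX s:A. EX N. open N & N ~= {} & N \<subseteq> W Int K s"
 using assms
proof (induction A arbitrary: W rule: finite_induct)
 case (insert s A)
 show ?case
 proof (cases "W - K s = {}")
  case True
  then show ?thesis using insert.prems(1,2) by (intro bexI[of _ s] exI[of _ W]) auto
 next
  case False
  have "open (W - K s - K s')" if "s' : A" for s'
  proof -
   have "W - K s - K s' = (W - K s) Int (W - K s')" by blast
   then show ?thesis using insert.prems(4) that by (metis open_Int insertI1 insertI2)
  qed
  then have "EX s':A. EX N. open N & N ~= {} & N \<subseteq> (W - K s) Int K s'"
   using False insert.prems by (intro insert.IH) auto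
  then show ?thesis by blast
 qed
qed simp

text \<open>Since \<open>s x\<close> and \<open>x\<close> have the same base coordinates,
  \<open>x - s x + cproj I x\<close> subtracts the section from the fibre coordinates only. This
  shear straightens the graph to the coordinate subspace of \<open>I\<close>.\<close>

lemma regular_point_of_graph:
 fixes X :: "(complex^'n) set"
 assumes U: "open U" "a : U" "a : X" and s: "holmap s U" "!!z. s z = s (cproj I z)"
  "!!z. cproj I (s z) = cproj I z"
  and XU: "X Int U = {x:U. x = s x}" and T: "open T" "holmap s T" "U \<subseteq> T" "!!z. cproj I z : T \<longleftrightarrow> z : T"
 shows "a : regular_points X (card I)"
proof -
 define \<phi> where "\<phi> x = x - s x + cproj I x" for x
 define \<psi> where "\<psi> w = w + s w - cproj I w" for w
 have I\<phi>: "cproj I (\<phi> x) = cproj I x" "cproj I (\<psi> x) = cproj I x" for x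
  by (simp_all add: \<phi>_def \<psi>_def s(3))
 have s\<phi>: "s (\<phi> x) = s x" "s (\<psi> x) = s x" for x
  using s(2)[of "\<phi> x"] s(2)[of "\<psi> x"] s(2)[of x] by (simp_all only: I\<phi>)
 have inv: "\<psi> (\<phi> x) = x" "\<phi> (\<psi> x) = x" for x
  unfolding \<psi>_def[of "\<phi> x"] \<phi>_def[of "\<psi> x"] s\<phi> I\<phi> by (simp_all add: \<phi>_def \<psi>_def)
 define V where "V = {w:T. \<psi> w : U}"
 have TT: "\<phi> x : T \<longleftrightarrow> x : T" for x using T(4)[of "\<phi> x"] T(4)[of x] by (simp only: I\<phi>)
 have hol\<psi>: "holmap \<psi> T"
  unfolding holomorphic_map_on_def \<psi>_def vector_add_component vector_minus_component
  using T(2) holmap_cproj[of I T]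
  by (intro allI hol_add hol_diff hol_coord) (simp_all add: holomorphic_map_on_def)
 have hol\<phi>: "holmap \<phi> U"
  unfolding holomorphic_map_on_def \<phi>_def vector_add_component vector_minus_component
  using s(1) holmap_cproj[of I U]
  by (intro allI hol_add hol_diff hol_coord) (simp_all add: holomorphic_map_on_def)
 have V: "open V"
  using continuous_open_preimage[OF holmap_imp_continuous_on[OF hol\<psi>] T(1) U(1)]
  by (simp add: V_def vimage_def Int_def)
 have \<phi>V: "\<phi> x : V" if "x : U" for x using that T(3) by (auto simp: V_def inv TT)
 have bij: "bij_betw \<phi> U V"
  by (rule bij_betw_byWitness[of _ \<psi>]) (use \<phi>V in \<open>auto simp: inv V_def\<close>)
 have inv\<psi>: "inv_into U \<phi> w = \<psi> w" if "w : V" for w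
  by (rule inv_into_f_eq) (use bij that in \<open>auto simp: bij_betw_def V_def inv\<close>)
 have "holmap (inv_into U \<phi>) V"
  unfolding holomorphic_map_on_def
 proof
  fix i
  have "hol (%w. \<psi> w $ i) V"
   using holmap_on_subset[OF hol\<psi>, of V] by (auto simp: V_def holomorphic_map_on_def)
  from hol_cong[OF this V] show "hol (%z. inv_into U \<phi> z $ i) V" by (simp only: inv\<psi>)
 qed
 then have bih: "biholomorphic_on \<phi> U V" unfolding biholomorphic_on_def using U(1) V bij hol\<phi> by blast
 have zero: "(ALL i. i ~: I --> \<phi> x $ i = 0) \<longleftrightarrow> x = s x" for x
 proof -
  have "\<phi> x $ i = x $ i" if "i : I" for i using arg_cong[OF I\<phi>(1)[of x], of "%z. z $ i"] that by simp
  moreover have "s x $ i = x $ i" if "i : I" for i using arg_cong[OF s(3)[of x], of "%z. z $ i"] that by simp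
  moreover have "\<phi> x $ i = x $ i - s x $ i" if "i ~: I" for i using that by (simp add: \<phi>_def)
  ultimately have *: "x $ i = s x $ i \<longleftrightarrow> i : I \<or> \<phi> x $ i = 0" for i by (cases "i : I") auto
  show ?thesis unfolding vec_eq_iff[of x "s x"] * by blast
 qed
 have "\<phi> ` (X Int U) = {w:V. ALL i. i ~: I --> w $ i = 0}"
 proof (intro equalityI subsetI)
  fix w assume "w : \<phi> ` (X Int U)"
  then show "w : {w:V. ALL i. i ~: I --> w $ i = 0}" unfolding XU using \<phi>V zero by blast
 next
  fix w assume w: "w : {w:V. ALL i. i ~: I --> w $ i = 0}"
  then have "\<psi> w = s (\<psi> w)" using zero[of "\<psi> w"] by (simp add: inv)
  then have "\<psi> w : X Int U" unfolding XU using w by (simp add: V_def)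
  then show "w : \<phi> ` (X Int U)" using inv(2)[of w] by (metis imageI)
 qed
 then show ?thesis unfolding regular_points_def mem_Collect_eq
  by (intro conjI U(3) exI[of _ U] exI[of _ V] exI[of _ \<phi>] exI[of _ I] U(2) bih refl)
qed

text \<open>Over an unbranched tube the base is covered by finitely many relatively closed sets, one
  for each sheet, over which that sheet lies in \<open>X\<close>. One of them contains an open set,
  and there \<open>X\<close> is locally the graph of the sheet.\<close>

lemma regular_point_if_projection_onto:
 fixes X :: "(complex^'n) set"
 assumes X: "analytic_subset X" "in_cone I X" and onto: "cylinder (- I) X = UNIV"
 shows "EX p. p : regular_points X (card I)"
proof -
 obtain r h p where "EX \<epsilon>>0. EX A. section_family I p \<epsilon> A & (ALL x:X Int tube I p \<epsilon>. EX s:A. x = s x)"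
  using sheets_exist[OF X, of 0] by (elim exE conjE bexE) (rule that, drule bspec, assumption, erule mp, assumption)
 then obtain \<epsilon> A where e: "\<epsilon> > 0" and A: "section_family I p \<epsilon> A"
  and cov: "ALL x:X Int tube I p \<epsilon>. EX s:A. x = s x"
  by (elim exE conjE) (rule that; assumption)
 let ?T = "tube I p \<epsilon>"
 note AD = section_familyD[OF A]
 have cX: "closed X" by (rule analytic_subset_closed[OF X(1)])
 have op: "open {z:?T. s z ~: X}" if s: "s : A" for s
  using continuous_open_preimage[OF holmap_imp_continuous_on[OF AD(2)[OF s]] open_tube, of "- X"] cX
  by (simp add: Int_def vimage_def open_Compl)
 have cov2: "EX s:A. s z : X" if z: "z : ?T" for z
 proof -
  have "z : cylinder (- I) X" using onto by simp
  then obtain x where x: "x : X" "cproj I z = cproj I x" by (auto simp: cylinder_def)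
  have "x : ?T" using z x(2) by (simp add: tube_def)
  then obtain s where s: "s : A" "x = s x" using bspec[OF cov, of x] x(1) by auto
  have "s x = s z" using AD(3)[OF s(1), of x] AD(3)[OF s(1), of z] by (simp only: x(2))
  then show ?thesis using s x(1) by (intro bexI[of _ s]) auto
 qed
 have "EX s:A. EX N. open N & N ~= {} & N \<subseteq> ?T Int {z. s z : X}"
 proof (rule open_subset_of_finite_closed_cover[OF AD(1) open_tube])
  show "?T ~= {}" using e centre_in_tube[of p I \<epsilon>] by blast
  show "?T \<subseteq> (\<Union>s\<in>A. {z. s z : X})" using cov2 by blast
  show "open (?T - {z. s z : X})" if "s : A" for s using op[OF that] by (simp add: set_diff_eq)
 qed
 then obtain s N z1 where s: "s : A" and N: "open N" "N \<subseteq> ?T" "!!z. z : N ==> s z : X" and z1: "z1 : N" by blast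
 define a where "a = s z1"
 have Ia: "cproj I a = cproj I z1" unfolding a_def by (rule AD(4)[OF s])
 have sa: "s a = a" using AD(3)[OF s, of a] AD(3)[OF s, of z1] unfolding Ia by (simp add: a_def)
 have aT: "a : ?T" using z1 N(2) by (auto simp: tube_def Ia)
 \<comment> \<open>\<open>x - a + z1\<close> has the same base coordinates as \<open>x\<close>, so
   the condition on \<open>N\<close> puts \<open>s x\<close> into \<open>X\<close>. The last
   condition leaves out the other sheets.\<close>
 define U where "U = ?T Int (%x. x - a + z1) -` N Int (\<Inter>s'\<in>A - {s}. {x:?T. s' x - x ~= 0})"
 have "open {x:?T. s' x - x ~= 0}" if s': "s' : A" for s'
 proof -
  have "continuous_on ?T (%x. s' x - x)" by (intro continuous_intros holmap_imp_continuous_on[OF AD(2)[OF s']])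
  from continuous_open_preimage[OF this open_tube open_Compl[OF closed_singleton[of 0]]] show ?thesis by (simp add: Int_def vimage_def)
 qed
 moreover have "open ((%x. x - a + z1) -` N)" by (intro open_vimage N(1) continuous_intros)
 ultimately have U: "open U" unfolding U_def using AD(1) by (intro open_Int open_INT) auto
 have "a : U" unfolding U_def using aT z1 AD(5)[OF _ s _ aT] sa by auto
 moreover have "a : X" unfolding a_def by (rule N(3)[OF z1])
 moreover have "X Int U = {x:U. x = s x}"
 proof (intro equalityI subsetI)
  fix x assume x: "x : X Int U"
  then obtain s' where s': "s' : A" "x = s' x" using bspec[OF cov, of x] by (auto simp: U_def)
  have "s' = s"
  proof (rule ccontr)
   assume "s' ~= s"
   then have "s' : A - {s}" using s'(1) by simp
   then have "s' x - x ~= 0" using x unfolding U_def by blast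
   then show False unfolding s'(2)[symmetric] by simp
  qed
  then show "x : {x:U. x = s x}" using s' x by simp
 next
  fix x assume x: "x : {x:U. x = s x}"
  then have "s (x - a + z1) : X" by (intro N(3)) (simp add: U_def)
  moreover have "s (x - a + z1) = s x"
   using AD(3)[OF s, of "x - a + z1"] AD(3)[OF s, of x] by (simp add: Ia)
  ultimately show "x : X Int U" using x by simp
 qed
 moreover have "U \<subseteq> ?T" by (auto simp: U_def)
 ultimately have "a : regular_points X (card I)"
  by (intro regular_point_of_graph[OF U _ _ _ AD(3)[OF s] AD(4)[OF s] _ open_tube AD(2)[OF s]]
    holmap_on_subset[OF AD(2)[OF s]]) simp_all
 then show ?thesis ..
qed

text \<open>The number of coordinates in Noether position is \<open>d\<close>: a regular point of
  dimension \<open>card I\<close> gives \<open>card I <= d\<close> by purity, and a regular point of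
  dimension \<open>d\<close> cannot project properly to fewer than \<open>d\<close>
  coordinates.\<close>

theorem algebraic_in_cone:
 fixes X :: "(complex^'n) set"
 assumes X: "pure_analytic_set d X" "algebraic_set X"
 shows "EX L L' I. linear_pair L L' & card I = d & in_cone I (L ` X)"
proof -
 have ne: "X ~= {}" and an: "analytic_subset X" using X(1) by (auto simp: pure_analytic_set_def)
 obtain L L' I where L: "linear_pair L L'" and cone: "in_cone I (L ` X)" and onto: "cylinder (- I) (L ` X) = UNIV"
  using noether_position[OF X(2) ne] by (elim exE conjE) (rule that; assumption)
 have anL: "analytic_subset (L ` X)" by (rule analytic_subset_linear_image[OF L an])
 obtain p where p: "p : regular_points (L ` X) (card I)" using regular_point_if_projection_onto[OF anL cone onto] by blast
 have "L' p : regular_points (L' ` L ` X) (card I)" by (rule regular_points_linear_image[OF linear_pairD(5)[OF L] p])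
 then have p': "L' p : regular_points X (card I)" by (simp only: linear_pair_image_image[OF L])
 then have "L' p : X" by (simp add: regular_points_def)
 then have le: "card I <= d" using pure_closure_regular(2)[OF X(1)] p' closure_subset by blast
 obtain x where x: "x : X" using ne by blast
 have "x : closure (regular_points X d)" by (rule pure_closure_regular(1)[OF X(1) x])
 then obtain q where "q : regular_points X d" by (metis closure_empty empty_iff equals0I)
 then have "L q : regular_points (L ` X) d" by (rule regular_points_linear_image[OF L])
 from projection_of_regular_part[OF anL cone this open_UNIV UNIV_I le] have "card I = d" by blast
 then show ?thesis using L cone by (intro exI[of _ L] exI[of _ L'] exI[of _ I]) simp
qed

section \<open>The Riemannian distance on projective space\<close>

definition herm :: "complex^'n => complex^'n => complex" where
 "herm z w = (\<Sum>i\<in>UNIV. z $ i * cnj (w $ i))"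

lemma herm_simps:
 fixes z w z' w' :: "complex^'n"
 shows "herm (z + z') w = herm z w + herm z' w" "herm (z - z') w = herm z w - herm z' w" "herm (c *s z) w = c * herm z w"
  "herm z (w + w') = herm z w + herm z w'" "herm z (w - w') = herm z w - herm z w'" "herm z (c *s w) = cnj c * herm z w"
 by (simp_all add: herm_def algebra_simps sum.distrib sum_subtractf sum_distrib_left)

lemma cnj_herm: "cnj (herm z w) = herm w z"
 by (simp add: herm_def mult.commute)

lemma herm_self: "herm z z = of_real ((norm z)\<^sup>2)"
proof -
 have "(norm z)\<^sup>2 = (\<Sum>i\<in>UNIV. (norm (z $ i))\<^sup>2)" by (simp add: norm_vec_def L2_set_def sum_nonneg)
 then show ?thesis unfolding herm_def complex_norm_square[symmetric] by (simp only: of_real_sum)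
qed

text \<open>The component of \<open>w\<close> orthogonal to \<open>z\<close>. It represents the
  tangent vector of projective space, as the metric ignores the component along
  \<open>z\<close>.\<close>

definition perp :: "complex^'n => complex^'n => complex^'n" where
 "perp z w = w - (herm w z / of_real ((norm z)\<^sup>2)) *s z"

lemma herm_perp: "z ~= 0 ==> herm (perp z w) z = 0"
 by (simp add: perp_def herm_simps herm_self)

lemma continuous_on_herm:
 assumes "continuous_on S f" "continuous_on S g"
 shows "continuous_on S (%x. herm (f x) (g x))"
 unfolding herm_def
 by (intro continuous_intros bounded_linear.continuous_on[OF bounded_linear_vec_nth] assms)

lemma of_real_scale: "complex_of_real r *s x = r *\<^sub>R x" for x :: "complex^'n"
 by (rule scaleR_vec_eq[symmetric])

section \<open>Comparison of an invariant metric with the Hermitian norm\<close>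

lemma metricD:
 assumes "projective_riemannian_metric g" "z ~= 0"
 shows "bilinear (g z)" "!!u v. g z u v = g z v u" "!!u. g z u u >= 0"
  "!!u. g z u u = 0 \<longleftrightarrow> u : complex_line z" "!!c u v. c ~= 0 ==> g (c *s z) (c *s u) (c *s v) = g z u v"
 using assms unfolding projective_riemannian_metric_def by blast+

text \<open>A null vector of a positive semidefinite form pairs trivially with every vector.
  Otherwise the form at \<open>y + t *\<^sub>R x\<close> is affine in \<open>t\<close> with nonzero
  slope, and the chosen \<open>t\<close> gives it the value \<open>- 1\<close>.\<close>

lemma metric_kernel:
 assumes g: "projective_riemannian_metric g" "z ~= 0" and x: "x : complex_line z"
 shows "g z x y = 0"
proof (rule ccontr)
 assume a: "g z x y ~= 0"
 note b = metricD(1)[OF g]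
 define t where "t = - (g z y y + 1) / (2 * g z x y)"
 have "g z x x = 0" using metricD(4)[OF g] x by blast
 then have "g z (y + t *\<^sub>R x) (y + t *\<^sub>R x) = g z y y + 2 * t * g z x y"
  using metricD(2)[OF g, of y x] by (simp add: bilinear_ladd[OF b] bilinear_radd[OF b] bilinear_lmul[OF b] bilinear_rmul[OF b])
 also have "\<dots> = - 1" using a by (simp add: t_def field_simps)
 finally show False using metricD(3)[OF g, of "y + t *\<^sub>R x"] by simp
qed

lemma metric_perp:
 assumes g: "projective_riemannian_metric g" "z ~= 0"
 shows "g z (perp z w) (perp z w) = g z w w"
proof -
 note b = metricD(1)[OF g]
 define x where "x = (herm w z / of_real ((norm z)\<^sup>2)) *s z"
 have x: "x : complex_line z" by (auto simp: x_def complex_line_def)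
 have "g z x y = 0" "g z y x = 0" for y using metric_kernel[OF g x, of y] metricD(2)[OF g, of y x] by auto
 moreover have "perp z w = w - x" by (simp add: perp_def x_def)
 ultimately show ?thesis by (simp add: bilinear_lsub[OF b] bilinear_rsub[OF b])
qed

lemma continuous_metric:
 assumes g: "projective_riemannian_metric g"
  and f: "continuous_on S f" "continuous_on S h" "!!x. x : S ==> f x ~= 0"
 shows "continuous_on S (%x. g (f x) (h x) (h x))"
proof -
 have c: "continuous_on (- {0}) (%z. g z u v)" for u v
 proof -
  have "ALL u v. smooth_on (- {0}) (%z. g z u v)"
   using g unfolding projective_riemannian_metric_def by (rule conjunct2)
  then have "smooth_on (- {0}) (%z. g z u v)" by (elim allE)
  then have "Ck_on 0 (- {0}) (%z. g z u v)" unfolding smooth_on_def by (rule spec)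
  then show ?thesis by simp
 qed
 have eq: "(\<Sum>(b, b')\<in>Basis \<times> Basis. (h x \<bullet> b') * ((h x \<bullet> b) * g (f x) b b')) = g (f x) (h x) (h x)" if "x : S" for x
 proof -
  note b = metricD(1)[OF g f(3)[OF that]]
  have "g (f x) (h x) (h x) = g (f x) (\<Sum>b\<in>Basis. (h x \<bullet> b) *\<^sub>R b) (\<Sum>b\<in>Basis. (h x \<bullet> b) *\<^sub>R b)"
   by (simp only: euclidean_representation)
  also have "\<dots> = (\<Sum>(b, b')\<in>Basis \<times> Basis. g (f x) ((h x \<bullet> b) *\<^sub>R b) ((h x \<bullet> b') *\<^sub>R b'))"
   by (rule bilinear_sum[OF b])
  finally show ?thesis by (simp add: bilinear_lmul[OF b] bilinear_rmul[OF b])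
 qed
 have "continuous_on S (%x. \<Sum>(b, b')\<in>Basis \<times> Basis. (h x \<bullet> b') * ((h x \<bullet> b) * g (f x) b b'))"
  unfolding case_prod_unfold
  by (intro continuous_intros f(2) continuous_on_compose2[OF c f(1)]) (use f(3) in auto)
 then show ?thesis by (rule continuous_on_eq) (simp add: eq)
qed

lemma metric_normalize:
 assumes g: "projective_riemannian_metric g" "z ~= 0" and x: "x ~= 0"
 shows "g z x x * (norm z)\<^sup>2 = (norm x)\<^sup>2 * g (inverse (norm z) *\<^sub>R z) (inverse (norm x) *\<^sub>R x) (inverse (norm x) *\<^sub>R x)"
proof -
 let ?c = "of_real (inverse (norm z)) :: complex" and ?z = "inverse (norm z) *\<^sub>R z"
 have z': "?z ~= 0" using g(2) by simp
 note b = metricD(1)[OF g(1) z']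
 have "?c ~= 0" using g(2) by simp
 from metricD(5)[OF g this, of x x]
 have "g z x x = g ?z (inverse (norm z) *\<^sub>R x) (inverse (norm z) *\<^sub>R x)" by (simp only: of_real_scale)
 also have "\<dots> = (inverse (norm z))\<^sup>2 * g ?z x x"
  by (simp add: bilinear_lmul[OF b] bilinear_rmul[OF b] power2_eq_square)
 finally have 1: "g z x x * (norm z)\<^sup>2 = g ?z x x" using g(2) by (simp add: field_simps)
 have "g ?z (inverse (norm x) *\<^sub>R x) (inverse (norm x) *\<^sub>R x) = (inverse (norm x))\<^sup>2 * g ?z x x"
  by (simp add: bilinear_lmul[OF b] bilinear_rmul[OF b] power2_eq_square)
 moreover have "(norm x)\<^sup>2 * (inverse (norm x))\<^sup>2 = 1" using x by (simp add: power_mult_distrib[symmetric])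
 ultimately have "(norm x)\<^sup>2 * g ?z (inverse (norm x) *\<^sub>R x) (inverse (norm x) *\<^sub>R x) = g ?z x x"
  by (metis mult.assoc mult_1)
 then show ?thesis using 1 by simp
qed

text \<open>Both estimates are homogeneous in \<open>z\<close> and in \<open>w\<close>, so they
  reduce to compact sets of unit vectors. Positivity on orthogonal pairs gives \<open>m\<close> and
  boundedness gives \<open>C\<close>; this compares \<open>g\<close> with the Fubini-Study
  metric.\<close>

lemma metric_bounds:
 fixes g :: "complex^'n => complex^'n => complex^'n => real"
 assumes g: "projective_riemannian_metric g"
 shows "EX m C. m > 0 & C >= 0 & (ALL z w. z ~= 0 -->
  m * (norm (perp z w))\<^sup>2 <= g z w w * (norm z)\<^sup>2 & g z w w * (norm z)\<^sup>2 <= C * (norm w)\<^sup>2)"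
proof -
 define S where "S = (sphere 0 1 \<times> sphere 0 1 :: ((complex^'n) \<times> (complex^'n)) set)"
 define S0 where "S0 = S Int {p. herm (snd p) (fst p) = 0}"
 define G where "G p = g (fst p) (snd p) (snd p)" for p
 have S: "compact S" by (simp add: S_def compact_Times)
 have "closed {p :: (complex^'n) \<times> (complex^'n). herm (snd p) (fst p) = 0}"
  by (intro closed_Collect_eq continuous_on_herm continuous_intros)
 then have S0: "compact S0" unfolding S0_def by (rule compact_Int_closed[OF S])
 have G: "continuous_on S G" unfolding G_def
  by (rule continuous_metric[OF g]) (auto simp: S_def intro!: continuous_intros)
 have pos: "G p > 0" if p: "p : S0" for p
 proof -
  have z: "fst p ~= 0" using p by (auto simp: S0_def S_def)
  have "snd p ~: complex_line (fst p)"
  proof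
   assume "snd p : complex_line (fst p)"
   then obtain c where c: "snd p = c *s fst p" by (auto simp: complex_line_def)
   then have "c = 0" using p z by (auto simp: S0_def herm_simps herm_self)
   then show False using c p by (auto simp: S0_def S_def)
  qed
  then show ?thesis using metricD(3,4)[OF g z, of "snd p"] by (simp add: G_def less_le)
 qed
 obtain m where m: "m > 0" "!!p. p : S0 ==> m <= G p"
 \<comment> \<open>When the space has complex dimension one there are no orthogonal unit vectors,
   and any positive \<open>m\<close> will do.\<close>
 proof (cases "S0 = {}")
  case True
  then show ?thesis using that[of 1] by auto
 next
  case False
  then obtain p0 where "p0 : S0" "ALL p:S0. G p0 <= G p"
   using continuous_attains_inf[OF S0 _ continuous_on_subset[OF G]] unfolding S0_def by blast
  then show ?thesis using that[of "G p0"] pos by blast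
 qed
 obtain C where "ALL x:G ` S. norm x <= C"
  using compact_imp_bounded[OF compact_continuous_image[OF G S]] unfolding bounded_iff by (rule exE)
 then have C: "G p <= C" if "p : S" for p
  using that by (metis abs_le_D1 imageI real_norm_def)
 have "m * (norm (perp z w))\<^sup>2 <= g z w w * (norm z)\<^sup>2 & g z w w * (norm z)\<^sup>2 <= max C 0 * (norm w)\<^sup>2" if z: "z ~= 0" for z w
 proof
  show "m * (norm (perp z w))\<^sup>2 <= g z w w * (norm z)\<^sup>2"
  proof (cases "perp z w = 0")
   case True
   then show ?thesis using metricD(3)[OF g z] by simp
  next
   case False
   let ?p = "(inverse (norm z) *\<^sub>R z, inverse (norm (perp z w)) *\<^sub>R perp z w)"
   have "herm (snd ?p) (fst ?p) = 0"
    unfolding fst_conv snd_conv scaleR_vec_eq herm_simps herm_perp[OF z] by simp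
   then have "?p : S0" using z False by (simp add: S0_def S_def)
   then have "m <= G ?p" by (rule m(2))
   then have "m * (norm (perp z w))\<^sup>2 <= (norm (perp z w))\<^sup>2 * G ?p"
    using mult_left_mono[OF _ zero_le_power2[of "norm (perp z w)"]] by (simp only: mult.commute[of m])
   also have "\<dots> = g z (perp z w) (perp z w) * (norm z)\<^sup>2" using metric_normalize[OF g z False] by (simp add: G_def)
   finally show ?thesis by (simp add: metric_perp[OF g z])
  qed
  show "g z w w * (norm z)\<^sup>2 <= max C 0 * (norm w)\<^sup>2"
  proof (cases "w = 0")
   case True
   then show ?thesis using bilinear_lzero[OF metricD(1)[OF g z]] by simp
  next
   case False
   let ?p = "(inverse (norm z) *\<^sub>R z, inverse (norm w) *\<^sub>R w)"
   have "?p : S" using z False by (simp add: S_def)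
   then have "G ?p <= max C 0" using C by fastforce
   then have "(norm w)\<^sup>2 * G ?p <= (norm w)\<^sup>2 * max C 0" by (rule mult_left_mono) simp
   then show ?thesis using metric_normalize[OF g z False] by (simp add: G_def mult.commute)
  qed
 qed
 then show ?thesis using m(1) by (intro exI[of _ m] exI[of _ "max C 0"]) simp
qed

section \<open>Lengths of curves and distance estimates\<close>

lemma curve_lengthE:
 assumes g: "projective_riemannian_metric g" and \<gamma>: "\<gamma> C1_differentiable_on {0..1}" "0 ~: \<gamma> ` {0..1}"
 obtains D where "!!t. t : {0..1} ==> (\<gamma> has_vector_derivative D t) (at t)"
  "(%t. sqrt (g (\<gamma> t) (D t) (D t))) integrable_on {0..1}"
  "curve_length g \<gamma> = integral {0..1} (%t. sqrt (g (\<gamma> t) (D t) (D t)))"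
proof -
 obtain D where D: "!!t. t : {0..1} ==> (\<gamma> has_vector_derivative D t) (at t)" "continuous_on {0..1} D"
  using \<gamma>(1) unfolding C1_differentiable_on_def by blast
 have c\<gamma>: "continuous_on {0..1} \<gamma>"
  by (intro continuous_at_imp_continuous_on ballI has_vector_derivative_continuous[OF D(1)])
 have "continuous_on {0..1} (%t. sqrt (g (\<gamma> t) (D t) (D t)))"
  by (intro continuous_intros continuous_metric[OF g c\<gamma> D(2)]) (use \<gamma>(2) in force)
 then have int: "(%t. sqrt (g (\<gamma> t) (D t) (D t))) integrable_on {0..1}" by (rule integrable_continuous_real)
 have len: "curve_length g \<gamma> = integral {0..1} (%t. sqrt (g (\<gamma> t) (D t) (D t)))"
  unfolding curve_length_def by (rule integral_cong) (simp add: vector_derivative_at[OF D(1)])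
 show thesis by (rule that[of D]) (erule D(1), rule int, rule len)
qed

lemma has_vector_derivative_divide_complex:
 fixes f h :: "real => complex"
 assumes "(f has_vector_derivative f') (at t)" "(h has_vector_derivative h') (at t)" "h t ~= 0"
 shows "((%t. f t / h t) has_vector_derivative (f' * h t - f t * h') / (h t * h t)) (at t)"
proof -
 have "((%t. f t / h t) has_derivative (%x. ((x *\<^sub>R f') * h t - f t * (x *\<^sub>R h')) / (h t * h t))) (at t)"
  using assms unfolding has_vector_derivative_def by (intro has_derivative_divide')
 moreover have "(%x. ((x *\<^sub>R f') * h t - f t * (x *\<^sub>R h')) / (h t * h t)) = (%x. x *\<^sub>R ((f' * h t - f t * h') / (h t * h t)))"
  by (simp add: scaleR_conv_of_real algebra_simps diff_divide_distrib)
 ultimately show ?thesis unfolding has_vector_derivative_def by simp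
qed

text \<open>The entries of the orthogonal projection onto the line through \<open>z\<close> separate lines.\<close>

definition proj_entry :: "'n => 'n => complex^'n => complex" where
 "proj_entry i j z = z $ i * cnj (z $ j) / herm z z"

lemma proj_entry_scale: "c ~= 0 ==> proj_entry i j (c *s z) = proj_entry i j z"
 by (simp add: proj_entry_def herm_simps)

text \<open>Along a lifted curve the entries of the projection change only through the velocity
  component orthogonal to the curve point, which the metric bounds from below. Integrating the
  derivative compares the change with the length.\<close>

lemma proj_entry_curve:
 assumes g: "projective_riemannian_metric g"
  and m: "m > 0" "!!z w. z ~= 0 ==> m * (norm (perp z w))\<^sup>2 <= g z w w * (norm z)\<^sup>2"
  and \<gamma>: "\<gamma> C1_differentiable_on {0..1}" "0 ~: \<gamma> ` {0..1}"
 shows "norm (proj_entry i j (\<gamma> 1) - proj_entry i j (\<gamma> 0)) <= 2 / sqrt m * curve_length g \<gamma>"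
proof -
 obtain D where D: "!!t. t : {0..1} ==> (\<gamma> has_vector_derivative D t) (at t)"
  "(%t. sqrt (g (\<gamma> t) (D t) (D t))) integrable_on {0..1}"
  "curve_length g \<gamma> = integral {0..1} (%t. sqrt (g (\<gamma> t) (D t) (D t)))"
  by (rule curve_lengthE[OF g \<gamma>]) (rule that; assumption)
 define P where "P t = perp (\<gamma> t) (D t)" for t
 define E where "E t = (P t $ i * cnj (\<gamma> t $ j) + \<gamma> t $ i * cnj (P t $ j)) / herm (\<gamma> t) (\<gamma> t)" for t
 have der: "((%t. proj_entry i j (\<gamma> t)) has_vector_derivative E t) (at t)" if t: "t : {0..1}" for t
 proof -
  have nz: "\<gamma> t ~= 0" using \<gamma>(2) t by force
  have c: "((%t. \<gamma> t $ k) has_vector_derivative D t $ k) (at t)" for k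
   by (rule bounded_linear.has_vector_derivative[OF bounded_linear_vec_nth D(1)[OF t]])
  have cc: "((%t. cnj (\<gamma> t $ k)) has_vector_derivative cnj (D t $ k)) (at t)" for k
   by (rule bounded_linear.has_vector_derivative[OF bounded_linear_cnj c])
  have hh: "((%t. herm (\<gamma> t) (\<gamma> t)) has_vector_derivative (herm (\<gamma> t) (D t) + herm (D t) (\<gamma> t))) (at t)"
   unfolding herm_def sum.distrib[symmetric]
   by (intro has_vector_derivative_sum has_vector_derivative_mult c cc)
  have h0: "herm (\<gamma> t) (\<gamma> t) ~= 0" using nz by (simp add: herm_self)
  have der: "((%t. proj_entry i j (\<gamma> t)) has_vector_derivative
   ((\<gamma> t $ i * cnj (D t $ j) + D t $ i * cnj (\<gamma> t $ j)) * herm (\<gamma> t) (\<gamma> t)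
     - (\<gamma> t $ i * cnj (\<gamma> t $ j)) * (herm (\<gamma> t) (D t) + herm (D t) (\<gamma> t))) / (herm (\<gamma> t) (\<gamma> t) * herm (\<gamma> t) (\<gamma> t))) (at t)"
   unfolding proj_entry_def
   by (intro has_vector_derivative_divide_complex has_vector_derivative_mult c cc hh h0)
  have Pk: "P t $ k = D t $ k - herm (D t) (\<gamma> t) / herm (\<gamma> t) (\<gamma> t) * \<gamma> t $ k" for k
   by (simp add: P_def perp_def herm_self)
  have cPk: "cnj (P t $ k) = cnj (D t $ k) - herm (\<gamma> t) (D t) / herm (\<gamma> t) (\<gamma> t) * cnj (\<gamma> t $ k)" for k
   by (simp add: P_def perp_def herm_self cnj_herm)
  have alg: "((x * d' + d * y) * h - (x * y) * (b + a)) / (h * h) = ((d - a / h * x) * y + x * (d' - b / h * y)) / h"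
   if "h ~= 0" for x y d d' a b h :: complex using that by (simp add: field_simps)
  show ?thesis using der unfolding alg[OF h0] E_def unfolding cPk unfolding Pk .
 qed
 have bd: "norm (E t) <= 2 / sqrt m * sqrt (g (\<gamma> t) (D t) (D t))" if t: "t : {0..1}" for t
 proof -
  have nz: "\<gamma> t ~= 0" using \<gamma>(2) t by force
  have "norm (P t $ i * cnj (\<gamma> t $ j) + \<gamma> t $ i * cnj (P t $ j)) <= norm (P t) * norm (\<gamma> t) + norm (\<gamma> t) * norm (P t)"
   by (rule norm_triangle_le, unfold norm_mult complex_mod_cnj)
    (intro add_mono mult_mono Finite_Cartesian_Product.norm_nth_le norm_ge_zero)
  then have 1: "norm (E t) <= 2 * norm (P t) / norm (\<gamma> t)"
  proof -
   have "norm (herm (\<gamma> t) (\<gamma> t)) = norm (\<gamma> t) * norm (\<gamma> t)"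
    unfolding herm_self norm_of_real by (simp add: power2_eq_square)
   then show ?thesis using \<open>norm (P t $ i * cnj (\<gamma> t $ j) + \<gamma> t $ i * cnj (P t $ j)) <= _\<close> nz
    by (simp add: E_def norm_divide field_simps)
  qed
  have "m * (norm (P t))\<^sup>2 <= g (\<gamma> t) (D t) (D t) * (norm (\<gamma> t))\<^sup>2" unfolding P_def by (rule m(2)[OF nz])
  then have "sqrt (m * (norm (P t))\<^sup>2) <= sqrt (g (\<gamma> t) (D t) (D t) * (norm (\<gamma> t))\<^sup>2)" by simp
  then have "sqrt m * norm (P t) <= sqrt (g (\<gamma> t) (D t) (D t)) * norm (\<gamma> t)" by (simp add: real_sqrt_mult)
  then have "2 * norm (P t) / norm (\<gamma> t) <= 2 / sqrt m * sqrt (g (\<gamma> t) (D t) (D t))"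
   using nz m(1) by (simp add: field_simps)
  then show ?thesis using 1 by simp
 qed
 have "(E has_integral (proj_entry i j (\<gamma> 1) - proj_entry i j (\<gamma> 0))) {0..1}"
  by (rule fundamental_theorem_of_calculus) (auto intro!: has_vector_derivative_at_within[OF der])
 then have E: "E integrable_on {0..1}" "integral {0..1} E = proj_entry i j (\<gamma> 1) - proj_entry i j (\<gamma> 0)"
  by (auto simp: has_integral_integrable_integral)
 have "norm (integral {0..1} E) <= integral {0..1} (%t. 2 / sqrt m * sqrt (g (\<gamma> t) (D t) (D t)))"
  by (intro integral_norm_bound_integral E(1) bd integrable_on_mult_right D(2))
 also have "\<dots> = 2 / sqrt m * curve_length g \<gamma>" unfolding D(3) by (rule integral_mult_right)
 finally show ?thesis unfolding E(2) .
qed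

text \<open>The straight segment joins the lines unless it meets the origin; in that case the
  vectors are proportional and a constant curve works. The infimum in \<open>riemannian_dist\<close>
  is thus over a nonempty set.\<close>

lemma curve_between_lines:
 fixes u w :: "complex^'n"
 assumes u: "u ~= 0" "w ~= 0"
 shows "EX \<gamma>. \<gamma> C1_differentiable_on {0..1} & 0 ~: \<gamma> ` {0..1} & \<gamma> 0 : complex_line u & \<gamma> 1 : complex_line w"
proof (cases "0 : (%t. u + t *\<^sub>R (w - u)) ` {0..1}")
 case True
 then obtain t where t: "u + t *\<^sub>R (w - u) = 0" by force
 have t0: "t ~= 0" using t u by auto
 have "t *\<^sub>R w = (t - 1) *\<^sub>R u" using t by (simp add: algebra_simps)
 then have "inverse t *\<^sub>R (t *\<^sub>R w) = inverse t *\<^sub>R ((t - 1) *\<^sub>R u)" by simp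
 then have "w = of_real (inverse t * (t - 1)) *s u" using t0 by (simp only: of_real_scale) simp
 then have "w : complex_line u" by (auto simp: complex_line_def)
 moreover have "w : complex_line w" unfolding complex_line_def by (rule range_eqI[of _ _ 1]) simp
 ultimately show ?thesis using u by (intro exI[of _ "%t. w"]) auto
next
 case False
 have "u : complex_line u" "w : complex_line w" unfolding complex_line_def by (rule range_eqI[of _ _ 1], simp)+
 moreover have "(%t. u + t *\<^sub>R (w - u)) C1_differentiable_on {0..1}"
  unfolding C1_differentiable_on_def by (rule exI[of _ "%t. w - u"]) (auto intro!: derivative_eq_intros)
 ultimately show ?thesis using False by (intro exI[of _ "%t. u + t *\<^sub>R (w - u)"]) auto
qed

lemma norm_vec_le_sum: "norm y <= (\<Sum>i\<in>UNIV. norm (y $ i))" for y :: "complex^'n"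
 unfolding norm_vec_def by (rule L2_set_le_sum) simp

text \<open>The phase \<mu> aligns \<open>u\<close> with \<open>w\<close>, so the squared distance
  becomes \<open>2 - 2 * norm c\<close>. The vector \<open>y\<close> is the difference of the two
  orthogonal projections applied to \<open>u\<close> and has squared norm
  \<open>1 - (norm c)\<^sup>2\<close>; the two quantities are compared using
  \<open>norm c <= 1\<close>.\<close>

lemma unit_vectors_close:
 fixes u w :: "complex^'n"
 assumes u: "norm u = 1" "norm w = 1"
 shows "EX \<mu>. norm \<mu> = 1 & norm (w - \<mu> *s u) <= 2 * (\<Sum>i\<in>UNIV. \<Sum>j\<in>UNIV. norm (proj_entry i j w - proj_entry i j u))"
proof -
 define c where "c = herm u w"
 define y where "y = c *s w - u"
 have nsq: "complex_of_real ((norm z)\<^sup>2) = herm z z" for z :: "complex^'n" by (simp add: herm_self)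
 have cc: "c * cnj c = of_real ((norm c)\<^sup>2)" by (simp only: complex_norm_square)
 have h: "herm u u = 1" "herm w w = 1" "herm w u = cnj c" "herm u w = c"
  using u by (simp_all add: herm_self c_def cnj_herm)
 have "complex_of_real ((norm y)\<^sup>2) = of_real (1 - (norm c)\<^sup>2)"
  unfolding nsq y_def herm_simps h using cc by (simp add: algebra_simps)
 then have y2: "(norm y)\<^sup>2 = 1 - (norm c)\<^sup>2" by (simp only: of_real_eq_iff)
 then have csq: "(norm c)\<^sup>2 <= 1" by (metis diff_ge_0_iff_ge zero_le_power2)
 then have c1: "norm c <= 1" by (metis norm_ge_zero one_power2 power2_le_imp_le zero_le_one)
 define \<mu> where "\<mu> = (if c = 0 then 1 else cnj c / of_real (norm c))"
 have l1: "norm \<mu> = 1" by (simp add: \<mu>_def norm_divide)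
 have lc: "cnj \<mu> * cnj c = of_real (norm c)" "\<mu> * c = of_real (norm c)"
  using cc by (auto simp: \<mu>_def field_simps power2_eq_square)
 have ll: "\<mu> * cnj \<mu> = 1" using l1 by (metis complex_norm_square of_real_1 one_power2)
 have "complex_of_real ((norm (w - \<mu> *s u))\<^sup>2) = of_real (2 - 2 * norm c)"
  unfolding nsq herm_simps h using lc ll by (simp add: algebra_simps)
 then have "(norm (w - \<mu> *s u))\<^sup>2 = 2 - 2 * norm c" by (simp only: of_real_eq_iff)
 also have "\<dots> <= 2 * (1 - (norm c)\<^sup>2)"
  using mult_left_mono[OF c1 norm_ge_zero[of c]] by (simp add: power2_eq_square)
 also have "\<dots> <= (2 * norm y)\<^sup>2" using y2 csq by (simp add: power_mult_distrib)
 finally have wy: "norm (w - \<mu> *s u) <= 2 * norm y" by (rule power2_le_imp_le) simp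
 have yi: "y $ i = (\<Sum>j\<in>UNIV. (proj_entry i j w - proj_entry i j u) * u $ j)" for i
 proof -
  have "(\<Sum>j\<in>UNIV. (proj_entry i j w - proj_entry i j u) * u $ j)
   = w $ i * (\<Sum>j\<in>UNIV. u $ j * cnj (w $ j)) - u $ i * (\<Sum>j\<in>UNIV. u $ j * cnj (u $ j))"
   unfolding sum_distrib_left sum_subtractf[symmetric]
   by (rule sum.cong) (simp_all add: proj_entry_def h algebra_simps)
  then show ?thesis by (simp add: y_def herm_def[symmetric] h mult.commute)
 qed
 have "norm (y $ i) <= (\<Sum>j\<in>UNIV. norm (proj_entry i j w - proj_entry i j u))" for i
  unfolding yi
 proof (rule order_trans[OF norm_sum], rule sum_mono)
  fix j
  have "norm (u $ j) <= 1" using Finite_Cartesian_Product.norm_nth_le[where x = u and i = j] u by simp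
  then show "norm ((proj_entry i j w - proj_entry i j u) * u $ j) <= norm (proj_entry i j w - proj_entry i j u)"
   by (simp add: norm_mult mult_left_le)
 qed
 then have "norm y <= (\<Sum>i\<in>UNIV. \<Sum>j\<in>UNIV. norm (proj_entry i j w - proj_entry i j u))"
  using norm_vec_le_sum[of y] by (meson order_trans sum_mono)
 then show ?thesis using wy l1 by (intro exI[of _ \<mu>]) linarith
qed

text \<open>Unit representatives of a line are determined up to a phase, hence \<mu>. Every
  admissible curve is at least as long as a multiple of the difference of the projection entries,
  and this passes to the infimum.\<close>

lemma riemannian_dist_lower:
 fixes g :: "complex^'n => complex^'n => complex^'n => real"
 assumes g: "projective_riemannian_metric g"
 shows "EX C>0. ALL u w. norm u = 1 & norm w = 1 -->
  (EX \<mu>. norm \<mu> = 1 & norm (w - \<mu> *s u) <= C * riemannian_dist g (complex_line u) (complex_line w))"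
proof -
 obtain m C0 where m: "m > 0" "!!z w. z ~= 0 ==> m * (norm (perp z w))\<^sup>2 <= g z w w * (norm z)\<^sup>2"
  using metric_bounds[OF g] by blast
 define N where "N = real CARD('n) * real CARD('n) * (2 / sqrt m)"
 have N: "N > 0" using m(1) by (simp add: N_def)
 have "EX \<mu>. norm \<mu> = 1 & norm (w - \<mu> *s u) <= 2 * N * riemannian_dist g (complex_line u) (complex_line w)"
  if u: "norm u = 1" "norm w = 1" for u w :: "complex^'n"
 proof -
  define s where "s = (\<Sum>i\<in>UNIV. \<Sum>j\<in>UNIV. norm (proj_entry i j w - proj_entry i j u))"
  have "s / N <= riemannian_dist g (complex_line u) (complex_line w)"
   unfolding riemannian_dist_def
  proof (rule cInf_greatest)
   show "curve_length g ` {\<gamma>. \<gamma> C1_differentiable_on {0..1} & 0 ~: \<gamma> ` {0..1} & \<gamma> 0 : complex_line u & \<gamma> 1 : complex_line w} ~= {}"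
    using curve_between_lines[of u w] u by fastforce
   fix l assume "l : curve_length g ` {\<gamma>. \<gamma> C1_differentiable_on {0..1} & 0 ~: \<gamma> ` {0..1} & \<gamma> 0 : complex_line u & \<gamma> 1 : complex_line w}"
   then obtain \<gamma> where l: "l = curve_length g \<gamma>" and \<gamma>: "\<gamma> C1_differentiable_on {0..1}" "0 ~: \<gamma> ` {0..1}"
    "\<gamma> 0 : complex_line u" "\<gamma> 1 : complex_line w" by blast
   obtain a b where ab: "\<gamma> 0 = a *s u" "\<gamma> 1 = b *s w" using \<gamma>(3,4) by (auto simp: complex_line_def)
   have "\<gamma> 0 ~= 0" "\<gamma> 1 ~= 0" using \<gamma>(2) by (metis atLeastAtMost_iff imageI order_refl zero_le_one)+
   then have "a ~= 0" "b ~= 0" using ab by auto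
   then have "norm (proj_entry i j w - proj_entry i j u) <= 2 / sqrt m * l" for i j
    using proj_entry_curve[OF g m \<gamma>(1,2), of i j] by (simp add: ab proj_entry_scale l)
   then have "s <= (\<Sum>i\<in>(UNIV :: 'n set). \<Sum>j\<in>(UNIV :: 'n set). 2 / sqrt m * l)" unfolding s_def by (intro sum_mono)
   then have "s <= N * l" by (simp add: N_def)
   then show "s / N <= l" using N by (simp add: field_simps)
  qed
  then have "s <= N * riemannian_dist g (complex_line u) (complex_line w)" using N by (simp add: field_simps)
  then show ?thesis using unit_vectors_close[OF u, folded s_def] by force
 qed
 then show ?thesis using N by (intro exI[of _ "2 * N"]) simp
qed

text \<open>The straight segment is a competitor in the infimum. The metric scales inversely with
  the norm of the base point, so its length is controlled by the distance \<eta> that it keeps from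
  the origin.\<close>

lemma riemannian_dist_upper:
 fixes g :: "complex^'n => complex^'n => complex^'n => real"
 assumes g: "projective_riemannian_metric g"
 shows "EX C>=0. ALL u w \<eta>. \<eta> > 0 & (ALL t. \<eta> <= norm (u + t *\<^sub>R (w - u))) -->
  riemannian_dist g (complex_line u) (complex_line w) <= C / \<eta> * norm (u - w)"
proof -
 obtain m C where C: "C >= 0" "!!z w. z ~= 0 ==> g z w w * (norm z)\<^sup>2 <= C * (norm w)\<^sup>2"
  using metric_bounds[OF g] by blast
 have "riemannian_dist g (complex_line u) (complex_line w) <= sqrt C / \<eta> * norm (u - w)"
  if \<eta>: "\<eta> > 0" and u: "!!t. \<eta> <= norm (u + t *\<^sub>R (w - u))" for u w :: "complex^'n" and \<eta>
 proof -
  define \<gamma> where "\<gamma> t = u + t *\<^sub>R (w - u)" for t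
  have d: "(\<gamma> has_vector_derivative (w - u)) (at t)" for t
   unfolding \<gamma>_def by (auto intro!: derivative_eq_intros)
  have C1: "\<gamma> C1_differentiable_on {0..1}"
   unfolding C1_differentiable_on_def by (rule exI[of _ "%t. w - u"]) (simp add: d)
  have n1: "\<eta> <= norm (\<gamma> t)" for t using u[of t] by (simp add: \<gamma>_def)
  have g0: "\<gamma> t ~= 0" for t using n1[of t] \<eta> by auto
  have z: "0 ~: \<gamma> ` {0..1}" using g0 by (metis imageE)
  obtain D where D: "!!t. t : {0..1} ==> (\<gamma> has_vector_derivative D t) (at t)"
   "(%t. sqrt (g (\<gamma> t) (D t) (D t))) integrable_on {0..1}"
   "curve_length g \<gamma> = integral {0..1} (%t. sqrt (g (\<gamma> t) (D t) (D t)))"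
   by (rule curve_lengthE[OF g C1 z]) (rule that; assumption)
  have "integral {0..1} (%t. sqrt (g (\<gamma> t) (D t) (D t))) <= integral {0..1} (%t::real. sqrt C / \<eta> * norm (u - w))"
  proof (rule integral_le[OF D(2)])
   fix t :: real assume t: "t : {0..1}"
   have "D t = w - u" by (rule vector_derivative_unique_at[OF D(1)[OF t] d])
   moreover have "g (\<gamma> t) (w - u) (w - u) * \<eta>\<^sup>2 <= C * (norm (w - u))\<^sup>2"
   proof -
    have "\<eta>\<^sup>2 <= (norm (\<gamma> t))\<^sup>2" using n1[of t] \<eta> by (intro power_mono) auto
    then have "g (\<gamma> t) (w - u) (w - u) * \<eta>\<^sup>2 <= g (\<gamma> t) (w - u) (w - u) * (norm (\<gamma> t))\<^sup>2"
     by (rule mult_left_mono) (rule metricD(3)[OF g g0])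
    then show ?thesis using C(2)[OF g0[of t], of "w - u"] by simp
   qed
   ultimately have "sqrt (g (\<gamma> t) (D t) (D t) * \<eta>\<^sup>2) <= sqrt (C * (norm (w - u))\<^sup>2)" by simp
   then have "sqrt (g (\<gamma> t) (D t) (D t)) * \<eta> <= sqrt C * norm (u - w)"
    using \<eta> by (simp add: real_sqrt_mult norm_minus_commute)
   then show "sqrt (g (\<gamma> t) (D t) (D t)) <= sqrt C / \<eta> * norm (u - w)" using \<eta> by (simp add: field_simps)
  qed (simp add: integrable_const_ivl)
  then have len: "curve_length g \<gamma> <= sqrt C / \<eta> * norm (u - w)" unfolding D(3) by simp
  have mem: "\<gamma> : {\<gamma>. \<gamma> C1_differentiable_on {0..1} & 0 ~: \<gamma> ` {0..1} & \<gamma> 0 : complex_line u & \<gamma> 1 : complex_line w}"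
  proof -
   have "\<gamma> 0 = 1 *s u" "\<gamma> 1 = 1 *s w" by (simp_all add: \<gamma>_def)
   then have "\<gamma> 0 : complex_line u" "\<gamma> 1 : complex_line w" unfolding complex_line_def by blast+
   then show ?thesis using C1 z by blast
  qed
  have "bdd_below (curve_length g ` {\<gamma>. \<gamma> C1_differentiable_on {0..1} & 0 ~: \<gamma> ` {0..1} & \<gamma> 0 : complex_line u & \<gamma> 1 : complex_line w})"
  proof (rule bdd_belowI2[of _ 0])
   fix \<beta> assume b: "\<beta> : {\<gamma>. \<gamma> C1_differentiable_on {0..1} & 0 ~: \<gamma> ` {0..1} & \<gamma> 0 : complex_line u & \<gamma> 1 : complex_line w}"
   then have b': "\<beta> C1_differentiable_on {0..1}" "0 ~: \<beta> ` {0..1}" by simp_all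
   obtain D where D: "(%t. sqrt (g (\<beta> t) (D t) (D t))) integrable_on {0..1}"
    "curve_length g \<beta> = integral {0..1} (%t. sqrt (g (\<beta> t) (D t) (D t)))"
    by (rule curve_lengthE[OF g b']) (rule that; assumption)
   show "0 <= curve_length g \<beta>" unfolding D(2)
   proof (rule integral_nonneg[OF D(1)])
    fix t :: real assume "t : {0..1}"
    then have "\<beta> t ~= 0" using b by force
    then show "0 <= sqrt (g (\<beta> t) (D t) (D t))" using metricD(3)[OF g] by simp
   qed
  qed
  from cInf_lower[OF imageI[OF mem] this] show ?thesis using len unfolding riemannian_dist_def by linarith
 qed
 then show ?thesis using C(1) by (intro exI[of _ "sqrt C"]) auto
qed

section \<open>Hausdorff null sets\<close>

lemma hausdorff_null_cover:
 assumes "hausdorff_measure M \<rho> s A = 0" "\<delta> > 0" "e > 0"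
 shows "EX U :: nat => 'a set. (ALL i. U i \<subseteq> M & ediam \<rho> (U i) <= ennreal \<delta>) & A \<subseteq> (\<Union>i. U i) &
  suminf (%i. diam_power \<rho> s (U i)) < ennreal e"
proof -
 have "hausdorff_premeasure M \<rho> s \<delta> A <= hausdorff_measure M \<rho> s A"
  unfolding hausdorff_measure_def by (rule SUP_upper) (use assms in simp)
 then have "hausdorff_premeasure M \<rho> s \<delta> A < ennreal e" using assms by simp
 then have "EX U:{U :: nat => 'a set. (ALL i. U i \<subseteq> M & ediam \<rho> (U i) <= ennreal \<delta>) & A \<subseteq> (\<Union>i. U i)}.
   suminf (%i. diam_power \<rho> s (U i)) < ennreal e"
  unfolding hausdorff_premeasure_def INF_less_iff .
 then show ?thesis by (elim bexE CollectE conjE) (intro exI conjI; assumption)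
qed

lemma hausdorff_nullI:
 assumes "!!\<delta> e :: real. \<delta> > 0 ==> e > 0 ==> EX U :: nat => 'a set. (ALL i. U i \<subseteq> M & ediam \<rho> (U i) <= ennreal \<delta>) &
  A \<subseteq> (\<Union>i. U i) & suminf (%i. diam_power \<rho> s (U i)) <= ennreal e"
 shows "hausdorff_measure M \<rho> s A = 0"
proof -
 have "hausdorff_premeasure M \<rho> s \<delta> A <= 0" if d: "\<delta> > 0" for \<delta>
 proof (rule ennreal_le_epsilon)
  fix e :: real assume e: "e > 0"
  obtain U :: "nat => 'a set" where U: "ALL i. U i \<subseteq> M & ediam \<rho> (U i) <= ennreal \<delta>" "A \<subseteq> (\<Union>i. U i)"
   "suminf (%i. diam_power \<rho> s (U i)) <= ennreal e"
   using assms[OF d e] by (elim exE conjE) (rule that; assumption)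
  have "hausdorff_premeasure M \<rho> s \<delta> A <= suminf (%i. diam_power \<rho> s (U i))"
   unfolding hausdorff_premeasure_def by (rule INF_lower) (use U(1,2) in simp)
  then show "hausdorff_premeasure M \<rho> s \<delta> A <= 0 + ennreal e" using U(3) by simp
 qed
 then have "hausdorff_measure M \<rho> s A <= 0" unfolding hausdorff_measure_def by (intro SUP_least) simp
 then show ?thesis by simp
qed

lemma hausdorff_null_subset:
 assumes "hausdorff_measure M \<rho> s B = 0" "A \<subseteq> B"
 shows "hausdorff_measure M \<rho> s A = 0"
proof (rule hausdorff_nullI)
 fix \<delta> e :: real assume "\<delta> > 0" "e > 0"
 from hausdorff_null_cover[OF assms(1) this] obtain U :: "nat => 'a set" where
  U: "ALL i. U i \<subseteq> M & ediam \<rho> (U i) <= ennreal \<delta>" "B \<subseteq> (\<Union>i. U i)" "suminf (%i. diam_power \<rho> s (U i)) < ennreal e"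
  by (elim exE conjE) (rule that; assumption)
 then show "EX U :: nat => 'a set. (ALL i. U i \<subseteq> M & ediam \<rho> (U i) <= ennreal \<delta>) &
  A \<subseteq> (\<Union>i. U i) & suminf (%i. diam_power \<rho> s (U i)) <= ennreal e"
  by (intro exI[of _ U] conjI order_trans[OF assms(2) U(2)] less_imp_le[OF U(3)])
qed

lemma diam_power_mono:
 assumes "ediam \<rho> U <= ennreal 1" "0 <= s" "s <= s'"
 shows "diam_power \<rho> s' U <= diam_power \<rho> s U"
proof -
 have d: "enn2real (ediam \<rho> U) <= 1" "enn2real (ediam \<rho> U) >= 0" using assms(1) by (auto intro: enn2real_leI)
 have "enn2real (ediam \<rho> U) powr s' <= enn2real (ediam \<rho> U) powr s" using d assms by (intro powr_mono')
 moreover have "enn2real (ediam \<rho> U) powr s' <= 1" using d assms by (intro powr_le1) auto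
 ultimately show ?thesis using assms by (auto simp: diam_power_def intro!: ennreal_leI simp flip: ennreal_1)
qed

lemma hausdorff_null_mono:
 assumes A: "hausdorff_measure M \<rho> s A = 0" and s: "0 <= s" "s <= s'"
 shows "hausdorff_measure M \<rho> s' A = 0"
proof (rule hausdorff_nullI)
 fix \<delta> e :: real assume d: "\<delta> > 0" "e > 0"
 \<comment> \<open>Raising the exponent decreases the power only for diameters at most
   \<open>1\<close>.\<close>
 have "min \<delta> 1 > 0" using d by simp
 from hausdorff_null_cover[OF A this d(2)] obtain U :: "nat => 'a set" where
  U: "ALL i. U i \<subseteq> M & ediam \<rho> (U i) <= ennreal (min \<delta> 1)" "A \<subseteq> (\<Union>i. U i)" "suminf (%i. diam_power \<rho> s (U i)) < ennreal e"
  by (elim exE conjE) (rule that; assumption)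
 have U1: "ediam \<rho> (U i) <= ennreal \<delta>" "ediam \<rho> (U i) <= ennreal 1" for i
  using order_trans[OF conjunct2[OF spec[OF U(1)]] ennreal_leI[of "min \<delta> 1" \<delta>]]
   order_trans[OF conjunct2[OF spec[OF U(1)]] ennreal_leI[of "min \<delta> 1" 1]] by auto
 have "suminf (%i. diam_power \<rho> s' (U i)) <= suminf (%i. diam_power \<rho> s (U i))"
  by (intro suminf_le diam_power_mono U1 s) auto
 then have "suminf (%i. diam_power \<rho> s' (U i)) <= ennreal e" using U(3) by simp
 then show "EX U :: nat => 'a set. (ALL i. U i \<subseteq> M & ediam \<rho> (U i) <= ennreal \<delta>) &
  A \<subseteq> (\<Union>i. U i) & suminf (%i. diam_power \<rho> s' (U i)) <= ennreal e"
  using U1(1) U(1,2) by (intro exI[of _ U]) simp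
qed

lemma hausdorff_null_UN:
 assumes A: "!!n :: nat. hausdorff_measure M \<rho> s (A n) = 0"
 shows "hausdorff_measure M \<rho> s (\<Union>n. A n) = 0"
proof (rule hausdorff_nullI)
 fix \<delta> e :: real assume d: "\<delta> > 0" "e > 0"
 have "ALL n. EX U :: nat => 'a set. (ALL i. U i \<subseteq> M & ediam \<rho> (U i) <= ennreal \<delta>) & A n \<subseteq> (\<Union>i. U i) &
  suminf (%i. diam_power \<rho> s (U i)) < ennreal (e * (1 / 2) ^ Suc n)"
  by (intro allI hausdorff_null_cover[OF A d(1)]) (use d in simp)
 from choice[OF this] obtain U where U: "ALL n. (ALL i. U n i \<subseteq> M & ediam \<rho> (U n i) <= ennreal \<delta>) & A n \<subseteq> (\<Union>i. U n i) &
  suminf (%i. diam_power \<rho> s (U n i)) < ennreal (e * (1 / 2) ^ Suc n)" by (elim exE)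
 define V where "V i = (%(n, k). U n k) (prod_decode i)" for i :: nat
 have "suminf (%i. diam_power \<rho> s (V i)) = suminf (%n. suminf (%i. diam_power \<rho> s (U n i)))"
  using suminf_ennreal_2dimen[of "%n. suminf (%i. diam_power \<rho> s (U n i))" "%(n, k). diam_power \<rho> s (U n k)"]
  by (simp add: V_def case_prod_unfold)
 also have "\<dots> <= suminf (%n. ennreal (e * (1 / 2) ^ Suc n))"
 proof (rule suminf_le)
  fix n
  show "suminf (%i. diam_power \<rho> s (U n i)) <= ennreal (e * (1 / 2) ^ Suc n)"
   using conjunct2[OF conjunct2[OF spec[OF U, of n]]] by (rule less_imp_le)
 qed auto
 also have "\<dots> = ennreal e"
  using sums_mult[OF power_half_series, of e] d by (intro suminf_ennreal_eq) auto
 finally have 1: "suminf (%i. diam_power \<rho> s (V i)) <= ennreal e" .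
 have 2: "ALL i. V i \<subseteq> M & ediam \<rho> (V i) <= ennreal \<delta>"
  using conjunct1[OF spec[OF U]] by (simp add: V_def case_prod_unfold)
 have 3: "(\<Union>n. A n) \<subseteq> (\<Union>i. V i)"
 proof
  fix x assume "x : (\<Union>n. A n)"
  then obtain n where "x : A n" by blast
  then obtain k where "x : U n k" using conjunct1[OF conjunct2[OF spec[OF U, of n]]] by blast
  then have "x : V (prod_encode (n, k))" by (simp add: V_def)
  then show "x : (\<Union>i. V i)" by blast
 qed
 show "EX U :: nat => 'a set. (ALL i. U i \<subseteq> M & ediam \<rho> (U i) <= ennreal \<delta>) &
  (\<Union>n. A n) \<subseteq> (\<Union>i. U i) & suminf (%i. diam_power \<rho> s (U i)) <= ennreal e"
  by (intro exI[of _ V] conjI 1 2 3)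
qed

lemma hausdorff_null_countable_UN:
 assumes J: "countable J" and A: "!!j. j : J ==> hausdorff_measure M \<rho> s (A j) = 0"
 shows "hausdorff_measure M \<rho> s (\<Union>j\<in>J. A j) = 0"
proof (cases "J = {}")
 case True
 show ?thesis
 proof (rule hausdorff_nullI)
  fix \<delta> e :: real assume "e > 0"
  then show "EX U :: nat => 'b set. (ALL i. U i \<subseteq> M & ediam \<rho> (U i) <= ennreal \<delta>) &
   (\<Union>j\<in>J. A j) \<subseteq> (\<Union>i. U i) & suminf (%i. diam_power \<rho> s (U i)) <= ennreal e"
   using True by (intro exI[of _ "%i. {}"]) (simp add: ediam_def diam_power_def bot_ennreal)
 qed
next
 case False
 have "hausdorff_measure M \<rho> s (\<Union>n. A (from_nat_into J n)) = 0"
  by (rule hausdorff_null_UN) (rule A[OF from_nat_into[OF False]])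
 moreover have "(\<Union>j\<in>J. A j) \<subseteq> (\<Union>n. A (from_nat_into J n))"
  using from_nat_into_surj[OF J] by blast
 ultimately show ?thesis by (rule hausdorff_null_subset)
qed

text \<open>Box counting: at most \<open>K * N ^ D\<close> sets of diameter at most
  \<open>c / N\<close> have a total \<open>s\<close>-power of order \<open>N powr (D - s)\<close>,
  which tends to zero for \<open>s > D\<close>.\<close>

lemma hausdorff_null_finite_covers:
 fixes K c :: real and D :: nat
 assumes s: "real D < s" and c: "c > 0"
  and cov: "!!N :: nat. N >= 1 ==> EX F. finite F & real (card F) <= K * real N ^ D & A \<subseteq> \<Union>F &
   (ALL U:F. U \<subseteq> M & (ALL x:U. ALL y:U. \<rho> x y <= c / real N))"
 shows "hausdorff_measure M \<rho> s A = 0"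
proof (rule hausdorff_nullI)
 fix \<delta> e :: real assume d: "\<delta> > 0" "e > 0"
 have s0: "s > 0" using s by simp
 have "((%N. real N powr (real D - s)) \<longlongrightarrow> 0) sequentially"
  by (rule tendsto_neg_powr) (use s in \<open>auto intro: filterlim_real_sequentially\<close>)
 from tendsto_mult[OF tendsto_const[of "K * c powr s"] this]
 have "((%N. K * c powr s * real N powr (real D - s)) \<longlongrightarrow> 0) sequentially" by simp
 then have ev1: "\<forall>\<^sub>F N in sequentially. K * c powr s * real N powr (real D - s) < e" using d(2) by (rule order_tendstoD)
 have "((%N. c / real N) \<longlongrightarrow> 0) sequentially" by (rule lim_const_over_n)
 then have ev2: "\<forall>\<^sub>F N in sequentially. c / real N < \<delta>" using d(1) by (rule order_tendstoD)
 have "\<forall>\<^sub>F N in sequentially. K * c powr s * real N powr (real D - s) < e & c / real N < \<delta> & 1 <= N"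
  using ev1 ev2 eventually_ge_at_top[of "1::nat"] by eventually_elim simp
 then obtain N where N: "K * c powr s * real N powr (real D - s) < e" "c / real N < \<delta>" "1 <= N"
  by (auto simp: eventually_sequentially)
 obtain F where F: "finite F" "real (card F) <= K * real N ^ D" "A \<subseteq> \<Union>F" "ALL U:F. U \<subseteq> M & (ALL x:U. ALL y:U. \<rho> x y <= c / real N)"
  using cov[OF N(3)] by (elim exE conjE) (rule that; assumption)
 obtain f where f: "bij_betw f {..<card F} F" using ex_bij_betw_nat_finite[OF F(1)] by (auto simp: atLeast0LessThan)
 define U where "U i = (if i < card F then f i else {})" for i
 have UF: "f i : F" if "i < card F" for i using f that by (auto simp: bij_betw_def)
 have dm: "ediam \<rho> (U i) <= ennreal (c / real N)" for i
  unfolding ediam_def using F(4) UF[of i] by (intro SUP_least ennreal_leI) (auto simp: U_def split: if_splits)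
 have "suminf (%i. diam_power \<rho> s (U i)) = (\<Sum>i<card F. diam_power \<rho> s (U i))"
  by (rule suminf_finite) (auto simp: U_def diam_power_def)
 also have "\<dots> <= (\<Sum>i<card F. ennreal ((c / real N) powr s))"
 proof (rule sum_mono)
  fix i
  have "enn2real (ediam \<rho> (U i)) <= c / real N" using dm[of i] c by (intro enn2real_leI) auto
  then have "enn2real (ediam \<rho> (U i)) powr s <= (c / real N) powr s" using s0 by (intro powr_mono2) auto
  then show "diam_power \<rho> s (U i) <= ennreal ((c / real N) powr s)" using s0 by (auto simp: diam_power_def intro: ennreal_leI)
 qed
 also have "\<dots> = ennreal (real (card F) * (c / real N) powr s)"
  by (simp add: ennreal_mult ennreal_of_nat_eq_real_of_nat)
 also have "\<dots> <= ennreal e"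
 proof (rule ennreal_leI)
  have "real (card F) * (c / real N) powr s <= K * real N ^ D * (c / real N) powr s" by (rule mult_right_mono[OF F(2)]) simp
  also have "\<dots> = K * c powr s * real N powr (real D - s)"
   using N(3) c by (simp add: powr_divide powr_diff powr_realpow)
  finally show "real (card F) * (c / real N) powr s <= e" using N(1) by simp
 qed
 finally have 1: "suminf (%i. diam_power \<rho> s (U i)) <= ennreal e" .
 have "ediam \<rho> (U i) <= ennreal \<delta>" for i by (rule order_trans[OF dm ennreal_leI]) (use N(2) in simp)
 moreover have "U i \<subseteq> M" for i using F(4) UF[of i] by (auto simp: U_def)
 moreover have "A \<subseteq> (\<Union>i. U i)"
 proof
  fix x assume "x : A"
  then obtain W where W: "W : F" "x : W" using F(3) by blast
  then obtain i where "i < card F" "f i = W" using bij_betw_imp_surj_on[OF f] by (metis imageE lessThan_iff)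
  then have "x : U i" using W by (simp add: U_def)
  then show "x : (\<Union>i. U i)" by blast
 qed
 ultimately show "EX U :: nat => 'a set. (ALL i. U i \<subseteq> M & ediam \<rho> (U i) <= ennreal \<delta>) &
  A \<subseteq> (\<Union>i. U i) & suminf (%i. diam_power \<rho> s (U i)) <= ennreal e"
  using 1 by (intro exI[of _ U]) simp
qed

lemma hausdorff_dim_ge:
 assumes "hausdorff_measure M \<rho> s A ~= 0"
 shows "hausdorff_dim M \<rho> A >= ereal s"
 unfolding hausdorff_dim_def
proof (rule Inf_greatest)
 fix x assume "x : {ereal s |s. 0 <= s & hausdorff_measure M \<rho> s A = 0}"
 then obtain t where t: "x = ereal t" "0 <= t" "hausdorff_measure M \<rho> t A = 0" by blast
 have "\<not> t <= s" using hausdorff_null_mono[OF t(3,2)] assms by blast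
 then show "ereal s <= x" using t(1) by simp
qed

lemma hausdorff_dim_le:
 assumes "!!s. s > t ==> hausdorff_measure M \<rho> s A = 0" "t >= 0"
 shows "hausdorff_dim M \<rho> A <= ereal t"
proof (rule ereal_le_epsilon2)
 fix e :: real assume "0 < e"
 then have "ereal (t + e) : {ereal s |s. 0 <= s & hausdorff_measure M \<rho> s A = 0}" using assms by auto
 then have "hausdorff_dim M \<rho> A <= ereal (t + e)" unfolding hausdorff_dim_def by (rule Inf_lower)
 then show "hausdorff_dim M \<rho> A <= ereal t + ereal e" by simp
qed

section \<open>Projections transverse to the asymptotic directions\<close>

text \<open>If the cone bound failed, points of \<open>X\<close> would escape to infinity with
  projections of smaller order. A limit of their normalised directions would be a nonzero asymptotic
  direction whose image under \<open>L\<close> has vanishing coordinates in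
  \<open>I\<close>.\<close>

lemma in_cone_if_transverse:
 fixes L :: "complex^'n => complex^'n"
 assumes L: "bounded_linear L" and tr: "!!u. u : tangent_cone_inf X ==> u ~= 0 ==> cproj I (L u) ~= 0"
 shows "in_cone I (L ` X)"
proof (rule ccontr)
 assume no: "\<not> in_cone I (L ` X)"
 interpret L: bounded_linear L by (rule L)
 have "ALL j::nat. EX x. x : X & norm (L x) > real j * (1 + norm (cproj I (L x)))"
 proof
  fix j :: nat
  show "EX x. x : X & norm (L x) > real j * (1 + norm (cproj I (L x)))"
  proof (rule ccontr)
   assume "\<nexists>x. x : X & norm (L x) > real j * (1 + norm (cproj I (L x)))"
   then have "ALL y:L ` X. norm y <= real j * (1 + norm (cproj I y))" by (auto simp: not_less)
   then have "in_cone I (L ` X)" unfolding in_cone_def by (intro exI[of _ "real j"]) simp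
   then show False using no by simp
  qed
 qed
 from choice[OF this] obtain x where x: "!!j. x j : X" "!!j. norm (L (x j)) > real j * (1 + norm (cproj I (L (x j))))" by blast
 obtain B where B: "B > 0" "!!z. norm (L z) <= norm z * B" using L.pos_bounded by blast
 have gr: "norm (x j) >= real j / B" for j
 proof -
  have "real j * 1 <= real j * (1 + norm (cproj I (L (x j))))" by (rule mult_left_mono) auto
  then have "real j <= norm (x j) * B" using x(2)[of j] B(2)[of "x j"] by simp
  then show ?thesis using B(1) by (simp add: field_simps)
 qed
 have x0: "x j ~= 0" for j
 proof
  assume "x j = 0"
  then have "norm (L (x j)) = 0" by (simp add: L.zero)
  moreover have "0 <= real j * (1 + norm (cproj I (L (x j))))" by simp
  ultimately show False using x(2)[of j] by linarith
 qed
 define y where "y j = x j /\<^sub>R norm (x j)" for j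
 have "ALL j. y j : sphere 0 1" using x0 by (simp add: y_def)
 then obtain l r where l: "l : sphere 0 1" and r: "strict_mono r" and lim: "(y \<circ> r) \<longlonglongrightarrow> l"
  using compact_sphere[of "0 :: complex^'n" 1] unfolding compact_def by blast
 have "filterlim (%j. real j / B) at_top sequentially"
  using filterlim_tendsto_pos_mult_at_top[OF tendsto_const[of "inverse B"] _ filterlim_real_sequentially] B(1)
  by (simp add: divide_inverse mult.commute)
 then have inf: "filterlim (%j. norm (x j)) at_top sequentially"
  by (rule filterlim_at_top_mono) (simp add: gr)
 have inf': "filterlim (%j. norm (x (r j))) at_top sequentially"
  by (rule filterlim_compose[OF inf filterlim_subseq[OF r]])
 have "l : tangent_cone_inf X"
  unfolding tangent_cone_inf_def mem_Collect_eq
  by (rule exI[of _ "%j. x (r j)"], rule exI[of _ "%j. norm (x (r j))"])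
   (use x(1) x0 inf' lim in \<open>simp add: y_def o_def\<close>)
 moreover have "l ~= 0" using l by auto
 moreover have "cproj I (L l) = 0"
 proof -
  have "continuous_on UNIV (%z. cproj I (L z))" by (intro continuous_on_cproj linear_continuous_on L)
  then have 1: "(%j. cproj I (L (y (r j)))) \<longlonglongrightarrow> cproj I (L l)"
   using lim continuous_on_tendsto_compose[of UNIV "%z. cproj I (L z)" "y \<circ> r" l] by (simp add: o_def)
  have bd: "norm (cproj I (L (y j))) <= B / real j" if j: "j > 0" for j
  proof -
   have "real j * norm (cproj I (L (x j))) <= norm (x j) * B"
    using x(2)[of j] B(2)[of "x j"] by (simp add: algebra_simps)
   then have "norm (cproj I (L (x j))) <= norm (x j) * B / real j" using j by (simp add: field_simps)
   moreover have "cproj I (L (y j)) = cproj I (L (x j)) /\<^sub>R norm (x j)"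
    by (simp add: y_def L.scaleR bounded_linear.linear[OF bounded_linear_cproj] linear_cmul)
   ultimately show ?thesis using x0[of j] by (simp add: field_simps)
  qed
  have "(%j. B / real (r j)) \<longlonglongrightarrow> 0"
   using LIMSEQ_subseq_LIMSEQ[OF lim_const_over_n[of B] r] by (simp add: o_def)
  then have 2: "(%j. cproj I (L (y (r j)))) \<longlonglongrightarrow> 0"
  proof (rule Lim_null_comparison[rotated])
   have "r j > 0" if "j > 0" for j using seq_suble[OF r, of j] that by simp
   then show "\<forall>\<^sub>F j in sequentially. norm (cproj I (L (y (r j)))) <= B / real (r j)"
    using bd by (intro eventually_sequentiallyI[of 1]) auto
  qed
  show ?thesis by (rule LIMSEQ_unique[OF 1 2])
 qed
 ultimately show False using tr by blast
qed

section \<open>The volume of unsuitable coordinate changes\<close>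

lemma norm_matrix_vector_component:
 "norm ((A *v x) $ i) <= real CARD('n) * norm A * norm x" for A :: "complex^'n^'n"
proof -
 have "norm ((A *v x) $ i) <= (\<Sum>j\<in>UNIV. norm (A $ i $ j * x $ j))"
  unfolding matrix_vector_mult_def by (simp add: norm_sum)
 also have "\<dots> <= (\<Sum>j\<in>(UNIV::'n set). norm A * norm x)"
 proof (rule sum_mono)
  fix j
  have "norm (A $ i $ j) <= norm A" by (rule order_trans[OF Finite_Cartesian_Product.norm_nth_le Finite_Cartesian_Product.norm_nth_le])
  then show "norm (A $ i $ j * x $ j) <= norm A * norm x"
   unfolding norm_mult by (intro mult_mono Finite_Cartesian_Product.norm_nth_le) auto
 qed
 finally show ?thesis by simp
qed

text \<open>For \<open>r = 0\<close> these are the matrices near the identity that are not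
  transverse to the direction \<open>u\<close>; positive \<open>r\<close> accounts for all
  directions close to \<open>u\<close>.\<close>

definition slab :: "'n set => real => complex^'n => real => (complex^'n^'n) set" where
 "slab I \<epsilon> u r = {A:cball (mat 1) \<epsilon>. ALL i:I. norm ((A *v u) $ i) <= r}"

lemma compact_slab: "compact (slab I \<epsilon> u r)"
proof -
 have cont: "continuous_on UNIV (%A :: complex^'n^'n. norm ((A *v u) $ i))" for i and u :: "complex^'n"
  unfolding matrix_vector_mult_def vec_lambda_beta
  by (intro continuous_intros bounded_linear.continuous_on[OF bounded_linear_vec_nth])
 have "closed {A :: complex^'n^'n. norm ((A *v u) $ i) <= r}" for i and u :: "complex^'n"
  by (rule closed_Collect_le[OF cont continuous_on_const])
 then have "closed (\<Inter>i\<in>I. {A. norm ((A *v u) $ i) <= r})" by blast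
 from compact_Int_closed[OF compact_cball this, of "mat 1" \<epsilon>]
 show ?thesis by (simp add: slab_def Int_def)
qed

text \<open>Adding \<open>a \<otimes> cnj u\<close> to a matrix adds \<open>a\<close> to its value at the unit vector \<open>u\<close>, so about
  \<open>r powr (- 2 * card I)\<close> translates of the slab are pairwise disjoint in a fixed ball.\<close>

lemma measure_slab_pos:
 fixes I :: "'n::finite set"
 assumes e: "\<epsilon> > 0"
 shows "EX K>=0. ALL u r. norm u = 1 & r > 0 --> measure lebesgue (slab I \<epsilon> u r) <= K * r ^ (2 * card I)"
proof -
 define n where "n = real CARD('n)"
 define Q where "Q = measure lebesgue (cball (mat 1 :: complex^'n^'n) (\<epsilon> + n * (n * 2)))"
 have Q0: "Q >= 0" by (simp add: Q_def)
 have big: "cball (mat 1 :: complex^'n^'n) (\<epsilon> + n * (n * 2)) : lmeasurable" by (intro lmeasurable_compact compact_cball)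
 have sl: "slab I \<epsilon> u r : lmeasurable" for u r by (rule lmeasurable_compact[OF compact_slab])
 have "measure lebesgue (slab I \<epsilon> u r) <= Q * 6 ^ (2 * card I) * r ^ (2 * card I)" if u: "norm u = 1" and r: "r > 0" for u :: "complex^'n" and r
 proof (cases "r >= 1 / 6")
  case True
  have "n * (n * 2) >= 0" by (simp add: n_def)
  then have "cball (mat 1 :: complex^'n^'n) \<epsilon> \<subseteq> cball (mat 1) (\<epsilon> + n * (n * 2))" by (intro subset_cball) linarith
  then have "slab I \<epsilon> u r \<subseteq> cball (mat 1) (\<epsilon> + n * (n * 2))" unfolding slab_def by blast
  then have "measure lebesgue (slab I \<epsilon> u r) <= Q" unfolding Q_def by (rule measure_mono_fmeasurable[OF _ fmeasurableD[OF sl] big])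
  also have "\<dots> <= Q * (6 * r) ^ (2 * card I)"
  proof -
   have "1 <= (6 * r) ^ (2 * card I)" using True by (intro one_le_power) simp
   from mult_left_mono[OF this Q0] show ?thesis by simp
  qed
  finally show ?thesis by (simp add: power_mult_distrib)
 next
  case False
  \<comment> \<open>For \<open>r\<close> below \<open>1 / 6\<close> a grid of spacing
    \<open>3 * r\<close> has at least \<open>1 / (6 * r)\<close> points in each real direction while
    all shifts keep size at most \<open>2\<close>.\<close>
  define M where "M = nat \<lfloor>1 / (3 * r)\<rfloor>"
  have M1: "real M <= 1 / (3 * r)" using r by (simp add: M_def)
  have "real M >= 1 / (3 * r) - 1" using r by (simp add: M_def)
  moreover have "1 / (3 * r) - 1 >= 1 / (6 * r)" using False r by (simp add: field_simps)
  ultimately have M2: "real M >= 1 / (6 * r)" by linarith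
  define J where "J = Pi\<^sub>E I (%_. {..<M} \<times> {..<M})"
  have J: "finite J" "card J = (M * M) ^ card I" by (auto simp: J_def finite_PiE card_PiE card_cartesian_product)
  define a where "a s i = (if i : I then of_real (3 * r) * Complex (real (fst (s i))) (real (snd (s i))) else 0)" for s :: "'n => nat \<times> nat" and i
  define T where "T s = (\<chi> i j. a s i * cnj (u $ j))" for s
  have Tu: "((A + T s) *v u) $ i = (A *v u) $ i + a s i" for A s i
  proof -
   have "(T s *v u) $ i = a s i * herm u u"
    by (simp add: T_def matrix_vector_mult_def herm_def sum_distrib_left mult_ac)
   then show ?thesis using u by (simp add: matrix_vector_mult_add_rdistrib herm_self)
  qed
  have aJ: "norm (a s i) <= 2" if s: "s : J" for s i
  proof (cases "i : I")
   case True
   then have "s i : {..<M} \<times> {..<M}" using s unfolding J_def by (rule PiE_mem[rotated])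
   then have "real (fst (s i)) <= real M" "real (snd (s i)) <= real M" by auto
   then have "norm (Complex (real (fst (s i))) (real (snd (s i)))) <= 2 * real M"
    using cmod_le[of "Complex (real (fst (s i))) (real (snd (s i)))"] by simp
   then have "3 * r * norm (Complex (real (fst (s i))) (real (snd (s i)))) <= 3 * r * (2 * real M)" using r by (intro mult_left_mono) auto
   also have "\<dots> <= 2" using M1 r by (simp add: field_simps)
   finally show ?thesis using True r by (simp add: a_def norm_mult)
  qed (simp add: a_def)
  have TJ: "norm (T s) <= n * (n * 2)" if s: "s : J" for s
  proof -
   have ent: "norm (T s $ i $ j) <= 2" for i j
    using aJ[OF s, of i] Finite_Cartesian_Product.norm_nth_le[of u j] u mult_mono[of "norm (a s i)" 2 "norm (u $ j)" 1]
    by (simp add: T_def norm_mult)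
   have "norm (T s $ i) <= n * 2" for i
    using order_trans[OF norm_vec_le_sum[of "T s $ i"] sum_mono[of UNIV "%j. norm (T s $ i $ j)" "%j. 2"]] ent by (simp add: n_def)
   then have "(\<Sum>i\<in>UNIV. norm (T s $ i)) <= (\<Sum>i\<in>(UNIV :: 'n set). n * 2)" by (intro sum_mono)
   moreover have "norm (T s) <= (\<Sum>i\<in>UNIV. norm (T s $ i))" unfolding norm_vec_def[of "T s"] by (rule L2_set_le_sum) simp
   ultimately show ?thesis by (simp add: n_def)
  qed
  have disj: "disjoint_family_on (%s. (+) (T s) ` slab I \<epsilon> u r) J"
   unfolding disjoint_family_on_def
  proof (intro ballI impI)
   fix s s' assume s: "s : J" "s' : J" "s ~= s'"
   obtain i where i: "i : I" "s i ~= s' i"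
    using s PiE_ext[of s I "%_. {..<M} \<times> {..<M}" s' ] unfolding J_def by blast
   \<comment> \<open>Two matrices of the slab differ at \<open>u\<close> in the coordinate
     \<open>i\<close> by at most \<open>2 * r\<close>, whereas distinct grid points are at least
     \<open>3 * r\<close> apart.\<close>
   show "(+) (T s) ` slab I \<epsilon> u r Int (+) (T s') ` slab I \<epsilon> u r = {}"
   proof (rule ccontr)
    assume "(+) (T s) ` slab I \<epsilon> u r Int (+) (T s') ` slab I \<epsilon> u r ~= {}"
    then obtain A A' where A: "A : slab I \<epsilon> u r" "A' : slab I \<epsilon> u r" "A + T s = A' + T s'"
     by (auto simp: add.commute)
    have "(A *v u) $ i + a s i = (A' *v u) $ i + a s' i" using Tu[of A s i] Tu[of A' s' i] A(3) by simp
    then have "a s i - a s' i = (A' *v u) $ i - (A *v u) $ i" by (simp add: algebra_simps)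
    then have "norm (a s i - a s' i) <= norm ((A' *v u) $ i) + norm ((A *v u) $ i)" by (metis norm_triangle_ineq4)
    also have "\<dots> <= r + r" using A(1,2) i(1) unfolding slab_def by (intro add_mono) blast+
    finally have le: "norm (a s i - a s' i) <= 2 * r" by simp
    obtain p q p' q' where pq: "s i = (p, q)" "s' i = (p', q')" by (metis surj_pair)
    have eq: "a s i - a s' i = of_real (3 * r) * Complex (real p - real p') (real q - real q')"
     using i(1) pq by (simp add: a_def complex_eq_iff algebra_simps)
    have "norm (Complex (real p - real p') (real q - real q')) >= 1"
    proof (cases "p = p'")
     case True
     then have "q ~= q'" using i(2) pq by simp
     then have "\<bar>real q - real q'\<bar> >= 1" by linarith
     then show ?thesis using abs_Im_le_cmod[of "Complex (real p - real p') (real q - real q')"] by simp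
    next
     case False
     then have "\<bar>real p - real p'\<bar> >= 1" by linarith
     then show ?thesis using abs_Re_le_cmod[of "Complex (real p - real p') (real q - real q')"] by simp
    qed
    then have "3 * r * 1 <= norm (a s i - a s' i)" unfolding eq norm_mult using r by (intro mult_mono) auto
    then show False using le r by simp
   qed
  qed
  have "real (card J) * measure lebesgue (slab I \<epsilon> u r) = (\<Sum>s\<in>J. measure lebesgue ((+) (T s) ` slab I \<epsilon> u r))"
   by (simp add: measure_translation)
  also have "\<dots> = measure lebesgue (\<Union>s\<in>J. (+) (T s) ` slab I \<epsilon> u r)"
  proof (rule measure_finite_Union[symmetric, OF J(1) _ disj])
   show "(%s. (+) (T s) ` slab I \<epsilon> u r) ` J \<subseteq> sets lebesgue"
    using fmeasurableD[OF measurable_translation[OF sl]] by blast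
   show "emeasure lebesgue ((+) (T s) ` slab I \<epsilon> u r) ~= \<infinity>" for s
    using fmeasurableD2[OF measurable_translation[OF sl]] by (simp only: infinity_ennreal_def not_False_eq_True)
  qed
  also have "\<dots> <= Q" unfolding Q_def
  proof (rule measure_mono_fmeasurable[OF _ _ big])
   show "(\<Union>s\<in>J. (+) (T s) ` slab I \<epsilon> u r) : sets lebesgue"
    using measurable_translation[OF sl] J(1) by (intro sets.finite_UN) (auto dest: fmeasurableD)
   show "(\<Union>s\<in>J. (+) (T s) ` slab I \<epsilon> u r) \<subseteq> cball (mat 1) (\<epsilon> + n * (n * 2))"
   proof
    fix A assume "A : (\<Union>s\<in>J. (+) (T s) ` slab I \<epsilon> u r)"
    then obtain s B where s: "s : J" "A = T s + B" "B : slab I \<epsilon> u r" by blast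
    have "norm (mat 1 - A) <= norm (mat 1 - B) + norm (T s)"
     unfolding s(2) using norm_triangle_ineq4[of "mat 1 - B" "T s"] by (simp add: algebra_simps)
    also have "\<dots> <= \<epsilon> + n * (n * 2)" using TJ[OF s(1)] s(3) by (simp add: slab_def dist_norm)
    finally show "A : cball (mat 1) (\<epsilon> + n * (n * 2))" by (simp add: dist_norm)
   qed
  qed
  finally have le: "real M ^ (2 * card I) * measure lebesgue (slab I \<epsilon> u r) <= Q"
   by (simp add: J(2) power_mult power2_eq_square)
  have "(1 / (6 * r)) ^ (2 * card I) * (6 * r) ^ (2 * card I) = (1 / (6 * r) * (6 * r)) ^ (2 * card I)"
   by (rule power_mult_distrib[symmetric])
  also have "1 / (6 * r) * (6 * r) = 1" using r by simp
  finally have "(1 / (6 * r)) ^ (2 * card I) * (6 * r) ^ (2 * card I) = 1" by (simp only: power_one)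
  then have one: "(1 / (6 * r)) ^ (2 * card I) * (6 * r) ^ (2 * card I) = 1" .
  have "x * m * y = m" if "x * y = 1" for x y m :: real
  proof -
   have "x * m * y = m * (x * y)" by (simp only: mult_ac)
   then show ?thesis using that by simp
  qed
  from this[OF one, of "measure lebesgue (slab I \<epsilon> u r)"]
  have "measure lebesgue (slab I \<epsilon> u r) = (1 / (6 * r)) ^ (2 * card I) * measure lebesgue (slab I \<epsilon> u r) * (6 * r) ^ (2 * card I)"
   by (rule sym)
  also have "\<dots> <= real M ^ (2 * card I) * measure lebesgue (slab I \<epsilon> u r) * (6 * r) ^ (2 * card I)"
   using M2 r by (intro mult_right_mono power_mono) auto
  also have "\<dots> <= Q * (6 * r) ^ (2 * card I)" using r by (intro mult_right_mono le) auto
  finally show ?thesis by (simp add: power_mult_distrib)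
 qed
 then show ?thesis using Q0 by (intro exI[of _ "Q * 6 ^ (2 * card I)"]) auto
qed

text \<open>The width \<open>r = 0\<close> is included by monotonicity and a limit, since a cover
  may contain sets of diameter zero. The limit is \<open>0\<close> because the exponent is positive
  for nonempty \<open>I\<close>.\<close>

lemma measure_slab:
 fixes I :: "'n::finite set"
 assumes e: "\<epsilon> > 0" and I: "I ~= {}"
 shows "EX K>=0. ALL u r. norm u = 1 & r >= 0 --> measure lebesgue (slab I \<epsilon> u r) <= K * r ^ (2 * card I)"
proof -
 obtain K where K: "K >= 0" "!!u r. norm u = 1 ==> r > 0 ==> measure lebesgue (slab I \<epsilon> u r) <= K * r ^ (2 * card I)"
  using measure_slab_pos[OF e, of I] by blast
 have kp: "card I > 0" using I by (simp add: card_gt_0_iff)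
 have "measure lebesgue (slab I \<epsilon> u 0) <= 0" if u: "norm u = 1" for u
 proof (rule LIMSEQ_le_const)
  have "(%n. K * (1 / real (Suc n)) ^ (2 * card I)) \<longlonglongrightarrow> K * 0 ^ (2 * card I)"
   by (intro tendsto_intros LIMSEQ_Suc[OF lim_const_over_n])
  then show "(%n. K * (1 / real (Suc n)) ^ (2 * card I)) \<longlonglongrightarrow> 0" using kp I by (simp add: power_0_left)
  have "measure lebesgue (slab I \<epsilon> u 0) <= K * (1 / real (Suc n)) ^ (2 * card I)" for n
  proof -
   have "slab I \<epsilon> u 0 \<subseteq> slab I \<epsilon> u (1 / real (Suc n))" by (auto simp: slab_def intro: order_trans)
   then have "measure lebesgue (slab I \<epsilon> u 0) <= measure lebesgue (slab I \<epsilon> u (1 / real (Suc n)))"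
    by (rule measure_mono_fmeasurable[OF _ fmeasurableD[OF lmeasurable_compact[OF compact_slab]] lmeasurable_compact[OF compact_slab]])
   also have "\<dots> <= K * (1 / real (Suc n)) ^ (2 * card I)" by (rule K(2)[OF u]) simp
   finally show ?thesis .
  qed
  then show "EX N. ALL n>=N. measure lebesgue (slab I \<epsilon> u 0) <= K * (1 / real (Suc n)) ^ (2 * card I)" by blast
 qed
 then have "measure lebesgue (slab I \<epsilon> u r) <= K * r ^ (2 * card I)" if "norm u = 1" "r >= 0" for u r
  using K(2)[OF that(1), of r] that kp by (cases "r = 0") (auto simp: power_0_left)
 then show ?thesis using K(1) by blast
qed

lemma complex_line_scale:
 assumes "c ~= 0"
 shows "complex_line (c *s z) = complex_line z"
proof -
 have "a *s z : range (%b. b *s (c *s z))" for a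
  by (rule range_eqI[of _ _ "a / c"]) (use assms in \<open>simp add: vector_smult_assoc\<close>)
 moreover have "a *s (c *s z) : range (%b. b *s z)" for a
  by (rule range_eqI[of _ _ "a * c"]) (simp add: vector_smult_assoc)
 ultimately show ?thesis unfolding complex_line_def by blast
qed

text \<open>A kernel vector satisfies \<open>x = (mat 1 - A) *v x\<close>, which is impossible for a
  contraction unless \<open>x = 0\<close>. The square of the dimension comes from the entrywise norm
  estimate.\<close>

lemma matrix_near_identity:
 fixes A :: "complex^'n^'n"
 assumes A: "norm (mat 1 - A) * (real CARD('n) * real CARD('n)) < 1"
 shows "EX A'. linear_pair ((*v) A) ((*v) A')"
proof -
 have inj0: "x = 0" if x: "A *v x = 0" for x
 proof (rule ccontr)
  assume "x ~= 0"
  have "x = (mat 1 - A) *v x" using x by (simp add: matrix_vector_mult_diff_rdistrib)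
  then have "norm x <= (\<Sum>i\<in>UNIV. norm (((mat 1 - A) *v x) $ i))" using norm_vec_le_sum[of x] by simp
  also have "\<dots> <= (\<Sum>i\<in>(UNIV :: 'n set). real CARD('n) * norm (mat 1 - A) * norm x)"
   by (intro sum_mono norm_matrix_vector_component)
  also have "\<dots> = norm (mat 1 - A) * (real CARD('n) * real CARD('n)) * norm x" by simp
  also have "\<dots> < 1 * norm x" using A \<open>x ~= 0\<close> by (intro mult_strict_right_mono) auto
  finally show False by simp
 qed
 have "inj ((*v) A)"
 proof (rule injI)
  fix x y assume "A *v x = A *v y"
  then have "A *v (x - y) = 0" by (simp add: matrix_vector_mult_diff_distrib)
  then show "x = y" using inj0[of "x - y"] by simp
 qed
 then obtain B where B: "B ** A = mat 1" using matrix_left_invertible_injective by blast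
 then have B': "A ** B = mat 1" by (simp only: matrix_left_right_inverse)
 show ?thesis
  by (rule exI[of _ B])
   (simp add: linear_pair_def matrix_vector_right_distrib vector_scalar_commute matrix_vector_mul_assoc B B')
qed

text \<open>Each set of an efficient cover of the asymptotic directions is turned into one slab that
  contains all matrices of the ball which are bad for some direction in that set. The total volume
  of the slabs is less than that of the ball, so a good matrix remains, and it is invertible because
  it is close to the identity.\<close>

theorem transverse_projection:
 fixes X :: "(complex^'n) set"
 assumes g: "projective_riemannian_metric g" and I: "I ~= {}"
  and null: "proj_hausdorff_measure g (2 * real (card I)) (asymptotic_directions X) = 0"
 shows "EX L L'. linear_pair L L' & in_cone I (L ` X)"
proof -
 let ?\<rho> = "riemannian_dist g" and ?k = "card I" and ?E = "mat 1 :: complex^'n^'n"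
 define n where "n = real CARD('n)"
 have n: "n > 0" by (simp add: n_def)
 define \<epsilon> where "\<epsilon> = 1 / (n * n)"
 have e: "\<epsilon> > 0" using n by (simp add: \<epsilon>_def)
 obtain K where K: "K >= 0" "!!u r. norm u = 1 ==> r >= 0 ==> measure lebesgue (slab I \<epsilon> u r) <= K * r ^ (2 * ?k)"
  using measure_slab[OF e I] by blast
 obtain C where C: "C > 0" "!!u w. norm u = 1 ==> norm w = 1 ==>
  EX \<mu>. norm \<mu> = 1 & norm (w - \<mu> *s u) <= C * ?\<rho> (complex_line u) (complex_line w)"
  using riemannian_dist_lower[OF g] by blast
 \<comment> \<open>A direction in a covering set of diameter \<open>d i\<close> lies, up to phase,
   within \<open>C * d i\<close> of the chosen unit vector. A matrix of the ball enlarges this by at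
   most \<open>n * (norm ?E + \<epsilon>)\<close> in each coordinate, so \<open>c * d i\<close> is
   the slab width.\<close>
 define c where "c = n * (norm ?E + \<epsilon>) * C"
 have c: "c >= 0" using n e C(1) by (simp add: c_def)
 define K' where "K' = K * c ^ (2 * ?k)"
 have K': "K' >= 0" using K(1) c by (simp add: K'_def)
 define v where "v = measure lebesgue (ball ?E \<epsilon>)"
 have v: "v > 0" unfolding v_def using content_ball_pos[OF e, of ?E] by simp
 \<comment> \<open>The summand \<open>1\<close> makes the denominator positive also for
   \<open>K' = 0\<close> and the inequality \<open>K' * \<eta> < v\<close> strict.\<close>
 define \<eta> where "\<eta> = v / (K' + 1)"
 have \<eta>: "\<eta> > 0" "K' * \<eta> < v" using v K' by (auto simp: \<eta>_def field_simps)
 \<comment> \<open>The mesh \<open>1\<close> makes the diameters finite; smallness of the total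
   volume comes from \<eta>.\<close>
 obtain U :: "nat => (complex^'n) set set" where U: "ALL i. U i \<subseteq> projective_space & ediam ?\<rho> (U i) <= ennreal 1"
  "asymptotic_directions X \<subseteq> (\<Union>i. U i)" "suminf (%i. diam_power ?\<rho> (2 * real ?k) (U i)) < ennreal \<eta>"
  using hausdorff_null_cover[OF null[unfolded proj_hausdorff_measure_def] zero_less_one \<eta>(1)]
  by (elim exE conjE) (rule that; assumption)
 define d where "d i = enn2real (ediam ?\<rho> (U i))" for i
 have d0: "d i >= 0" for i by (simp add: d_def)
 have fin: "ediam ?\<rho> (U i) < top" for i
  using order.strict_trans1[OF conjunct2[OF spec[OF U(1), of i]] ennreal_less_top] .
 have d: "?\<rho> l l' <= d i" if "l : U i" "l' : U i" for i l l'
 proof -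
  have "ennreal (?\<rho> l l') <= ediam ?\<rho> (U i)"
   unfolding ediam_def by (rule SUP_upper2[OF that(1)], rule SUP_upper2[OF that(2)]) simp
  also have "\<dots> = ennreal (d i)" unfolding d_def using fin[of i] by simp
  finally show ?thesis using d0[of i] by (simp add: ennreal_le_iff)
 qed
 have unit: "EX u. norm u = 1 & complex_line u = complex_line z" if z: "z ~= 0" for z :: "complex^'n"
  using z by (intro exI[of _ "of_real (inverse (norm z)) *s z"]) (simp add: norm_vec_scale norm_inverse complex_line_scale)
 have "ALL i. EX u. U i ~= {} --> norm u = 1 & complex_line u : U i"
 proof
  fix i
  show "EX u. U i ~= {} --> norm u = 1 & complex_line u : U i"
  proof (cases "U i = {}")
   case False
   then obtain l where l: "l : U i" by blast
   then have "l : projective_space" using spec[OF U(1), of i] by blast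
   then obtain z where z: "z ~= 0" "l = complex_line z" unfolding projective_space_def by blast
   obtain u where "norm u = 1" "complex_line u = complex_line z" using unit[OF z(1)] by blast
   then show ?thesis using l z(2) by (intro exI[of _ u]) simp
  qed simp
 qed
 from choice[OF this] obtain u where u: "!!i. U i ~= {} ==> norm (u i) = 1 & complex_line (u i) : U i" by blast
 define S where "S i = (if U i = {} then {} else slab I \<epsilon> (u i) (c * d i))" for i
 have Sm: "S i : lmeasurable" for i
  using lmeasurable_compact[OF compact_slab, of I \<epsilon> "u i" "c * d i"] by (simp add: S_def)
 have Se: "emeasure lebesgue (S i) <= ennreal K' * diam_power ?\<rho> (2 * real ?k) (U i)" for i
 proof (cases "U i = {}")
  case False
  have "?k > 0" using I by (simp add: card_gt_0_iff)
  then have "d i powr real (2 * ?k) = d i ^ (2 * ?k)" by (intro powr_realpow' d0) (use I in simp)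
  then have dp: "diam_power ?\<rho> (2 * real ?k) (U i) = ennreal (d i ^ (2 * ?k))"
   using False I by (simp add: diam_power_def d_def)
  have "emeasure lebesgue (S i) = ennreal (measure lebesgue (S i))" using Sm[of i] by (simp add: emeasure_eq_measure2)
  also have "\<dots> <= ennreal (K' * d i ^ (2 * ?k))"
   using K(2)[of "u i" "c * d i"] u[OF False] c d0[of i] False
   by (intro ennreal_leI) (simp add: S_def K'_def power_mult_distrib mult.assoc)
  finally show ?thesis unfolding dp using K' d0[of i] by (simp add: ennreal_mult)
 qed (simp add: S_def)
 have bad: "A : (\<Union>i. S i)" if A: "A : ball ?E \<epsilon>" and w: "w : tangent_cone_inf X" "w ~= 0" and z: "cproj I (A *v w) = 0" for A w
 proof -
  have nA: "norm A <= norm ?E + \<epsilon>" using A norm_triangle_sub[of A ?E] by (simp add: dist_norm norm_minus_commute)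
  have "complex_line w : asymptotic_directions X" using w by (auto simp: asymptotic_directions_def)
  then obtain i where i: "complex_line w : U i" using U(2) by blast
  then have ne: "U i ~= {}" by blast
  define w' where "w' = of_real (inverse (norm w)) *s w"
  have w': "norm w' = 1" "complex_line w' = complex_line w"
   using w(2) by (simp_all add: w'_def norm_vec_scale norm_inverse complex_line_scale)
  obtain \<mu> where m: "norm \<mu> = 1" "norm (w' - \<mu> *s u i) <= C * ?\<rho> (complex_line (u i)) (complex_line w')"
   using C(2)[OF conjunct1[OF u[OF ne]] w'(1)] by blast
  have "?\<rho> (complex_line (u i)) (complex_line w') <= d i" unfolding w'(2) by (rule d[OF conjunct2[OF u[OF ne]] i])
  then have "C * ?\<rho> (complex_line (u i)) (complex_line w') <= C * d i" using C(1) by simp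
  then have wd: "norm (w' - \<mu> *s u i) <= C * d i" using m(2) by linarith
  have "norm ((A *v u i) $ j) <= c * d i" if j: "j : I" for j
  proof -
   have "cproj I (A *v w) $ j = 0" using z by simp
   then have "(A *v w') $ j = 0" using j by (simp add: w'_def vector_scalar_commute)
   then have "(A *v (w' - \<mu> *s u i)) $ j = - (\<mu> * (A *v u i) $ j)"
    by (simp add: matrix_vector_mult_diff_distrib vector_scalar_commute)
   then have "norm ((A *v u i) $ j) = norm ((A *v (w' - \<mu> *s u i)) $ j)" using m(1) by (simp add: norm_mult)
   also have "\<dots> <= n * norm A * norm (w' - \<mu> *s u i)" unfolding n_def by (rule norm_matrix_vector_component)
   also have "\<dots> <= n * (norm ?E + \<epsilon>) * (C * d i)" using nA wd n e by (intro mult_mono) auto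
   finally show ?thesis by (simp add: c_def mult.assoc)
  qed
  then have "A : S i" using A ne by (simp add: S_def slab_def)
  then show ?thesis by blast
 qed
 have "EX A:ball ?E \<epsilon>. A ~: (\<Union>i. S i)"
 proof (rule ccontr)
  assume "\<not> (EX A:ball ?E \<epsilon>. A ~: (\<Union>i. S i))"
  then have sub: "ball ?E \<epsilon> \<subseteq> (\<Union>i. S i)" by blast
  have rg: "range S \<subseteq> sets lebesgue" using fmeasurableD[OF Sm] by blast
  have "ennreal v = emeasure lebesgue (ball ?E \<epsilon>)"
   unfolding v_def using lmeasurable_ball[of ?E \<epsilon>] by (simp add: emeasure_eq_measure2)
  also have "\<dots> <= emeasure lebesgue (\<Union>i. S i)" by (rule emeasure_mono[OF sub]) (use rg in blast)
  also have "\<dots> <= suminf (%i. emeasure lebesgue (S i))" by (rule emeasure_subadditive_countably[OF rg])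
  also have "\<dots> <= suminf (%i. ennreal K' * diam_power ?\<rho> (2 * real ?k) (U i))" by (intro suminf_le Se) auto
  also have "\<dots> = ennreal K' * suminf (%i. diam_power ?\<rho> (2 * real ?k) (U i))" by (rule ennreal_suminf_cmult)
  also have "\<dots> <= ennreal K' * ennreal \<eta>" by (rule mult_left_mono[OF less_imp_le[OF U(3)]]) simp
  also have "\<dots> = ennreal (K' * \<eta>)" using K' \<eta>(1) by (simp add: ennreal_mult)
  finally have "v <= K' * \<eta>" using K' \<eta>(1) by (simp add: ennreal_le_iff)
  then show False using \<eta>(2) by simp
 qed
 then obtain A where A: "A : ball ?E \<epsilon>" "A ~: (\<Union>i. S i)" by blast
 have "norm (?E - A) < 1 / (n * n)" using A(1) by (simp add: dist_norm \<epsilon>_def)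
 then have "norm (?E - A) * (n * n) < 1" using n by (simp add: pos_less_divide_eq)
 then obtain A' where A': "linear_pair ((*v) A) ((*v) A')" using matrix_near_identity[of A] unfolding n_def by blast
 have "in_cone I ((*v) A ` X)"
 proof (rule in_cone_if_transverse[OF linear_pair_bounded_linear[OF A']])
  fix w assume "w : tangent_cone_inf X" "w ~= 0"
  then show "cproj I (A *v w) ~= 0" using bad[OF A(1)] A(2) by blast
 qed
 then show ?thesis using A' by blast
qed

section \<open>Asymptotic directions of algebraic sets\<close>

lemma polyfn_lipschitz:
 fixes f :: "complex^'n => complex"
 assumes "polyfn f"
 shows "EX C>=0. ALL v w. norm v <= R & norm w <= R --> norm (f v - f w) <= C * norm (v - w)"
 using assms
proof (induction rule: polyfn.induct)
 case (const c)
 show ?case by (rule exI[of _ 0]) simp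
next
 case (coord i)
 have "norm (v $ i - w $ i) <= norm (v - w)" for v w :: "complex^'n"
  using Finite_Cartesian_Product.norm_nth_le[of "v - w" i] by simp
 then show ?case by (intro exI[of _ 1]) simp
next
 case (add f h)
 then obtain C C' where C: "C >= 0" "!!v w. norm v <= R ==> norm w <= R ==> norm (f v - f w) <= C * norm (v - w)"
  and C': "C' >= 0" "!!v w. norm v <= R ==> norm w <= R ==> norm (h v - h w) <= C' * norm (v - w)" by blast
 have "norm (f v + h v - (f w + h w)) <= (C + C') * norm (v - w)" if "norm v <= R" "norm w <= R" for v w
  using norm_triangle_ineq[of "f v - f w" "h v - h w"] C(2)[OF that] C'(2)[OF that] by (simp add: algebra_simps)
 then show ?case using C(1) C'(1) by (intro exI[of _ "C + C'"]) simp
next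
 case (mult f h)
 then obtain C C' where C: "C >= 0" "!!v w. norm v <= R ==> norm w <= R ==> norm (f v - f w) <= C * norm (v - w)"
  and C': "C' >= 0" "!!v w. norm v <= R ==> norm w <= R ==> norm (h v - h w) <= C' * norm (v - w)" by blast
 have bd: "EX B>=0. ALL v. norm v <= R --> norm (q v) <= B" if "polyfn q" for q :: "complex^'n => complex"
 proof -
  have "compact (q ` cball 0 R)" by (intro compact_continuous_image continuous_on_polyfn[OF that] compact_cball)
  from compact_imp_bounded[OF this, unfolded bounded_iff] obtain B where "ALL x:q ` cball 0 R. norm x <= B" by (rule exE)
  then show ?thesis by (intro exI[of _ "max B 0"]) (auto simp: le_max_iff_disj)
 qed
 obtain B where B: "B >= 0" "!!v. norm v <= R ==> norm (f v) <= B" using bd[OF mult.hyps(1)] by blast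
 obtain B' where B': "B' >= 0" "!!v. norm v <= R ==> norm (h v) <= B'" using bd[OF mult.hyps(2)] by blast
 have "norm (f v * h v - f w * h w) <= (B * C' + B' * C) * norm (v - w)" if v: "norm v <= R" "norm w <= R" for v w
 proof -
  have "f v * h v - f w * h w = f v * (h v - h w) + h w * (f v - f w)" by (simp add: algebra_simps)
  then have "norm (f v * h v - f w * h w) <= norm (f v) * norm (h v - h w) + norm (h w) * norm (f v - f w)"
   by (metis norm_mult norm_triangle_ineq)
  also have "\<dots> <= B * (C' * norm (v - w)) + B' * (C * norm (v - w))"
   using B B' C C' v by (intro add_mono mult_mono) auto
  finally show ?thesis by (simp add: algebra_simps)
 qed
 then show ?case using B(1) B'(1) C(1) C'(1) by (intro exI[of _ "B * C' + B' * C"]) simp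
qed

section \<open>Lipschitz dependence of simple roots\<close>

lemma poly_difference:
 fixes p :: "complex poly"
 assumes "degree p <= k"
 shows "poly p x - poly p y = (x - y) * (\<Sum>i\<le>k. coeff p i * (\<Sum>a<i. y ^ (i - Suc a) * x ^ a))"
proof -
 have "poly p x - poly p y = (\<Sum>i\<le>k. coeff p i * (x ^ i - y ^ i))"
  unfolding poly_eq_sum_le[OF assms] by (simp add: sum_subtractf right_diff_distrib)
 also have "\<dots> = (x - y) * (\<Sum>i\<le>k. coeff p i * (\<Sum>a<i. y ^ (i - Suc a) * x ^ a))"
  unfolding power_diff_sumr2 sum_distrib_left by (simp add: mult_ac sum_distrib_left)
 finally show ?thesis .
qed

lemma poly_pderiv_eq_sum:
 fixes p :: "complex poly"
 assumes "degree p <= k"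
 shows "poly (pderiv p) x = (\<Sum>i\<le>k. coeff p i * (\<Sum>a<i. x ^ (i - Suc a) * x ^ a))"
proof -
 have inner: "(\<Sum>a<i. x ^ (i - Suc a) * x ^ a) = of_nat i * x ^ (i - 1)" for i
 proof -
  have "x ^ (i - Suc a) * x ^ a = x ^ (i - 1)" if "a : {..<i}" for a using that by (simp add: power_add[symmetric])
  then show ?thesis by simp
 qed
 have sm: "pderiv (\<Sum>i\<le>m. monom (c i) i) = (\<Sum>i\<le>m. pderiv (monom (c i) i))" for m and c :: "nat => complex"
  by (induction m) (simp_all add: pderiv_add)
 have "p = (\<Sum>i\<le>k. monom (coeff p i) i)" using poly_as_sum_of_monoms'[OF assms] by simp
 then have "poly (pderiv p) x = poly (pderiv (\<Sum>i\<le>k. monom (coeff p i) i)) x" by simp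
 also have "\<dots> = (\<Sum>i\<le>k. of_nat i * coeff p i * x ^ (i - 1))"
  by (simp add: sm pderiv_monom poly_sum poly_monom)
 finally show ?thesis unfolding inner by (simp add: mult_ac)
qed

text \<open>\<open>G\<close> is a divided difference: it is continuous and equals the nonzero
  derivative at \<open>(v0, v0)\<close>, so it is bounded below nearby. The difference of two roots
  times \<open>G\<close> is a difference of coefficients, and these are Lipschitz in the base
  coordinates.\<close>

lemma simple_root_lipschitz:
 fixes Q :: "complex^'n => complex poly"
 assumes Q: "!!i. polyfn (%v. coeff (Q v) i)" "!!v. degree (Q v) <= k" "!!v. Q (cproj I v) = Q v"
  and s: "poly (pderiv (Q v0)) (v0 $ j) ~= 0"
 shows "EX r>0. EX \<Lambda>>=0. ALL v:ball v0 r. ALL w:ball v0 r. poly (Q v) (v $ j) = 0 & poly (Q w) (w $ j) = 0 -->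
  norm (v $ j - w $ j) <= \<Lambda> * norm (cproj I v - cproj I w)"
proof -
 define G where "G z = (\<Sum>i\<le>k. coeff (Q (snd z)) i * (\<Sum>a<i. (snd z $ j) ^ (i - Suc a) * (fst z $ j) ^ a))" for z :: "(complex^'n) \<times> (complex^'n)"
 have "continuous_on UNIV G" unfolding G_def
  by (intro continuous_intros bounded_linear.continuous_on[OF bounded_linear_vec_nth]
    continuous_on_compose2[OF continuous_on_polyfn[OF Q(1)] _ subset_UNIV])
 then have "continuous_on UNIV (%z. norm (G z))" by (rule continuous_on_norm)
 then have "open ((%z. norm (G z)) -` {norm (G (v0, v0)) / 2 <..})" by (intro open_vimage open_greaterThan)
 moreover have G0: "G (v0, v0) ~= 0" using s unfolding poly_pderiv_eq_sum[OF Q(2)] by (simp add: G_def)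
 then have "(v0, v0) : (%z. norm (G z)) -` {norm (G (v0, v0)) / 2 <..}" by simp
 ultimately obtain A B where AB: "open A" "open B" "v0 : A" "v0 : B" "A \<times> B \<subseteq> (%z. norm (G z)) -` {norm (G (v0, v0)) / 2 <..}"
  by (rule open_prod_elim) blast
 obtain r0 where r0: "r0 > 0" "ball v0 r0 \<subseteq> A Int B" using AB(1-4) open_contains_ball[of "A Int B"] by blast
 define r where "r = min r0 1"
 define c where "c = norm (G (v0, v0)) / 2"
 define R where "R = norm v0 + 1"
 have c: "c > 0" using G0 by (simp add: c_def)
 have "ALL i. EX C>=0. ALL v w. norm v <= R & norm w <= R --> norm (coeff (Q v) i - coeff (Q w) i) <= C * norm (v - w)"
  by (intro allI polyfn_lipschitz[OF Q(1)])
 from choice[OF this] obtain C where C: "!!i. C i >= 0"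
  "!!i v w. norm v <= R ==> norm w <= R ==> norm (coeff (Q v) i - coeff (Q w) i) <= C i * norm (v - w)" by blast
 define \<Lambda> where "\<Lambda> = (\<Sum>i\<le>k. C i * R ^ i) / c"
 have R0: "R >= 0" by (simp add: R_def)
 have nb: "norm v <= R" if "v : ball v0 r" for v
  using that norm_triangle_sub[of v v0] by (simp add: r_def R_def dist_norm norm_minus_commute)
 have "norm (v $ j - w $ j) <= \<Lambda> * norm (cproj I v - cproj I w)"
  if v: "v : ball v0 r" and w: "w : ball v0 r" and z: "poly (Q v) (v $ j) = 0" "poly (Q w) (w $ j) = 0" for v w
 proof -
  have "(v, w) : A \<times> B" using v w r0(2) by (auto simp: r_def)
  then have cG: "c <= norm (G (v, w))" using AB(5) by (force simp: c_def)
  have vj: "norm (v $ j) <= R" by (rule order_trans[OF Finite_Cartesian_Product.norm_nth_le nb[OF v]])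
  have dI: "norm (coeff (Q v) i - coeff (Q w) i) <= C i * norm (cproj I v - cproj I w)" for i
   using C(2)[of "cproj I v" "cproj I w" i] order_trans[OF norm_cproj_le nb[OF v]] order_trans[OF norm_cproj_le nb[OF w]]
   by (simp add: Q(3))
  have "(v $ j - w $ j) * G (v, w) = poly (Q w) (v $ j) - poly (Q w) (w $ j)"
   unfolding poly_difference[OF Q(2)] G_def by simp
  also have "\<dots> = poly (Q w) (v $ j) - poly (Q v) (v $ j)" using z by simp
  also have "\<dots> = (\<Sum>i\<le>k. (coeff (Q w) i - coeff (Q v) i) * (v $ j) ^ i)"
   unfolding poly_eq_sum_le[OF Q(2)] by (simp add: sum_subtractf left_diff_distrib)
  finally have "norm (v $ j - w $ j) * norm (G (v, w)) <= (\<Sum>i\<le>k. norm ((coeff (Q w) i - coeff (Q v) i) * (v $ j) ^ i))"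
   by (metis norm_mult norm_sum)
  also have "\<dots> <= (\<Sum>i\<le>k. C i * norm (cproj I v - cproj I w) * R ^ i)"
  proof (rule sum_mono)
   fix i
   have "norm ((coeff (Q w) i - coeff (Q v) i) * (v $ j) ^ i) = norm (coeff (Q v) i - coeff (Q w) i) * norm (v $ j) ^ i"
    by (simp add: norm_mult norm_power norm_minus_commute)
   also have "\<dots> <= C i * norm (cproj I v - cproj I w) * R ^ i"
    using dI[of i] vj C(1)[of i] by (intro mult_mono power_mono) auto
   finally show "norm ((coeff (Q w) i - coeff (Q v) i) * (v $ j) ^ i) <= C i * norm (cproj I v - cproj I w) * R ^ i" .
  qed
  also have "\<dots> = (\<Sum>i\<le>k. C i * R ^ i) * norm (cproj I v - cproj I w)"
   unfolding sum_distrib_right by (rule sum.cong) (simp_all only: mult_ac)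
  finally have "norm (v $ j - w $ j) * norm (G (v, w)) <= (\<Sum>i\<le>k. C i * R ^ i) * norm (cproj I v - cproj I w)" .
  moreover have "norm (v $ j - w $ j) * c <= norm (v $ j - w $ j) * norm (G (v, w))" using cG by (intro mult_left_mono) auto
  ultimately have "norm (v $ j - w $ j) * c <= (\<Sum>i\<le>k. C i * R ^ i) * norm (cproj I v - cproj I w)" by linarith
  then show ?thesis using c by (simp add: \<Lambda>_def field_simps)
 qed
 moreover have "\<Lambda> >= 0" using C(1) R0 c by (auto simp: \<Lambda>_def intro!: divide_nonneg_pos sum_nonneg)
 moreover have "r > 0" using r0(1) by (simp add: r_def)
 ultimately show ?thesis by blast
qed

text \<open>Such a set is a bounded Lipschitz graph over its projection to the coordinates in
  \<open>I\<close>.\<close>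

definition lipschitz_over :: "'n set => (complex^'n) set => bool" where
 "lipschitz_over I A \<longleftrightarrow> bounded A &
  (EX \<Lambda>>=0. ALL v:A. ALL w:A. norm (v - w) <= \<Lambda> * norm (cproj I v - cproj I w))"

lemma floor_eq_imp_close:
 assumes "\<lfloor>real N * a\<rfloor> = \<lfloor>real N * b\<rfloor>" "N >= 1"
 shows "\<bar>a - b\<bar> <= 1 / real N"
proof -
 have "\<bar>real N * a - real N * b\<bar> <= 1" using assms(1) by linarith
 moreover have "\<bar>real N * a - real N * b\<bar> = real N * \<bar>a - b\<bar>" by (simp add: abs_mult right_diff_distrib[symmetric])
 ultimately show ?thesis using assms(2) by (simp add: field_simps)
qed

text \<open>Normalising one base coordinate to \<open>1\<close> leaves \<open>card I - 1\<close>
  complex ones, that is \<open>2 * card I - 2\<close> real ones. The cells of a grid in these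
  coordinates give the covers for box counting.\<close>

lemma lines_of_lipschitz_null:
 fixes A :: "(complex^'n) set"
 assumes g: "projective_riemannian_metric g" and L: "linear_pair L' L" and A: "lipschitz_over I A"
  and i0: "i0 : I" "!!v. v : A ==> v $ i0 = 1" and s: "s > 2 * real (card I) - 2"
 shows "hausdorff_measure projective_space (riemannian_dist g) s (complex_line ` L' ` A) = 0"
proof -
 obtain \<Lambda> where \<Lambda>: "\<Lambda> >= 0" "!!v w. v : A ==> w : A ==> norm (v - w) <= \<Lambda> * norm (cproj I v - cproj I w)"
  using A unfolding lipschitz_over_def by blast
 obtain R0 where "ALL v:A. norm v <= R0" using A unfolding lipschitz_over_def bounded_iff by blast
 moreover obtain R :: nat where "R0 <= real R" using real_arch_simple by blast
 ultimately have R: "norm v <= real R" if "v : A" for v using that by force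
 obtain B where B: "B > 0" "!!z. norm (L' z) <= norm z * B"
  using bounded_linear.pos_bounded[OF linear_pair_bounded_linear[OF L]] by blast
 obtain B' where B': "B' > 0" "!!z. norm (L z) <= norm z * B'"
  using bounded_linear.pos_bounded[OF linear_pair_bounded_linear[OF linear_pairD(5)[OF L]]] by blast
 obtain C where C: "C >= 0" "!!u w \<eta>. \<eta> > 0 ==> (!!t. \<eta> <= norm (u + t *\<^sub>R (w - u))) ==>
  riemannian_dist g (complex_line u) (complex_line w) <= C / \<eta> * norm (u - w)"
  using riemannian_dist_upper[OF g] by blast
 interpret L': bounded_linear L' by (rule linear_pair_bounded_linear[OF L])
 have dist: "riemannian_dist g (complex_line (L' v)) (complex_line (L' w)) <= C * B' * B * norm (v - w)" if v: "v : A" "w : A" for v w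
 proof -
  \<comment> \<open>The coordinate \<open>i0\<close> stays \<open>1\<close> along the segment, which
    keeps its image away from the origin as the upper distance estimate requires.\<close>
  have "1 / B' <= norm (L' v + t *\<^sub>R (L' w - L' v))" for t
  proof -
   define z where "z = v + t *\<^sub>R (w - v)"
   have "z $ i0 = 1" using i0(2)[OF v(1)] i0(2)[OF v(2)] by (simp add: z_def)
   then have "1 <= norm z" using Finite_Cartesian_Product.norm_nth_le[of z i0] by simp
   also have "norm z = norm (L (L' z))" by (simp add: linear_pairD(4)[OF L])
   also have "\<dots> <= norm (L' z) * B'" by (rule B'(2))
   finally have "1 / B' <= norm (L' z)" using B'(1) by (simp add: field_simps)
   then show ?thesis by (simp add: z_def L'.add L'.scaleR L'.diff)
  qed
  from C(2)[OF _ this] have "riemannian_dist g (complex_line (L' v)) (complex_line (L' w)) <= C * B' * norm (L' v - L' w)"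
   using B'(1) by simp
  also have "\<dots> <= C * B' * (norm (v - w) * B)" using B(2)[of "v - w"] C(1) B'(1) by (intro mult_left_mono) (auto simp: L'.diff)
  finally show ?thesis by (simp add: mult_ac)
 qed
 define n where "n = real CARD('n)"
 define J where "J = I - {i0}"
 have cJ: "card J = card I - 1" "card I >= 1" using i0(1) by (auto simp: J_def card_Diff_singleton Suc_le_eq card_gt_0_iff)
 \<comment> \<open>The summand \<open>1\<close> makes the constant positive even when one of the
   factors is zero.\<close>
 define cc where "cc = C * B' * B * \<Lambda> * (n * 2) + 1"
 have cc: "cc > 0" using C(1) B(1) B'(1) \<Lambda>(1) by (simp add: cc_def n_def add_nonneg_pos)
 have sD: "real (2 * card J) < s" using s cJ by (simp add: of_nat_diff)
 show ?thesis
 proof (rule hausdorff_null_finite_covers[OF sD cc, where K = "real (2 * R + 1) ^ (2 * card J)"])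
  fix N :: nat assume N: "N >= 1"
  define cell where "cell v = restrict (%i. (\<lfloor>real N * Re (v $ i)\<rfloor>, \<lfloor>real N * Im (v $ i)\<rfloor>)) J" for v :: "complex^'n"
  define T where "T = {- int (R * N)..int (R * N)}"
  define W where "W = Pi\<^sub>E J (%_. T \<times> T)"
  have cT: "card T = 2 * R * N + 1" by (simp add: T_def nat_add_distrib nat_mult_distrib)
  have W: "finite W" "card W = (card T * card T) ^ card J" by (auto simp: W_def T_def finite_PiE card_PiE card_cartesian_product)
  have inT: "\<lfloor>real N * x\<rfloor> : T" if x: "\<bar>x\<bar> <= real R" for x
  proof -
   have "\<bar>real N * x\<bar> <= real N * real R" using x by (simp add: abs_mult mult_left_mono)
   then have "- real_of_int (int (R * N)) <= real N * x" "real N * x <= real_of_int (int (R * N))" by (auto simp: abs_le_iff mult.commute)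
   then show ?thesis unfolding T_def by (simp add: le_floor_iff floor_le_iff)
  qed
  have cellW: "cell v : W" if v: "v : A" for v
  proof -
   have "\<bar>Re (v $ i)\<bar> <= real R" "\<bar>Im (v $ i)\<bar> <= real R" for i
    using order_trans[OF Finite_Cartesian_Product.norm_nth_le[of v i] R[OF v]] abs_Re_le_cmod[of "v $ i"] abs_Im_le_cmod[of "v $ i"] by linarith+
   then show ?thesis by (auto simp: cell_def W_def intro!: inT)
  qed
  define F where "F = (%\<kappa>. complex_line ` L' ` {v:A. cell v = \<kappa>}) ` W"
  have "card F <= card W" unfolding F_def by (rule card_image_le[OF W(1)])
  moreover have "real (card W) <= real (2 * R + 1) ^ (2 * card J) * real N ^ (2 * card J)"
  proof -
   have "real (card T) <= real (2 * R + 1) * real N" using N by (simp add: cT algebra_simps)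
   then have "real (card T) ^ (2 * card J) <= (real (2 * R + 1) * real N) ^ (2 * card J)" by (rule power_mono) simp
   then show ?thesis by (simp add: W(2) power_mult power2_eq_square power_mult_distrib mult_ac)
  qed
  ultimately have 1: "real (card F) <= real (2 * R + 1) ^ (2 * card J) * real N ^ (2 * card J)" by linarith
  have 2: "complex_line ` L' ` A \<subseteq> \<Union>F" using cellW by (auto simp: F_def)
  have nz: "L' v ~= 0" if "v : A" for v
  proof
   assume "L' v = 0"
   then have "L (L' v) = L 0" by simp
   moreover have "L 0 = 0" by (rule linear_0[OF bounded_linear.linear[OF linear_pair_bounded_linear[OF linear_pairD(5)[OF L]]]])
   ultimately show False using i0(2)[OF that] by (simp add: linear_pairD(4)[OF L])
  qed
  have 3: "U \<subseteq> projective_space & (ALL x:U. ALL y:U. riemannian_dist g x y <= cc / real N)" if UF: "U : F" for U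
  proof -
   obtain \<kappa> where U: "U = complex_line ` L' ` {v:A. cell v = \<kappa>}" using UF by (auto simp: F_def)
   have "riemannian_dist g (complex_line (L' v)) (complex_line (L' w)) <= cc / real N"
    if v: "v : A" "w : A" and ce: "cell v = cell w" for v w
   proof -
    have comp: "norm ((cproj I v - cproj I w) $ i) <= 2 / real N" for i
    proof (cases "i : J")
     case True
     have "cell v i = cell w i" using ce by simp
     then have "\<bar>Re (v $ i) - Re (w $ i)\<bar> <= 1 / real N" "\<bar>Im (v $ i) - Im (w $ i)\<bar> <= 1 / real N"
      using True N by (auto simp: cell_def intro!: floor_eq_imp_close)
     then show ?thesis using True cmod_le[of "v $ i - w $ i"] by (simp add: J_def)
    next
     case False
     then show ?thesis using i0(2)[OF v(1)] i0(2)[OF v(2)] by (auto simp: J_def)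
    qed
    have "norm (cproj I v - cproj I w) <= (\<Sum>i\<in>(UNIV :: 'n set). 2 / real N)"
     by (rule order_trans[OF norm_vec_le_sum sum_mono]) (rule comp)
    then have "norm (cproj I v - cproj I w) <= n * 2 / real N" by (simp add: n_def)
    then have "\<Lambda> * norm (cproj I v - cproj I w) <= \<Lambda> * (n * 2 / real N)" by (rule mult_left_mono) (rule \<Lambda>(1))
    then have "norm (v - w) <= \<Lambda> * (n * 2 / real N)" using \<Lambda>(2)[OF v] by linarith
    then have "C * B' * B * norm (v - w) <= C * B' * B * (\<Lambda> * (n * 2 / real N))" using C(1) B(1) B'(1) by (intro mult_left_mono) auto
    also have "\<dots> <= cc / real N" using N by (simp add: cc_def field_simps)
    finally show ?thesis using dist[OF v] by linarith
   qed
   then show ?thesis unfolding U using nz by (auto simp: projective_space_def)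
  qed
  show "EX F. finite F & real (card F) <= real (2 * R + 1) ^ (2 * card J) * real N ^ (2 * card J) & complex_line ` L' ` A \<subseteq> \<Union>F &
   (ALL U:F. U \<subseteq> projective_space & (ALL x:U. ALL y:U. riemannian_dist g x y <= cc / real N))"
   by (intro exI[of _ F] conjI 1 2 ballI) (use 3 W(1) in \<open>auto simp: F_def\<close>)
 qed
qed

section \<open>Equations of the cone of asymptotic directions\<close>

lemma degree_le_if_growth:
 fixes p :: "complex poly"
 assumes p: "!!t. norm (poly p t) <= C * (1 + norm t * a) ^ M" and C: "C >= 0" "a >= 0"
 shows "degree p <= M"
proof -
 have "poly p \<xi> = (\<Sum>k\<le>M. (deriv ^^ k) (poly p) 0 / fact k * \<xi> ^ k)" for \<xi>
 proof (rule Liouville_polynomial[where A = 1 and B = "C * (1 + a) ^ M"])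
  show "poly p holomorphic_on UNIV"
   by (auto simp: holomorphic_on_def field_differentiable_def intro!: exI poly_DERIV)
  fix z :: complex assume z: "1 <= norm z"
  have "1 + norm z * a <= (1 + a) * norm z" using z C(2) by (simp add: algebra_simps)
  then have "(1 + norm z * a) ^ M <= ((1 + a) * norm z) ^ M" using C(2) by (intro power_mono) auto
  from mult_left_mono[OF this C(1)] show "norm (poly p z) <= C * (1 + a) ^ M * norm z ^ M"
   using p[of z] by (simp add: power_mult_distrib mult.assoc)
 qed
 then have "poly p \<xi> = poly (\<Sum>k\<le>M. monom ((deriv ^^ k) (poly p) 0 / fact k) k) \<xi>" for \<xi>
  by (simp add: poly_sum poly_monom)
 then have "p = (\<Sum>k\<le>M. monom ((deriv ^^ k) (poly p) 0 / fact k) k)"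
  by (simp add: poly_eq_poly_eq_iff[symmetric] fun_eq_iff)
 moreover have "degree (\<Sum>k\<le>M. monom ((deriv ^^ k) (poly p) 0 / fact k) k) <= M"
  by (rule degree_sum_le) (auto intro: order_trans[OF degree_monom_le])
 ultimately show ?thesis by simp
qed

text \<open>The growth exponent \<open>M\<close> bounds the degree on every line. The homogeneous
  part of degree \<open>M\<close>, which may be zero, is therefore the limit of \<sigma> rescaled by
  the power \<open>M\<close>.\<close>

lemma top_degree_part:
 fixes \<sigma> :: "complex^'n => complex"
 assumes \<sigma>: "polyfn \<sigma>" "poly_growth M \<sigma>" and I: "!!z. \<sigma> (cproj I z) = \<sigma> z"
 shows "EX \<tau>. polyfn \<tau> & (ALL z. \<tau> (cproj I z) = \<tau> z) & (ALL c z. \<tau> (c *s z) = c ^ M * \<tau> z) &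
  (ALL t u v. filterlim t at_top sequentially & (ALL n. t n > 0) & u \<longlonglongrightarrow> v -->
    (%n. \<sigma> (of_real (t n) *s u n) / of_real (t n) ^ M) \<longlonglongrightarrow> \<tau> v)"
proof -
 obtain H N where H: "ALL u t. \<sigma> (t *s u) = poly (H u) t" "ALL i. polyfn (%u. coeff (H u) i)" "ALL u. degree (H u) <= N"
  using polyfn_homogeneous_parts[OF \<sigma>(1)] by (elim exE conjE) (rule that; assumption)
 have polyeq: "p = q" if "!!t. poly p t = poly q t" for p q :: "complex poly"
  using that by (simp add: poly_eq_poly_eq_iff[symmetric] fun_eq_iff)
 obtain C where C: "C >= 0" "!!z. norm (\<sigma> z) <= C * (1 + norm z) ^ M" using \<sigma>(2) unfolding poly_growth_def by blast
 have deg: "degree (H u) <= M" for u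
  by (rule degree_le_if_growth[where C = C and a = "norm u"])
   (use C H(1)[rule_format, symmetric] in \<open>simp_all add: norm_vec_scale[symmetric]\<close>)
 define \<tau> where "\<tau> u = coeff (H u) M" for u
 have h1: "H (cproj I u) = H u" for u
 proof (rule polyeq)
  fix t
  have "\<sigma> (t *s cproj I u) = \<sigma> (t *s u)" using I[of "t *s u"] by simp
  then show "poly (H (cproj I u)) t = poly (H u) t" using H(1) by simp
 qed
 have h2: "H (c *s u) = pcompose (H u) [:0, c:]" for c u
 proof (rule polyeq)
  fix t
  have "poly (H (c *s u)) t = \<sigma> ((t * c) *s u)" using H(1)[rule_format, of t "c *s u"] by (simp add: vector_smult_assoc)
  then show "poly (H (c *s u)) t = poly (pcompose (H u) [:0, c:]) t" using H(1) by (simp add: poly_pcompose)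
 qed
 have t1: "\<tau> (c *s z) = c ^ M * \<tau> z" for c z unfolding \<tau>_def h2 by (rule coeff_pcompose_linear)
 have lim: "(%n. \<sigma> (of_real (t n) *s u n) / of_real (t n) ^ M) \<longlonglongrightarrow> \<tau> v"
  if t: "filterlim t at_top sequentially" "!!n. t n > 0" and u: "u \<longlonglongrightarrow> v" for t :: "nat => real" and u v
 proof -
  have inv0: "(%n. inverse (t n)) \<longlonglongrightarrow> 0" by (rule tendsto_inverse_0_at_top[OF t(1)])
  have ratio: "(%n. complex_of_real (t n) ^ i / of_real (t n) ^ M) \<longlonglongrightarrow> (if i = M then 1 else 0)" if i: "i <= M" for i
  proof (cases "i = M")
   case True
   have "complex_of_real (t n) ^ M / of_real (t n) ^ M = 1" for n using t(2)[of n] by simp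
   then show ?thesis using True by simp
  next
   case False
   have "(%n. of_real (inverse (t n) ^ (M - i))) \<longlonglongrightarrow> (of_real (0 ^ (M - i)) :: complex)"
    by (intro tendsto_of_real tendsto_power inv0)
   moreover have "complex_of_real (inverse (t n) ^ (M - i)) = of_real (t n) ^ i / of_real (t n) ^ M" for n
   proof -
    have "t n ~= 0" using t(2)[of n] by simp
    moreover have "t n ^ M = t n ^ i * t n ^ (M - i)" using i by (simp add: power_add[symmetric])
    ultimately have "inverse (t n) ^ (M - i) = t n ^ i / t n ^ M" by (simp add: power_inverse field_simps)
    then show ?thesis by simp
   qed
   ultimately show ?thesis using False i by (simp add: power_0_left)
  qed
  have cf: "(%n. coeff (H (u n)) i) \<longlonglongrightarrow> coeff (H v) i" for i
   using continuous_on_tendsto_compose[OF continuous_on_polyfn[OF spec[OF H(2), of i], of UNIV] u] by simp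
  have "(%n. \<Sum>i\<le>M. coeff (H (u n)) i * (of_real (t n) ^ i / of_real (t n) ^ M)) \<longlonglongrightarrow>
   (\<Sum>i\<le>M. coeff (H v) i * (if i = M then 1 else 0))"
   by (intro tendsto_sum tendsto_mult cf ratio) simp
  moreover have "(\<Sum>i\<le>M. coeff (H v) i * (if i = M then 1 else 0)) = \<tau> v"
   by (simp add: \<tau>_def if_distrib cong: if_cong)
  moreover have "(\<Sum>i\<le>M. coeff (H (u n)) i * (of_real (t n) ^ i / of_real (t n) ^ M)) = \<sigma> (of_real (t n) *s u n) / of_real (t n) ^ M" for n
   using H(1) by (simp add: poly_eq_sum_le[OF deg] sum_divide_distrib)
  ultimately show ?thesis by simp
 qed
 show ?thesis
 proof (rule exI[of _ \<tau>], intro conjI allI impI)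
  show "polyfn \<tau>" unfolding \<tau>_def[abs_def] by (rule spec[OF H(2)])
  show "\<tau> (cproj I z) = \<tau> z" for z by (simp add: \<tau>_def h1)
  show "\<tau> (c *s z) = c ^ M * \<tau> z" for c z by (rule t1)
  show "(%n. \<sigma> (of_real (t n) *s u n) / of_real (t n) ^ M) \<longlonglongrightarrow> \<tau> v"
   if "filterlim t at_top sequentially & (ALL n. t n > 0) & u \<longlonglongrightarrow> v" for t u v
   using that by (intro lim) auto
 qed
qed

lemma lin_form_axis: "lin_form (axis j 1) z = z $ j"
 by (simp add: lin_form_def axis_def if_distrib[of "%c. c * _"] sum.delta cong: if_cong)

text \<open>Rescaling the fibre equation of the coordinate \<open>j\<close> along a sequence tending
  to infinity keeps, of the coefficient of index \<open>i\<close>, only the part of degree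
  \<open>k - i\<close>. In the limit this is a monic polynomial, jointly homogeneous in
  \<open>v\<close> and the unknown, that vanishes on the asymptotic directions.\<close>

lemma asymptotic_equations:
 fixes Y :: "(complex^'n) set"
 assumes Y: "analytic_subset Y" "in_cone I Y" and dp: "dense_projection I Y"
 shows "EX k. EX q :: complex^'n => complex poly. (ALL i. polyfn (%v. coeff (q v) i)) &
  (ALL v. degree (q v) = k & coeff (q v) k = 1) & (ALL v. q (cproj I v) = q v) &
  (ALL c v x. poly (q (c *s v)) (c * x) = c ^ k * poly (q v) x) & (ALL x. poly (q 0) x = x ^ k) &
  (ALL v:tangent_cone_inf Y. poly (q v) (v $ j) = 0)"
proof -
 obtain k where k: "ALL c. EX \<sigma>. (ALL i. hol (\<sigma> i) UNIV) & (ALL i<=k. poly_growth (k - i) (\<sigma> i)) &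
  (ALL z. \<sigma> k z = 1) & (ALL i z. \<sigma> i z = \<sigma> i (cproj I z)) &
  (ALL x:Y. (\<Sum>i\<le>k. \<sigma> i x * lin_form c x ^ i) = 0) &
  (ALL z. (ALL x:Y. cproj I x = cproj I z --> lin_form c x ~= lin_form c z) -->
    (\<Sum>i\<le>k. \<sigma> i z * lin_form c z ^ i) ~= 0)"
  using fibre_polynomials[OF Y dp] by (elim exE)
 obtain \<sigma> where \<sigma>: "ALL i. hol (\<sigma> i) UNIV" "ALL i<=k. poly_growth (k - i) (\<sigma> i)" "ALL z. \<sigma> k z = 1"
  "ALL i z. \<sigma> i z = \<sigma> i (cproj I z)" "ALL x:Y. (\<Sum>i\<le>k. \<sigma> i x * lin_form (axis j 1) x ^ i) = 0"
  using spec[OF k, of "axis j 1"] by (elim exE conjE) (rule that; assumption)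
 have "ALL i. EX \<tau>. i <= k --> polyfn \<tau> & (ALL z. \<tau> (cproj I z) = \<tau> z) & (ALL c z. \<tau> (c *s z) = c ^ (k - i) * \<tau> z) &
  (ALL t u v. filterlim t at_top sequentially & (ALL n. t n > 0) & u \<longlonglongrightarrow> v -->
    (%n. \<sigma> i (of_real (t n) *s u n) / of_real (t n) ^ (k - i)) \<longlonglongrightarrow> \<tau> v)" (is "ALL i. EX \<tau>. ?P i \<tau>")
 proof
  fix i
  show "EX \<tau>. ?P i \<tau>"
  proof (cases "i <= k")
   case True
   then have gr: "poly_growth (k - i) (\<sigma> i)" using \<sigma>(2) by simp
   have "EX \<tau>. polyfn \<tau> & (ALL z. \<tau> (cproj I z) = \<tau> z) & (ALL c z. \<tau> (c *s z) = c ^ (k - i) * \<tau> z) &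
  (ALL t u v. filterlim t at_top sequentially & (ALL n. t n > 0) & u \<longlonglongrightarrow> v -->
    (%n. \<sigma> i (of_real (t n) *s u n) / of_real (t n) ^ (k - i)) \<longlonglongrightarrow> \<tau> v)"
    by (rule top_degree_part[OF polyfn_if_growth[OF spec[OF \<sigma>(1)] gr] gr]) (rule \<sigma>(4)[rule_format, symmetric])
   then show ?thesis by (elim exE) (rule exI, rule impI)
  qed simp
 qed
 from choice[OF this] obtain \<tau> where \<tau>: "ALL i. ?P i (\<tau> i)" by (elim exE)
 have \<tau>p: "polyfn (\<tau> i)" and \<tau>I: "!!z. \<tau> i (cproj I z) = \<tau> i z" and \<tau>h: "!!c z. \<tau> i (c *s z) = c ^ (k - i) * \<tau> i z"
  and \<tau>l: "!!t u v. filterlim t at_top sequentially ==> (ALL n. t n > 0) ==> u \<longlonglongrightarrow> v ==>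
    (%n. \<sigma> i (of_real (t n) *s u n) / of_real (t n) ^ (k - i)) \<longlonglongrightarrow> \<tau> i v" if "i <= k" for i
  using mp[OF spec[OF \<tau>, of i] that] by simp_all
 have \<tau>k: "\<tau> k v = 1" for v
 proof -
  have "(%n. \<sigma> k (of_real (real (Suc n)) *s v) / of_real (real (Suc n)) ^ (k - k)) \<longlonglongrightarrow> \<tau> k v"
   by (rule \<tau>l[OF order_refl filterlim_compose[OF filterlim_real_sequentially filterlim_Suc]]) auto
  then have "(%n::nat. 1) \<longlonglongrightarrow> \<tau> k v" using \<sigma>(3) by simp
  then show ?thesis using LIMSEQ_unique[OF tendsto_const] by metis
 qed
 define q where "q v = (\<Sum>i\<le>k. monom (\<tau> i v) i)" for v
 have cq: "coeff (q v) i = (if i <= k then \<tau> i v else 0)" for v i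
  by (simp add: q_def coeff_sum if_distrib sum.delta cong: if_cong)
 have dq: "degree (q v) <= k" for v by (rule degree_le) (simp add: cq)
 have pq: "poly (q v) x = (\<Sum>i\<le>k. \<tau> i v * x ^ i)" for v x by (simp add: poly_eq_sum_le[OF dq] cq)
 show ?thesis
 proof (rule exI[of _ k], rule exI[of _ q], intro conjI allI ballI)
  show "polyfn (%v. coeff (q v) i)" for i
   by (cases "i <= k") (simp_all add: cq \<tau>p polyfn.const)
  show "coeff (q v) k = 1" for v by (simp add: cq \<tau>k)
  then show "degree (q v) = k" for v using dq[of v] le_degree[of "q v" k] by (metis le_antisym zero_neq_one)
  show "q (cproj I v) = q v" for v unfolding q_def by (rule sum.cong) (simp_all add: \<tau>I)
  show "poly (q (c *s v)) (c * x) = c ^ k * poly (q v) x" for c v x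
  proof -
   have "\<tau> i (c *s v) * (c * x) ^ i = c ^ k * (\<tau> i v * x ^ i)" if "i : {..k}" for i
   proof -
    have "c ^ k = c ^ (k - i) * c ^ i" using that by (simp add: power_add[symmetric])
    then show ?thesis using that by (simp add: \<tau>h power_mult_distrib)
   qed
   then show ?thesis unfolding pq sum_distrib_left by (intro sum.cong refl)
  qed
  show "poly (q 0) x = x ^ k" for x
  proof -
   have "\<tau> i 0 = 0" if "i < k" for i using \<tau>h[of i 0 0] that by (simp add: power_0_left)
   then have "(\<Sum>i<k. \<tau> i 0 * x ^ i) = 0" by simp
   then show ?thesis unfolding pq by (simp add: lessThan_Suc_atMost[symmetric] \<tau>k)
  qed
  fix v assume "v : tangent_cone_inf Y"
  then obtain x t where xt: "ALL n. x n : Y" "ALL n. t n > 0" "filterlim t at_top sequentially" "(%n. x n /\<^sub>R t n) \<longlonglongrightarrow> v"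
   unfolding tangent_cone_inf_def mem_Collect_eq by (elim exE conjE) (rule that; assumption)
  define u where "u n = x n /\<^sub>R t n" for n
  have u: "u \<longlonglongrightarrow> v" using xt(4) by (simp add: u_def[abs_def])
  have xu: "x n = of_real (t n) *s u n" for n
  proof -
   have "t n ~= 0" using spec[OF xt(2), of n] by simp
   then show ?thesis by (simp add: u_def of_real_scale)
  qed
  have "(%n. \<Sum>i\<le>k. \<sigma> i (of_real (t n) *s u n) / of_real (t n) ^ (k - i) * (u n $ j) ^ i) \<longlonglongrightarrow> (\<Sum>i\<le>k. \<tau> i v * (v $ j) ^ i)"
   by (intro tendsto_sum tendsto_mult \<tau>l xt(2,3) u tendsto_power tendsto_vec_nth) simp
  moreover have "(\<Sum>i\<le>k. \<sigma> i (of_real (t n) *s u n) / of_real (t n) ^ (k - i) * (u n $ j) ^ i) = 0" for n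
  proof -
   have t0: "t n ~= 0" using spec[OF xt(2), of n] by simp
   have "\<sigma> i (of_real (t n) *s u n) / of_real (t n) ^ (k - i) * (u n $ j) ^ i = \<sigma> i (x n) * (x n $ j) ^ i / of_real (t n) ^ k"
    if "i : {..k}" for i
   proof -
    have "complex_of_real (t n) ^ k = of_real (t n) ^ (k - i) * of_real (t n) ^ i" using that by (simp add: power_add[symmetric])
    moreover have "(x n $ j) ^ i = of_real (t n) ^ i * (u n $ j) ^ i" by (simp add: xu power_mult_distrib)
    ultimately show ?thesis using t0 by (simp add: xu[symmetric])
   qed
   then have "(\<Sum>i\<le>k. \<sigma> i (of_real (t n) *s u n) / of_real (t n) ^ (k - i) * (u n $ j) ^ i) = (\<Sum>i\<le>k. \<sigma> i (x n) * (x n $ j) ^ i) / of_real (t n) ^ k"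
    unfolding sum_divide_distrib by (intro sum.cong refl)
   also have "(\<Sum>i\<le>k. \<sigma> i (x n) * (x n $ j) ^ i) = 0"
    using bspec[OF \<sigma>(5) spec[OF xt(1), of n]] by (simp add: lin_form_axis)
   finally show ?thesis by simp
  qed
  ultimately have "(%n::nat. 0) \<longlonglongrightarrow> (\<Sum>i\<le>k. \<tau> i v * (v $ j) ^ i)" by simp
  then show "poly (q v) (v $ j) = 0" unfolding pq using LIMSEQ_unique[OF tendsto_const] by metis
 qed
qed

lemma tangent_cone_linear_image:
 assumes L: "linear_pair L L'" and u: "u : tangent_cone_inf X"
 shows "L u : tangent_cone_inf (L ` X)"
proof -
 obtain x t where xt: "ALL n. x n : X" "ALL n. t n > 0" "filterlim (%n. norm (x n)) at_top sequentially"
  "filterlim t at_top sequentially" "(%n. x n /\<^sub>R t n) \<longlonglongrightarrow> u"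
  using u unfolding tangent_cone_inf_def mem_Collect_eq by (elim exE conjE) (rule that; assumption)
 obtain B where B: "B > 0" "!!z. norm (L' z) <= norm z * B"
  using bounded_linear.pos_bounded[OF linear_pair_bounded_linear[OF linear_pairD(5)[OF L]]] by blast
 interpret L: bounded_linear L by (rule linear_pair_bounded_linear[OF L])
 have lim: "filterlim (%n. norm (x n) / B) at_top sequentially"
  using filterlim_tendsto_pos_mult_at_top[OF tendsto_const[of "inverse B"] _ xt(3)] B(1)
  by (simp add: divide_inverse mult.commute)
 have ge: "norm (x n) / B <= norm (L (x n))" for n
  using B(2)[of "L (x n)"] B(1) by (simp add: linear_pairD(4)[OF L] field_simps)
 have 1: "filterlim (%n. norm (L (x n))) at_top sequentially"
  by (rule filterlim_at_top_mono[OF lim]) (simp add: ge)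
 have "(%n. L (x n /\<^sub>R t n)) \<longlonglongrightarrow> L u" by (rule L.tendsto[OF xt(5)])
 then have 2: "(%n. L (x n) /\<^sub>R t n) \<longlonglongrightarrow> L u" by (simp add: L.scaleR)
 show ?thesis unfolding tangent_cone_inf_def mem_Collect_eq
  by (rule exI[of _ "%n. L (x n)"], rule exI[of _ t]) (use xt(1,2,4) 1 2 in simp)
qed

text \<open>\<mu> is one less than the multiplicity of the root \<open>x\<close>; the derivative of
  order \<mu> has \<open>x\<close> as a simple root.\<close>

lemma multiplicity_exists:
 fixes p :: "complex poly"
 assumes p: "degree p = k" "coeff p k = 1" and x: "poly p x = 0"
 shows "EX \<mu>. poly ((pderiv ^^ \<mu>) p) x = 0 & poly (pderiv ((pderiv ^^ \<mu>) p)) x ~= 0"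
proof -
 define m where "m = (LEAST m. poly ((pderiv ^^ m) p) x ~= 0)"
 have "poly ((pderiv ^^ k) p) x ~= 0" by (simp add: higher_pderiv_monic[OF p])
 then have m: "poly ((pderiv ^^ m) p) x ~= 0" unfolding m_def by (rule LeastI)
 then have "m ~= 0" using x by (metis funpow_0)
 then obtain \<mu> where \<mu>: "m = Suc \<mu>" using not0_implies_Suc by blast
 have "poly ((pderiv ^^ \<mu>) p) x = 0" using not_less_Least[of \<mu> "%m. poly ((pderiv ^^ m) p) x ~= 0"] \<mu> by (auto simp: m_def)
 then show ?thesis using m \<mu> by (intro exI[of _ \<mu>]) simp
qed

lemma higher_pderiv_family:
 assumes "!!i. polyfn (%v. coeff (q v) i)" "!!v. degree (q v) <= k"
 shows "polyfn (%v. coeff ((pderiv ^^ \<mu>) (q v)) i)" "degree ((pderiv ^^ \<mu>) (q v)) <= k"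
proof (induction \<mu> arbitrary: i)
 case (Suc \<mu>)
 {
  case 1
  show ?case unfolding funpow.simps comp_apply coeff_pderiv by (intro polyfn.mult polyfn.const Suc)
 next
  case 2
  show ?case using Suc(2) by (simp add: degree_pderiv)
 }
qed (use assms in simp_all)

text \<open>Points whose fibre coordinates are roots with the multiplicities given by \<mu> lie in
  \<open>S \<mu>\<close>, where these coordinates become simple roots of derivatives. Near such a
  point \<open>S \<mu>\<close> is a Lipschitz graph over the base. There are countably many patterns
  \<mu>, and by Lindelof's theorem countably many balls suffice for each.\<close>

theorem asymptotic_directions_null:
 fixes X :: "(complex^'n) set"
 assumes X: "pure_analytic_set d X" "algebraic_set X" and g: "projective_riemannian_metric g" and s: "s > 2 * real d - 2"
 shows "proj_hausdorff_measure g s (asymptotic_directions X) = 0"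
proof -
 obtain L L' I where L: "linear_pair L L'" and cI: "card I = d" and cone: "in_cone I (L ` X)"
  using algebraic_in_cone[OF X] by (elim exE conjE) (rule that; assumption)
 have an: "analytic_subset X" using X(1) by (simp add: pure_analytic_set_def)
 have anL: "analytic_subset (L ` X)" by (rule analytic_subset_linear_image[OF L an])
 have "x : closure (regular_points (L ` X) d)" if "x : L ` X" for x
  by (rule regular_dense_linear_image[OF L pure_closure_regular(1)[OF X(1)] that])
 then have dp: "dense_projection I (L ` X)" by (intro dense_projection_if_regular_dense[OF anL cone cI])
 let ?Q = "%j k (q :: complex^'n => complex poly). (ALL i. polyfn (%v. coeff (q v) i)) &
  (ALL v. degree (q v) = k & coeff (q v) k = 1) & (ALL v. q (cproj I v) = q v) &
  (ALL c v x. poly (q (c *s v)) (c * x) = c ^ k * poly (q v) x) & (ALL x. poly (q 0) x = x ^ k) &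
  (ALL v:tangent_cone_inf (L ` X). poly (q v) (v $ j) = 0)"
 have "ALL j. EX k. EX q. ?Q j k q" by (intro allI asymptotic_equations[OF anL cone dp])
 from choice[OF this] obtain k where "ALL j. EX q. ?Q j (k j) q" by (elim exE)
 from choice[OF this] obtain q where "ALL j. ?Q j (k j) (q j)" by (elim exE)
 then have q1: "polyfn (%v. coeff (q j v) i)" and q2: "degree (q j v) = k j" "coeff (q j v) (k j) = 1"
  and q3: "q j (cproj I v) = q j v" and q4: "poly (q j (c *s v)) (c * x) = c ^ k j * poly (q j v) x"
  and q5: "poly (q j 0) x = x ^ k j" and q6: "v' : tangent_cone_inf (L ` X) ==> poly (q j v') (v' $ j) = 0" for i j v c x v'
  by simp_all
 define Z where "Z = {v. ALL j: - I. poly (q j v) (v $ j) = 0}"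
 define S where "S \<mu> = {v. ALL j: - I. poly ((pderiv ^^ \<mu> j) (q j v)) (v $ j) = 0}" for \<mu> :: "'n => nat"
 have Zscale: "c *s v : Z" if "v : Z" for c v using that by (simp add: Z_def q4)
 \<comment> \<open>If all base coordinates vanished, each equation would read
   \<open>x ^ k j = 0\<close> and force \<open>v = 0\<close>. Hence some coordinate in
   \<open>I\<close> can be scaled to \<open>1\<close>.\<close>
 have Z0: "EX i:I. v $ i ~= 0" if v: "v : Z" "v ~= 0" for v
 proof (rule ccontr)
  assume "\<not> (EX i:I. v $ i ~= 0)"
  then have I0: "!!i. i : I ==> v $ i = 0" by blast
  then have "cproj I v = 0" by (simp add: vec_eq_iff)
  then have "q j v = q j 0" for j using q3[of j v] by simp
  then have "v $ j = 0" if "j ~: I" for j using v(1) that by (auto simp: Z_def q5)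
  then have "v = 0" using I0 by (auto simp: vec_eq_iff)
  then show False using v(2) by simp
 qed
 have "ALL v0. EX \<mu> r. v0 : Z --> r > 0 & v0 : S \<mu> & lipschitz_over I (ball v0 r Int S \<mu>)"
 proof (intro allI)
  fix v0
  show "EX \<mu> r. v0 : Z --> r > 0 & v0 : S \<mu> & lipschitz_over I (ball v0 r Int S \<mu>)"
  proof (cases "v0 : Z")
   case True
   have "ALL j: - I. EX \<mu>. poly ((pderiv ^^ \<mu>) (q j v0)) (v0 $ j) = 0 & poly (pderiv ((pderiv ^^ \<mu>) (q j v0))) (v0 $ j) ~= 0"
    using True by (intro ballI multiplicity_exists[OF q2]) (simp add: Z_def)
   from bchoice[OF this] obtain \<mu> where \<mu>: "!!j. j : - I ==> poly ((pderiv ^^ \<mu> j) (q j v0)) (v0 $ j) = 0"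
    "!!j. j : - I ==> poly (pderiv ((pderiv ^^ \<mu> j) (q j v0))) (v0 $ j) ~= 0" by blast
   define P where "P j r \<longleftrightarrow> (EX \<Lambda>>=0. ALL v:ball v0 r. ALL w:ball v0 r. poly ((pderiv ^^ \<mu> j) (q j v)) (v $ j) = 0 &
    poly ((pderiv ^^ \<mu> j) (q j w)) (w $ j) = 0 --> norm (v $ j - w $ j) <= \<Lambda> * norm (cproj I v - cproj I w))" for j r
   have ex: "EX r>0. P j r" if j: "j : - I" for j
   proof -
    have fam: "polyfn (%v. coeff ((pderiv ^^ \<mu> j) (q j v)) i)" "degree ((pderiv ^^ \<mu> j) (q j v)) <= k j" for i v
     by (rule higher_pderiv_family[OF q1, where k = "k j"], simp add: q2)+
    show ?thesis unfolding P_def by (rule simple_root_lipschitz[OF fam]) (simp_all add: q3 \<mu>(2)[OF j])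
   qed
   have mono: "P j r'" if P: "P j r" and r: "0 < r'" "r' <= r" for j r r'
   proof -
    have sub: "ball v0 r' \<subseteq> ball v0 r" using r by (intro subset_ball)
    from P[unfolded P_def] obtain \<Lambda> where \<Lambda>: "\<Lambda> >= 0" "ALL v:ball v0 r. ALL w:ball v0 r. poly ((pderiv ^^ \<mu> j) (q j v)) (v $ j) = 0 &
    poly ((pderiv ^^ \<mu> j) (q j w)) (w $ j) = 0 --> norm (v $ j - w $ j) <= \<Lambda> * norm (cproj I v - cproj I w)"
     by (elim exE conjE)
    show ?thesis unfolding P_def
     by (rule exI[of _ \<Lambda>], rule conjI[OF \<Lambda>(1)], rule ballI, rule ballI, rule bspec[OF bspec[OF \<Lambda>(2)]])
      (erule subsetD[OF sub])+
   qed
   have "EX r>0. ALL j: - I. P j r"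
    by (rule finite_common_radius) (simp, erule ex, (rule mono; assumption))
   then obtain r where r: "r > 0" "ALL j: - I. P j r" by (elim exE conjE)
   from bchoice[OF r(2)[unfolded P_def]] obtain \<Lambda> where \<Lambda>0: "ALL j: - I. \<Lambda> j >= 0 & (ALL v:ball v0 r. ALL w:ball v0 r.
    poly ((pderiv ^^ \<mu> j) (q j v)) (v $ j) = 0 & poly ((pderiv ^^ \<mu> j) (q j w)) (w $ j) = 0 -->
    norm (v $ j - w $ j) <= \<Lambda> j * norm (cproj I v - cproj I w))" by (elim exE)
   have \<Lambda>: "\<Lambda> j >= 0" "v : ball v0 r ==> w : ball v0 r ==> poly ((pderiv ^^ \<mu> j) (q j v)) (v $ j) = 0 ==>
    poly ((pderiv ^^ \<mu> j) (q j w)) (w $ j) = 0 ==> norm (v $ j - w $ j) <= \<Lambda> j * norm (cproj I v - cproj I w)"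
    if "j : - I" for j v w using bspec[OF \<Lambda>0 that] by simp_all
   define \<Lambda>' where "\<Lambda>' = 1 + (\<Sum>j\<in>- I. \<Lambda> j)"
   have L': "norm (v - w) <= \<Lambda>' * norm (cproj I v - cproj I w)" if v: "v : ball v0 r Int S \<mu>" "w : ball v0 r Int S \<mu>" for v w
   proof -
    have "v - w = cproj I (v - w) + (\<Sum>j\<in>- I. axis j ((v - w) $ j))"
     by (simp add: vec_eq_iff axis_def sum.delta' if_distrib cong: if_cong)
    then have "norm (v - w) <= norm (cproj I (v - w)) + norm (\<Sum>j\<in>- I. axis j ((v - w) $ j))" by (metis norm_triangle_ineq)
    also have "norm (\<Sum>j\<in>- I. axis j ((v - w) $ j)) <= (\<Sum>j\<in>- I. norm (v $ j - w $ j))"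
    proof (rule order_trans[OF norm_sum sum_mono])
     show "norm (axis j ((v - w) $ j) :: complex^'n) <= norm (v $ j - w $ j)" for j
      by (rule order_trans[OF norm_vec_le_sum]) (simp add: axis_def if_distrib[of norm] cong: if_cong)
    qed
    also have "\<dots> <= (\<Sum>j\<in>- I. \<Lambda> j * norm (cproj I v - cproj I w))"
     using v by (intro sum_mono \<Lambda>(2)) (auto simp: S_def)
    finally show ?thesis by (simp add: \<Lambda>'_def distrib_right sum_distrib_right)
   qed
   have "bounded (ball v0 r Int S \<mu>)" by (rule bounded_subset[OF bounded_ball]) blast
   moreover have "\<Lambda>' >= 0" unfolding \<Lambda>'_def using \<Lambda>(1) by (intro add_nonneg_nonneg sum_nonneg) auto
   ultimately have "lipschitz_over I (ball v0 r Int S \<mu>)" unfolding lipschitz_over_def using L' by blast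
   moreover have "v0 : S \<mu>" using \<mu>(1) by (simp add: S_def)
   ultimately show ?thesis using r(1) by (intro exI[of _ \<mu>] exI[of _ r]) simp
  qed simp
 qed
 from choice[OF this] obtain \<mu> where "ALL v0. EX r. v0 : Z --> r > 0 & v0 : S (\<mu> v0) & lipschitz_over I (ball v0 r Int S (\<mu> v0))" by (elim exE)
 from choice[OF this] obtain r where r: "ALL v0. v0 : Z --> r v0 > 0 & v0 : S (\<mu> v0) & lipschitz_over I (ball v0 (r v0) Int S (\<mu> v0))" by (elim exE)
 define F where "F m = (%v. ball v (r v)) ` {v:Z. \<mu> v = m}" for m
 have "EX F'. F' \<subseteq> F m & countable F' & \<Union>F' = \<Union>(F m)" for m
 proof -
  have op: "open T" if "T : F m" for T using that by (auto simp: F_def)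
  show ?thesis by (rule Lindelof[of "F m"]) (erule op, (intro exI conjI; assumption))
 qed
 then have "ALL m. EX F'. F' \<subseteq> F m & countable F' & \<Union>F' = \<Union>(F m)" by (intro allI)
 from choice[OF this] obtain F' where F': "ALL m. F' m \<subseteq> F m & countable (F' m) & \<Union>(F' m) = \<Union>(F m)" by (elim exE)
 define A where "A i m B = B Int S m Int {v. v $ i = 1}" for i m B
 let ?M = "hausdorff_measure projective_space (riemannian_dist g) s"
 have null: "?M (complex_line ` L' ` A i m B) = 0" if i: "i : I" and B: "B : F' m" for i m B
 proof (rule lines_of_lipschitz_null[OF g linear_pairD(5)[OF L] _ i])
  have "B : F m" using F' B by blast
  then obtain v where v: "v : Z" "\<mu> v = m" "B = ball v (r v)" by (auto simp: F_def)
  have "lipschitz_over I (ball v (r v) Int S (\<mu> v))" using mp[OF spec[OF r] v(1)] by (elim conjE)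
  then have "lipschitz_over I (B Int S m)" unfolding v(2) v(3)[symmetric] .
  then show "lipschitz_over I (A i m B)" unfolding lipschitz_over_def A_def by (blast intro: bounded_subset)
  show "v $ i = 1" if "v : A i m B" for v using that by (simp add: A_def)
  show "2 * real (card I) - 2 < s" using s cI by simp
 qed
 have "?M (\<Union>i\<in>I. \<Union>m. \<Union>B\<in>F' m. complex_line ` L' ` A i m B) = 0"
  by (intro hausdorff_null_countable_UN null countableI_type) (use F' in \<open>auto intro: countable_finite\<close>)
 moreover have "asymptotic_directions X \<subseteq> (\<Union>i\<in>I. \<Union>m. \<Union>B\<in>F' m. complex_line ` L' ` A i m B)"
 proof
  fix l assume "l : asymptotic_directions X"
  then obtain u where u: "u : tangent_cone_inf X" "u ~= 0" "l = complex_line u" by (auto simp: asymptotic_directions_def)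
  have LuZ: "L u : Z" using q6[OF tangent_cone_linear_image[OF L u(1)]] by (simp add: Z_def)
  have "L u ~= 0"
  proof
   assume "L u = 0"
   then have "L' (L u) = L' 0" by simp
   then show False using u(2) linear_0[OF bounded_linear.linear[OF linear_pair_bounded_linear[OF linear_pairD(5)[OF L]]]]
    by (simp add: linear_pairD(4)[OF L])
  qed
  then obtain i where i: "i : I" "L u $ i ~= 0" using Z0[OF LuZ] by blast
  define v where "v = (1 / L u $ i) *s L u"
  have vZ: "v : Z" unfolding v_def by (rule Zscale[OF LuZ])
  have rv: "r v > 0" "v : S (\<mu> v)" using mp[OF spec[OF r] vZ] by simp_all
  then have "v : \<Union>(F (\<mu> v))" using vZ by (auto simp: F_def)
  then obtain B where B: "B : F' (\<mu> v)" "v : B" using F' by blast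
  have "v : A i (\<mu> v) B" using B(2) rv(2) i(2) by (simp add: A_def v_def)
  moreover have "l = complex_line (L' v)"
   using u(3) i(2) by (simp add: v_def linear_pairD(2)[OF linear_pairD(5)[OF L]] linear_pairD(4)[OF L] complex_line_scale)
  ultimately show "l : (\<Union>i\<in>I. \<Union>m. \<Union>B\<in>F' m. complex_line ` L' ` A i m B)" using B(1) i(1) by blast
 qed
 ultimately show ?thesis unfolding proj_hausdorff_measure_def by (rule hausdorff_null_subset)
qed

section \<open>The two alternatives\<close>

lemma algebraic_if_null:
 fixes X :: "(complex^'n) set"
 assumes d: "1 <= d" "d <= CARD('n)" and X: "pure_analytic_set d X" and g: "projective_riemannian_metric g"
  and null: "proj_hausdorff_measure g (2 * real d) (asymptotic_directions X) = 0"
 shows "algebraic_set X"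
proof -
 obtain I :: "'n set" where I: "card I = d" using obtain_subset_with_card_n[OF d(2)] by blast
 have I0: "I ~= {}" using I d(1) by auto
 have nl: "proj_hausdorff_measure g (2 * real (card I)) (asymptotic_directions X) = 0" using null I by simp
 obtain L L' where L: "linear_pair L L'" and cone: "in_cone I (L ` X)"
  using transverse_projection[OF g I0 nl] by (elim exE conjE) (rule that; assumption)
 have an: "analytic_subset X" using X by (simp add: pure_analytic_set_def)
 have anL: "analytic_subset (L ` X)" by (rule analytic_subset_linear_image[OF L an])
 have "x : closure (regular_points (L ` X) d)" if "x : L ` X" for x
  by (rule regular_dense_linear_image[OF L pure_closure_regular(1)[OF X] that])
 then have "dense_projection I (L ` X)" by (intro dense_projection_if_regular_dense[OF anL cone I])
 then have "algebraic_set (L ` X)" by (rule algebraic_if_in_cone[OF anL cone])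
 then have "algebraic_set (L' ` L ` X)" by (rule algebraic_set_linear_image[OF linear_pairD(5)[OF L]])
 then show ?thesis by (simp only: linear_pair_image_image[OF L])
qed

lemma asymptotic_dim_ge:
 fixes X :: "(complex^'n) set"
 assumes d: "1 <= d" "d <= CARD('n)" and X: "pure_analytic_set d X" and g: "projective_riemannian_metric g"
 shows "proj_hausdorff_dim g (asymptotic_directions X) >= ereal (2 * real d - 2)"
proof (cases "d = 1")
 case True
 \<comment> \<open>For \<open>d = 1\<close> the bound is \<open>0\<close>, and the infimum that
   defines the dimension runs over nonnegative exponents only.\<close>
 then show ?thesis unfolding proj_hausdorff_dim_def hausdorff_dim_def by (auto intro!: Inf_greatest)
next
 case False
 have "proj_hausdorff_measure g (2 * real (d - 1)) (asymptotic_directions X) ~= 0"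
 proof
  assume null: "proj_hausdorff_measure g (2 * real (d - 1)) (asymptotic_directions X) = 0"
  have "d - 1 <= CARD('n)" using d(2) by simp
  then obtain I :: "'n set" where I: "card I = d - 1" using obtain_subset_with_card_n by blast
  have I0: "I ~= {}" using I d(1) False by auto
  have nl: "proj_hausdorff_measure g (2 * real (card I)) (asymptotic_directions X) = 0" using null I by simp
  obtain L L' where L: "linear_pair L L'" and cone: "in_cone I (L ` X)"
   using transverse_projection[OF g I0 nl] by (elim exE conjE) (rule that; assumption)
  have an: "analytic_subset X" and ne: "X ~= {}" using X by (auto simp: pure_analytic_set_def)
  obtain x where "x : X" using ne by blast
  then have "x : closure (regular_points X d)" by (rule pure_closure_regular(1)[OF X])
  then obtain p where "p : regular_points X d" by (metis closure_empty empty_iff equals0I)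
  then have p: "L p : regular_points (L ` X) d" by (rule regular_points_linear_image[OF L])
  \<comment> \<open>In cone position over at most \<open>d\<close> coordinates, a regular point of
    dimension \<open>d\<close> forces exactly \<open>d\<close> of them.\<close>
  have "card I = d"
   by (rule conjunct1[OF projection_of_regular_part[OF analytic_subset_linear_image[OF L an] cone p open_UNIV UNIV_I]]) (use I in simp)
  then show False using I d(1) by simp
 qed
 then have "proj_hausdorff_dim g (asymptotic_directions X) >= ereal (2 * real (d - 1))"
  unfolding proj_hausdorff_dim_def proj_hausdorff_measure_def by (rule hausdorff_dim_ge)
 moreover have "2 * real (d - 1) = 2 * real d - 2" using d(1) by (simp add: of_nat_diff)
 ultimately show ?thesis by simp
qed

theorem corollary3p2:
  fixes X :: "(complex^'n) set" and d :: nat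
    and g :: "complex^'n \<Rightarrow> complex^'n \<Rightarrow> complex^'n \<Rightarrow> real"
  assumes "1 \<le> d" and "d \<le> CARD('n)"
    and "pure_analytic_set d X"
    and "projective_riemannian_metric g"
  shows "(let \<Sigma> = asymptotic_directions X;
              alt_i = (algebraic_set X \<and> proj_hausdorff_dim g \<Sigma> = ereal (2 * real d - 2));
              alt_ii = (\<not> algebraic_set X \<and>
                        proj_hausdorff_measure g (2 * real d) \<Sigma> > 0 \<and>
                        proj_hausdorff_dim g \<Sigma> \<ge> ereal (2 * real d))
          in (alt_i \<or> alt_ii) \<and> \<not> (alt_i \<and> alt_ii) \<and>
             proj_hausdorff_dim g \<Sigma> \<noteq> ereal (2 * real d - 1))"
proof (cases "algebraic_set X")
 case True
 have "proj_hausdorff_dim g (asymptotic_directions X) <= ereal (2 * real d - 2)"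
  unfolding proj_hausdorff_dim_def
 proof (rule hausdorff_dim_le)
  show "hausdorff_measure projective_space (riemannian_dist g) s (asymptotic_directions X) = 0" if "s > 2 * real d - 2" for s
   using asymptotic_directions_null[OF assms(3) True assms(4) that] unfolding proj_hausdorff_measure_def .
 qed (use assms(1) in simp)
 then have "proj_hausdorff_dim g (asymptotic_directions X) = ereal (2 * real d - 2)"
  using asymptotic_dim_ge[OF assms] by (rule antisym)
 then show ?thesis using True by (simp add: Let_def)
next
 case False
 have nz: "proj_hausdorff_measure g (2 * real d) (asymptotic_directions X) ~= 0"
  using algebraic_if_null[OF assms] False by blast
 then have ge: "proj_hausdorff_dim g (asymptotic_directions X) >= ereal (2 * real d)"
  unfolding proj_hausdorff_dim_def proj_hausdorff_measure_def by (rule hausdorff_dim_ge)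
 have "ereal (2 * real d - 1) < ereal (2 * real d)" by simp
 then have "proj_hausdorff_dim g (asymptotic_directions X) ~= ereal (2 * real d - 1)" using ge by auto
 then show ?thesis using False nz ge by (simp add: Let_def zero_less_iff_neq_zero)
qed

end
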